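(* Let $k$ be an algebraically closed field of characteristic zero and $R=k[x_1,\ldots,x_n]$ with $n\ge3$. Let $J\subseteq R$ be a $2$-equigenerated ideal of codimension at least two with minimal graded free resolution $$0\to R(-\delta_1-\delta_2-\delta_3)\to\bigoplus_{i=1}^3R(-2-\delta_i)\to R(-2)^3\to J\to0.$$ Then the list of all possible vectors $\underline\delta=(\delta_1,\delta_2,\delta_3)$ and $\underline\epsilon=(\epsilon_1)$ and their respective values $\deg(R/J)$ and $\mathrm{Bour}(J)$ is: - $\underline\delta=(1,2,2)$, $\underline\epsilon=(1)$, $\deg(R/J)=2$, $\mathrm{Bour}(J)=1$; - $\underline\delta=(2,2,2)$, $\underline\epsilon=(2)$, $\deg(R/J)=0$, $\mathrm{Bour}(J)=4$.
   Context: $J=(f_1,f_2,f_3)$ is minimally generated by three forms of degree $d=2$. In general the minimal resolution is written $0\to\bigoplus_{j=1}^{m-2}R(-d-\delta_{j+2}-\epsilon_j)\to\bigoplus_{i=1}^mR(-d-\delta_i)\to R(-d)^3\to J\to0$ with $1\le\delta_1\le\cdots\le\delta_m$, positive integers $\epsilon_j$ and $\delta_3+\epsilon_1\le\cdots\le\delta_m+\epsilon_{m-2}$; here $m=3$, and $\epsilon_1$ is defined by $d+\delta_3+\epsilon_1=\delta_1+\delta_2+\delta_3$. $\deg(R/J)$ is the codimension-two degree: the usual multiplicity of $R/J$ if $\mathrm{ht}(J)=2$, and $0$ if $\mathrm{ht}(J)\ge3$. Bourbaki degree: $\mathrm{Syz}(J)\subseteq R^3$ carries the standard grading, $e=\mathrm{indeg}(\mathrm{Syz}(J))$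 is the least degree of a nonzero homogeneous syzygy (so $e=\delta_1$), and $\nu$ is a minimal generator of degree $e$. If $J$ is perfect of height two put $\mathrm{Bour}(J)=0$; otherwise $\mathrm{Syz}(J)/R\nu$ is isomorphic, up to shift, to an unmixed homogeneous ideal $I_\nu$ of height $2$ and $\mathrm{Bour}(J)=\deg(R/I_\nu)$. In all cases $\mathrm{Bour}(J)=d^2-ed+e^2-\deg(R/J)$. *)

theory Defs
  imports
    "HOL-Algebra.Algebraic_Closure_Type"
    "HOL-Library.Poly_Mapping"
    "HOL-Library.Cardinality"
    "HOL-Library.Extended_Nat"
    "HOL-Computational_Algebra.Polynomial"
    "Jordan_Normal_Form.Matrix_Kernel"
begin

text \<open>Polynomials over \<open>'k\<close> whose variables are the elements of the finite type \<open>'n\<close>.  HOL-Algebra's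
  ideals and prime ideals are applied to the type through \<^const>\<open>ring_of_type_algebra\<close>.\<close>

type_synonym ('k, 'n) mpoly = "('n \<Rightarrow>\<^sub>0 nat) \<Rightarrow>\<^sub>0 'k"

abbreviation ideal_gen :: "'a::comm_ring_1 set \<Rightarrow> 'a set" where
  "ideal_gen S \<equiv> Idl\<^bsub>ring_of_type_algebra\<^esub> S"

abbreviation is_ideal :: "'a::comm_ring_1 set \<Rightarrow> bool" where
  "is_ideal I \<equiv> ideal I ring_of_type_algebra"

abbreviation is_prime :: "'a::comm_ring_1 set \<Rightarrow> bool" where
  "is_prime P \<equiv> primeideal P ring_of_type_algebra"


subsection \<open>Gradings\<close>

definition mon_degree :: "('n::finite \<Rightarrow>\<^sub>0 nat) \<Rightarrow> nat" where
  "mon_degree m = (\<Sum>i\<in>UNIV. Poly_Mapping.lookup m i)"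

text \<open>Zero is homogeneous of every degree and is the only form of negative degree.\<close>

definition homogeneous :: "int \<Rightarrow> ('k::zero, 'n::finite) mpoly \<Rightarrow> bool" where
  "homogeneous d p \<longleftrightarrow> (\<forall>m\<in>Poly_Mapping.keys p. int (mon_degree m) = d)"

definition homogeneous_vec :: "int \<Rightarrow> ('k::zero, 'n::finite) mpoly vec \<Rightarrow> bool" where
  "homogeneous_vec d v \<longleftrightarrow> (\<forall>i<dim_vec v. homogeneous d (v $ i))"

definition homogeneous_ideal :: "('k::comm_ring_1, 'n::finite) mpoly set \<Rightarrow> bool" where
  "homogeneous_ideal I \<longleftrightarrow> is_ideal I \<and> I = ideal_gen {f \<in> I. \<exists>d. homogeneous d f}"

definition equigenerated :: "int \<Rightarrow> ('k::comm_ring_1, 'n::finite) mpoly set \<Rightarrow> bool" where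
  "equigenerated d J \<longleftrightarrow> (\<exists>S. (\<forall>f\<in>S. homogeneous d f) \<and> J = ideal_gen S)"

definition minimal_form_generators ::
    "int \<Rightarrow> ('k::comm_ring_1, 'n::finite) mpoly set \<Rightarrow> ('k, 'n) mpoly list \<Rightarrow> bool" where
  "minimal_form_generators d J fs \<longleftrightarrow>
     (\<forall>f\<in>set fs. homogeneous d f) \<and> ideal_gen (set fs) = J \<and>
     (\<forall>i<length fs. ideal_gen (set (take i fs @ drop (Suc i) fs)) \<noteq> J)"


subsection \<open>Height and unmixedness\<close>

definition prime_height :: "'a::comm_ring_1 set \<Rightarrow> enat" where
  "prime_height P =
     Sup {enat r | r Q. (\<forall>i\<le>r. is_prime (Q i)) \<and> (\<forall>i<r. Q i \<subset> Q (Suc i)) \<and> Q r = P}"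

text \<open>The unit ideal has height \<open>\<infinity>\<close>.\<close>

definition height :: "'a::comm_ring_1 set \<Rightarrow> enat" where
  "height I = Inf {prime_height P | P. is_prime P \<and> I \<subseteq> P}"

definition associated_primes :: "'a::comm_ring_1 set \<Rightarrow> 'a set set" where
  "associated_primes I = {P. is_prime P \<and> (\<exists>a. P = {r. r * a \<in> I})}"

definition unmixed :: "'a::comm_ring_1 set \<Rightarrow> bool" where
  "unmixed I \<longleftrightarrow> (\<forall>P\<in>associated_primes I. prime_height P = height I)"


subsection \<open>Multiplicity\<close>

abbreviation k_dim :: "('k::field, 'n::finite) mpoly set \<Rightarrow> nat" where
  "k_dim \<equiv> vector_space.dim (\<lambda>c p. Poly_Mapping.single 0 c * p)"

text \<open>The Hilbert function of \<open>R/I\<close>; its value at \<open>t\<close> is the dimension of \<open>R\<^sub>t / I\<^sub>t\<close>.\<close>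

definition hilbert_function :: "('k::field, 'n::finite) mpoly set \<Rightarrow> nat \<Rightarrow> nat" where
  "hilbert_function I t =
     k_dim {p :: ('k, 'n) mpoly. homogeneous (int t) p} - k_dim {p \<in> I. homogeneous (int t) p}"

definition hilbert_polynomial :: "('k::field, 'n::finite) mpoly set \<Rightarrow> rat poly" where
  "hilbert_polynomial I =
     (THE P. \<forall>\<^sub>F t in sequentially. poly P (of_nat t) = of_nat (hilbert_function I t))"

text \<open>The multiplicity of \<open>R/I\<close>: the normalized leading coefficient of the Hilbert polynomial (whose
  degree is \<open>dim R/I - 1\<close>), or the length of \<open>R/I\<close> if the Hilbert polynomial vanishes.\<close>

definition multiplicity_quot :: "('k::field, 'n::finite) mpoly set \<Rightarrow> rat" where
  "multiplicity_quot I =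
     (let P = hilbert_polynomial I in
      if P = 0 then of_nat (\<Sum>t | hilbert_function I t \<noteq> 0. hilbert_function I t)
      else fact (degree P) * lead_coeff P)"

definition codim2_degree :: "('k::field, 'n::finite) mpoly set \<Rightarrow> rat" where
  "codim2_degree J = (if height J = 2 then multiplicity_quot J else 0)"


subsection \<open>Graded free resolutions\<close>

text \<open>A list \<open>[b\<^sub>0, \<dots>, b\<^sub>r]\<close> of integers stands for the graded free module
  \<open>R(-b\<^sub>0) \<oplus> \<dots> \<oplus> R(-b\<^sub>r)\<close>, and a matrix for its action on column vectors.\<close>

definition graded_map :: "int list \<Rightarrow> int list \<Rightarrow> ('k::zero, 'n::finite) mpoly mat \<Rightarrow> bool" where
  "graded_map as bs A \<longleftrightarrow> A \<in> carrier_mat (length bs) (length as) \<and>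
     (\<forall>i<length bs. \<forall>j<length as. homogeneous (as ! j - bs ! i) (A $$ (i, j)))"

definition mat_image :: "'a::semiring_0 mat \<Rightarrow> 'a vec set" where
  "mat_image A = {A *\<^sub>v v | v. v \<in> carrier_vec (dim_col A)}"

text \<open>\<open>Fs = [F\<^sub>1, \<dots>, F\<^sub>p]\<close> are the free modules of a resolution
  \<open>0 \<rightarrow> F\<^sub>p \<rightarrow> \<dots> \<rightarrow> F\<^sub>1 \<rightarrow> J \<rightarrow> 0\<close>, prolonged by \<open>F\<^sub>0 = R\<close> to the left of \<open>R/J\<close> and by zero modules
  beyond \<open>p\<close>, so that exactness at \<open>F\<^sub>p\<close> is injectivity of the last map.\<close>

definition res_module :: "int list list \<Rightarrow> nat \<Rightarrow> int list" where
  "res_module Fs i = (if i \<le> length Fs then ([0] # Fs) ! i else [])"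

definition graded_free_resolution ::
    "('k::comm_ring_1, 'n::finite) mpoly set \<Rightarrow> int list list \<Rightarrow> (nat \<Rightarrow> ('k, 'n) mpoly mat) \<Rightarrow> bool"
  where
  "graded_free_resolution J Fs \<phi> \<longleftrightarrow>
     (\<forall>i. graded_map (res_module Fs (Suc i)) (res_module Fs i) (\<phi> i)) \<and>
     mat_image (\<phi> 0) = {v \<in> carrier_vec 1. v $ 0 \<in> J} \<and>
     (\<forall>i. mat_kernel (\<phi> i) = mat_image (\<phi> (Suc i)))"

text \<open>As a resolution of \<open>J\<close>: the maps into \<open>F\<^sub>1, F\<^sub>2, \<dots>\<close> have entries in the irrelevant ideal.\<close>

definition minimal_graded_free_resolution ::
    "('k::comm_ring_1, 'n::finite) mpoly set \<Rightarrow> int list list \<Rightarrow> (nat \<Rightarrow> ('k, 'n) mpoly mat) \<Rightarrow> bool"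
  where
  "minimal_graded_free_resolution J Fs \<phi> \<longleftrightarrow> graded_free_resolution J Fs \<phi> \<and>
     (\<forall>l\<ge>1. \<forall>i<dim_row (\<phi> l). \<forall>j<dim_col (\<phi> l). Poly_Mapping.lookup (\<phi> l $$ (i, j)) 0 = 0)"

definition proj_dim_quot :: "('k::comm_ring_1, 'n::finite) mpoly set \<Rightarrow> nat" where
  "proj_dim_quot J = (LEAST p. \<exists>Fs \<phi>. length Fs = p \<and> graded_free_resolution J Fs \<phi>)"

text \<open>Polynomial rings are Cohen-Macaulay, so the grade of \<open>J\<close> is its height.\<close>

definition perfect_height_two :: "('k::comm_ring_1, 'n::finite) mpoly set \<Rightarrow> bool" where
  "perfect_height_two J \<longleftrightarrow> height J = 2 \<and> proj_dim_quot J = 2"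


subsection \<open>Bourbaki degree\<close>

definition syz :: "'a::comm_ring_1 list \<Rightarrow> 'a vec set" where
  "syz fs = {v \<in> carrier_vec (length fs). vec_of_list fs \<bullet> v = 0}"

definition indeg :: "('k::comm_ring_1, 'n::finite) mpoly vec set \<Rightarrow> nat" where
  "indeg M = (LEAST t. \<exists>v\<in>M. v \<noteq> 0\<^sub>v (dim_vec v) \<and> homogeneous_vec (int t) v)"

text \<open>A nonzero homogeneous syzygy of the initial degree is automatically a minimal generator.\<close>

definition initial_syzygy ::
    "('k::comm_ring_1, 'n::finite) mpoly list \<Rightarrow> ('k, 'n) mpoly vec \<Rightarrow> bool" where
  "initial_syzygy fs \<nu> \<longleftrightarrow> \<nu> \<in> syz fs \<and> \<nu> \<noteq> 0\<^sub>v (length fs) \<and>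
     homogeneous_vec (int (indeg (syz fs))) \<nu>"

text \<open>An isomorphism from \<open>Syz/R\<nu>\<close> to a shift of \<open>I\<close> is given as an \<open>R\<close>-linear map from \<open>Syz\<close> onto \<open>I\<close>
  with kernel \<open>R\<nu>\<close> that raises degrees by a constant \<open>s\<close>.\<close>

definition bourbaki_ideal ::
    "('k::comm_ring_1, 'n::finite) mpoly list \<Rightarrow> ('k, 'n) mpoly vec \<Rightarrow> ('k, 'n) mpoly set \<Rightarrow> bool"
  where
  "bourbaki_ideal fs \<nu> I \<longleftrightarrow> homogeneous_ideal I \<and> unmixed I \<and> height I = 2 \<and>
     (\<exists>\<psi> s.
        (\<forall>v\<in>syz fs. \<forall>w\<in>syz fs. \<psi> (v + w) = \<psi> v + \<psi> w) \<and>
        (\<forall>r. \<forall>v\<in>syz fs. \<psi> (r \<cdot>\<^sub>v v) = r * \<psi> v) \<and>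
        (\<forall>t. \<forall>v\<in>syz fs. homogeneous_vec t v \<longrightarrow> homogeneous (t + s) (\<psi> v)) \<and>
        \<psi> ` syz fs = I \<and>
        {v \<in> syz fs. \<psi> v = 0} = {r \<cdot>\<^sub>v \<nu> | r. True})"

text \<open>For an ideal \<open>J\<close> minimally generated by three forms of the same degree; the value does not depend
  on the choice of the generators, of \<open>\<nu>\<close> or of the Bourbaki ideal.\<close>

definition bourbaki_degree :: "('k::field, 'n::finite) mpoly set \<Rightarrow> rat" where
  "bourbaki_degree J =
     (if perfect_height_two J then 0
      else THE b. \<exists>d fs \<nu> I. length fs = 3 \<and> minimal_form_generators d J fs \<and>
             initial_syzygy fs \<nu> \<and> bourbaki_ideal fs \<nu> I \<and> b = multiplicity_quot I)"

end

theory Submission imports Defs begin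

text \<open>A resolution of the given shape forces the three quadrics to be linearly independent. The Koszul syzygies
  have degree two, so minimality leaves the column degrees \<open>(1, 2, 2)\<close> and \<open>(2, 2, 2)\<close> only. In the first case
  the linear syzygy \<open>(v\<^sub>1, v\<^sub>2, v\<^sub>3)\<close> is unique up to scalars, its entries span a space of dimension two, and after
  a change of generators \<open>J = (yg, xg, q)\<close> with linear forms \<open>x\<close>, \<open>y\<close>, \<open>g\<close>; then \<open>J\<close> has height two, multiplicity
  two by its Hilbert series, and Bourbaki ideal \<open>(x, y)\<close>. In the second case the Koszul complex is exact, so \<open>J\<close> has
  height three, and the Bourbaki ideal of the syzygy \<open>(x, -y, 0)\<close> of \<open>(y, x, q)\<close> is the complete intersection
  \<open>(x, y)\<close> of two quadrics. Projective dimension three, that is \<open>Tor\<^sub>3(R/J, k) \<noteq> 0\<close>, rules out perfection.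
  Both cases occur, for \<open>(x\<^sub>1x\<^sub>2, x\<^sub>1\<^sup>2, x\<^sub>3\<^sup>2)\<close> and \<open>(x\<^sub>1\<^sup>2, x\<^sub>2\<^sup>2, x\<^sub>3\<^sup>2)\<close>.\<close>

subsection \<open>Degrees in one variable\<close>

text \<open>\<open>height\<close> is an infimum of suprema of chain lengths, so the upper bounds
  carry the weight. They come from counting polynomials by their degrees in the single variables:
  every inclusion in a chain of primes costs a power of the bound \<open>t\<close>, while a prime
  that contains no nonzero polynomial in the variables \<open>T\<close> leaves
  \<open>(t + 1) ^ card T\<close> independent classes. Upper bounds on heights thus reduce to
  finding a large \<open>T\<close>, and division in one variable, up to powers of a leading
  coefficient, finds it. Unmixedness of the ideal of a regular pair is settled by the same device,
  applied to the annihilator of a class. The second obstacle is that \<open>bourbaki_degree\<close>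
  is a definite description over all generators, initial syzygies and Bourbaki ideals. Hence the
  transport along graded isomorphisms of syzygy modules, and the reduction of every initial syzygy
  to the shape \<open>(x, -y, 0)\<close>. A linear one is unique up to a constant; in the other case
  they form a three-dimensional space, each member gets its own Bourbaki ideal, and only the
  multiplicity is common.\<close>

lemma unique_sum_aux:
  fixes V :: "'n::finite set"
  assumes "finite V" "finite A" "finite B" "A \<noteq> {}" "B \<noteq> {}"
  shows "\<exists>a\<in>A. \<exists>b\<in>B. \<forall>a'\<in>A. \<forall>b'\<in>B. a' + b' = a + b \<longrightarrow>
    (\<forall>v\<in>V. Poly_Mapping.lookup a' v = Poly_Mapping.lookup a v \<and> Poly_Mapping.lookup b' v = (Poly_Mapping.lookup b v :: nat))"
  using assms
proof (induction V arbitrary: A B rule: finite_induct)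
  case empty
  then show ?case by auto
next
  case (insert v V)
  \<comment> \<open>Keep the exponents that are maximal in the new variable. A sum can be maximal
    there only if both summands are, so every competing decomposition already lies in
    \<open>A'\<close> and \<open>B'\<close>.\<close>
  define \<alpha> where "\<alpha> = Max ((\<lambda>a. Poly_Mapping.lookup a v) ` A)"
  define \<beta> where "\<beta> = Max ((\<lambda>a. Poly_Mapping.lookup a v) ` B)"
  define A' where "A' = {a\<in>A. Poly_Mapping.lookup a v = \<alpha>}"
  define B' where "B' = {b\<in>B. Poly_Mapping.lookup b v = \<beta>}"
  have \<alpha>: "Poly_Mapping.lookup a v \<le> \<alpha>" if "a \<in> A" for a
    unfolding \<alpha>_def using insert that by auto
  have \<beta>: "Poly_Mapping.lookup a v \<le> \<beta>" if "a \<in> B" for a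
    unfolding \<beta>_def using insert that by auto
  have "\<alpha> \<in> (\<lambda>a. Poly_Mapping.lookup a v) ` A" unfolding \<alpha>_def using insert by (intro Max_in) auto
  then have A': "A' \<noteq> {}" unfolding A'_def by auto
  have "\<beta> \<in> (\<lambda>a. Poly_Mapping.lookup a v) ` B" unfolding \<beta>_def using insert by (intro Max_in) auto
  then have B': "B' \<noteq> {}" unfolding B'_def by auto
  have "finite A'" "finite B'" unfolding A'_def B'_def using insert by auto
  from insert.IH[OF this A' B'] obtain a b where ab: "a \<in> A'" "b \<in> B'"
    "\<forall>a'\<in>A'. \<forall>b'\<in>B'. a' + b' = a + b \<longrightarrow>
    (\<forall>v\<in>V. Poly_Mapping.lookup a' v = Poly_Mapping.lookup a v \<and> Poly_Mapping.lookup b' v = Poly_Mapping.lookup b v)"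
    by (elim bexE) (rule that)
  have *: "\<forall>w\<in>insert v V. Poly_Mapping.lookup a' w = Poly_Mapping.lookup a w \<and> Poly_Mapping.lookup b' w = Poly_Mapping.lookup b w"
    if "a' \<in> A" "b' \<in> B" "a' + b' = a + b" for a' b'
  proof -
    have "Poly_Mapping.lookup a' v + Poly_Mapping.lookup b' v = \<alpha> + \<beta>"
      using arg_cong[OF that(3), of "\<lambda>m. Poly_Mapping.lookup m v"] ab(1,2) by (simp add: lookup_add A'_def B'_def)
    then have "Poly_Mapping.lookup a' v = \<alpha>" "Poly_Mapping.lookup b' v = \<beta>"
      using \<alpha>[OF that(1)] \<beta>[OF that(2)] by linarith+
    moreover from this have "a' \<in> A'" "b' \<in> B'" using that by (simp_all add: A'_def B'_def)
    with ab(3) that(3) have "\<forall>w\<in>V. Poly_Mapping.lookup a' w = Poly_Mapping.lookup a w \<and> Poly_Mapping.lookup b' w = Poly_Mapping.lookup b w"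
      by blast
    ultimately show ?thesis using ab(1,2) by (simp add: A'_def B'_def)
  qed
  have aA: "a \<in> A" and bB: "b \<in> B" using ab(1,2) by (simp_all add: A'_def B'_def)
  show ?case
  proof (rule bexI[OF bexI[OF _ bB] aA], intro ballI impI)
    fix a' b' w assume "a' \<in> A" "b' \<in> B" "a' + b' = a + b" "w \<in> insert v V"
    then show "Poly_Mapping.lookup a' w = Poly_Mapping.lookup a w \<and> Poly_Mapping.lookup b' w = Poly_Mapping.lookup b w"
      using *[of a' b'] by blast
  qed
qed

text \<open>A monomial order in disguise: maximising one coordinate after the other selects the
  lexicographically largest elements of \<open>A\<close> and \<open>B\<close>, and the sum of two
  maxima is reached only once.\<close>

lemma unique_sum:
  fixes A B :: "('n::finite \<Rightarrow>\<^sub>0 nat) set"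
  assumes "finite A" "finite B" "A \<noteq> {}" "B \<noteq> {}"
  obtains a b where "a \<in> A" "b \<in> B"
    "\<And>a' b'. a' \<in> A \<Longrightarrow> b' \<in> B \<Longrightarrow> a' + b' = a + b \<Longrightarrow> a' = a \<and> b' = b"
proof -
  obtain a b where ab: "a \<in> A" "b \<in> B" "\<forall>a'\<in>A. \<forall>b'\<in>B. a' + b' = a + b \<longrightarrow>
    (\<forall>v\<in>UNIV. Poly_Mapping.lookup a' v = Poly_Mapping.lookup a v \<and> Poly_Mapping.lookup b' v = (Poly_Mapping.lookup b v :: nat))"
    using unique_sum_aux[OF finite_class.finite_UNIV assms] by (elim bexE) (rule that)
  show ?thesis
  proof (rule that[OF ab(1,2)])
    fix a' b' assume "a' \<in> A" "b' \<in> B" "a' + b' = a + b"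
    with ab(3) have "\<forall>v\<in>UNIV. Poly_Mapping.lookup a' v = Poly_Mapping.lookup a v \<and> Poly_Mapping.lookup b' v = Poly_Mapping.lookup b v"
      by blast
    then show "a' = a \<and> b' = b" by (simp add: poly_mapping_eq_iff fun_eq_iff)
  qed
qed

text \<open>A single pair of exponents contributes to this coefficient, so nothing can
  cancel.\<close>

lemma lookup_mult_unique:
  fixes p q :: "('k::comm_ring_1, 'n) mpoly"
  assumes "\<And>a' b'. a' \<in> Poly_Mapping.keys p \<Longrightarrow> b' \<in> Poly_Mapping.keys q \<Longrightarrow> a' + b' = a + b \<Longrightarrow> a' = a \<and> b' = b"
  shows "Poly_Mapping.lookup (p * q) (a + b) = Poly_Mapping.lookup p a * Poly_Mapping.lookup q b"
proof -
  let ?f = "\<lambda>(a', b'). Poly_Mapping.lookup p a' * Poly_Mapping.lookup q b' when a + b = a' + b'"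
  have "Poly_Mapping.lookup (p * q) (a + b) = Sum_any ?f"
    by (simp add: times_poly_mapping.rep_eq prod_fun_unfold_prod)
  also have "\<dots> = sum ?f {(a, b)}"
  proof (rule Sum_any.expand_superset)
    show "{x. ?f x \<noteq> 0} \<subseteq> {(a, b)}"
    proof
      fix x assume x: "x \<in> {x. ?f x \<noteq> 0}"
      obtain a' b' where [simp]: "x = (a', b')" by fastforce
      from x have "a' \<in> Poly_Mapping.keys p" "b' \<in> Poly_Mapping.keys q" "a + b = a' + b'"
        by (auto simp: in_keys_iff when_def split: if_splits)
      then show "x \<in> {(a, b)}" using assms[of a' b'] by simp
    qed
  qed simp
  finally show ?thesis by simp
qed

text \<open>Degrees are taken variable by variable because the divisions below treat one variable at
  a time and have to control the others.\<close>

definition degv :: "'n::finite \<Rightarrow> ('k::zero, 'n) mpoly \<Rightarrow> nat" where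
  "degv i p = Max (insert 0 ((\<lambda>m. Poly_Mapping.lookup m i) ` Poly_Mapping.keys p))"

lemma degv_le_iff: "degv i p \<le> d \<longleftrightarrow> (\<forall>m\<in>Poly_Mapping.keys p. Poly_Mapping.lookup m i \<le> d)"
  by (auto simp: degv_def)

lemma lookup_le_degv: "m \<in> Poly_Mapping.keys p \<Longrightarrow> Poly_Mapping.lookup m i \<le> degv i p"
  using degv_le_iff by blast

lemma degv_less_iff: "0 < d \<Longrightarrow> degv i p < d \<longleftrightarrow> (\<forall>m\<in>Poly_Mapping.keys p. Poly_Mapping.lookup m i < d)"
  by (auto simp: degv_def)

lemma degv_attained:
  assumes "p \<noteq> 0"
  obtains m where "m \<in> Poly_Mapping.keys p" "Poly_Mapping.lookup m i = degv i p"
proof (cases "degv i p = 0")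
  case True
  have "Poly_Mapping.keys p \<noteq> {}" using assms by simp
  then obtain m where m: "m \<in> Poly_Mapping.keys p" by blast
  from True show ?thesis using that[OF m] lookup_le_degv[OF m, of i] by simp
next
  case False
  have "degv i p \<in> insert 0 ((\<lambda>m. Poly_Mapping.lookup m i) ` Poly_Mapping.keys p)"
    unfolding degv_def by (rule Max_in) auto
  with False have "degv i p \<in> (\<lambda>m. Poly_Mapping.lookup m i) ` Poly_Mapping.keys p" by simp
  then show ?thesis by (rule imageE) (rule that, simp_all)
qed

lemma degv_zero [simp]: "degv i 0 = 0"
  by (simp add: degv_def)

lemma degv_single: "degv i (Poly_Mapping.single m c) = (if c = 0 then 0 else Poly_Mapping.lookup m i)"
  by (simp add: degv_def)

lemma degv_add_le: "degv i p \<le> d \<Longrightarrow> degv i q \<le> d \<Longrightarrow> degv i (p + q) \<le> d"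
  for p q :: "('k::comm_monoid_add, 'n::finite) mpoly"
  using keys_add[of p q] by (auto simp: degv_le_iff)

lemma degv_uminus [simp]: "degv i (- p) = degv i p"
  for p :: "('k::comm_ring_1, 'n::finite) mpoly"
proof -
  have "Poly_Mapping.keys (- p) = Poly_Mapping.keys p" by (auto simp: in_keys_iff)
  then show ?thesis unfolding degv_def by metis
qed

lemma degv_diff_le: "degv i p \<le> d \<Longrightarrow> degv i q \<le> d \<Longrightarrow> degv i (p - q) \<le> d"
  for p q :: "('k::comm_ring_1, 'n::finite) mpoly"
  using degv_add_le[of i p d "- q"] by simp

lemma degv_sum_le: "(\<And>x. x \<in> I \<Longrightarrow> degv i (f x) \<le> d) \<Longrightarrow> degv i (sum f I) \<le> d"
  for f :: "_ \<Rightarrow> ('k::comm_monoid_add, 'n::finite) mpoly"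
  by (induction I rule: infinite_finite_induct) (auto intro: degv_add_le)

lemma degv_mult_le: "degv i p \<le> d \<Longrightarrow> degv i q \<le> e \<Longrightarrow> degv i (p * q) \<le> d + e"
  for p q :: "('k::comm_ring_1, 'n::finite) mpoly"
  unfolding degv_le_iff
proof
  fix m assume *: "\<forall>m\<in>Poly_Mapping.keys p. Poly_Mapping.lookup m i \<le> d"
    "\<forall>m\<in>Poly_Mapping.keys q. Poly_Mapping.lookup m i \<le> e" "m \<in> Poly_Mapping.keys (p * q)"
  then obtain a b where "m = a + b" "a \<in> Poly_Mapping.keys p" "b \<in> Poly_Mapping.keys q"
    using keys_mult[of p q] by blast
  then show "Poly_Mapping.lookup m i \<le> d + e" using * by (simp add: lookup_add add_mono)
qed

text \<open>\<open>unique_sum\<close> is applied to the terms of top degree in x_i only. The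
  surviving term shows at once that products do not vanish and that \<open>degv\<close> is
  additive.\<close>

lemma mult_unique_key:
  fixes p q :: "('k::idom, 'n::finite) mpoly"
  assumes "p \<noteq> 0" "q \<noteq> 0"
  shows "\<exists>m\<in>Poly_Mapping.keys (p * q). Poly_Mapping.lookup m i = degv i p + degv i q"
proof -
  define A where "A = {a\<in>Poly_Mapping.keys p. Poly_Mapping.lookup a i = degv i p}"
  define B where "B = {b\<in>Poly_Mapping.keys q. Poly_Mapping.lookup b i = degv i q}"
  have "A \<noteq> {}" unfolding A_def by (rule degv_attained[OF assms(1), of i]) auto
  moreover have "B \<noteq> {}" unfolding B_def by (rule degv_attained[OF assms(2), of i]) auto
  moreover have "finite A" "finite B" by (simp_all add: A_def B_def)
  ultimately obtain a b where ab: "a \<in> A" "b \<in> B"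
    "\<And>a' b'. a' \<in> A \<Longrightarrow> b' \<in> B \<Longrightarrow> a' + b' = a + b \<Longrightarrow> a' = a \<and> b' = b"
    using unique_sum[of A B] by metis
  have "Poly_Mapping.lookup (p * q) (a + b) = Poly_Mapping.lookup p a * Poly_Mapping.lookup q b"
  proof (rule lookup_mult_unique)
    fix a' b' assume *: "a' \<in> Poly_Mapping.keys p" "b' \<in> Poly_Mapping.keys q" "a' + b' = a + b"
    have "Poly_Mapping.lookup a' i + Poly_Mapping.lookup b' i = degv i p + degv i q"
      using arg_cong[OF *(3), of "\<lambda>m. Poly_Mapping.lookup m i"] ab(1,2) by (simp add: lookup_add A_def B_def)
    then have "Poly_Mapping.lookup a' i = degv i p" "Poly_Mapping.lookup b' i = degv i q"
      using lookup_le_degv[OF *(1), of i] lookup_le_degv[OF *(2), of i] by linarith+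
    then have "a' \<in> A" "b' \<in> B" using * unfolding A_def B_def by auto
    then show "a' = a \<and> b' = b" using ab(3) * by blast
  qed
  then have "a + b \<in> Poly_Mapping.keys (p * q)"
    using ab(1,2) by (simp add: in_keys_iff A_def B_def)
  moreover have "Poly_Mapping.lookup (a + b) i = degv i p + degv i q"
    using ab(1,2) by (simp add: lookup_add A_def B_def)
  ultimately show ?thesis by blast
qed

lemma mpoly_mult_eq_0 [simp]: "p * q = 0 \<longleftrightarrow> p = 0 \<or> q = 0"
  for p q :: "('k::idom, 'n::finite) mpoly"
proof
  assume "p * q = 0"
  then show "p = 0 \<or> q = 0" using mult_unique_key[of p q undefined] keys_zero by (metis empty_iff)
qed auto

lemma mpoly_mult_cancel: "p \<noteq> 0 \<Longrightarrow> p * a = p * b \<longleftrightarrow> a = b"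
  for p a b :: "('k::idom, 'n::finite) mpoly"
proof -
  assume "p \<noteq> 0"
  have "p * a = p * b \<longleftrightarrow> p * (a - b) = 0" by (simp add: right_diff_distrib)
  with \<open>p \<noteq> 0\<close> show ?thesis by simp
qed

lemma mpoly_power_eq_0: "p \<noteq> 0 \<Longrightarrow> p ^ N \<noteq> 0"
  for p :: "('k::idom, 'n::finite) mpoly"
  by (induction N) auto

lemma degv_mult: "p \<noteq> 0 \<Longrightarrow> q \<noteq> 0 \<Longrightarrow> degv i (p * q) = degv i p + degv i q"
  for p q :: "('k::idom, 'n::finite) mpoly"
proof (rule antisym)
  show "degv i (p * q) \<le> degv i p + degv i q" by (rule degv_mult_le) simp_all
  assume "p \<noteq> 0" "q \<noteq> 0"
  then obtain m where "m \<in> Poly_Mapping.keys (p * q)" "Poly_Mapping.lookup m i = degv i p + degv i q"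
    using mult_unique_key by blast
  then show "degv i p + degv i q \<le> degv i (p * q)" using lookup_le_degv by metis
qed

text \<open>The subring of polynomials in the variables of \<open>T\<close>. For a prime
  \<open>P\<close>, the condition \<open>P \<inter> polys_in T \<subseteq> {0}\<close> says that
  these variables are algebraically independent modulo \<open>P\<close>.\<close>

definition polys_in :: "'n::finite set \<Rightarrow> ('k::zero, 'n) mpoly set" where
  "polys_in T = {p. \<forall>i. i \<notin> T \<longrightarrow> degv i p = 0}"

lemma polys_in_mult: "p \<in> polys_in T \<Longrightarrow> q \<in> polys_in T \<Longrightarrow> p * q \<in> polys_in T"
  for p q :: "('k::idom, 'n::finite) mpoly"
  unfolding polys_in_def by (cases "p = 0 \<or> q = 0") (auto simp: degv_mult)

lemma degv_one [simp]: "degv i (1 :: ('k::comm_ring_1, 'n::finite) mpoly) = 0"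
  using degv_single[of i 0 "1::'k"] by simp

lemma degv_power_zero: "degv i p = 0 \<Longrightarrow> degv i (p ^ N) = 0"
  for p :: "('k::comm_ring_1, 'n::finite) mpoly"
proof (induction N)
  case (Suc N)
  then show ?case using degv_mult_le[of i p 0 "p ^ N" 0] by simp
qed simp

lemma polys_in_1: "(1 :: ('k::comm_ring_1, 'n::finite) mpoly) \<in> polys_in T"
  by (simp add: polys_in_def)

lemma polys_in_power: "p \<in> polys_in T \<Longrightarrow> p ^ N \<in> polys_in T"
  for p :: "('k::idom, 'n::finite) mpoly"
  by (induction N) (auto intro: polys_in_mult polys_in_1)

subsection \<open>Pseudo-division\<close>

text \<open>Splits off the part of top degree in x_i. The bounds in the other variables say that
  neither piece brings in new variables, which allows divisions in different variables to be
  nested.\<close>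

lemma leading_part:
  fixes p :: "('k::comm_ring_1, 'n::finite) mpoly"
  obtains L p' where "p = L * Poly_Mapping.single (Poly_Mapping.single i (degv i p)) 1 + p'"
    "degv i L = 0" "\<And>j. degv j L \<le> degv j p" "\<And>j. degv j p' \<le> degv j p"
    "p \<noteq> 0 \<Longrightarrow> L \<noteq> 0" "0 < degv i p \<Longrightarrow> degv i p' < degv i p"
proof -
  let ?X = "Poly_Mapping.single i (degv i p)"
  define M where "M = {m\<in>Poly_Mapping.keys p. Poly_Mapping.lookup m i = degv i p}"
  define L where "L = (\<Sum>m\<in>M. Poly_Mapping.single (m - ?X) (Poly_Mapping.lookup p m))"
  define p1 where "p1 = (\<Sum>m\<in>M. Poly_Mapping.single m (Poly_Mapping.lookup p m))"
  have fin: "finite M" by (simp add: M_def)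
  \<comment> \<open>Subtraction of exponents truncates at zero. Nothing is lost on \<open>M\<close>,
    where the exponent of x_i equals the one subtracted.\<close>
  have sub: "m - ?X + ?X = m" if "m \<in> M" for m
    using that by (intro poly_mapping_eqI) (auto simp: lookup_add lookup_minus lookup_single when_def M_def)
  have LX: "L * Poly_Mapping.single ?X 1 = p1"
    unfolding L_def p1_def sum_distrib_right by (rule sum.cong) (simp_all add: mult_single sub)
  have lp1: "Poly_Mapping.lookup p1 m = (if m \<in> M then Poly_Mapping.lookup p m else 0)" for m
    unfolding p1_def lookup_sum using fin
    by (simp add: lookup_single when_def sum.delta)
  have kp': "Poly_Mapping.keys (p - p1) = Poly_Mapping.keys p - M"
    by (auto simp: in_keys_iff lookup_minus lp1 M_def split: if_splits)
  show thesis
  proof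
    show "p = L * Poly_Mapping.single ?X 1 + (p - p1)" by (simp add: LX)
    have "degv j L \<le> (if j = i then 0 else degv j p)" for j
      unfolding L_def
    proof (rule degv_sum_le)
      fix m assume "m \<in> M"
      then show "degv j (Poly_Mapping.single (m - ?X) (Poly_Mapping.lookup p m)) \<le> (if j = i then 0 else degv j p)"
        using lookup_le_degv[of m p j]
        by (auto simp: degv_single lookup_minus lookup_single M_def when_def)
    qed
    note le = this
    show "degv i L = 0" using le[of i] by simp
    show "degv j L \<le> degv j p" for j using le[of j] by (simp split: if_splits)
    show "degv j (p - p1) \<le> degv j p" for j
      unfolding degv_le_iff kp' using lookup_le_degv[of _ p j] by blast
    show "L \<noteq> 0" if "p \<noteq> 0"
    proof
      assume "L = 0"
      then have "p1 = 0" using LX by simp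
      moreover obtain m where "m \<in> Poly_Mapping.keys p" "Poly_Mapping.lookup m i = degv i p"
        using degv_attained[OF \<open>p \<noteq> 0\<close>, of i] .
      ultimately show False using lp1[of m] by (simp add: M_def in_keys_iff)
    qed
    show "degv i (p - p1) < degv i p" if "0 < degv i p"
      unfolding degv_less_iff[OF that] kp'
    proof
      fix m assume "m \<in> Poly_Mapping.keys p - M"
      then show "Poly_Mapping.lookup m i < degv i p"
        using lookup_le_degv[of m p i] unfolding M_def by auto
    qed
  qed
qed

text \<open>Division in x_i over the ring of the other variables, where powers of \<open>L\<close>
  replace its inverse. A variable absent from \<open>p\<close> is absent from \<open>L\<close> and
  \<open>p'\<close> too, so the steps of the division cannot raise the degree in it.\<close>

lemma pseudo_division:
  fixes p :: "('k::idom, 'n::finite) mpoly"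
  assumes p: "p = L * Poly_Mapping.single (Poly_Mapping.single i (degv i p)) 1 + p'"
    "degv i L = 0" "\<And>j. degv j L \<le> degv j p" "\<And>j. degv j p' \<le> degv j p" "degv i p' < degv i p"
  shows "\<exists>N q r. L ^ N * c = q * p + r \<and> degv i r < degv i p \<and> (\<forall>j. degv j p = 0 \<longrightarrow> degv j r \<le> degv j c)"
proof (induction "degv i c" arbitrary: c rule: less_induct)
  case less
  let ?d = "degv i p" and ?D = "degv i c"
  show ?case
  proof (cases "?D < ?d")
    case True
    then show ?thesis by (intro exI[of _ 0] exI[of _ 0] exI[of _ c]) auto
  next
    case False
    then have D: "0 < ?D" "?d \<le> ?D" using p(5) by auto
    obtain C c' where c: "c = C * Poly_Mapping.single (Poly_Mapping.single i ?D) 1 + c'"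
      "degv i C = 0" "\<And>j. degv j C \<le> degv j c" "\<And>j. degv j c' \<le> degv j c"
      "degv i c' < degv i c"
      by (rule leading_part[of c i]) (use D(1) in blast)
    let ?X = "\<lambda>e. Poly_Mapping.single (Poly_Mapping.single i e) 1 :: ('k, 'n) mpoly"
    \<comment> \<open>Cross-multiplication cancels the two leading terms; the second form of
      \<open>c2\<close> makes the drop of the degree visible.\<close>
    define c2 where "c2 = L * c - C * ?X (?D - ?d) * p"
    have X: "?X ?D = ?X (?D - ?d) * ?X ?d"
      using D(2) by (simp add: mult_single flip: single_add)
    have c2: "c2 = L * c' - C * ?X (?D - ?d) * p'"
    proof -
      have "L * c = L * (C * (?X (?D - ?d) * ?X ?d) + c')"
        by (subst c(1)) (simp only: X)
      moreover have "C * ?X (?D - ?d) * p = C * ?X (?D - ?d) * (L * ?X ?d + p')"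
        by (subst p(1)) (simp only:)
      ultimately show ?thesis unfolding c2_def by (simp only: algebra_simps)
    qed
    have dX: "degv j (?X e) = (if j = i then e else 0)" for j e
      by (simp add: degv_single lookup_single when_def)
    have "degv i (L * c') \<le> ?D - 1"
      using degv_mult_le[of i L 0 c' "?D - 1"] p(2) c(5) by auto
    moreover have "degv i (C * ?X (?D - ?d) * p') \<le> ?D - 1"
      using degv_mult_le[OF degv_mult_le[of i C 0 "?X (?D - ?d)" "?D - ?d"], of p' "?d - 1"] c(2) p(5) D dX by simp
    ultimately have lt: "degv i c2 < ?D" using D(1) unfolding c2 by (metis Suc_diff_1 degv_diff_le less_Suc_eq_le)
    have le: "degv j c2 \<le> degv j c" if j: "degv j p = 0" for j
    proof -
      have "j \<noteq> i" using j p(5) by auto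
      have "degv j (L * c') \<le> degv j c"
        using degv_mult_le[of j L 0 c' "degv j c"] p(3)[of j] j c(4) by simp
      moreover have "degv j (C * ?X (?D - ?d) * p') \<le> degv j c"
        using degv_mult_le[OF degv_mult_le[of j C "degv j c" "?X (?D - ?d)" 0], of p' 0]
          c(3)[of j] p(4)[of j] j dX \<open>j \<noteq> i\<close> by simp
      ultimately show ?thesis unfolding c2 by (rule degv_diff_le)
    qed
    obtain N q r where r: "L ^ N * c2 = q * p + r" "degv i r < ?d"
      "\<forall>j. degv j p = 0 \<longrightarrow> degv j r \<le> degv j c2"
      using less.hyps[OF lt] by blast
    have "L ^ Suc N * c = (q + L ^ N * C * ?X (?D - ?d)) * p + r"
      using r(1) unfolding c2_def by (simp add: algebra_simps)
    then show ?thesis using r(2,3) le by (meson order_trans)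
  qed
qed

text \<open>The remainder \<open>r\<close> of \<open>c\<close> makes \<open>p2 * r\<close> a
  multiple of \<open>p1\<close>. As \<open>p2\<close> is free of x_i, the degree of this product in
  x_i is that of \<open>r\<close>, too small for a nonzero multiple. So \<open>p2\<close> is a
  nonzerodivisor modulo \<open>p1\<close> once \<open>L\<close> is inverted.\<close>

lemma triangular_regular2:
  fixes p1 p2 :: "('k::idom, 'n::finite) mpoly"
  assumes p1: "p1 = L * Poly_Mapping.single (Poly_Mapping.single i (degv i p1)) 1 + p1'"
    "degv i L = 0" "\<And>j. degv j L \<le> degv j p1" "\<And>j. degv j p1' \<le> degv j p1" "degv i p1' < degv i p1"
    and p2: "p2 \<noteq> 0" "degv i p2 = 0" and c: "p2 * c = u * p1"
  shows "\<exists>N q. L ^ N * c = q * p1"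
proof -
  obtain N q r where r: "L ^ N * c = q * p1 + r" "degv i r < degv i p1"
    using pseudo_division[OF p1] by blast
  have eq: "p2 * r = (L ^ N * u - p2 * q) * p1"
  proof -
    have "r = L ^ N * c - q * p1" using r(1) by simp
    then have "p2 * r = L ^ N * (p2 * c) - p2 * (q * p1)"
      by (simp only: right_diff_distrib mult.left_commute)
    then show ?thesis unfolding c by (simp add: algebra_simps)
  qed
  have "r = 0"
  proof (rule ccontr)
    assume "r \<noteq> 0"
    then have "p2 * r \<noteq> 0" using p2 by simp
    then have "L ^ N * u - p2 * q \<noteq> 0" "p1 \<noteq> 0" using eq by auto
    then have "degv i p2 + degv i r = degv i (L ^ N * u - p2 * q) + degv i p1"
      using \<open>r \<noteq> 0\<close> p2(1) eq by (simp flip: degv_mult)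
    then show False using r(2) p2(2) by linarith
  qed
  then show ?thesis using r(1) by auto
qed

text \<open>Divide by \<open>p1\<close> in x_i and then by \<open>p2\<close> in x_j. The remainder
  is small in both variables, and comparing degrees first in x_i and then in x_j forces it to
  vanish. This is regularity of a triangular sequence up to leading coefficients.\<close>

lemma triangular_regular3:
  fixes p1 p2 p3 :: "('k::idom, 'n::finite) mpoly"
  assumes p1: "p1 = L * Poly_Mapping.single (Poly_Mapping.single i (degv i p1)) 1 + p1'"
    "degv i L = 0" "\<And>j. degv j L \<le> degv j p1" "\<And>j. degv j p1' \<le> degv j p1" "degv i p1' < degv i p1"
    and p2: "p2 = K * Poly_Mapping.single (Poly_Mapping.single j (degv j p2)) 1 + p2'"
    "degv j K = 0" "\<And>j'. degv j' K \<le> degv j' p2" "\<And>j'. degv j' p2' \<le> degv j' p2" "degv j p2' < degv j p2"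
    and "degv i p2 = 0" "degv j L = 0" "L \<noteq> 0"
    and p3: "p3 \<noteq> 0" "degv i p3 = 0" "degv j p3 = 0" and c: "p3 * c = u * p1 + v * p2"
  shows "\<exists>M N q q'. L ^ M * K ^ N * c = q * p1 + q' * p2"
proof -
  obtain M q0 r0 where r0: "L ^ M * c = q0 * p1 + r0" "degv i r0 < degv i p1"
    using pseudo_division[OF p1] by blast
  obtain N q1 r where r: "K ^ N * r0 = q1 * p2 + r" "degv j r < degv j p2"
      "degv i r \<le> degv i r0"
    using pseudo_division[OF p2, of r0] assms(11) by blast
  have eq1: "L ^ M * K ^ N * c = K ^ N * q0 * p1 + q1 * p2 + r"
  proof -
    have "L ^ M * K ^ N * c = K ^ N * (L ^ M * c)" by (simp add: algebra_simps)
    also have "\<dots> = K ^ N * q0 * p1 + K ^ N * r0" unfolding r0 by (simp add: algebra_simps)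
    finally show ?thesis unfolding r(1) by (simp add: algebra_simps)
  qed
  have eq2: "p3 * r = (L ^ M * K ^ N * u - p3 * K ^ N * q0) * p1 + (L ^ M * K ^ N * v - p3 * q1) * p2"
  proof -
    have "r = L ^ M * K ^ N * c - (K ^ N * q0 * p1 + q1 * p2)" using eq1 by simp
    then have "p3 * r = L ^ M * K ^ N * (p3 * c) - p3 * (K ^ N * q0 * p1 + q1 * p2)"
      by (simp only: right_diff_distrib mult.left_commute)
    then show ?thesis unfolding c by (simp add: algebra_simps)
  qed
  define u' where "u' = L ^ M * K ^ N * u - p3 * K ^ N * q0"
  define v' where "v' = L ^ M * K ^ N * v - p3 * q1"
  \<comment> \<open>The coefficient of \<open>p2\<close> is reduced modulo \<open>p1\<close> as
    well. Then one side of \<open>eq3\<close> has degree below that of \<open>p1\<close> in x_i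
    while the other is a multiple of \<open>p1\<close>, so both vanish.\<close>
  obtain P h v'' where v'': "L ^ P * v' = h * p1 + v''" "degv i v'' < degv i p1"
    using pseudo_division[OF p1] by blast
  have eq3: "L ^ P * p3 * r - v'' * p2 = (L ^ P * u' + h * p2) * p1"
  proof -
    have "p3 * r = u' * p1 + v' * p2" using eq2 unfolding u'_def v'_def .
    then have "L ^ P * p3 * r = L ^ P * u' * p1 + (L ^ P * v') * p2"
      by (simp only: mult.assoc distrib_left)
    then show ?thesis unfolding v'' by (simp add: algebra_simps)
  qed
  have dL: "degv i (L ^ P) = 0" "degv j (L ^ P) = 0"
    using p1(2) assms(12) by (simp_all add: degv_power_zero)
  have "degv i (L ^ P * p3 * r - v'' * p2) < degv i p1"
  proof -
    have "degv i (L ^ P * p3 * r) \<le> degv i p1 - 1"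
      using degv_mult_le[OF degv_mult_le[of i "L ^ P" 0 p3 0], of r "degv i p1 - 1"] dL p3 r(3) r0(2) by simp
    moreover have "degv i (v'' * p2) \<le> degv i p1 - 1"
      using degv_mult_le[of i v'' "degv i p1 - 1" p2 0] v''(2) assms(11) by simp
    ultimately have "degv i (L ^ P * p3 * r - v'' * p2) \<le> degv i p1 - 1" by (rule degv_diff_le)
    then show ?thesis using r0(2) by linarith
  qed
  then have "L ^ P * u' + h * p2 = 0"
    unfolding eq3 by (cases "L ^ P * u' + h * p2 = 0"; cases "p1 = 0") (auto simp: degv_mult)
  then have eq4: "L ^ P * p3 * r = v'' * p2" using eq3 by simp
  have "r = 0"
  proof (rule ccontr)
    assume "r \<noteq> 0"
    have "L ^ P * p3 \<noteq> 0" using p3(1) assms(13) mpoly_power_eq_0[of L P] by simp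
    then have "degv j (L ^ P * p3 * r) = degv j r"
      using \<open>r \<noteq> 0\<close> p3 dL assms(13) mpoly_power_eq_0[of L P] by (simp add: degv_mult)
    moreover have "v'' \<noteq> 0" "p2 \<noteq> 0" using eq4 \<open>L ^ P * p3 \<noteq> 0\<close> \<open>r \<noteq> 0\<close> by auto
    ultimately show False using r(2) eq4 by (simp add: degv_mult)
  qed
  then show ?thesis using eq1 by auto
qed

subsection \<open>Ideals and chains of primes\<close>

lemma is_ideal_iff:
  "is_ideal I \<longleftrightarrow> 0 \<in> I \<and> (\<forall>a\<in>I. \<forall>b\<in>I. a + b \<in> I) \<and> (\<forall>r. \<forall>a\<in>I. r * a \<in> I)"
  for I :: "'a::comm_ring_1 set"
proof
  assume I: "is_ideal I"
  interpret ideal I ring_of_type_algebra by (rule I)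
  have "\<zero>\<^bsub>ring_of_type_algebra\<^esub> \<in> I" "\<And>a b. a \<in> I \<Longrightarrow> b \<in> I \<Longrightarrow> a \<oplus>\<^bsub>ring_of_type_algebra\<^esub> b \<in> I"
    by (rule additive_subgroup.zero_closed, unfold_locales)
      (rule additive_subgroup.a_closed, unfold_locales)
  then show "0 \<in> I \<and> (\<forall>a\<in>I. \<forall>b\<in>I. a + b \<in> I) \<and> (\<forall>r. \<forall>a\<in>I. r * a \<in> I)"
    using I_l_closed by (simp add: ring_of_type_algebra_def)
next
  assume *: "0 \<in> I \<and> (\<forall>a\<in>I. \<forall>b\<in>I. a + b \<in> I) \<and> (\<forall>r. \<forall>a\<in>I. r * a \<in> I)"
  interpret ring "ring_of_type_algebra :: 'a ring" by (rule ring_from_type_algebra)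
  have neg: "- a \<in> I" if "a \<in> I" for a
    using * that by (metis mult_minus1)
  have inv: "m_inv (add_monoid ring_of_type_algebra) a = - a" for a :: 'a
    unfolding a_inv_def[symmetric]
    by (rule minus_equality) (auto simp: ring_of_type_algebra_def)
  have "subgroup I (add_monoid ring_of_type_algebra)"
  proof (rule subgroup.intro)
    fix x assume "x \<in> I"
    then show "inv\<^bsub>add_monoid ring_of_type_algebra\<^esub> x \<in> I" using inv neg by simp
  qed (use * in \<open>auto simp: ring_of_type_algebra_def\<close>)
  then show "is_ideal I"
  proof (intro idealI ring_from_type_algebra)
    fix a x assume "a \<in> I"
    then have "x * a \<in> I" using * by blast
    then show "x \<otimes>\<^bsub>ring_of_type_algebra\<^esub> a \<in> I" "a \<otimes>\<^bsub>ring_of_type_algebra\<^esub> x \<in> I"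
      by (simp_all add: ring_of_type_algebra_def mult.commute)
  qed
qed

lemma is_ideal_zero: "is_ideal I \<Longrightarrow> 0 \<in> I"
  and is_ideal_add: "is_ideal I \<Longrightarrow> a \<in> I \<Longrightarrow> b \<in> I \<Longrightarrow> a + b \<in> I"
  and is_ideal_mult: "is_ideal I \<Longrightarrow> a \<in> I \<Longrightarrow> r * a \<in> I"
  for I :: "'a::comm_ring_1 set"
  by (auto simp: is_ideal_iff)

lemma is_ideal_uminus: "is_ideal I \<Longrightarrow> a \<in> I \<Longrightarrow> - a \<in> I"
  for I :: "'a::comm_ring_1 set"
  using is_ideal_mult[of I a "- 1"] by simp

lemma is_ideal_diff: "is_ideal I \<Longrightarrow> a \<in> I \<Longrightarrow> b \<in> I \<Longrightarrow> a - b \<in> I"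
  for I :: "'a::comm_ring_1 set"
  using is_ideal_add[of I a "- b"] is_ideal_uminus[of I b] by simp

lemma is_prime_iff:
  "is_prime P \<longleftrightarrow> is_ideal P \<and> 1 \<notin> P \<and> (\<forall>a b. a * b \<in> P \<longrightarrow> a \<in> P \<or> b \<in> P)"
  for P :: "'a::comm_ring_1 set"
proof -
  have "UNIV = P \<longleftrightarrow> 1 \<in> P" if "is_ideal P"
    using that unfolding is_ideal_iff by (metis UNIV_I UNIV_eq_I mult.right_neutral)
  moreover have "is_prime P \<longleftrightarrow> is_ideal P \<and> UNIV \<noteq> P \<and> (\<forall>a b. a * b \<in> P \<longrightarrow> a \<in> P \<or> b \<in> P)"
    unfolding primeideal_def primeideal_axioms_def
    using cring_from_type_algebra[where 'a = 'a] by (auto simp: ring_of_type_algebra_def)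
  ultimately show ?thesis by blast
qed

lemma is_ideal_ideal_gen: "is_ideal (ideal_gen S)"
  for S :: "'a::comm_ring_1 set"
proof -
  interpret ring "ring_of_type_algebra :: 'a ring" by (rule ring_from_type_algebra)
  show ?thesis by (rule genideal_ideal) (simp add: ring_of_type_algebra_def)
qed

lemma ideal_gen_superset: "S \<subseteq> ideal_gen S"
  for S :: "'a::comm_ring_1 set"
proof -
  interpret ring "ring_of_type_algebra :: 'a ring" by (rule ring_from_type_algebra)
  show ?thesis by (rule genideal_self) (simp add: ring_of_type_algebra_def)
qed

lemma ideal_gen_subset: "is_ideal I \<Longrightarrow> S \<subseteq> I \<Longrightarrow> ideal_gen S \<subseteq> I"
  for S :: "'a::comm_ring_1 set"
proof -
  interpret ring "ring_of_type_algebra :: 'a ring" by (rule ring_from_type_algebra)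
  show "is_ideal I \<Longrightarrow> S \<subseteq> I \<Longrightarrow> ideal_gen S \<subseteq> I" by (rule genideal_minimal)
qed

lemma ideal_gen_3: "ideal_gen {a, b, c} = {u * a + v * b + w * c | u v w. True}"
  (is "_ = ?I") for a b c :: "'a::comm_ring_1"
proof
  have "is_ideal ?I"
    unfolding is_ideal_iff
  proof (intro conjI ballI allI)
    show "0 \<in> ?I" by (rule CollectI, intro exI[of _ 0]) simp
    fix x r assume "x \<in> ?I"
    then obtain u v w where x: "x = u * a + v * b + w * c" by blast
    show "r * x \<in> ?I"
      unfolding x by (rule CollectI, intro exI[of _ "r * u"] exI[of _ "r * v"] exI[of _ "r * w"]) (simp add: algebra_simps)
    fix y assume "y \<in> ?I"
    then obtain u' v' w' where y: "y = u' * a + v' * b + w' * c" by blast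
    show "x + y \<in> ?I"
      unfolding x y by (rule CollectI, intro exI[of _ "u + u'"] exI[of _ "v + v'"] exI[of _ "w + w'"]) (simp add: algebra_simps)
  qed
  moreover have "a \<in> ?I" by (rule CollectI, rule exI[of _ 1], rule exI[of _ 0], rule exI[of _ 0]) simp
  moreover have "b \<in> ?I" by (rule CollectI, rule exI[of _ 0], rule exI[of _ 1], rule exI[of _ 0]) simp
  moreover have "c \<in> ?I" by (rule CollectI, rule exI[of _ 0], rule exI[of _ 0], rule exI[of _ 1]) simp
  ultimately show "ideal_gen {a, b, c} \<subseteq> ?I" by (intro ideal_gen_subset) simp_all
  have "a \<in> ideal_gen {a, b, c}" "b \<in> ideal_gen {a, b, c}" "c \<in> ideal_gen {a, b, c}"
    using ideal_gen_superset[of "{a, b, c}"] by simp_all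
  then show "?I \<subseteq> ideal_gen {a, b, c}"
    using is_ideal_ideal_gen[of "{a, b, c}"] by (auto intro!: is_ideal_add is_ideal_mult)
qed

lemma ideal_gen_2: "ideal_gen {a, b} = {u * a + v * b | u v. True}"
  for a b :: "'a::comm_ring_1"
proof -
  have "ideal_gen {a, b} = ideal_gen {a, b, b}" by simp
  also have "\<dots> = {u * a + v * b | u v. True}"
    unfolding ideal_gen_3
  proof safe
    fix u v w
    show "\<exists>u' v'. u * a + v * b + w * b = u' * a + v' * b \<and> True"
      by (intro exI[of _ u] exI[of _ "v + w"]) (simp add: algebra_simps)
    show "\<exists>u' v' w'. u * a + v * b = u' * a + v' * b + w' * b \<and> True"
      by (intro exI[of _ u] exI[of _ v] exI[of _ 0]) simp
  qed
  finally show ?thesis .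
qed

lemma ideal_gen_1: "ideal_gen {a} = {u * a | u. True}"
  for a :: "'a::comm_ring_1"
proof -
  have "ideal_gen {a} = ideal_gen {a, a}" by simp
  also have "\<dots> = {u * a | u. True}"
    unfolding ideal_gen_2
  proof safe
    fix u v
    show "\<exists>u'. u * a + v * a = u' * a \<and> True"
      by (intro exI[of _ "u + v"]) (simp add: algebra_simps)
    show "\<exists>u' v'. u * a = u' * a + v' * a \<and> True"
      by (intro exI[of _ u] exI[of _ 0]) simp
  qed
  finally show ?thesis .
qed

text \<open>Krull's argument: an ideal maximal among those missing \<open>S\<close> is prime,
  because enlarging it by \<open>a\<close> or by \<open>b\<close> brings in elements of
  \<open>S\<close>, and their product would lie in the ideal together with
  \<open>a * b\<close>.\<close>

lemma prime_ideal_avoiding: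
  fixes I S :: "'a::comm_ring_1 set"
  assumes I: "is_ideal I" and S: "1 \<in> S" "\<And>s t. s \<in> S \<Longrightarrow> t \<in> S \<Longrightarrow> s * t \<in> S" "I \<inter> S = {}"
  obtains P where "is_prime P" "I \<subseteq> P" "P \<inter> S = {}"
proof -
  define A where "A = {K. is_ideal K \<and> I \<subseteq> K \<and> K \<inter> S = {}}"
  have "\<exists>M\<in>A. \<forall>W\<in>A. M \<subseteq> W \<longrightarrow> W = M"
  proof (rule subset_Zorn_nonempty)
    show "A \<noteq> {}" using I S unfolding A_def by blast
    fix CC assume CC: "CC \<noteq> {}" "subset.chain A CC"
    then have CA: "CC \<subseteq> A" and lin: "\<And>W Y. W \<in> CC \<Longrightarrow> Y \<in> CC \<Longrightarrow> W \<subseteq> Y \<or> Y \<subseteq> W"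
      unfolding subset.chain_def by auto
    have "is_ideal (\<Union>CC)"
      unfolding is_ideal_iff
    proof (intro conjI ballI allI)
      obtain K where "K \<in> CC" using CC by blast
      then show "0 \<in> \<Union>CC" using CA unfolding A_def by (auto simp: is_ideal_iff)
      fix a r assume "a \<in> \<Union>CC"
      then obtain K where K: "K \<in> CC" "a \<in> K" by blast
      then have "is_ideal K" using CA unfolding A_def by blast
      then show "r * a \<in> \<Union>CC" using K(1) is_ideal_mult[OF \<open>is_ideal K\<close> K(2), of r] by blast
      fix b assume "b \<in> \<Union>CC"
      then obtain L where L: "L \<in> CC" "b \<in> L" by blast
      then have "is_ideal L" using CA unfolding A_def by blast
      from lin[OF K(1) L(1)] show "a + b \<in> \<Union>CC"
      proof
        assume "K \<subseteq> L"
        then have "a + b \<in> L" using \<open>is_ideal L\<close> K L by (auto intro: is_ideal_add)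
        then show ?thesis using L by blast
      next
        assume "L \<subseteq> K"
        then have "a + b \<in> K" using \<open>is_ideal K\<close> K L by (auto intro: is_ideal_add)
        then show ?thesis using K by blast
      qed
    qed
    moreover have "I \<subseteq> \<Union>CC" using CC(1) CA unfolding A_def by blast
    moreover have "\<Union>CC \<inter> S = {}" using CA unfolding A_def by blast
    ultimately show "\<Union>CC \<in> A" unfolding A_def by blast
  qed
  then obtain M where "M \<in> A" and max: "\<And>W. W \<in> A \<Longrightarrow> M \<subseteq> W \<Longrightarrow> W = M" by metis
  then have M: "is_ideal M" "I \<subseteq> M" "M \<inter> S = {}" unfolding A_def by blast+
  have ext: "\<exists>m\<in>M. \<exists>r. m + r * a \<in> S" if "a \<notin> M" for a
  proof (rule ccontr)
    assume no: "\<not> (\<exists>m\<in>M. \<exists>r. m + r * a \<in> S)"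
    define K where "K = {m + r * a | m r. m \<in> M}"
    have "is_ideal K"
      unfolding is_ideal_iff
    proof (intro conjI ballI allI)
      show "0 \<in> K" unfolding K_def using is_ideal_zero[OF M(1)]
        by (intro CollectI exI[of _ 0]) simp
      fix x s assume "x \<in> K"
      then obtain m r where x: "x = m + r * a" "m \<in> M" unfolding K_def by blast
      show "s * x \<in> K" unfolding K_def x using is_ideal_mult[OF M(1) x(2), of s]
        by (intro CollectI exI[of _ "s * m"] exI[of _ "s * r"]) (simp add: algebra_simps)
      fix y assume "y \<in> K"
      then obtain m' r' where y: "y = m' + r' * a" "m' \<in> M" unfolding K_def by blast
      show "x + y \<in> K" unfolding K_def x y using is_ideal_add[OF M(1) x(2) y(2)]
        by (intro CollectI exI[of _ "m + m'"] exI[of _ "r + r'"]) (simp add: algebra_simps)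
    qed
    moreover have MK: "M \<subseteq> K"
    proof
      fix m assume "m \<in> M"
      then show "m \<in> K" unfolding K_def by (intro CollectI exI[of _ m] exI[of _ 0]) simp
    qed
    moreover have "K \<inter> S = {}" using no unfolding K_def by blast
    ultimately have "K = M" using max M(2) unfolding A_def by blast
    moreover have "a \<in> K" unfolding K_def using is_ideal_zero[OF M(1)]
      by (intro CollectI exI[of _ 0] exI[of _ 1]) simp
    ultimately show False using that by blast
  qed
  have "is_prime M"
    unfolding is_prime_iff
  proof (intro conjI allI impI M(1))
    show "1 \<notin> M" using M(3) S(1) by blast
    fix a b assume ab: "a * b \<in> M"
    show "a \<in> M \<or> b \<in> M"
    proof (rule ccontr)
      assume "\<not> ?thesis"
      then obtain m r m' r' where mr: "m \<in> M" "m + r * a \<in> S" "m' \<in> M" "m' + r' * b \<in> S"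
        using ext by blast
      have "(m + r * a) * (m' + r' * b) = (m' + r' * b) * m + (r * a) * m' + (r * r') * (a * b)"
        by (simp add: algebra_simps)
      also have "\<dots> \<in> M" by (intro is_ideal_add is_ideal_mult M(1) mr ab)
      finally show False using S(2)[OF mr(2) mr(4)] M(3) by blast
    qed
  qed
  then show ?thesis using that M by blast
qed

text \<open>The elements outside \<open>P\<close> times powers of \<open>f\<close> form a
  multiplicative set. It misses \<open>I\<close> because \<open>f\<close> is a nonzerodivisor modulo
  \<open>I\<close>, and a prime avoiding it lies below \<open>P\<close> without containing
  \<open>f\<close>. This replaces localisation in the lower bounds for heights.\<close>

lemma smaller_prime:
  fixes P I :: "'a::comm_ring_1 set"
  assumes "is_prime P" "is_ideal I" "I \<subseteq> P" "\<And>c. f * c \<in> I \<Longrightarrow> c \<in> I"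
  obtains Q where "is_prime Q" "I \<subseteq> Q" "Q \<subseteq> P" "f \<notin> Q"
proof -
  define S where "S = {s * f ^ k | s k. s \<notin> P}"
  have P: "is_ideal P" "1 \<notin> P" "\<And>a b. a * b \<in> P \<Longrightarrow> a \<in> P \<or> b \<in> P"
    using assms(1) unfolding is_prime_iff by blast+
  have one: "1 \<in> S" unfolding S_def using P(2) by (intro CollectI exI[of _ 1] exI[of _ 0]) simp
  have closed: "s * t \<in> S" if st: "s \<in> S" "t \<in> S" for s t
  proof -
    obtain s' k where s: "s = s' * f ^ k" "s' \<notin> P" using st unfolding S_def by blast
    obtain t' l where t: "t = t' * f ^ l" "t' \<notin> P" using st unfolding S_def by blast
    have "s' * t' \<notin> P" using P(3) s(2) t(2) by blast
    then show ?thesis unfolding S_def s t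
      by (intro CollectI exI[of _ "s' * t'"] exI[of _ "k + l"]) (simp add: power_add algebra_simps)
  qed
  have cancel: "c \<in> I" if "c * f ^ k \<in> I" for c k
    using that by (induction k) (use assms(4) in \<open>auto simp: algebra_simps\<close>)
  then have disj: "I \<inter> S = {}" unfolding S_def using assms(3) by blast
  obtain Q where Q: "is_prime Q" "I \<subseteq> Q" "Q \<inter> S = {}"
    using prime_ideal_avoiding[OF assms(2) one closed disj] by blast
  have "Q \<subseteq> P"
  proof
    fix q assume "q \<in> Q"
    moreover have "q \<in> S" if "q \<notin> P"
      unfolding S_def using that by (intro CollectI exI[of _ q] exI[of _ 0]) simp
    ultimately show "q \<in> P" using Q(3) by blast
  qed
  moreover have "f \<in> S" unfolding S_def using P(2) by (intro CollectI exI[of _ 1]) (auto intro: exI[of _ 1])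
  ultimately show ?thesis using that Q by blast
qed

definition prime_chain :: "nat \<Rightarrow> 'a::comm_ring_1 set \<Rightarrow> bool" where
  "prime_chain r P \<longleftrightarrow> (\<exists>Q. (\<forall>i\<le>r. is_prime (Q i)) \<and> (\<forall>i<r. Q i \<subset> Q (Suc i)) \<and> Q r = P)"

lemma prime_height_chain: "prime_height P = Sup {enat r | r. prime_chain r P}"
  unfolding prime_height_def prime_chain_def by (rule arg_cong[of _ _ Sup]) blast

lemma prime_chain_0: "is_prime P \<Longrightarrow> prime_chain 0 P"
  unfolding prime_chain_def by (intro exI[of _ "\<lambda>_. P"]) simp

lemma prime_chain_Suc:
  assumes "prime_chain r Q" "Q \<subset> P" "is_prime P"
  shows "prime_chain (Suc r) P"
proof -
  obtain F where F: "\<forall>i\<le>r. is_prime (F i)" "\<forall>i<r. F i \<subset> F (Suc i)" "F r = Q"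
    using assms(1) unfolding prime_chain_def by blast
  have "\<forall>i<Suc r. (F(Suc r := P)) i \<subset> (F(Suc r := P)) (Suc i)"
  proof (intro allI impI)
    fix i assume "i < Suc r"
    then consider "i < r" | "i = r" by linarith
    then show "(F(Suc r := P)) i \<subset> (F(Suc r := P)) (Suc i)"
      by cases (use F assms(2) in auto)
  qed
  moreover have "\<forall>i\<le>Suc r. is_prime ((F(Suc r := P)) i)"
    using F(1) assms(3) by (auto simp: le_Suc_eq)
  ultimately show ?thesis unfolding prime_chain_def by (intro exI[of _ "F(Suc r := P)"]) simp
qed

lemma prime_chain_SucE:
  assumes "prime_chain (Suc r) P"
  obtains Q where "prime_chain r Q" "is_prime Q" "Q \<subset> P" "is_prime P"
proof -
  obtain F where F: "\<forall>i\<le>Suc r. is_prime (F i)" "\<forall>i<Suc r. F i \<subset> F (Suc i)" "F (Suc r) = P"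
    using assms unfolding prime_chain_def by blast
  have "prime_chain r (F r)" unfolding prime_chain_def using F by (intro exI[of _ F]) auto
  moreover have "is_prime (F r)" "F r \<subset> P" "is_prime P" using F by auto
  ultimately show ?thesis by (rule that)
qed

lemma prime_height_ge: "prime_chain r P \<Longrightarrow> enat r \<le> prime_height P"
  unfolding prime_height_chain by (rule Sup_upper) blast

lemma prime_height_le: "(\<And>r. prime_chain r P \<Longrightarrow> r \<le> m) \<Longrightarrow> prime_height P \<le> enat m"
  unfolding prime_height_chain by (rule Sup_least) auto

text \<open>A regular sequence is peeled off from its end: each element yields a smaller prime that
  still contains the earlier ones.\<close>

lemma prime_chain_2:
  fixes P :: "('k::idom, 'n::finite) mpoly set"
  assumes "is_prime P" "f1 \<in> P" "f2 \<in> P" "f1 \<noteq> 0" "\<And>c u. f2 * c = u * f1 \<Longrightarrow> \<exists>v. c = v * f1"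
  shows "prime_chain 2 P"
proof -
  have P: "is_ideal P" using assms(1) by (simp add: is_prime_iff)
  have sub: "ideal_gen {f1} \<subseteq> P" using assms(2) by (intro ideal_gen_subset P) simp
  obtain Q where Q: "is_prime Q" "ideal_gen {f1} \<subseteq> Q" "Q \<subseteq> P" "f2 \<notin> Q"
  proof (rule smaller_prime[OF assms(1) is_ideal_ideal_gen sub])
    fix c assume "f2 * c \<in> ideal_gen {f1}"
    then show "c \<in> ideal_gen {f1}" using assms(5) unfolding ideal_gen_1 by blast
  qed
  have "is_ideal {0 :: ('k, 'n) mpoly}" by (simp add: is_ideal_iff)
  moreover have "{0} \<subseteq> Q" using Q(1) by (simp add: is_prime_iff is_ideal_iff)
  ultimately obtain Q0 where Q0: "is_prime Q0" "{0} \<subseteq> Q0" "Q0 \<subseteq> Q" "f1 \<notin> Q0"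
    using smaller_prime[OF Q(1), of "{0}" f1] assms(4) by auto
  have "f1 \<in> Q" using Q(2) ideal_gen_superset[of "{f1}"] by blast
  then have "prime_chain 1 Q" using prime_chain_Suc[OF prime_chain_0[OF Q0(1)], of Q] Q0 Q by auto
  then show ?thesis using prime_chain_Suc[of 1 Q P] Q assms(1,3) by (auto simp: numeral_2_eq_2)
qed

lemma prime_chain_3:
  fixes P :: "('k::idom, 'n::finite) mpoly set"
  assumes "is_prime P" "f1 \<in> P" "f2 \<in> P" "f3 \<in> P" "f1 \<noteq> 0"
    "\<And>c u. f2 * c = u * f1 \<Longrightarrow> \<exists>v. c = v * f1"
    "\<And>c u v. f3 * c = u * f1 + v * f2 \<Longrightarrow> \<exists>u' v'. c = u' * f1 + v' * f2"
  shows "prime_chain 3 P"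
proof -
  have P: "is_ideal P" using assms(1) by (simp add: is_prime_iff)
  have sub: "ideal_gen {f1, f2} \<subseteq> P" using assms(2,3) by (intro ideal_gen_subset P) simp
  obtain Q where Q: "is_prime Q" "ideal_gen {f1, f2} \<subseteq> Q" "Q \<subseteq> P" "f3 \<notin> Q"
  proof (rule smaller_prime[OF assms(1) is_ideal_ideal_gen sub])
    fix c assume "f3 * c \<in> ideal_gen {f1, f2}"
    then show "c \<in> ideal_gen {f1, f2}" using assms(7) unfolding ideal_gen_2 by blast
  qed
  have "f1 \<in> Q" "f2 \<in> Q" using Q(2) ideal_gen_superset[of "{f1, f2}"] by auto
  from prime_chain_2[OF Q(1) this assms(5,6)] have "prime_chain 2 Q" .
  then show ?thesis using prime_chain_Suc[of 2 Q P] Q assms(1,4) by (auto simp: numeral_3_eq_3 numeral_2_eq_2)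
qed

section \<open>Dimensions of subspaces, sums and images\<close>

context vector_space
begin

lemma independent_sum_0:
  assumes "finite B" "independent B" "(\<Sum>v\<in>B. f v *s v) = 0" "x \<in> B"
  shows "f x = 0"
  using assms(2) unfolding independent_explicit_finite_subsets by (metis assms(1,3,4) order_refl)

text \<open>An infinite basis has cardinality zero, so \<open>dim\<close> is monotone only inside a
  finite span; hence the set \<open>F\<close> here and below.\<close>

lemma dim_mono_finite:
  assumes "finite F" "W \<subseteq> span F" "U \<subseteq> W"
  shows "dim U \<le> dim W"
proof -
  obtain B where B: "B \<subseteq> U" "independent B" "U \<subseteq> span B" "card B = dim U"
    using basis_exists[of U] by metis
  obtain D where D: "B \<subseteq> D" "D \<subseteq> W" "independent D" "W \<subseteq> span D"
    using maximal_independent_subset_extend[of B W] B assms(3) by (metis order_trans)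
  have "finite D"
    using independent_span_bound[OF assms(1) D(3)] D(2) assms(2) by (metis order_trans)
  moreover have "card D = dim W" using basis_card_eq_dim[OF D(2,4,3)] .
  ultimately show ?thesis using B(4) D(1) by (metis card_mono)
qed

text \<open>A basis \<open>B\<close> of the intersection is extended to bases \<open>D\<close> and
  \<open>E\<close> of the two spaces, and \<open>D \<union> (E - B)\<close> is a basis of the
  sum.\<close>

lemma dim_sum_Int:
  assumes F: "finite F" "U \<subseteq> span F" "W \<subseteq> span F" and sub: "subspace U" "subspace W"
  shows "dim {u + w | u w. u \<in> U \<and> w \<in> W} + dim (U \<inter> W) = dim U + dim W"
proof -
  obtain B where B: "B \<subseteq> U \<inter> W" "independent B" "U \<inter> W \<subseteq> span B" "card B = dim (U \<inter> W)"
    using basis_exists[of "U \<inter> W"] by metis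
  obtain D where D: "B \<subseteq> D" "D \<subseteq> U" "independent D" "U \<subseteq> span D"
    using maximal_independent_subset_extend[of B U] B by (metis le_inf_iff)
  obtain E where E: "B \<subseteq> E" "E \<subseteq> W" "independent E" "W \<subseteq> span E"
    using maximal_independent_subset_extend[of B W] B by (metis le_inf_iff)
  have fin: "finite D" "finite E"
    using independent_span_bound[OF F(1) D(3)] independent_span_bound[OF F(1) E(3)] D(2) E(2) F(2,3)
    by (metis order_trans)+
  then have finB: "finite B" using D(1) finite_subset by metis
  have dimD: "card D = dim U" and dimE: "card E = dim W"
    using basis_card_eq_dim[OF D(2,4,3)] basis_card_eq_dim[OF E(2,4,3)] .
  have key: "(\<forall>v\<in>D. f v = 0) \<and> (\<forall>v\<in>E - B. f v = 0)"
    if sum0: "(\<Sum>v\<in>D. f v *s v) + (\<Sum>v\<in>E - B. f v *s v) = 0" for f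
  proof -
    let ?w = "\<Sum>v\<in>E - B. f v *s v"
    have "?w \<in> W" using E(2) sub(2) by (intro subspace_sum subspace_scale) auto
    moreover have "?w = - (\<Sum>v\<in>D. f v *s v)" using sum0 by (simp add: eq_neg_iff_add_eq_0 add.commute)
    moreover have "(\<Sum>v\<in>D. f v *s v) \<in> U" using D(2) sub(1) by (intro subspace_sum subspace_scale) auto
    ultimately have "?w \<in> U \<inter> W" using sub(1) by (simp add: subspace_neg)
    then have "?w \<in> span B" using B(3) by blast
    then obtain g where g: "?w = (\<Sum>v\<in>B. g v *s v)" using span_finite[OF finB] by auto
    \<comment> \<open>The part of the relation outside \<open>D\<close> lies in both spaces.
      Rewriting it over \<open>B\<close> turns it into a relation over \<open>E\<close>
      alone.\<close>
    let ?h = "\<lambda>v. if v \<in> B then - g v else f v"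
    have "(\<Sum>v\<in>E. ?h v *s v) = (\<Sum>v\<in>B. ?h v *s v) + (\<Sum>v\<in>E - B. ?h v *s v)"
      by (subst sum.subset_diff[OF E(1) fin(2)]) (rule add.commute)
    also have "(\<Sum>v\<in>B. ?h v *s v) = - (\<Sum>v\<in>B. g v *s v)"
      by (simp add: sum_negf)
    also have "(\<Sum>v\<in>E - B. ?h v *s v) = ?w" by (intro sum.cong) auto
    finally have "(\<Sum>v\<in>E. ?h v *s v) = 0" using g by simp
    then have h0: "?h v = 0" if "v \<in> E" for v
      using independent_sum_0[OF fin(2) E(3) _ that, of ?h] by blast
    have fE: "\<forall>v\<in>E - B. f v = 0"
    proof
      fix v assume "v \<in> E - B"
      then show "f v = 0" using h0[of v] by simp
    qed
    then have "?w = 0" by (intro sum.neutral) simp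
    then have "(\<Sum>v\<in>D. f v *s v) = 0" using sum0 by simp
    then have "\<forall>v\<in>D. f v = 0"
      using independent_sum_0[OF fin(1) D(3), of f] by blast
    with fE show ?thesis by blast
  qed
  have disj: "D \<inter> (E - B) = {}"
  proof (rule ccontr)
    assume "D \<inter> (E - B) \<noteq> {}"
    then obtain x where x: "x \<in> D" "x \<in> E - B" by blast
    have "x \<in> span B" using x D(2) E(2) B(3) by blast
    moreover have "span B \<subseteq> span (E - {x})" using x E(1) by (intro span_mono) blast
    ultimately have "dependent E" using x(2) unfolding dependent_def by blast
    then show False using E(3) by blast
  qed
  have ind: "independent (D \<union> (E - B))"
  proof (rule independent_if_scalars_zero)
    fix f x assume *: "(\<Sum>v\<in>D \<union> (E - B). f v *s v) = 0" "x \<in> D \<union> (E - B)"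
    have "(\<Sum>v\<in>D. f v *s v) + (\<Sum>v\<in>E - B. f v *s v) = 0"
      using *(1) sum.union_disjoint[of D "E - B" "\<lambda>v. f v *s v"] fin disj by simp
    then show "f x = 0" using key[of f] *(2) by blast
  qed (use fin in simp)
  have "card (D \<union> (E - B)) = dim {u + w | u w. u \<in> U \<and> w \<in> W}"
  proof (rule basis_card_eq_dim[OF _ _ ind])
    show "D \<union> (E - B) \<subseteq> {u + w | u w. u \<in> U \<and> w \<in> W}"
    proof
      fix x assume "x \<in> D \<union> (E - B)"
      then consider "x \<in> U" | "x \<in> W" using D(2) E(2) by blast
      then show "x \<in> {u + w | u w. u \<in> U \<and> w \<in> W}"
      proof cases
        case 1
        then show ?thesis using subspace_0[OF sub(2)] by (intro CollectI exI[of _ x] exI[of _ 0]) simp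
      next
        case 2
        then show ?thesis using subspace_0[OF sub(1)] by (intro CollectI exI[of _ 0] exI[of _ x]) simp
      qed
    qed
    have "span D \<subseteq> span (D \<union> (E - B))" "span E \<subseteq> span (D \<union> (E - B))"
      using D(1) by (intro span_mono; blast)+
    then show "{u + w | u w. u \<in> U \<and> w \<in> W} \<subseteq> span (D \<union> (E - B))"
      using D(4) E(4) by (auto intro!: span_add)
  qed
  moreover have "card (D \<union> (E - B)) + card B = card D + card E"
    using card_Un_disjoint[OF _ _ disj] fin finB E(1) card_mono[OF fin(2) E(1)]
    by (simp add: card_Diff_subset)
  ultimately show ?thesis using B(4) dimD dimE by simp
qed

lemma dim_inj_image:
  assumes f: "\<And>x y. f (x + y) = f x + f y" "\<And>c x. f (c *s x) = c *s f x" "\<And>x. f x = 0 \<Longrightarrow> x = 0"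
    and "finite F" "S \<subseteq> span F" "subspace S"
  shows "dim (f ` S) = dim S"
proof -
  have inj: "inj f"
  proof (rule injI)
    fix x y assume "f x = f y"
    moreover have "f (x - y) + f y = f x" using f(1)[of "x - y" y] by simp
    ultimately show "x = y" using f(3)[of "x - y"] by simp
  qed
  have fsum: "f (\<Sum>v\<in>A. c v *s v) = (\<Sum>v\<in>A. c v *s f v)" for A c
    by (induction A rule: infinite_finite_induct) (use f(1)[of 0 0] f in simp_all)
  obtain B where B: "B \<subseteq> S" "independent B" "S \<subseteq> span B" "card B = dim S"
    using basis_exists[of S] by metis
  have fin: "finite B"
    using independent_span_bound[OF assms(4) B(2)] B(1) assms(5) by (metis order_trans)
  have "card (f ` B) = dim (f ` S)"
  proof (rule basis_card_eq_dim)
    show "f ` B \<subseteq> f ` S" using B(1) by (rule image_mono)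
    show "f ` S \<subseteq> span (f ` B)"
    proof
      fix y assume "y \<in> f ` S"
      then obtain x where x: "y = f x" "x \<in> span B" using B(3) by blast
      then obtain c where "x = (\<Sum>v\<in>B. c v *s v)" using span_finite[OF fin] by auto
      then have "y = (\<Sum>v\<in>B. c v *s f v)" using x fsum by simp
      also have "\<dots> \<in> span (f ` B)" by (intro span_sum span_scale span_base) simp
      finally show "y \<in> span (f ` B)" .
    qed
    show "independent (f ` B)"
    proof (rule independent_if_scalars_zero)
      fix g x assume *: "(\<Sum>v\<in>f ` B. g v *s v) = 0" "x \<in> f ` B"
      have "(\<Sum>v\<in>f ` B. g v *s v) = (\<Sum>v\<in>B. g (f v) *s f v)"
        using inj by (subst sum.reindex) (auto intro: inj_on_subset)
      then have "f (\<Sum>v\<in>B. g (f v) *s v) = 0" using * fsum[of "\<lambda>v. g (f v)"] by simp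
      then have "(\<Sum>v\<in>B. g (f v) *s v) = 0" by (rule f(3))
      then have "\<forall>v\<in>B. g (f v) = 0"
        using independent_sum_0[OF fin B(2), of "\<lambda>v. g (f v)"] by blast
      then show "g x = 0" using *(2) by blast
    qed (use fin in simp)
  qed
  then show ?thesis using card_image[of f B] inj B(4) by (metis inj_on_subset subset_UNIV)
qed

end

section \<open>Polynomials as a vector space over the coefficients\<close>

interpretation mpoly: vector_space "\<lambda>(c::'k::field) (p::('k,'n::finite) mpoly). Poly_Mapping.single 0 c * p"
  by unfold_locales (simp_all add: algebra_simps single_add mult_single flip: mult.assoc)

definition supp_in :: "('n \<Rightarrow>\<^sub>0 nat) set \<Rightarrow> ('k::field, 'n::finite) mpoly set" where
  "supp_in M = {p. Poly_Mapping.keys p \<subseteq> M}"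

lemma mpoly_as_sum: "p = (\<Sum>m\<in>Poly_Mapping.keys p. Poly_Mapping.single 0 (Poly_Mapping.lookup p m) * Poly_Mapping.single m 1)"
  for p :: "('k::field, 'n::finite) mpoly"
proof -
  have "Poly_Mapping.lookup (\<Sum>m\<in>Poly_Mapping.keys p. Poly_Mapping.single 0 (Poly_Mapping.lookup p m) * Poly_Mapping.single m 1) k
      = Poly_Mapping.lookup p k" for k
    by (simp add: mult_single lookup_sum lookup_single when_def sum.delta in_keys_iff)
  then show ?thesis by (intro poly_mapping_eqI) simp
qed

lemma keys_scale: "Poly_Mapping.keys (Poly_Mapping.single 0 c * p) \<subseteq> Poly_Mapping.keys p"
  for p :: "('k::field, 'n::finite) mpoly"
  using keys_mult[of "Poly_Mapping.single 0 c" p] by (auto split: if_splits)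

lemma subspace_supp_in: "mpoly.subspace (supp_in M)"
  for M :: "('n::finite \<Rightarrow>\<^sub>0 nat) set"
proof (rule mpoly.subspaceI)
  show "0 \<in> supp_in M" by (simp add: supp_in_def)
  show "x + y \<in> supp_in M" if "x \<in> supp_in M" "y \<in> supp_in M" for x y
    using that keys_add[of x y] by (auto simp: supp_in_def)
  show "Poly_Mapping.single 0 c * x \<in> supp_in M" if "x \<in> supp_in M" for c x
    using that keys_scale[of c x] by (auto simp: supp_in_def)
qed

lemma supp_in_span: "supp_in M \<subseteq> mpoly.span ((\<lambda>m. Poly_Mapping.single m 1) ` M)"
  for M :: "('n::finite \<Rightarrow>\<^sub>0 nat) set"
proof
  fix p :: "('k::field, 'n) mpoly" assume "p \<in> supp_in M"
  then have "(\<Sum>m\<in>Poly_Mapping.keys p. Poly_Mapping.single 0 (Poly_Mapping.lookup p m) * Poly_Mapping.single m 1)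
     \<in> mpoly.span ((\<lambda>m. Poly_Mapping.single m 1) ` M)"
    unfolding supp_in_def by (intro mpoly.span_sum mpoly.span_scale mpoly.span_base) auto
  then show "p \<in> mpoly.span ((\<lambda>m. Poly_Mapping.single m 1) ` M)" using mpoly_as_sum[of p] by simp
qed

lemma dim_supp_in:
  fixes M :: "('n::finite \<Rightarrow>\<^sub>0 nat) set"
  assumes "finite M"
  shows "k_dim (supp_in M :: ('k::field, 'n) mpoly set) = card M"
proof -
  let ?e = "\<lambda>m. Poly_Mapping.single m 1 :: ('k, 'n) mpoly"
  have inj: "inj ?e" by (rule injI) (metis keys_single one_neq_zero singleton_inject)
  have "card (?e ` M) = k_dim (supp_in M :: ('k, 'n) mpoly set)"
  proof (rule mpoly.basis_card_eq_dim)
    show "?e ` M \<subseteq> supp_in M" by (auto simp: supp_in_def)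
    show "supp_in M \<subseteq> mpoly.span (?e ` M)" by (rule supp_in_span)
    show "mpoly.independent (?e ` M)"
    proof (rule mpoly.independent_if_scalars_zero)
      fix f x assume *: "(\<Sum>v\<in>?e ` M. Poly_Mapping.single 0 (f v) * v) = 0" "x \<in> ?e ` M"
      have "(\<Sum>v\<in>?e ` M. Poly_Mapping.single 0 (f v) * v) = (\<Sum>m\<in>M. Poly_Mapping.single m (f (?e m)))"
        using inj by (subst sum.reindex) (auto intro: inj_on_subset simp: mult_single)
      then have "Poly_Mapping.lookup (\<Sum>m\<in>M. Poly_Mapping.single m (f (?e m))) k = 0" for k
        using *(1) by simp
      moreover have "Poly_Mapping.lookup (\<Sum>m\<in>M. Poly_Mapping.single m (f (?e m))) k = f (?e k)" if "k \<in> M" for k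
        using that assms by (simp add: lookup_sum lookup_single when_def sum.delta)
      ultimately show "f x = 0" using *(2) by auto
    qed (use assms in simp)
  qed
  then show ?thesis using inj by (simp add: card_image inj_on_subset)
qed

lemma subspace_ideal: "is_ideal I \<Longrightarrow> mpoly.subspace I"
  by (rule mpoly.subspaceI) (auto simp: is_ideal_iff)

lemma supp_in_finite:
  assumes "finite M"
  obtains F where "finite F" "supp_in M \<subseteq> mpoly.span F"
  using supp_in_span[of M] assms by (metis finite_imageI)

subsection \<open>Growth and height\<close>

text \<open>Cubes of exponents rather than simplices: their size is an exact power, and degree
  bounds for products can be read off variable by variable.\<close>

definition box :: "'n::finite set \<Rightarrow> nat \<Rightarrow> ('n \<Rightarrow>\<^sub>0 nat) set" where
  "box T t = {m. \<forall>i. Poly_Mapping.lookup m i \<le> (if i \<in> T then t else 0)}"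

lemma card_box: "finite (box T t)" "card (box T t) = (t + 1) ^ card T"
  for T :: "'n::finite set"
proof -
  have bij: "bij_betw Poly_Mapping.lookup (box T t) (\<Pi>\<^sub>E i\<in>UNIV. if i \<in> T then {..t} else {0})"
  proof (rule bij_betwI[where g = Abs_poly_mapping])
    show "Poly_Mapping.lookup \<in> box T t \<rightarrow> (\<Pi>\<^sub>E i\<in>UNIV. if i \<in> T then {..t} else {0})"
      by (force simp: box_def split: if_splits)
    show "Abs_poly_mapping \<in> (\<Pi>\<^sub>E i\<in>UNIV. if i \<in> T then {..t} else {0}) \<rightarrow> box T t"
    proof
      fix f assume "f \<in> (\<Pi>\<^sub>E i\<in>(UNIV::'n set). if i \<in> T then {..t} else {0::nat})"
      then have f: "f i \<in> (if i \<in> T then {..t} else {0})" for i by (rule PiE_mem) simp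
      have "f i \<le> (if i \<in> T then t else 0)" for i using f[of i] by (cases "i \<in> T") simp_all
      then show "Abs_poly_mapping f \<in> box T t" unfolding box_def by simp
    qed
  qed simp_all
  have fin: "finite (\<Pi>\<^sub>E i\<in>(UNIV::'n set). if i \<in> T then {..t} else {0})"
    by (intro finite_PiE) auto
  then show "finite (box T t)" using bij bij_betw_finite by blast
  have "card (box T t) = card (\<Pi>\<^sub>E i\<in>(UNIV::'n set). if i \<in> T then {..t} else {0})"
    using bij by (rule bij_betw_same_card)
  also have "\<dots> = (\<Prod>i\<in>(UNIV::'n set). if i \<in> T then t + 1 else 1)"
    by (subst card_PiE) (auto intro!: prod.cong)
  also have "\<dots> = (t + 1) ^ card T"
    by (simp add: prod.If_cases)
  finally show "card (box T t) = (t + 1) ^ card T" .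
qed

abbreviation "Bx t \<equiv> supp_in (box UNIV t)"

lemma Bx_iff: "p \<in> Bx t \<longleftrightarrow> (\<forall>i. degv i p \<le> t)"
  by (auto simp: supp_in_def box_def degv_le_iff)

lemma supp_in_box_subset: "supp_in (box T t) \<subseteq> Bx t \<inter> polys_in T"
proof
  fix p assume p: "p \<in> supp_in (box T t)"
  have d: "degv i p \<le> (if i \<in> T then t else 0)" for i
    unfolding degv_le_iff
  proof
    fix m assume "m \<in> Poly_Mapping.keys p"
    then have "m \<in> box T t" using p unfolding supp_in_def by blast
    then show "Poly_Mapping.lookup m i \<le> (if i \<in> T then t else 0)" unfolding box_def by blast
  qed
  have "degv i p \<le> t" for i using d[of i] by (cases "i \<in> T") simp_all
  moreover have "degv i p = 0" if "i \<notin> T" for i using d[of i] that by simp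
  ultimately show "p \<in> Bx t \<inter> polys_in T"
    unfolding Bx_iff polys_in_def Int_iff mem_Collect_eq by blast
qed

text \<open>The dimension of \<open>Bx t\<close> modulo \<open>Q\<close>: a Hilbert function for the
  filtration by degrees in the single variables, which makes sense for inhomogeneous primes too. By
  \<open>dim_ideal_Bx_le\<close> the subtraction does not truncate.\<close>

definition box_hilbert :: "('k::field, 'n::finite) mpoly set \<Rightarrow> nat \<Rightarrow> nat" where
  "box_hilbert Q t = (t + 1) ^ CARD('n) - k_dim (Q \<inter> Bx t)"

lemma dim_Bx: "k_dim (Bx t :: ('k::field, 'n::finite) mpoly set) = (t + 1) ^ CARD('n)"
  by (simp add: dim_supp_in card_box)

lemma dim_Bx_mono:
  fixes V W :: "('k::field, 'n::finite) mpoly set"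
  assumes "V \<subseteq> W" "W \<subseteq> Bx t"
  shows "k_dim V \<le> k_dim W"
proof -
  obtain F where "finite F" "Bx t \<subseteq> mpoly.span (F :: ('k, 'n) mpoly set)"
    using supp_in_finite[OF card_box(1)] by metis
  then show ?thesis using mpoly.dim_mono_finite[of F W V] assms by blast
qed

lemma dim_Bx_sum:
  fixes V W :: "('k::field, 'n::finite) mpoly set"
  assumes "V \<subseteq> Bx t" "W \<subseteq> Bx t" "mpoly.subspace V" "mpoly.subspace W" "Z \<subseteq> Bx t"
    "\<And>v w. v \<in> V \<Longrightarrow> w \<in> W \<Longrightarrow> v + w \<in> Z"
  shows "k_dim V + k_dim W \<le> k_dim Z + k_dim (V \<inter> W)"
proof -
  obtain F where F: "finite F" "Bx t \<subseteq> mpoly.span (F :: ('k, 'n) mpoly set)"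
    using supp_in_finite[OF card_box(1)] by metis
  have "k_dim {v + w | v w. v \<in> V \<and> w \<in> W} \<le> k_dim Z"
    using assms(5,6) by (intro dim_Bx_mono) auto
  then show ?thesis
    using mpoly.dim_sum_Int[of F V W] F assms by fastforce
qed

lemma dim_ideal_Bx_le: "k_dim (Q \<inter> Bx t) \<le> (t + 1) ^ CARD('n)"
  for Q :: "('k::field, 'n::finite) mpoly set"
  using dim_Bx_mono[of "Q \<inter> Bx t" "Bx t" t] by (simp add: dim_Bx)

text \<open>\<open>Bx s\<close> modulo \<open>Q\<close> embeds into \<open>Bx t\<close> modulo
  \<open>Q\<close>; the embedding is expressed through the dimension of a sum.\<close>

lemma box_hilbert_mono:
  fixes Q :: "('k::field, 'n::finite) mpoly set"
  assumes "is_ideal Q" "s \<le> t"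
  shows "box_hilbert Q s \<le> box_hilbert Q t"
proof -
  have st: "Bx s \<subseteq> (Bx t :: ('k, 'n) mpoly set)" using assms(2) by (meson Bx_iff order_trans subsetI)
  have "k_dim (Q \<inter> Bx t) + k_dim (Bx s :: ('k, 'n) mpoly set) \<le> k_dim (Bx t :: ('k, 'n) mpoly set) + k_dim (Q \<inter> Bx t \<inter> Bx s)"
  proof (rule dim_Bx_sum[of _ t])
    show "mpoly.subspace (Q \<inter> Bx t)"
      by (intro mpoly.subspace_inter subspace_ideal assms subspace_supp_in)
    fix v w assume "v \<in> Q \<inter> Bx t" "w \<in> (Bx s :: ('k, 'n) mpoly set)"
    then show "v + w \<in> Bx t" using st by (intro mpoly.subspace_add[OF subspace_supp_in]) auto
  qed (use st subspace_supp_in in auto)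
  moreover have "Q \<inter> Bx t \<inter> Bx s = Q \<inter> Bx s" using st by blast
  ultimately show ?thesis unfolding box_hilbert_def dim_Bx by simp
qed

text \<open>Multiplication by \<open>x\<close> is injective modulo the prime \<open>Q\<close> and
  lands in \<open>P\<close>. So the image of \<open>Bx t\<close> accounts for
  \<open>box_hilbert Q t\<close> dimensions that are lost on passing from \<open>Q\<close> to
  \<open>P\<close>.\<close>

lemma box_hilbert_step:
  fixes P Q :: "('k::field, 'n::finite) mpoly set"
  assumes "is_prime Q" "is_ideal P" "Q \<subseteq> P" "x \<in> P" "x \<notin> Q" "x \<in> Bx d"
  shows "box_hilbert P (t + d) + box_hilbert Q t \<le> box_hilbert Q (t + d)"
proof -
  have Q: "is_ideal Q" using assms(1) by (simp add: is_prime_iff)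
  have x0: "x \<noteq> 0" using assms(5) Q by (auto simp: is_ideal_iff)
  let ?f = "\<lambda>p. x * p"
  have img: "k_dim (?f ` V) = k_dim V" if "V \<subseteq> Bx t" "mpoly.subspace V" for V
  proof -
    obtain F where "finite F" "Bx t \<subseteq> mpoly.span (F :: ('k, 'n) mpoly set)"
      using supp_in_finite[OF card_box(1)] by metis
    then show ?thesis
      using that x0 by (intro mpoly.dim_inj_image[of ?f F]) (auto simp: algebra_simps)
  qed
  have sub: "?f ` Bx t \<subseteq> Bx (t + d)"
    using assms(6) degv_mult_le[of _ x d _ t] by (auto simp: Bx_iff add.commute)
  have sp: "mpoly.subspace (?f ` Bx t)"
  proof (rule mpoly.subspaceI)
    show "0 \<in> ?f ` Bx t" by (rule image_eqI[of _ _ 0]) (auto simp: Bx_iff)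
    fix y z c assume "y \<in> ?f ` Bx t"
    then obtain y' where y: "y = x * y'" "y' \<in> Bx t" by blast
    show "Poly_Mapping.single 0 c * y \<in> ?f ` Bx t"
      using mpoly.subspace_scale[OF subspace_supp_in y(2), of c] unfolding y(1)
      by (intro image_eqI[of _ _ "Poly_Mapping.single 0 c * y'"]) (simp_all add: algebra_simps)
    assume "z \<in> ?f ` Bx t"
    then obtain z' where z: "z = x * z'" "z' \<in> Bx t" by blast
    show "y + z \<in> ?f ` Bx t"
      using mpoly.subspace_add[OF subspace_supp_in y(2) z(2)] unfolding y(1) z(1)
      by (intro image_eqI[of _ _ "y' + z'"]) (simp_all add: algebra_simps)
  qed
  have int: "Q \<inter> Bx (t + d) \<inter> ?f ` Bx t = ?f ` (Q \<inter> Bx t)"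
  proof
    show "?f ` (Q \<inter> Bx t) \<subseteq> Q \<inter> Bx (t + d) \<inter> ?f ` Bx t"
      using sub is_ideal_mult[OF Q] by auto
    show "Q \<inter> Bx (t + d) \<inter> ?f ` Bx t \<subseteq> ?f ` (Q \<inter> Bx t)"
      using assms(1,5) unfolding is_prime_iff by blast
  qed
  have "k_dim (Q \<inter> Bx (t + d)) + k_dim (?f ` Bx t) \<le> k_dim (P \<inter> Bx (t + d)) + k_dim (Q \<inter> Bx (t + d) \<inter> ?f ` Bx t)"
  proof (rule dim_Bx_sum[of _ "t + d"])
    show "mpoly.subspace (Q \<inter> Bx (t + d))"
      by (intro mpoly.subspace_inter subspace_ideal Q subspace_supp_in)
    show "mpoly.subspace (?f ` Bx t)" "?f ` Bx t \<subseteq> Bx (t + d)" by (rule sp, rule sub)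
    fix v w assume v: "v \<in> Q \<inter> Bx (t + d)" and w: "w \<in> ?f ` Bx t"
    have "v + w \<in> Bx (t + d)" using v w sub by (intro mpoly.subspace_add[OF subspace_supp_in]) auto
    moreover have "w \<in> P" using w assms(2,4) is_ideal_mult[OF assms(2,4)] by (auto simp: mult.commute)
    then have "v + w \<in> P" using v assms(2,3) by (auto intro: is_ideal_add)
    ultimately show "v + w \<in> P \<inter> Bx (t + d)" by blast
  qed auto
  moreover have "k_dim (?f ` Bx t) = (t + 1) ^ CARD('n)" using img[of "Bx t"] subspace_supp_in dim_Bx by force
  moreover have "k_dim (?f ` (Q \<inter> Bx t)) = k_dim (Q \<inter> Bx t)"
    by (intro img mpoly.subspace_inter subspace_ideal Q subspace_supp_in) simp
  ultimately show ?thesis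
    unfolding box_hilbert_def int using dim_ideal_Bx_le[of P "t + d"] dim_ideal_Bx_le[of Q t] by linarith
qed

text \<open>Adding up \<open>N\<close> instances of \<open>box_hilbert_step\<close> bounds
  \<open>N * box_hilbert P s\<close> by the value for \<open>Q\<close> at \<open>s + N * d\<close>.
  For \<open>N = s + 1\<close> this argument is \<open>(s + 1) * (d + 1) - 1\<close>, so a whole
  factor \<open>s + 1\<close> is gained at the price of a constant.\<close>

lemma prime_chain_growth:
  fixes P :: "('k::field, 'n::finite) mpoly set"
  assumes "prime_chain r P"
  shows "\<exists>c. \<forall>s. (s + 1) ^ r * box_hilbert P s \<le> c * (s + 1) ^ CARD('n)"
  using assms
proof (induction r arbitrary: P)
  case 0
  show ?case by (rule exI[of _ 1]) (simp add: box_hilbert_def)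
next
  case (Suc r)
  from Suc.prems obtain Q where Q: "prime_chain r Q" "is_prime Q" "Q \<subset> P" "is_prime P"
    by (rule prime_chain_SucE)
  obtain c where c: "\<And>s. (s + 1) ^ r * box_hilbert Q s \<le> c * (s + 1) ^ CARD('n)"
    using Suc.IH[OF Q(1)] by blast
  obtain x where x: "x \<in> P" "x \<notin> Q" using Q(3) by blast
  define d where "d = Max (range (\<lambda>i. degv i x))"
  have d: "x \<in> Bx d" unfolding Bx_iff d_def by (auto intro: Max_ge)
  have idP: "is_ideal P" and idQ: "is_ideal Q" using Q by (simp_all add: is_prime_iff)
  have iter: "N * box_hilbert P s \<le> box_hilbert Q (s + N * d)" for N s
  proof (induction N)
    case (Suc N)
    have "box_hilbert P (s + N * d + d) + box_hilbert Q (s + N * d) \<le> box_hilbert Q (s + N * d + d)"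
      using box_hilbert_step[OF Q(2) idP _ x d] Q(3) by blast
    moreover have "box_hilbert P s \<le> box_hilbert P (s + N * d + d)"
      by (rule box_hilbert_mono[OF idP]) simp
    ultimately show ?case using Suc by (simp add: algebra_simps)
  qed simp
  show ?case
  proof (intro exI allI)
    fix s
    let ?u = "s + (s + 1) * d"
    have "(s + 1) ^ Suc r * box_hilbert P s = (s + 1) ^ r * ((s + 1) * box_hilbert P s)"
      by (simp only: power_Suc mult.assoc mult.left_commute)
    also have "\<dots> \<le> (?u + 1) ^ r * box_hilbert Q ?u"
      by (intro mult_mono power_mono iter) simp_all
    also have "\<dots> \<le> c * (?u + 1) ^ CARD('n)" by (rule c)
    also have "?u + 1 = (s + 1) * (d + 1)" by simp
    finally show "(s + 1) ^ Suc r * box_hilbert P s \<le> (c * (d + 1) ^ CARD('n)) * (s + 1) ^ CARD('n)"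
      by (simp only: power_mult_distrib mult.assoc mult.left_commute mult.commute)
  qed
qed

text \<open>Polynomials in the variables of \<open>T\<close> stay independent modulo
  \<open>P\<close>, so \<open>box_hilbert P\<close> grows at least with the power
  \<open>card T\<close>, whereas a chain of length \<open>r\<close> allows at most the power
  \<open>CARD('n) - r\<close>.\<close>

lemma prime_height_polys_in:
  fixes P :: "('k::field, 'n::finite) mpoly set"
  assumes "is_prime P" "P \<inter> polys_in T \<subseteq> {0}"
  shows "prime_height P \<le> enat (CARD('n) - card T)"
proof (rule prime_height_le)
  fix r assume "prime_chain r P"
  then obtain c where c: "\<And>s. (s + 1) ^ r * box_hilbert P s \<le> c * (s + 1) ^ CARD('n)"
    using prime_chain_growth by blast
  have P: "is_ideal P" using assms(1) by (simp add: is_prime_iff)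
  have low: "(s + 1) ^ card T \<le> box_hilbert P s" for s
  proof -
    have "k_dim (P \<inter> Bx s) + k_dim (supp_in (box T s) :: ('k, 'n) mpoly set)
        \<le> k_dim (Bx s :: ('k, 'n) mpoly set) + k_dim (P \<inter> Bx s \<inter> supp_in (box T s))"
    proof (rule dim_Bx_sum[of _ s])
      show "mpoly.subspace (P \<inter> Bx s)"
        by (intro mpoly.subspace_inter subspace_ideal P subspace_supp_in)
      fix v w assume "v \<in> P \<inter> Bx s" "w \<in> (supp_in (box T s) :: ('k, 'n) mpoly set)"
      then show "v + w \<in> Bx s" using supp_in_box_subset[of T s]
        by (intro mpoly.subspace_add[OF subspace_supp_in]) auto
    qed (use supp_in_box_subset[of T s] subspace_supp_in in auto)
    moreover have "P \<inter> Bx s \<inter> supp_in (box T s) \<subseteq> {0}"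
      using supp_in_box_subset[of T s] assms(2) by blast
    then have "k_dim (P \<inter> Bx s \<inter> supp_in (box T s)) \<le> k_dim (supp_in {} :: ('k, 'n) mpoly set)"
      by (intro dim_Bx_mono[of _ _ s]) (auto simp: supp_in_def)
    ultimately show ?thesis
      unfolding box_hilbert_def by (simp add: dim_supp_in card_box)
  qed
  show "r \<le> CARD('n) - card T"
  proof (rule ccontr)
    assume "\<not> ?thesis"
    moreover have "card T \<le> CARD('n)" by (rule card_mono) simp_all
    ultimately have le: "CARD('n) + 1 \<le> r + card T" by linarith
    \<comment> \<open>Evaluation at \<open>s = c\<close> is enough, since
      \<open>(c + 1) ^ (CARD('n) + 1)\<close> exceeds \<open>c * (c + 1) ^ CARD('n)\<close>.\<close>
    have "(c + 1) ^ (CARD('n) + 1) \<le> (c + 1) ^ (r + card T)" by (rule power_increasing[OF le]) simp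
    also have "\<dots> \<le> (c + 1) ^ r * box_hilbert P c" unfolding power_add by (intro mult_mono low) simp_all
    also have "\<dots> \<le> c * (c + 1) ^ CARD('n)" by (rule c)
    finally show False by simp
  qed
qed

subsection \<open>Regular pairs\<close>

text \<open>A regular sequence of length two without properness, which is supplied separately in the
  form \<open>1 \<notin> ideal_gen {g1, g2}\<close>.\<close>

definition regular_pair :: "'a::comm_ring_1 \<Rightarrow> 'a \<Rightarrow> bool" where
  "regular_pair g1 g2 \<longleftrightarrow> g1 \<noteq> 0 \<and> (\<forall>c u. g2 * c = u * g1 \<longrightarrow> (\<exists>v. c = v * g1))"

lemma regular_pair_syzygy:
  fixes g1 g2 :: "('k::field, 'n::finite) mpoly"
  assumes "regular_pair g1 g2" "a * g1 + b * g2 = 0"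
  obtains c where "a = c * g2" "b = - c * g1"
proof -
  have "g2 * b = (- a) * g1" using assms(2) by (simp add: eq_neg_iff_add_eq_0 algebra_simps)
  then obtain v where v: "b = v * g1" using assms(1) unfolding regular_pair_def by blast
  have "g1 * a = g1 * (- v * g2)" using assms(2) unfolding v by (simp add: eq_neg_iff_add_eq_0 algebra_simps)
  then have "a = - v * g2" using assms(1) mpoly_mult_cancel unfolding regular_pair_def by metis
  then show ?thesis using that[of "- v"] v by simp
qed

lemma polys_in_empty: "s \<in> polys_in {} \<Longrightarrow> s = Poly_Mapping.single 0 (Poly_Mapping.lookup s 0)"
proof (rule poly_mapping_eqI)
  fix m assume s: "s \<in> polys_in {}"
  show "Poly_Mapping.lookup s m = Poly_Mapping.lookup (Poly_Mapping.single 0 (Poly_Mapping.lookup s 0)) m"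
  proof (cases "m = 0")
    case False
    have "m \<notin> Poly_Mapping.keys s"
    proof
      assume "m \<in> Poly_Mapping.keys s"
      then have "Poly_Mapping.lookup m i = 0" for i
        using lookup_le_degv[of m s i] s by (simp add: polys_in_def)
      then show False using False by (simp add: poly_mapping_eq_iff fun_eq_iff)
    qed
    then show ?thesis using False by (simp add: in_keys_iff lookup_single)
  qed simp
qed

lemma leading_coeff_polys_in:
  fixes p :: "('k::field, 'n::finite) mpoly"
  assumes "p \<in> polys_in (insert i T)" "0 < degv i p"
  obtains L p' where "p = L * Poly_Mapping.single (Poly_Mapping.single i (degv i p)) 1 + p'"
    "degv i L = 0" "\<And>j. degv j L \<le> degv j p" "\<And>j. degv j p' \<le> degv j p" "degv i p' < degv i p"
    "L \<noteq> 0" "L \<in> polys_in T"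
proof (rule leading_part[of p i])
  fix L p' assume *: "p = L * Poly_Mapping.single (Poly_Mapping.single i (degv i p)) 1 + p'"
    "degv i L = 0" "\<And>j. degv j L \<le> degv j p" "\<And>j. degv j p' \<le> degv j p"
    "p \<noteq> 0 \<Longrightarrow> L \<noteq> 0" "0 < degv i p \<Longrightarrow> degv i p' < degv i p"
  have "p \<noteq> 0" using assms(2) by auto
  have "degv j L = 0" if "j \<notin> T" for j
    using that *(2) *(3)[of j] assms(1) unfolding polys_in_def by (cases "j = i") auto
  then have "L \<in> polys_in T" unfolding polys_in_def by blast
  then show thesis using that[OF *(1-4) *(6)[OF assms(2)] *(5)[OF \<open>p \<noteq> 0\<close>]] by blast
qed

text \<open>An elementwise form of the isomorphisms \<open>Hom(R/P, R/(g\<^sub>1, g\<^sub>2)) = Ext\<^sup>2(R/P, R) = Hom(R/P, R/(p\<^sub>1, p\<^sub>2))\<close> for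
  regular sequences in \<open>P\<close>; the right hand side vanishes up to leading coefficients by means of \<open>p\<^sub>3\<close>.\<close>

lemma regular_pair_quotient_torsion_free:
  fixes g1 g2 a :: "('k::field, 'n::finite) mpoly"
  assumes reg: "regular_pair g1 g2" and a: "a \<notin> ideal_gen {g1, g2}"
  obtains T where "CARD('n) - 2 \<le> card T" "\<And>s. s \<in> polys_in T \<Longrightarrow> s * a \<in> ideal_gen {g1, g2} \<Longrightarrow> s = 0"
proof -
  let ?I = "ideal_gen {g1, g2}"
  \<comment> \<open>A maximal member of \<open>TT\<close> is a largest set of variables independent
    on the class of \<open>a\<close> modulo the ideal.\<close>
  define TT where "TT = {T :: 'n set. \<forall>s\<in>polys_in T. s * a \<in> ?I \<longrightarrow> s = 0}"
  have "{} \<in> TT"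
    unfolding TT_def
  proof (intro CollectI ballI impI)
    fix s :: "('k, 'n) mpoly" assume s: "s \<in> polys_in {}" "s * a \<in> ?I"
    obtain c where c: "s = Poly_Mapping.single 0 c" using polys_in_empty[OF s(1)] by blast
    show "s = 0"
    proof (rule ccontr)
      assume "s \<noteq> 0"
      then have "c \<noteq> 0" using c by auto
      have "Poly_Mapping.single 0 (inverse c) * (s * a) \<in> ?I"
        by (rule is_ideal_mult[OF is_ideal_ideal_gen s(2)])
      moreover have "Poly_Mapping.single 0 (inverse c) * (s * a) = a"
        using \<open>c \<noteq> 0\<close> by (simp add: c mult_single flip: mult.assoc)
      ultimately show False using a by simp
    qed
  qed
  then obtain T where T: "T \<in> TT" "\<And>T'. T' \<in> TT \<Longrightarrow> T \<subseteq> T' \<Longrightarrow> T = T'"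
    using finite_has_maximal[of TT] by (metis empty_iff finite_code)
  have T0: "s = 0" if "s \<in> polys_in T" "s * a \<in> ?I" for s using T(1) that unfolding TT_def by blast
  \<comment> \<open>By maximality, every further variable \<open>v\<close> is algebraic: some
    polynomial over \<open>T\<close> that really involves \<open>v\<close> annihilates the class of
    \<open>a\<close>.\<close>
  have ex: "\<exists>p\<in>polys_in (insert v T). p * a \<in> ?I \<and> 0 < degv v p" if v: "v \<notin> T" for v
  proof -
    have "insert v T \<notin> TT" using T(2)[of "insert v T"] v by blast
    then obtain p where p: "p \<in> polys_in (insert v T)" "p * a \<in> ?I" "p \<noteq> 0" unfolding TT_def by blast
    have "0 < degv v p"
    proof (rule ccontr)
      assume "\<not> 0 < degv v p"
      then have "degv w p = 0" if "w \<notin> T" for w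
        using that p(1) unfolding polys_in_def by (cases "w = v") auto
      then have "p \<in> polys_in T" unfolding polys_in_def by blast
      then show False using T0 p by blast
    qed
    then show ?thesis using p by blast
  qed
  have "CARD('n) - 2 \<le> card T"
  proof (rule ccontr)
    assume "\<not> ?thesis"
    then have "3 \<le> card (- T)" by (simp add: Compl_eq_Diff_UNIV card_Diff_subset)
    then obtain V where V: "V \<subseteq> - T" "card V = 3" by (metis obtain_subset_with_card_n)
    then obtain i j l where V': "V = {i, j, l}" and ne: "i \<noteq> j" "i \<noteq> l" "j \<noteq> l" unfolding card_3_iff by blast
    then have ijl: "i \<notin> T" "j \<notin> T" "l \<notin> T" using V by auto
    obtain p1 where p1: "p1 \<in> polys_in (insert i T)" "p1 * a \<in> ?I" "0 < degv i p1" using ex[OF ijl(1)] by blast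
    obtain p2 where p2: "p2 \<in> polys_in (insert j T)" "p2 * a \<in> ?I" "0 < degv j p2" using ex[OF ijl(2)] by blast
    obtain p3 where p3: "p3 \<in> polys_in (insert l T)" "p3 * a \<in> ?I" "0 < degv l p3" using ex[OF ijl(3)] by blast
    obtain L p1' where L: "p1 = L * Poly_Mapping.single (Poly_Mapping.single i (degv i p1)) 1 + p1'"
      "degv i L = 0" "\<And>j. degv j L \<le> degv j p1" "\<And>j. degv j p1' \<le> degv j p1" "degv i p1' < degv i p1"
      "L \<noteq> 0" "L \<in> polys_in T"
      by (rule leading_coeff_polys_in[OF p1(1,3)]) (rule that)
    obtain K p2' where K: "p2 = K * Poly_Mapping.single (Poly_Mapping.single j (degv j p2)) 1 + p2'"
      "degv j K = 0" "\<And>j'. degv j' K \<le> degv j' p2" "\<And>j'. degv j' p2' \<le> degv j' p2" "degv j p2' < degv j p2"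
      "K \<noteq> 0" "K \<in> polys_in T"
      by (rule leading_coeff_polys_in[OF p2(1,3)]) (rule that)
    have d: "degv i p2 = 0" "degv i p3 = 0" "degv j p3 = 0" "degv j L = 0"
      using p2(1) p3(1) L(7) ne ijl unfolding polys_in_def by auto
    have nz: "p1 \<noteq> 0" "p2 \<noteq> 0" "p3 \<noteq> 0" using p1(3) p2(3) p3(3) by auto
    obtain \<alpha>1 \<beta>1 where e1: "p1 * a = \<alpha>1 * g1 + \<beta>1 * g2" using p1(2) unfolding ideal_gen_2 by blast
    obtain \<alpha>2 \<beta>2 where e2: "p2 * a = \<alpha>2 * g1 + \<beta>2 * g2" using p2(2) unfolding ideal_gen_2 by blast
    obtain \<alpha>3 \<beta>3 where e3: "p3 * a = \<alpha>3 * g1 + \<beta>3 * g2" using p3(2) unfolding ideal_gen_2 by blast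
    \<comment> \<open>Multiplying two representations crosswise leaves a relation between
      \<open>g1\<close> and \<open>g2\<close>, which must be a Koszul relation.\<close>
    have koszul: "\<exists>c. q * \<alpha> - p * \<alpha>' = c * g2 \<and> q * \<beta> - p * \<beta>' = - c * g1"
      if "p * a = \<alpha> * g1 + \<beta> * g2" "q * a = \<alpha>' * g1 + \<beta>' * g2" for p q \<alpha> \<beta> \<alpha>' \<beta>'
    proof -
      have "(q * \<alpha> - p * \<alpha>') * g1 + (q * \<beta> - p * \<beta>') * g2 = q * (p * a) - p * (q * a)"
        unfolding that by (simp add: algebra_simps)
      also have "\<dots> = 0" by (simp add: algebra_simps)
      finally show ?thesis using regular_pair_syzygy[OF reg] by metis
    qed
    obtain c12 where c12: "p2 * \<alpha>1 - p1 * \<alpha>2 = c12 * g2" "p2 * \<beta>1 - p1 * \<beta>2 = - c12 * g1"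
      using koszul[OF e1 e2] by blast
    obtain c13 where c13: "p3 * \<alpha>1 - p1 * \<alpha>3 = c13 * g2" "p3 * \<beta>1 - p1 * \<beta>3 = - c13 * g1"
      using koszul[OF e1 e3] by blast
    obtain c23 where c23: "p3 * \<alpha>2 - p2 * \<alpha>3 = c23 * g2" "p3 * \<beta>2 - p2 * \<beta>3 = - c23 * g1"
      using koszul[OF e2 e3] by blast
    \<comment> \<open>The three Koszul coefficients satisfy the alternating relation of their
      origin, so \<open>p3 * c12\<close> lies in the ideal of \<open>p1\<close> and
      \<open>p2\<close>. Then so does \<open>c12\<close>, up to the leading coefficients
      \<open>L\<close> and \<open>K\<close>.\<close>
    have "(p3 * c12 - p2 * c13 + p1 * c23) * g1 =
        - (p3 * (p2 * \<beta>1 - p1 * \<beta>2) - p2 * (p3 * \<beta>1 - p1 * \<beta>3) + p1 * (p3 * \<beta>2 - p2 * \<beta>3))"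
      unfolding c12(2) c13(2) c23(2) by (simp add: algebra_simps)
    also have "\<dots> = 0" by (simp add: algebra_simps)
    finally have "p3 * c12 - p2 * c13 + p1 * c23 = 0" using reg unfolding regular_pair_def by simp
    then have "p3 * c12 = (- c23) * p1 + c13 * p2" by (simp add: algebra_simps)
    from triangular_regular3[OF L(1-5) K(1-5) d(1,4) L(6) nz(3) d(2,3) this]
    obtain M N u v where uv: "L ^ M * K ^ N * c12 = u * p1 + v * p2" by blast
    define s where "s = L ^ M * K ^ N"
    \<comment> \<open>Changing the coefficients by \<open>- v * g2\<close> and \<open>v * g1\<close>
      does not alter the represented element, but makes both divisible by \<open>p1\<close> up to
      powers of \<open>L\<close>. Cancelling \<open>p1\<close> then gives a nonzero \<open>S\<close>
      over \<open>T\<close> that annihilates the class of \<open>a\<close>, against the choice of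
      \<open>T\<close>.\<close>
    have "p2 * (s * \<alpha>1 - v * g2) = (s * \<alpha>2 + u * g2) * p1"
    proof -
      have "s * (p2 * \<alpha>1 - p1 * \<alpha>2) = (s * c12) * g2" unfolding c12(1) by (simp add: mult.assoc)
      also have "\<dots> = (u * p1 + v * p2) * g2" using uv unfolding s_def by simp
      finally show ?thesis by (simp add: algebra_simps)
    qed
    then obtain N' z where z: "L ^ N' * (s * \<alpha>1 - v * g2) = z * p1"
      using triangular_regular2[OF L(1-5) nz(2) d(1)] by blast
    have "p2 * (s * \<beta>1 + v * g1) = (s * \<beta>2 - u * g1) * p1"
    proof -
      have "s * (p2 * \<beta>1 - p1 * \<beta>2) = - (s * c12) * g1" unfolding c12(2) by (simp add: mult.assoc)
      also have "\<dots> = - (u * p1 + v * p2) * g1" using uv unfolding s_def by simp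
      finally show ?thesis by (simp add: algebra_simps)
    qed
    then obtain N'' z' where z': "L ^ N'' * (s * \<beta>1 + v * g1) = z' * p1"
      using triangular_regular2[OF L(1-5) nz(2) d(1)] by blast
    define S where "S = L ^ N' * L ^ N'' * s"
    have "p1 * (S * a) = L ^ N' * L ^ N'' * (s * (p1 * a))" unfolding S_def by (simp add: algebra_simps)
    also have "\<dots> = L ^ N'' * (L ^ N' * (s * \<alpha>1 - v * g2)) * g1 + L ^ N' * (L ^ N'' * (s * \<beta>1 + v * g1)) * g2"
      unfolding e1 by (simp add: algebra_simps)
    also have "\<dots> = p1 * (L ^ N'' * z * g1 + L ^ N' * z' * g2)" unfolding z z' by (simp add: algebra_simps)
    finally have "S * a = L ^ N'' * z * g1 + L ^ N' * z' * g2" using mpoly_mult_cancel[OF nz(1)] by blast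
    then have "S * a \<in> ?I" unfolding ideal_gen_2 by blast
    moreover have "S \<in> polys_in T" unfolding S_def s_def by (intro polys_in_mult polys_in_power L(7) K(7))
    moreover have "S \<noteq> 0" unfolding S_def s_def using mpoly_power_eq_0[OF L(6)] mpoly_power_eq_0[OF K(6)] by simp
    ultimately show False using T0 by blast
  qed
  then show ?thesis using that T0 by blast
qed

text \<open>An associated prime is the annihilator of a class, and such an annihilator contains no
  nonzero polynomial in the variables \<open>T\<close> found above.\<close>

lemma prime_height_associated:
  fixes g1 g2 :: "('k::field, 'n::finite) mpoly"
  assumes "regular_pair g1 g2" "is_prime P" "P = {r. r * a \<in> ideal_gen {g1, g2}}"
  shows "prime_height P \<le> 2"
proof -
  have "a \<notin> ideal_gen {g1, g2}" using assms(2,3) by (auto simp: is_prime_iff)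
  then obtain T where T: "CARD('n) - 2 \<le> card T" "\<And>s. s \<in> polys_in T \<Longrightarrow> s * a \<in> ideal_gen {g1, g2} \<Longrightarrow> s = 0"
    using regular_pair_quotient_torsion_free[OF assms(1)] by metis
  have "P \<inter> polys_in T \<subseteq> {0}" using T(2) unfolding assms(3) by blast
  from prime_height_polys_in[OF assms(2) this] have "prime_height P \<le> enat (CARD('n) - card T)" .
  also have "\<dots> \<le> enat 2" using T(1) by simp
  finally show ?thesis by (simp add: numeral_eq_enat)
qed

lemma prime_over_disjoint_polys:
  fixes I :: "('k::field, 'n::finite) mpoly set"
  assumes "is_ideal I" "\<And>s. s \<in> polys_in T \<Longrightarrow> s \<in> I \<Longrightarrow> s = 0"
  obtains P where "is_prime P" "I \<subseteq> P" "prime_height P \<le> enat (CARD('n) - card T)"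
proof -
  obtain P where P: "is_prime P" "I \<subseteq> P" "P \<inter> (polys_in T - {0}) = {}"
  proof (rule prime_ideal_avoiding[OF assms(1)])
    show "(1 :: ('k, 'n) mpoly) \<in> polys_in T - {0}" using polys_in_1 by simp
    show "s * t \<in> polys_in T - {0}" if "s \<in> polys_in T - {0}" "t \<in> polys_in T - {0}" for s t :: "('k, 'n) mpoly"
      using that polys_in_mult by auto
    show "I \<inter> (polys_in T - {0}) = {}" using assms(2) by blast
  qed
  have "P \<inter> polys_in T \<subseteq> {0}" using P(3) by blast
  then show ?thesis using that P prime_height_polys_in by blast
qed

text \<open>The class of 1 is the relevant one here. The result stands in for Krull's height theorem
  for two elements.\<close>

lemma prime_over_regular_pair:
  fixes g1 g2 :: "('k::field, 'n::finite) mpoly"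
  assumes "regular_pair g1 g2" "1 \<notin> ideal_gen {g1, g2}"
  obtains P where "is_prime P" "ideal_gen {g1, g2} \<subseteq> P" "prime_height P \<le> 2"
proof -
  obtain T where T: "CARD('n) - 2 \<le> card T" "\<And>s. s \<in> polys_in T \<Longrightarrow> s * 1 \<in> ideal_gen {g1, g2} \<Longrightarrow> s = 0"
    using regular_pair_quotient_torsion_free[OF assms] by metis
  obtain P where P: "is_prime P" "ideal_gen {g1, g2} \<subseteq> P" "prime_height P \<le> enat (CARD('n) - card T)"
    using prime_over_disjoint_polys[OF is_ideal_ideal_gen, of T "{g1, g2}"] T(2) by auto
  note P(3)
  also have "enat (CARD('n) - card T) \<le> enat 2" using T(1) by simp
  finally show ?thesis using that P by (simp add: numeral_eq_enat)
qed

text \<open>A nonzero multiple of a polynomial that involves x_i involves x_i too, so all the other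
  variables are independent modulo \<open>c\<close>.\<close>

lemma prime_over_principal:
  fixes c :: "('k::field, 'n::finite) mpoly"
  assumes "c = 0 \<or> 0 < degv i c"
  obtains P where "is_prime P" "ideal_gen {c} \<subseteq> P" "prime_height P \<le> 1"
proof -
  obtain P where P: "is_prime P" "ideal_gen {c} \<subseteq> P" "prime_height P \<le> enat (CARD('n) - card (UNIV - {i}))"
  proof (rule prime_over_disjoint_polys[OF is_ideal_ideal_gen])
    fix s assume s: "s \<in> polys_in (UNIV - {i})" "s \<in> ideal_gen {c}"
    then obtain u where u: "s = u * c" unfolding ideal_gen_1 by blast
    have "degv i s = 0" using s(1) unfolding polys_in_def by auto
    then show "s = 0" using assms u by (cases "u = 0"; cases "c = 0") (auto simp: degv_mult)
  qed
  have "0 < CARD('n)" by simp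
  then have "CARD('n) - card (UNIV - {i}) = 1" by (simp add: card_Diff_singleton)
  then show ?thesis using that P by (simp add: one_enat_def)
qed

lemma height_le: "is_prime P \<Longrightarrow> I \<subseteq> P \<Longrightarrow> height I \<le> prime_height P"
  unfolding height_def by (rule Inf_lower) blast

lemma height_ge: "(\<And>P. is_prime P \<Longrightarrow> I \<subseteq> P \<Longrightarrow> h \<le> prime_height P) \<Longrightarrow> h \<le> height I"
  unfolding height_def by (rule Inf_greatest) blast

subsection \<open>Homogeneous components\<close>

lemma mon_degree_add: "mon_degree (a + b) = mon_degree a + mon_degree b"
  by (simp add: mon_degree_def lookup_add sum.distrib)

lemma mon_degree_zero [simp]: "mon_degree 0 = 0"
  by (simp add: mon_degree_def)

lemma mon_degree_eq_0: "mon_degree m = 0 \<longleftrightarrow> m = 0"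
  by (auto simp: mon_degree_def poly_mapping_eq_iff fun_eq_iff)

lemma mon_degree_1:
  assumes "mon_degree m = 1" "Poly_Mapping.lookup m i \<noteq> 0"
  shows "m = Poly_Mapping.single i 1"
proof (rule poly_mapping_eqI)
  have "mon_degree m = Poly_Mapping.lookup m i + (\<Sum>j\<in>UNIV - {i}. Poly_Mapping.lookup m j)"
    unfolding mon_degree_def by (rule sum.remove) simp_all
  with assms have *: "Poly_Mapping.lookup m i = 1" "(\<Sum>j\<in>UNIV - {i}. Poly_Mapping.lookup m j) = 0" by linarith+
  fix j show "Poly_Mapping.lookup m j = Poly_Mapping.lookup (Poly_Mapping.single i 1) j"
    using * by (cases "j = i") (simp_all add: lookup_single)
qed

text \<open>Degrees are integers, so shifts need no truncated subtraction and components of negative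
  degree are zero.\<close>

definition hcomp :: "int \<Rightarrow> ('k::zero, 'n::finite) mpoly \<Rightarrow> ('k, 'n) mpoly" where
  "hcomp d p = Poly_Mapping.mapp (\<lambda>m c. if int (mon_degree m) = d then c else 0) p"

lemma lookup_hcomp: "Poly_Mapping.lookup (hcomp d p) m = (if int (mon_degree m) = d then Poly_Mapping.lookup p m else 0)"
  by (simp add: hcomp_def lookup_mapp when_def in_keys_iff)

lemma homogeneous_lookup: "homogeneous d p \<longleftrightarrow> (\<forall>m. Poly_Mapping.lookup p m \<noteq> 0 \<longrightarrow> int (mon_degree m) = d)"
  by (simp add: homogeneous_def Ball_def in_keys_iff)

lemma hcomp_add: "hcomp d (p + q) = hcomp d p + hcomp d q"
  for p q :: "('k::comm_ring_1, 'n::finite) mpoly"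
  by (rule poly_mapping_eqI) (simp add: lookup_hcomp lookup_add)

lemma hcomp_diff: "hcomp d (p - q) = hcomp d p - hcomp d q"
  for p q :: "('k::comm_ring_1, 'n::finite) mpoly"
  by (rule poly_mapping_eqI) (simp add: lookup_hcomp lookup_minus)

lemma homogeneous_hcomp [simp]: "homogeneous d (hcomp d p)"
  by (simp add: homogeneous_lookup lookup_hcomp)

lemma hcomp_homogeneous: "homogeneous d p \<Longrightarrow> hcomp e p = (if e = d then p else 0)"
  by (rule poly_mapping_eqI) (auto simp: homogeneous_lookup lookup_hcomp)

lemma hcomp_neg: "d < 0 \<Longrightarrow> hcomp d p = 0"
  by (rule poly_mapping_eqI) (auto simp: lookup_hcomp)

lemma homogeneous_neg: "homogeneous d p \<Longrightarrow> d < 0 \<Longrightarrow> p = 0"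
  by (metis hcomp_homogeneous hcomp_neg)

lemma homogeneous_zero [simp]: "homogeneous d 0"
  by (simp add: homogeneous_lookup)

lemma homogeneous_add: "homogeneous d p \<Longrightarrow> homogeneous d q \<Longrightarrow> homogeneous d (p + q)"
  for p q :: "('k::comm_ring_1, 'n::finite) mpoly"
  using keys_add[of p q] by (auto simp: homogeneous_def)

lemma homogeneous_uminus: "homogeneous d p \<Longrightarrow> homogeneous d (- p)"
  for p :: "('k::comm_ring_1, 'n::finite) mpoly"
  by (simp add: homogeneous_lookup)

lemma homogeneous_diff: "homogeneous d p \<Longrightarrow> homogeneous d q \<Longrightarrow> homogeneous d (p - q)"
  for p q :: "('k::comm_ring_1, 'n::finite) mpoly"
  using homogeneous_add[of d p "- q"] homogeneous_uminus[of d q] by simp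

lemma homogeneous_mult: "homogeneous d p \<Longrightarrow> homogeneous e q \<Longrightarrow> homogeneous (d + e) (p * q)"
  for p q :: "('k::comm_ring_1, 'n::finite) mpoly"
  unfolding homogeneous_def
proof
  fix m assume *: "\<forall>m\<in>Poly_Mapping.keys p. int (mon_degree m) = d" "\<forall>m\<in>Poly_Mapping.keys q. int (mon_degree m) = e"
    "m \<in> Poly_Mapping.keys (p * q)"
  then obtain a b where "m = a + b" "a \<in> Poly_Mapping.keys p" "b \<in> Poly_Mapping.keys q"
    using keys_mult[of p q] by blast
  then show "int (mon_degree m) = d + e" using * by (simp add: mon_degree_add)
qed

abbreviation cst :: "'k::zero \<Rightarrow> ('k, 'n::finite) mpoly" where
  "cst \<equiv> Poly_Mapping.single 0"

lemma homogeneous_cst [simp]: "homogeneous 0 (cst c)"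
  by (simp add: homogeneous_lookup lookup_single when_def)

lemma homogeneous_cst_mult: "homogeneous d p \<Longrightarrow> homogeneous d (cst c * p)"
  for p :: "('k::comm_ring_1, 'n::finite) mpoly"
  using homogeneous_mult[of 0 "cst c" d p] by simp

lemma homogeneous_0_cst: "homogeneous 0 p \<Longrightarrow> p = cst (Poly_Mapping.lookup p 0)"
  by (rule poly_mapping_eqI) (auto simp: homogeneous_lookup lookup_single when_def mon_degree_eq_0)

text \<open>Terms of \<open>a\<close> outside degree \<open>d - e\<close> contribute nothing in
  degree \<open>d\<close>. Relations whose coefficients are forms can therefore be replaced by their
  homogeneous parts.\<close>

lemma hcomp_mult:
  fixes a f :: "('k::comm_ring_1, 'n::finite) mpoly"
  assumes "homogeneous e f"
  shows "hcomp d (a * f) = hcomp (d - e) a * f"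
proof -
  let ?r = "a - hcomp (d - e) a"
  have "hcomp d (?r * f) = 0"
  proof (rule poly_mapping_eqI)
    fix m
    have False if m: "Poly_Mapping.lookup (?r * f) m \<noteq> 0" "int (mon_degree m) = d"
    proof -
      have "m \<in> Poly_Mapping.keys (?r * f)" using m(1) by (simp add: in_keys_iff)
      then obtain u v where uv: "m = u + v" "u \<in> Poly_Mapping.keys ?r" "v \<in> Poly_Mapping.keys f"
        using keys_mult[of ?r f] by blast
      then have "int (mon_degree u) = d - e"
        using assms m(2) by (simp add: homogeneous_def mon_degree_add)
      then show False using uv(2) by (simp add: in_keys_iff lookup_minus lookup_hcomp)
    qed
    then show "Poly_Mapping.lookup (hcomp d (?r * f)) m = Poly_Mapping.lookup 0 m" by (auto simp: lookup_hcomp)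
  qed
  moreover have "a * f = hcomp (d - e) a * f + ?r * f" by (simp add: algebra_simps)
  moreover have "homogeneous d (hcomp (d - e) a * f)"
    using homogeneous_mult[OF homogeneous_hcomp assms, of "d - e" a] by simp
  ultimately show ?thesis by (simp add: hcomp_add hcomp_homogeneous)
qed

lemma homogeneous_mult_cancel:
  fixes a f :: "('k::idom, 'n::finite) mpoly"
  assumes "homogeneous e f" "f \<noteq> 0" "homogeneous d (a * f)"
  shows "homogeneous (d - e) a"
proof -
  have "f * hcomp (d - e) a = f * a"
    using hcomp_mult[OF assms(1), of d a] hcomp_homogeneous[OF assms(3), of d] by (simp add: mult.commute)
  then show ?thesis using mpoly_mult_cancel[OF assms(2)] homogeneous_hcomp by metis
qed

text \<open>Only \<open>0 + 0\<close> gives the exponent 0, so the constant term is multiplicative.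
  It serves as reduction modulo the irrelevant ideal in the arguments from minimality.\<close>

lemma lookup_mult_0:
  fixes p q :: "('k::comm_ring_1, 'n::finite) mpoly"
  shows "Poly_Mapping.lookup (p * q) 0 = Poly_Mapping.lookup p 0 * Poly_Mapping.lookup q 0"
proof -
  have "a' = 0 \<and> b' = 0" if "a' + b' = 0 + 0" for a' b' :: "'n \<Rightarrow>\<^sub>0 nat"
  proof -
    have "mon_degree a' + mon_degree b' = 0" using arg_cong[OF that, of mon_degree] by (simp add: mon_degree_add)
    then show ?thesis by (simp add: mon_degree_eq_0)
  qed
  from lookup_mult_unique[of p q 0 0, OF this] show ?thesis by simp
qed

lemma cst_inverse: "c \<noteq> 0 \<Longrightarrow> cst (inverse c) * (cst c * p) = p"
  for p :: "('k::field, 'n::finite) mpoly"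
  by (simp add: mult_single flip: mult.assoc)

lemma cst_power: "cst c ^ N = cst (c ^ N)"
  for c :: "'k::field"
  by (induction N) (simp_all add: mult_single)

subsection \<open>Linear forms\<close>

text \<open>Puts a linear form into the shape required by the triangular lemmas. Its leading
  coefficient is a constant, so the divisions become exact afterwards.\<close>

lemma linear_form_leading:
  fixes x :: "('k::field, 'n::finite) mpoly"
  assumes "homogeneous 1 x" "Poly_Mapping.lookup x (Poly_Mapping.single i 1) \<noteq> 0"
  defines "c \<equiv> Poly_Mapping.lookup x (Poly_Mapping.single i 1)"
  defines "x' \<equiv> x - Poly_Mapping.single (Poly_Mapping.single i 1) c"
  shows "degv i x = 1" "x = cst c * Poly_Mapping.single (Poly_Mapping.single i (degv i x)) 1 + x'"
    "\<And>j. degv j x' \<le> degv j x" "degv i x' < degv i x"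
proof -
  have x'l: "Poly_Mapping.lookup x' m = (if m = Poly_Mapping.single i 1 then 0 else Poly_Mapping.lookup x m)" for m
    by (simp add: x'_def lookup_minus lookup_single c_def when_def)
  have le: "Poly_Mapping.lookup m j \<le> 1" "Poly_Mapping.lookup m i \<noteq> 0 \<Longrightarrow> m = Poly_Mapping.single i 1"
    if "m \<in> Poly_Mapping.keys x" for m j
  proof -
    have md: "mon_degree m = 1" using assms(1) that by (simp add: homogeneous_def)
    then show "Poly_Mapping.lookup m j \<le> 1"
      unfolding mon_degree_def by (metis finite member_le_sum UNIV_I zero_le)
    assume i: "Poly_Mapping.lookup m i \<noteq> 0"
    show "m = Poly_Mapping.single i 1" by (rule mon_degree_1[OF md i])
  qed
  show d: "degv i x = 1"
  proof (rule antisym)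
    show "degv i x \<le> 1" unfolding degv_le_iff using le(1) by blast
    have "Poly_Mapping.single i 1 \<in> Poly_Mapping.keys x" using assms(2) by (simp add: in_keys_iff)
    from lookup_le_degv[OF this, of i] show "1 \<le> degv i x" by simp
  qed
  show "x = cst c * Poly_Mapping.single (Poly_Mapping.single i (degv i x)) 1 + x'"
    unfolding d x'_def by (simp add: mult_single)
  show "degv j x' \<le> degv j x" for j
    unfolding degv_le_iff
  proof
    fix m assume "m \<in> Poly_Mapping.keys x'"
    then have "m \<in> Poly_Mapping.keys x" by (auto simp: in_keys_iff x'l split: if_splits)
    then show "Poly_Mapping.lookup m j \<le> degv j x" by (rule lookup_le_degv)
  qed
  show "degv i x' < degv i x"
  proof (unfold d, subst degv_less_iff)
    show "\<forall>m\<in>Poly_Mapping.keys x'. Poly_Mapping.lookup m i < 1"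
  proof
    fix m assume "m \<in> Poly_Mapping.keys x'"
    then have m: "m \<in> Poly_Mapping.keys x" "m \<noteq> Poly_Mapping.single i 1"
      by (auto simp: in_keys_iff x'l split: if_splits)
    show "Poly_Mapping.lookup m i < 1" using le(2)[OF m(1)] m(2) by auto
  qed
  qed simp
qed

lemma degv_cst [simp]: "degv i (cst c) = 0"
  by (simp add: degv_single)

lemma linear_form_variable:
  fixes x :: "('k::field, 'n::finite) mpoly"
  assumes "homogeneous 1 x" "x \<noteq> 0"
  obtains i where "Poly_Mapping.lookup x (Poly_Mapping.single i 1) \<noteq> 0"
proof -
  obtain m where m: "m \<in> Poly_Mapping.keys x" using assms(2) by (metis ex_in_conv keys_eq_empty)
  have md: "mon_degree m = 1" using assms(1) m by (simp add: homogeneous_def)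
  then obtain i where i: "Poly_Mapping.lookup m i \<noteq> 0"
    unfolding mon_degree_def by (metis sum.neutral zero_neq_one)
  have "m = Poly_Mapping.single i 1" by (rule mon_degree_1[OF md i])
  then show ?thesis using that m by (simp add: in_keys_iff)
qed

lemma linear_form_reduce:
  fixes x :: "('k::field, 'n::finite) mpoly"
  assumes "homogeneous 1 x" "Poly_Mapping.lookup x (Poly_Mapping.single i 1) \<noteq> 0"
  obtains q r where "a = q * x + r" "degv i r = 0" "\<And>j. degv j x = 0 \<Longrightarrow> degv j r \<le> degv j a"
proof -
  define c where "c = Poly_Mapping.lookup x (Poly_Mapping.single i 1)"
  note lead = linear_form_leading[OF assms, folded c_def]
  obtain N q r where r: "cst c ^ N * a = q * x + r" "degv i r < degv i x" "\<And>j. degv j x = 0 \<Longrightarrow> degv j r \<le> degv j a"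
    using pseudo_division[OF lead(2) _ _ lead(3,4), of a] by auto
  have c: "c ^ N \<noteq> 0" using assms(2) by (simp add: c_def)
  let ?e = "cst (inverse (c ^ N)) :: ('k, 'n) mpoly"
  have "a = ?e * (cst c ^ N * a)" unfolding cst_power by (rule cst_inverse[OF c, symmetric])
  also have "\<dots> = (?e * q) * x + ?e * r" unfolding r(1) by (simp add: algebra_simps)
  finally have "a = (?e * q) * x + ?e * r" .
  moreover have "degv j (?e * r) \<le> degv j r" for j using degv_mult_le[of j ?e 0 r "degv j r"] by simp
  moreover have "degv i r = 0" using r(2) lead(1) by simp
  ultimately show ?thesis using that[of "?e * q" "?e * r"] r(3) by (metis le_zero_eq order_trans)
qed

lemma linear_form_regular:
  fixes x :: "('k::field, 'n::finite) mpoly"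
  assumes "homogeneous 1 x" "Poly_Mapping.lookup x (Poly_Mapping.single i 1) \<noteq> 0"
    and "r \<noteq> 0" "degv i r = 0" "r * b = u * x"
  shows "\<exists>v. b = v * x"
proof -
  define c where "c = Poly_Mapping.lookup x (Poly_Mapping.single i 1)"
  note lead = linear_form_leading[OF assms(1,2), folded c_def]
  obtain N q where "cst c ^ N * b = q * x"
    using triangular_regular2[OF lead(2) _ _ lead(3,4) assms(3,4,5)] by auto
  moreover have "c ^ N \<noteq> 0" using assms(2) by (simp add: c_def)
  ultimately have "b = cst (inverse (c ^ N)) * (q * x)" using cst_inverse[of "c ^ N" b] by (simp add: cst_power)
  then show ?thesis by (metis mult.assoc)
qed

text \<open>Reduce \<open>a\<close> modulo \<open>x\<close> to a polynomial free of x_i. If this is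
  not zero, it is a nonzerodivisor modulo \<open>x\<close>, so \<open>x\<close> divides
  \<open>b\<close>.\<close>

lemma linear_form_prime:
  fixes x :: "('k::field, 'n::finite) mpoly"
  assumes "homogeneous 1 x" "x \<noteq> 0" "a * b = u * x"
  shows "(\<exists>v. a = v * x) \<or> (\<exists>v. b = v * x)"
proof -
  obtain i where i: "Poly_Mapping.lookup x (Poly_Mapping.single i 1) \<noteq> 0"
    by (rule linear_form_variable[OF assms(1,2)])
  obtain q r where r: "a = q * x + r" "degv i r = 0" by (rule linear_form_reduce[OF assms(1) i, of a])
  show ?thesis
  proof (cases "r = 0")
    case True
    then show ?thesis using r(1) by auto
  next
    case False
    have "r * b = (u - q * b) * x" using assms(3) r(1) by (simp add: algebra_simps)
    then show ?thesis using linear_form_regular[OF assms(1) i False r(2)] by blast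
  qed
qed

locale linear_pair =
  fixes x y :: "('k::field, 'n::finite) mpoly"
  assumes x: "homogeneous 1 x" and y: "homogeneous 1 y"
    and indep: "\<And>c d. cst c * x + cst d * y = 0 \<Longrightarrow> c = 0 \<and> d = 0"
begin

text \<open>One step of Gaussian elimination: a multiple of \<open>x\<close> clears the variable x_i
  from \<open>y\<close>.\<close>

lemma triangular:
  obtains i j l y' where "Poly_Mapping.lookup x (Poly_Mapping.single i 1) \<noteq> 0"
    "y' = y - l * x" "homogeneous 1 y'" "degv i y' = 0" "Poly_Mapping.lookup y' (Poly_Mapping.single j 1) \<noteq> 0"
proof -
  have "x \<noteq> 0" using indep[of 1 0] by auto
  then obtain i where i: "Poly_Mapping.lookup x (Poly_Mapping.single i 1) \<noteq> 0"
    using linear_form_variable[OF x] by metis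
  define e where "e = Poly_Mapping.lookup y (Poly_Mapping.single i 1) / Poly_Mapping.lookup x (Poly_Mapping.single i 1)"
  define y' where "y' = y - cst e * x"
  have h: "homogeneous 1 y'" unfolding y'_def by (intro homogeneous_diff y homogeneous_cst_mult x)
  have scal: "Poly_Mapping.lookup (cst e * x) m = e * Poly_Mapping.lookup x m" for m
    by (subst mult_map_scale_conv_mult[symmetric]) (simp add: map.rep_eq when_def)
  have l0: "Poly_Mapping.lookup y' (Poly_Mapping.single i 1) = 0"
    by (simp only: y'_def lookup_minus scal) (simp only: e_def, use i in simp)
  have "degv i y' \<le> 0"
    unfolding degv_le_iff
  proof
    fix m assume m: "m \<in> Poly_Mapping.keys y'"
    show "Poly_Mapping.lookup m i \<le> 0"
    proof (rule ccontr)
      assume "\<not> ?thesis"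
      then have mi: "Poly_Mapping.lookup m i \<noteq> 0" by simp
      have md: "mon_degree m = 1" using h m by (simp add: homogeneous_def)
      have "m = Poly_Mapping.single i 1" by (rule mon_degree_1[OF md mi])
      then show False using m l0 by (simp add: in_keys_iff)
    qed
  qed
  then have di: "degv i y' = 0" by simp
  have "y' \<noteq> 0"
  proof
    assume "y' = 0"
    then have "cst (- e) * x + cst 1 * y = 0" by (simp add: y'_def single_uminus)
    then show False using indep[of "- e" 1] by simp
  qed
  then obtain j where "Poly_Mapping.lookup y' (Poly_Mapping.single j 1) \<noteq> 0"
    using linear_form_variable[OF h] by metis
  then show ?thesis using that[OF i y'_def h di] by blast
qed

lemma regular: "regular_pair x y"
proof -
  obtain i j l y' where *: "Poly_Mapping.lookup x (Poly_Mapping.single i 1) \<noteq> 0"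
    "y' = y - l * x" "homogeneous 1 y'" "degv i y' = 0" "Poly_Mapping.lookup y' (Poly_Mapping.single j 1) \<noteq> 0"
    by (rule triangular)
  have nz: "x \<noteq> 0" "y' \<noteq> 0" using *(1,5) by auto
  show ?thesis
    unfolding regular_pair_def
  proof (intro conjI allI impI nz(1))
    fix c u assume "y * c = u * x"
    then have "y' * c = (u - l * c) * x" unfolding *(2) by (simp add: algebra_simps)
    then show "\<exists>v. c = v * x" using linear_form_regular[OF x *(1) nz(2) *(4)] by blast
  qed
qed

text \<open>Reduce \<open>a\<close> modulo the triangular pair to a polynomial free of x_i and x_j.
  If it is not zero, \<open>triangular_regular3\<close> applies, and the powers of leading
  coefficients in it are invertible constants.\<close>

lemma prime:
  assumes "a * b \<in> ideal_gen {x, y}"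
  shows "a \<in> ideal_gen {x, y} \<or> b \<in> ideal_gen {x, y}"
proof -
  obtain i j l y' where *: "Poly_Mapping.lookup x (Poly_Mapping.single i 1) \<noteq> 0"
    "y' = y - l * x" "homogeneous 1 y'" "degv i y' = 0" "Poly_Mapping.lookup y' (Poly_Mapping.single j 1) \<noteq> 0"
    by (rule triangular)
  have mem: "u * x + v * y' \<in> ideal_gen {x, y}" for u v
    unfolding ideal_gen_2 *(2) by (intro CollectI exI[of _ "u - v * l"] exI[of _ v]) (simp add: algebra_simps)
  obtain u v where uv: "a * b = u * x + v * y" using assms unfolding ideal_gen_2 by blast
  obtain q r0 where r0: "a = q * x + r0" "degv i r0 = 0" by (rule linear_form_reduce[OF x *(1), of a])
  obtain q' r where r: "r0 = q' * y' + r" "degv j r = 0" "degv i r \<le> degv i r0"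
    using linear_form_reduce[OF *(3,5), of r0] *(4) by metis
  have a: "a = q * x + q' * y' + r" using r0 r by simp
  show ?thesis
  proof (cases "r = 0")
    case True
    then show ?thesis using a mem by simp
  next
    case False
    have "u * x + v * y = (u + v * l) * x + v * y'" unfolding *(2) by (simp add: algebra_simps)
    then have "r * b = (u + v * l - q * b) * x + (v - q' * b) * y'"
      using uv unfolding a by (simp add: algebra_simps)
    note rb = this
    define c where "c = Poly_Mapping.lookup x (Poly_Mapping.single i 1)"
    define c' where "c' = Poly_Mapping.lookup y' (Poly_Mapping.single j 1)"
    note lx = linear_form_leading[OF x *(1), folded c_def]
    note ly = linear_form_leading[OF *(3,5), folded c'_def]
    have nz: "c \<noteq> 0" "c' \<noteq> 0" using *(1,5) by (simp_all add: c_def c'_def)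
    have dr: "degv i r = 0" using r(3) r0(2) by simp
    have dc: "degv m (cst c :: ('k, 'n) mpoly) \<le> N" "degv m (cst c' :: ('k, 'n) mpoly) \<le> N" for m N by simp_all
    have cn: "(cst c :: ('k, 'n) mpoly) \<noteq> 0" using nz(1) by (metis lookup_single_eq lookup_zero)
    obtain M N s t where st: "cst c ^ M * cst c' ^ N * b = s * x + t * y'"
      using triangular_regular3[OF lx(2) degv_cst dc(1) lx(3,4) ly(2) degv_cst dc(2) ly(3,4) *(4) degv_cst cn False dr r(2) rb]
      by blast
    have "cst c ^ M * cst c' ^ N = cst (c ^ M * c' ^ N)" by (simp add: cst_power mult_single)
    moreover have "c ^ M * c' ^ N \<noteq> 0" using nz by simp
    ultimately have "b = cst (inverse (c ^ M * c' ^ N)) * (s * x + t * y')" using cst_inverse st by metis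
    then show ?thesis using is_ideal_mult[OF is_ideal_ideal_gen mem] by metis
  qed
qed

end

text \<open>Every prime over the pair has a chain of length two below it. The upper bounds are
  \<open>prime_over_regular_pair\<close> for one suitable prime and
  \<open>prime_height_associated\<close> for all associated ones.\<close>

lemma height_regular_pair:
  fixes x y :: "('k::field, 'n::finite) mpoly"
  assumes reg: "regular_pair x y" and one: "1 \<notin> ideal_gen {x, y}"
  shows "height (ideal_gen {x, y}) = 2" and "unmixed (ideal_gen {x, y})"
proof -
  have ge: "2 \<le> prime_height P" if "is_prime P" "ideal_gen {x, y} \<subseteq> P" for P
  proof -
    have "x \<in> P" "y \<in> P" using that(2) ideal_gen_superset[of "{x, y}"] by auto
    then have "prime_chain 2 P"
      using reg that(1) unfolding regular_pair_def by (intro prime_chain_2[of P x y]) auto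
    then show ?thesis using prime_height_ge[of 2 P] by (simp add: numeral_eq_enat)
  qed
  obtain P where P: "is_prime P" "ideal_gen {x, y} \<subseteq> P" "prime_height P \<le> 2"
    by (rule prime_over_regular_pair[OF reg one])
  show h: "height (ideal_gen {x, y}) = 2"
    using height_le[OF P(1,2)] P(3) height_ge[of "ideal_gen {x, y}" 2] ge by (meson antisym order_trans)
  show "unmixed (ideal_gen {x, y})"
    unfolding unmixed_def h
  proof
    fix Q assume "Q \<in> associated_primes (ideal_gen {x, y})"
    then obtain a where Q: "is_prime Q" "Q = {r. r * a \<in> ideal_gen {x, y}}"
      unfolding associated_primes_def by blast
    have "ideal_gen {x, y} \<subseteq> Q"
      unfolding Q(2) using is_ideal_mult[OF is_ideal_ideal_gen[of "{x, y}"], of _ a] by (auto simp: mult.commute)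
    then show "prime_height Q = 2"
      using ge[OF Q(1)] prime_height_associated[OF reg Q] by (meson antisym)
  qed
qed

lemma homogeneous_ideal_pair:
  fixes x y :: "('k::field, 'n::finite) mpoly"
  assumes "homogeneous d x" "homogeneous e y"
  shows "homogeneous_ideal (ideal_gen {x, y})"
  unfolding homogeneous_ideal_def
proof (intro conjI is_ideal_ideal_gen equalityI ideal_gen_subset)
  show "{x, y} \<subseteq> ideal_gen {f \<in> ideal_gen {x, y}. \<exists>d. homogeneous d f}"
    using ideal_gen_superset[of "{x, y}"] assms
    by (intro subset_trans[OF _ ideal_gen_superset]) auto
qed blast

lemma one_notin_ideal_gen_pair:
  fixes x y :: "('k::field, 'n::finite) mpoly"
  assumes "Poly_Mapping.lookup x 0 = 0" "Poly_Mapping.lookup y 0 = 0"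
  shows "1 \<notin> ideal_gen {x, y}"
proof
  assume "1 \<in> ideal_gen {x, y}"
  then obtain u v where "1 = u * x + v * y" unfolding ideal_gen_2 by blast
  then have "Poly_Mapping.lookup (1 :: ('k, 'n) mpoly) 0 = Poly_Mapping.lookup (u * x + v * y) 0" by simp
  then show False using assms by (simp add: lookup_add lookup_mult_0)
qed

lemma homogeneous_lookup_0: "homogeneous d p \<Longrightarrow> d \<noteq> 0 \<Longrightarrow> Poly_Mapping.lookup p 0 = 0"
  by (metis homogeneous_lookup mon_degree_zero of_nat_0)

subsection \<open>Syzygies of three elements\<close>

definition vec3 :: "'a \<Rightarrow> 'a \<Rightarrow> 'a \<Rightarrow> 'a vec" where
  "vec3 a b c = vec_of_list [a, b, c]"

lemma vec3_index [simp]: "vec3 a b c $ 0 = a" "vec3 a b c $ Suc 0 = b" "vec3 a b c $ 2 = c"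
  by (simp_all add: vec3_def vec_of_list_index numeral_2_eq_2)

lemma vec3_carrier [simp]: "vec3 a b c \<in> carrier_vec 3"
  by (rule carrier_vecI) (simp add: vec3_def)

lemma eq_vec3I:
  fixes v w :: "'a vec"
  assumes "v \<in> carrier_vec 3" "w \<in> carrier_vec 3" "v $ 0 = w $ 0" "v $ Suc 0 = w $ Suc 0" "v $ 2 = w $ 2"
  shows "v = w"
proof (rule eq_vecI)
  fix i assume "i < dim_vec w"
  then have "i = 0 \<or> i = Suc 0 \<or> i = 2" using assms(2) by auto
  then show "v $ i = w $ i" using assms by auto
qed (use assms in auto)

lemma syz3_iff: "v \<in> syz [f1, f2, f3] \<longleftrightarrow> v \<in> carrier_vec 3 \<and> f1 * v $ 0 + f2 * v $ Suc 0 + f3 * v $ 2 = 0"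
  for v :: "'a::comm_ring_1 vec"
proof -
  have "vec_of_list [f1, f2, f3] \<bullet> v = f1 * v $ 0 + f2 * v $ Suc 0 + f3 * v $ 2" if "v \<in> carrier_vec 3"
  proof -
    have "vec_of_list [f1, f2, f3] \<bullet> v = (\<Sum>i\<in>{0..<3}. vec3 f1 f2 f3 $ i * v $ i)"
      using that by (simp add: scalar_prod_def vec3_def)
    also have "{0..<3} = {0, Suc 0, 2::nat}" by auto
    finally show ?thesis by (simp add: algebra_simps)
  qed
  moreover have "v \<in> syz [f1, f2, f3] \<longleftrightarrow> v \<in> carrier_vec 3 \<and> vec_of_list [f1, f2, f3] \<bullet> v = 0"
    unfolding syz_def by (simp add: numeral_3_eq_3)
  ultimately show ?thesis by metis
qed

lemma homogeneous_vec3: "v \<in> carrier_vec 3 \<Longrightarrow>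
    homogeneous_vec d v \<longleftrightarrow> homogeneous d (v $ 0) \<and> homogeneous d (v $ Suc 0) \<and> homogeneous d (v $ 2)"
  for v :: "('k::comm_ring_1, 'n::finite) mpoly vec"
proof -
  assume v: "v \<in> carrier_vec 3"
  have "(\<forall>i<3. homogeneous d (v $ i)) \<longleftrightarrow> homogeneous d (v $ 0) \<and> homogeneous d (v $ Suc 0) \<and> homogeneous d (v $ 2)"
    by (auto simp: numeral_3_eq_3 numeral_2_eq_2 less_Suc_eq)
  then show ?thesis using v by (simp add: homogeneous_vec_def)
qed

lemma syz_carrier: "v \<in> syz fs \<Longrightarrow> v \<in> carrier_vec (length fs)"
  by (simp add: syz_def)

lemma syz_add: "v \<in> syz fs \<Longrightarrow> w \<in> syz fs \<Longrightarrow> v + w \<in> syz fs"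
proof -
  assume vw: "v \<in> syz fs" "w \<in> syz fs"
  have c: "vec_of_list fs \<in> carrier_vec (length fs)" by (rule carrier_vecI) simp
  have "vec_of_list fs \<bullet> (v + w) = vec_of_list fs \<bullet> v + vec_of_list fs \<bullet> w"
    by (rule scalar_prod_add_distrib[OF c syz_carrier[OF vw(1)] syz_carrier[OF vw(2)]])
  moreover have "v + w \<in> carrier_vec (length fs)"
    by (rule add_carrier_vec[OF syz_carrier[OF vw(1)] syz_carrier[OF vw(2)]])
  moreover have "vec_of_list fs \<bullet> v = 0" "vec_of_list fs \<bullet> w = 0" using vw by (simp_all only: syz_def mem_Collect_eq)
  ultimately show ?thesis unfolding syz_def by (intro CollectI conjI) (simp_all only: add_0_left)
qed

lemma syz_smult: "v \<in> syz fs \<Longrightarrow> r \<cdot>\<^sub>v v \<in> syz fs"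
proof -
  assume v: "v \<in> syz fs"
  have c: "vec_of_list fs \<in> carrier_vec (length fs)" by (rule carrier_vecI) simp
  have "vec_of_list fs \<bullet> (r \<cdot>\<^sub>v v) = r * (vec_of_list fs \<bullet> v)"
    by (rule scalar_prod_smult_distrib[OF c syz_carrier[OF v]])
  moreover have "r \<cdot>\<^sub>v v \<in> carrier_vec (length fs)"
    by (rule smult_carrier_vec[THEN iffD2, OF syz_carrier[OF v]])
  moreover have "vec_of_list fs \<bullet> v = 0" using v by (simp only: syz_def mem_Collect_eq)
  ultimately show ?thesis unfolding syz_def by (intro CollectI conjI) (simp_all only: mult_zero_right)
qed

lemma bourbaki_idealE:
  assumes "bourbaki_ideal fs \<nu> I"
  obtains \<psi> s where "\<And>v w. v \<in> syz fs \<Longrightarrow> w \<in> syz fs \<Longrightarrow> \<psi> (v + w) = \<psi> v + \<psi> w"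
    "\<And>r v. v \<in> syz fs \<Longrightarrow> \<psi> (r \<cdot>\<^sub>v v) = r * \<psi> v"
    "\<And>t v. v \<in> syz fs \<Longrightarrow> homogeneous_vec t v \<Longrightarrow> homogeneous (t + s) (\<psi> v)"
    "\<psi> ` syz fs = I" "{v \<in> syz fs. \<psi> v = 0} = {r \<cdot>\<^sub>v \<nu> | r. True}"
proof -
  obtain \<psi> s where \<psi>: "\<forall>v\<in>syz fs. \<forall>w\<in>syz fs. \<psi> (v + w) = \<psi> v + \<psi> w"
    "\<forall>r. \<forall>v\<in>syz fs. \<psi> (r \<cdot>\<^sub>v v) = r * \<psi> v"
    "\<forall>t. \<forall>v\<in>syz fs. homogeneous_vec t v \<longrightarrow> homogeneous (t + s) (\<psi> v)"
    "\<psi> ` syz fs = I" "{v \<in> syz fs. \<psi> v = 0} = {r \<cdot>\<^sub>v \<nu> | r. True}"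
    using assms unfolding bourbaki_ideal_def by blast
  show ?thesis
    by (rule that[of \<psi> s]) (use \<psi> in blast)+
qed

text \<open>The isomorphism between two Bourbaki ideals is multiplication by a ring element \<open>c\<close>; as the ideals
  have height two, \<open>c\<close> is a unit.\<close>

lemma bourbaki_ideal_unique:
  fixes x y :: "('k::field, 'n::finite) mpoly"
  assumes "bourbaki_ideal fs \<nu> (ideal_gen {x, y})" "regular_pair x y" "bourbaki_ideal fs \<nu> I"
  shows "I = ideal_gen {x, y}"
proof -
  obtain \<psi> s where \<psi>: "\<And>v w. v \<in> syz fs \<Longrightarrow> w \<in> syz fs \<Longrightarrow> \<psi> (v + w) = \<psi> v + \<psi> w"
    "\<And>r v. v \<in> syz fs \<Longrightarrow> \<psi> (r \<cdot>\<^sub>v v) = r * \<psi> v"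
    "\<And>t v. v \<in> syz fs \<Longrightarrow> homogeneous_vec t v \<Longrightarrow> homogeneous (t + s) (\<psi> v)"
    "\<psi> ` syz fs = ideal_gen {x, y}" "{v \<in> syz fs. \<psi> v = 0} = {r \<cdot>\<^sub>v \<nu> | r. True}"
    by (rule bourbaki_idealE[OF assms(1)]) (rule that)
  obtain \<theta> s' where \<theta>: "\<And>v w. v \<in> syz fs \<Longrightarrow> w \<in> syz fs \<Longrightarrow> \<theta> (v + w) = \<theta> v + \<theta> w"
    "\<And>r v. v \<in> syz fs \<Longrightarrow> \<theta> (r \<cdot>\<^sub>v v) = r * \<theta> v"
    "\<And>t v. v \<in> syz fs \<Longrightarrow> homogeneous_vec t v \<Longrightarrow> homogeneous (t + s') (\<theta> v)"
    "\<theta> ` syz fs = I" "{v \<in> syz fs. \<theta> v = 0} = {r \<cdot>\<^sub>v \<nu> | r. True}"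
    by (rule bourbaki_idealE[OF assms(3)]) (rule that)
  have hI: "height I = 2" using assms(3) unfolding bourbaki_ideal_def by blast
  have ker: "\<theta> v = 0" if "v \<in> syz fs" "\<psi> v = 0" for v
    using that \<psi>(5) \<theta>(5) by blast
  obtain vx vy where v: "vx \<in> syz fs" "\<psi> vx = x" "vy \<in> syz fs" "\<psi> vy = y"
  proof -
    have "x \<in> \<psi> ` syz fs" "y \<in> \<psi> ` syz fs" unfolding \<psi>(4) using ideal_gen_superset[of "{x, y}"] by auto
    then show thesis using that by blast
  qed
  \<comment> \<open>This combination is killed by \<open>\<psi>\<close>, hence by
    \<open>\<theta>\<close>, as both kernels consist of the multiples of \<open>\<nu>\<close>.
    Regularity then produces the common factor \<open>c\<close>.\<close>
  have "y \<cdot>\<^sub>v vx + (- x) \<cdot>\<^sub>v vy \<in> syz fs" by (intro syz_add syz_smult v)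
  moreover have "\<psi> (y \<cdot>\<^sub>v vx + (- x) \<cdot>\<^sub>v vy) = 0"
    using \<psi>(1)[OF syz_smult[OF v(1), of y] syz_smult[OF v(3), of "- x"]] \<psi>(2)[OF v(1)] \<psi>(2)[OF v(3)] v
    by (simp add: algebra_simps)
  ultimately have "\<theta> (y \<cdot>\<^sub>v vx + (- x) \<cdot>\<^sub>v vy) = 0" by (rule ker)
  then have rel: "y * \<theta> vx = \<theta> vy * x"
    using \<theta>(1)[OF syz_smult[OF v(1), of y] syz_smult[OF v(3), of "- x"]] \<theta>(2)[OF v(1)] \<theta>(2)[OF v(3)]
    by (simp add: algebra_simps)
  then obtain c where c: "\<theta> vx = c * x" using assms(2) unfolding regular_pair_def by blast
  have "x * \<theta> vy = x * (c * y)" using rel c by (simp add: algebra_simps)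
  then have cy: "\<theta> vy = c * y" using assms(2) mpoly_mult_cancel unfolding regular_pair_def by blast
  have \<theta>c: "\<theta> v = c * \<psi> v" if vs: "v \<in> syz fs" for v
  proof -
    have "\<psi> v \<in> ideal_gen {x, y}" using \<psi>(4) vs by blast
    then obtain a b where ab: "\<psi> v = a * x + b * y" unfolding ideal_gen_2 by blast
    let ?w = "(- a) \<cdot>\<^sub>v vx + (- b) \<cdot>\<^sub>v vy"
    have w: "?w \<in> syz fs" by (intro syz_add syz_smult v)
    have "\<psi> (v + ?w) = \<psi> v - a * x - b * y"
      using \<psi>(1)[OF vs w] \<psi>(1)[OF syz_smult[OF v(1), of "- a"] syz_smult[OF v(3), of "- b"]] \<psi>(2)[OF v(1)] \<psi>(2)[OF v(3)] v
      by (simp add: algebra_simps)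
    then have "\<theta> (v + ?w) = 0" using ker[OF syz_add[OF vs w]] ab by simp
    moreover have "\<theta> (v + ?w) = \<theta> v - a * (c * x) - b * (c * y)"
      using \<theta>(1)[OF vs w] \<theta>(1)[OF syz_smult[OF v(1), of "- a"] syz_smult[OF v(3), of "- b"]] \<theta>(2)[OF v(1)] \<theta>(2)[OF v(3)] c cy
      by (simp add: algebra_simps)
    ultimately show ?thesis unfolding ab by (simp add: algebra_simps)
  qed
  have Ic: "I = (\<lambda>p. c * p) ` ideal_gen {x, y}"
    unfolding \<psi>(4)[symmetric] \<theta>(4)[symmetric] image_image by (rule image_cong[OF refl \<theta>c])
  \<comment> \<open>Otherwise \<open>I\<close> would lie in a principal ideal that has a prime of
    height at most one above it.\<close>
  have "\<not> (c = 0 \<or> 0 < degv i c)" for i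
  proof
    assume "c = 0 \<or> 0 < degv i c"
    then obtain P where P: "is_prime P" "ideal_gen {c} \<subseteq> P" "prime_height P \<le> 1" by (rule prime_over_principal)
    have "I \<subseteq> ideal_gen {c}" unfolding Ic ideal_gen_1 by (auto simp: mult.commute)
    then have "height I \<le> prime_height P" using P by (intro height_le) auto
    then have "(2::enat) \<le> 1" using hI P(3) by (metis order_trans)
    then show False by (simp add: numeral_eq_enat one_enat_def)
  qed
  then have "c \<noteq> 0" "c \<in> polys_in {}" by (auto simp: polys_in_def)
  then obtain k where k: "c = cst k" "k \<noteq> 0" using polys_in_empty[of c] by (metis single_zero)
  show ?thesis
  proof
    show "I \<subseteq> ideal_gen {x, y}" unfolding Ic using is_ideal_mult[OF is_ideal_ideal_gen] by blast
    show "ideal_gen {x, y} \<subseteq> I"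
    proof
      fix p assume "p \<in> ideal_gen {x, y}"
      then have "cst (inverse k) * p \<in> ideal_gen {x, y}" by (rule is_ideal_mult[OF is_ideal_ideal_gen])
      moreover have "p = c * (cst (inverse k) * p)" using cst_inverse[OF k(2), of p] k(1) by (simp add: mult.left_commute)
      ultimately show "p \<in> I" unfolding Ic by blast
    qed
  qed
qed

text \<open>A graded isomorphism of degree zero with its inverse, demanded on the syzygies only.
  Homogeneity is an equivalence, so initial degrees and initial syzygies correspond.\<close>

definition syz_iso :: "('k::field, 'n::finite) mpoly list \<Rightarrow> ('k, 'n) mpoly list \<Rightarrow>
    (('k, 'n) mpoly vec \<Rightarrow> ('k, 'n) mpoly vec) \<Rightarrow> (('k, 'n) mpoly vec \<Rightarrow> ('k, 'n) mpoly vec) \<Rightarrow> bool" where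
  "syz_iso fs gs T T' \<longleftrightarrow>
     (\<forall>v\<in>syz fs. T v \<in> syz gs \<and> T' (T v) = v) \<and> (\<forall>v\<in>syz gs. T' v \<in> syz fs \<and> T (T' v) = v) \<and>
     (\<forall>v\<in>syz fs. \<forall>w\<in>syz fs. T (v + w) = T v + T w) \<and> (\<forall>r. \<forall>v\<in>syz fs. T (r \<cdot>\<^sub>v v) = r \<cdot>\<^sub>v T v) \<and>
     (\<forall>t. \<forall>v\<in>syz fs. homogeneous_vec t v \<longleftrightarrow> homogeneous_vec t (T v))"

lemma syz_isoD:
  assumes "syz_iso fs gs T T'"
  shows "\<And>v. v \<in> syz fs \<Longrightarrow> T v \<in> syz gs" "\<And>v. v \<in> syz fs \<Longrightarrow> T' (T v) = v"
    "\<And>v. v \<in> syz gs \<Longrightarrow> T' v \<in> syz fs" "\<And>v. v \<in> syz gs \<Longrightarrow> T (T' v) = v"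
    "\<And>v w. v \<in> syz fs \<Longrightarrow> w \<in> syz fs \<Longrightarrow> T (v + w) = T v + T w"
    "\<And>r v. v \<in> syz fs \<Longrightarrow> T (r \<cdot>\<^sub>v v) = r \<cdot>\<^sub>v T v"
    "\<And>t v. v \<in> syz fs \<Longrightarrow> homogeneous_vec t v \<longleftrightarrow> homogeneous_vec t (T v)"
  using assms unfolding syz_iso_def by blast+

lemma bourbaki_ideal_syz_iso:
  assumes "syz_iso fs gs T T'" "\<nu> \<in> syz fs" "bourbaki_ideal gs (T \<nu>) I"
  shows "bourbaki_ideal fs \<nu> I"
proof -
  note T = syz_isoD[OF assms(1)]
  obtain \<psi> s where \<psi>: "\<And>v w. v \<in> syz gs \<Longrightarrow> w \<in> syz gs \<Longrightarrow> \<psi> (v + w) = \<psi> v + \<psi> w"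
    "\<And>r v. v \<in> syz gs \<Longrightarrow> \<psi> (r \<cdot>\<^sub>v v) = r * \<psi> v"
    "\<And>t v. v \<in> syz gs \<Longrightarrow> homogeneous_vec t v \<Longrightarrow> homogeneous (t + s) (\<psi> v)"
    "\<psi> ` syz gs = I" "{v \<in> syz gs. \<psi> v = 0} = {r \<cdot>\<^sub>v T \<nu> | r. True}"
    by (rule bourbaki_idealE[OF assms(3)]) (rule that)
  have img: "T ` syz fs = syz gs"
  proof
    show "T ` syz fs \<subseteq> syz gs" using T(1) by blast
    show "syz gs \<subseteq> T ` syz fs"
    proof
      fix v assume "v \<in> syz gs"
      then show "v \<in> T ` syz fs" using T(3,4) by (metis imageI)
    qed
  qed
  have ker: "{v \<in> syz fs. \<psi> (T v) = 0} = {r \<cdot>\<^sub>v \<nu> | r. True}"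
  proof
    show "{r \<cdot>\<^sub>v \<nu> | r. True} \<subseteq> {v \<in> syz fs. \<psi> (T v) = 0}"
    proof
      fix v assume "v \<in> {r \<cdot>\<^sub>v \<nu> | r. True}"
      then obtain r where v: "v = r \<cdot>\<^sub>v \<nu>" by blast
      have "T v = r \<cdot>\<^sub>v T \<nu>" unfolding v by (rule T(6)[OF assms(2)])
      then have "\<psi> (T v) = 0" using \<psi>(5) by blast
      then show "v \<in> {v \<in> syz fs. \<psi> (T v) = 0}" using v syz_smult[OF assms(2), of r] by simp
    qed
    show "{v \<in> syz fs. \<psi> (T v) = 0} \<subseteq> {r \<cdot>\<^sub>v \<nu> | r. True}"
    proof
      fix v assume v: "v \<in> {v \<in> syz fs. \<psi> (T v) = 0}"
      then have vs: "v \<in> syz fs" "T v \<in> syz gs" "\<psi> (T v) = 0" using T(1) by simp_all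
      then have "T v \<in> {r \<cdot>\<^sub>v T \<nu> | r. True}" unfolding \<psi>(5)[symmetric] by simp
      then obtain r where "T v = r \<cdot>\<^sub>v T \<nu>" by blast
      also have "\<dots> = T (r \<cdot>\<^sub>v \<nu>)" by (rule T(6)[OF assms(2), symmetric])
      finally have eq: "T v = T (r \<cdot>\<^sub>v \<nu>)" .
      have "v = T' (T v)" by (rule T(2)[OF vs(1), symmetric])
      also have "\<dots> = r \<cdot>\<^sub>v \<nu>" unfolding eq by (rule T(2)[OF syz_smult[OF assms(2)]])
      finally have "v = r \<cdot>\<^sub>v \<nu>" .
      then show "v \<in> {r \<cdot>\<^sub>v \<nu> | r. True}" by blast
    qed
  qed
  show ?thesis
    unfolding bourbaki_ideal_def
  proof (intro conjI exI[of _ "\<lambda>v. \<psi> (T v)"] exI[of _ s] ballI allI impI)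
    show "homogeneous_ideal I" "unmixed I" "height I = 2" using assms(3) unfolding bourbaki_ideal_def by blast+
    show "(\<lambda>v. \<psi> (T v)) ` syz fs = I" using img \<psi>(4) by (metis image_image)
    show "\<psi> (T (v + w)) = \<psi> (T v) + \<psi> (T w)" if "v \<in> syz fs" "w \<in> syz fs" for v w
      using \<psi>(1)[OF T(1) T(1)] T(5) that by simp
    show "\<psi> (T (r \<cdot>\<^sub>v v)) = r * \<psi> (T v)" if "v \<in> syz fs" for r v
      using \<psi>(2)[OF T(1)] T(6) that by simp
    show "homogeneous (t + s) (\<psi> (T v))" if "v \<in> syz fs" "homogeneous_vec t v" for t v
      using \<psi>(3)[OF T(1)] T(7) that by simp
  qed (rule ker)
qed

lemma syz_iso_trans:
  assumes "syz_iso fs gs T T'" "syz_iso gs hs U U'"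
  shows "syz_iso fs hs (U \<circ> T) (T' \<circ> U')"
  using syz_isoD[OF assms(1)] syz_isoD[OF assms(2)] unfolding syz_iso_def by simp

text \<open>The definition sees \<open>\<nu>\<close> only through the submodule it
  generates.\<close>

lemma bourbaki_ideal_scale:
  fixes fs :: "('k::field, 'n::finite) mpoly list"
  assumes "bourbaki_ideal fs (cst c \<cdot>\<^sub>v \<nu>) I" "c \<noteq> 0"
  shows "bourbaki_ideal fs \<nu> I"
proof -
  have "{r \<cdot>\<^sub>v (cst c \<cdot>\<^sub>v \<nu>) | r. True} = {r \<cdot>\<^sub>v \<nu> | r. True}"
  proof
    show "{r \<cdot>\<^sub>v (cst c \<cdot>\<^sub>v \<nu>) | r. True} \<subseteq> {r \<cdot>\<^sub>v \<nu> | r. True}"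
    proof safe
      fix r
      show "\<exists>r'. r \<cdot>\<^sub>v (cst c \<cdot>\<^sub>v \<nu>) = r' \<cdot>\<^sub>v \<nu> \<and> True"
        by (intro exI[of _ "r * cst c"] conjI smult_smult_assoc TrueI)
    qed
    show "{r \<cdot>\<^sub>v \<nu> | r. True} \<subseteq> {r \<cdot>\<^sub>v (cst c \<cdot>\<^sub>v \<nu>) | r. True}"
    proof safe
      fix r
      have "(r * cst (inverse c)) \<cdot>\<^sub>v (cst c \<cdot>\<^sub>v \<nu>) = r \<cdot>\<^sub>v \<nu>"
        using assms(2) by (simp add: smult_smult_assoc mult.assoc mult_single)
      then show "\<exists>r'. r \<cdot>\<^sub>v \<nu> = r' \<cdot>\<^sub>v (cst c \<cdot>\<^sub>v \<nu>) \<and> True" by metis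
    qed
  qed
  then show ?thesis using assms(1) unfolding bourbaki_ideal_def by simp
qed

text \<open>Expresses vanishing by a scalar multiple, a form that linear maps transport without
  reference to dimensions.\<close>

lemma vec_eq_0_iff_smult: "v = 0\<^sub>v (dim_vec v) \<longleftrightarrow> 0 \<cdot>\<^sub>v v = v"
  for v :: "'a::comm_ring_1 vec"
proof -
  have "0 \<cdot>\<^sub>v v = 0\<^sub>v (dim_vec v)" by (rule eq_vecI) simp_all
  then show ?thesis by metis
qed

lemma indeg_syz_iso:
  fixes fs :: "('k::field, 'n::finite) mpoly list"
  assumes "syz_iso fs gs T T'"
  shows "indeg (syz fs) = indeg (syz gs)"
proof -
  note T = syz_isoD[OF assms]
  have "(\<exists>v\<in>syz fs. v \<noteq> 0\<^sub>v (dim_vec v) \<and> homogeneous_vec (int t) v) \<longleftrightarrow>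
        (\<exists>v\<in>syz gs. v \<noteq> 0\<^sub>v (dim_vec v) \<and> homogeneous_vec (int t) v)" for t
    unfolding vec_eq_0_iff_smult
  proof
    assume "\<exists>v\<in>syz fs. 0 \<cdot>\<^sub>v v \<noteq> v \<and> homogeneous_vec (int t) v"
    then obtain v where v: "v \<in> syz fs" "0 \<cdot>\<^sub>v v \<noteq> v" "homogeneous_vec (int t) v" by blast
    have "0 \<cdot>\<^sub>v T v = T (0 \<cdot>\<^sub>v v)" using T(6)[OF v(1)] by simp
    then have "0 \<cdot>\<^sub>v T v \<noteq> T v" using T(2)[OF v(1)] T(2)[OF syz_smult[OF v(1), of 0]] v(2) by metis
    moreover have "homogeneous_vec (int t) (T v)" using T(7)[OF v(1)] v(3) by blast
    ultimately show "\<exists>v\<in>syz gs. 0 \<cdot>\<^sub>v v \<noteq> v \<and> homogeneous_vec (int t) v" using T(1)[OF v(1)] by blast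
  next
    assume "\<exists>v\<in>syz gs. 0 \<cdot>\<^sub>v v \<noteq> v \<and> homogeneous_vec (int t) v"
    then obtain v where v: "v \<in> syz gs" "0 \<cdot>\<^sub>v v \<noteq> v" "homogeneous_vec (int t) v" by blast
    have T'v: "T' v \<in> syz fs" "T (T' v) = v" using T(3,4) v(1) by blast+
    have "T (0 \<cdot>\<^sub>v T' v) = 0 \<cdot>\<^sub>v v" using T(6)[OF T'v(1), of 0] T'v(2) by simp
    then have "0 \<cdot>\<^sub>v T' v \<noteq> T' v" using v(2) T'v(2) by metis
    moreover have "homogeneous_vec (int t) (T' v)" using T(7)[OF T'v(1)] T'v(2) v(3) by simp
    ultimately show "\<exists>v\<in>syz fs. 0 \<cdot>\<^sub>v v \<noteq> v \<and> homogeneous_vec (int t) v" using T'v(1) by blast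
  qed
  then show ?thesis unfolding indeg_def by simp
qed

lemma carrier3_smult:
  fixes v :: "'a::comm_ring_1 vec"
  assumes "v \<in> carrier_vec 3"
  shows "(r \<cdot>\<^sub>v v) $ 0 = r * v $ 0" "(r \<cdot>\<^sub>v v) $ Suc 0 = r * v $ Suc 0" "(r \<cdot>\<^sub>v v) $ 2 = r * v $ 2"
  using carrier_vecD[OF assms] by simp_all

lemma carrier3_add:
  fixes v w :: "'a::comm_ring_1 vec"
  assumes "v \<in> carrier_vec 3" "w \<in> carrier_vec 3"
  shows "(v + w) $ 0 = v $ 0 + w $ 0" "(v + w) $ Suc 0 = v $ Suc 0 + w $ Suc 0" "(v + w) $ 2 = v $ 2 + w $ 2"
  using carrier_vecD[OF assms(1)] carrier_vecD[OF assms(2)] by simp_all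

lemmas carrier3_smult_vec3 = carrier3_smult[OF vec3_carrier]

text \<open>Quadrics \<open>yg, xg, q\<close> whose syzygies are generated by \<open>(x, -y, 0)\<close> and the two Koszul relations with \<open>q\<close>.
  Complete intersections of three quadrics (\<open>e = 2\<close>, \<open>g = 1\<close>) and the ideals with a linear syzygy (\<open>e = 1\<close>)
  are both of this form, and \<open>(x, y)\<close> is the Bourbaki ideal.\<close>

locale koszul_frame =
  fixes x y g q :: "('k::field, 'n::finite) mpoly" and e :: nat
  assumes reg: "regular_pair x y"
    and q_xy: "\<And>c. q * c \<in> ideal_gen {x, y} \<Longrightarrow> c \<in> ideal_gen {x, y}"
    and q_g: "\<And>c u. q * c = u * g \<Longrightarrow> \<exists>v. c = v * g"
    and g0: "g \<noteq> 0"
    and hx: "homogeneous (int e) x" and hy: "homogeneous (int e) y"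
    and hg: "homogeneous (2 - int e) g" and hq: "homogeneous 2 q"
    and e: "1 \<le> e" "e \<le> 2"
begin

lemma x0: "x \<noteq> 0"
  using reg by (simp add: regular_pair_def)

lemma const0: "Poly_Mapping.lookup x 0 = 0" "Poly_Mapping.lookup y 0 = 0" "Poly_Mapping.lookup q 0 = 0"
  using homogeneous_lookup_0[OF hx] homogeneous_lookup_0[OF hy] homogeneous_lookup_0[OF hq] e by auto

lemma one_notin: "1 \<notin> ideal_gen {x, y}"
  by (rule one_notin_ideal_gen_pair[OF const0(1,2)])

lemma homogeneous_gens: "homogeneous 2 (y * g)" "homogeneous 2 (x * g)"
  using homogeneous_mult[OF hy hg] homogeneous_mult[OF hx hg] by simp_all

text \<open>Regularity is used three times: \<open>c\<close> is divisible by \<open>g\<close>, the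
  quotient lies in the ideal of \<open>x\<close> and \<open>y\<close>, and what remains is a
  relation of the regular pair. The coefficients \<open>\<alpha>\<close>, \<open>\<beta>\<close>,
  \<open>\<gamma>\<close> belong to the syzygies \<open>(x, -y, 0)\<close>,
  \<open>(-q, 0, y * g)\<close> and \<open>(0, -q, x * g)\<close>.\<close>

lemma syzygy:
  assumes "y * g * a + x * g * b + q * c = 0"
  obtains \<alpha> \<beta> \<gamma> where "a = \<alpha> * x - \<beta> * q" "b = - \<alpha> * y - \<gamma> * q" "c = (\<beta> * y + \<gamma> * x) * g"
proof -
  have "q * c = (- (a * y) - b * x) * g" using assms by (simp add: eq_neg_iff_add_eq_0 algebra_simps)
  then obtain c' where c': "c = c' * g" using q_g by blast
  have "g * (a * y + b * x + q * c') = 0" using assms unfolding c' by (simp add: algebra_simps)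
  then have rel: "a * y + b * x + q * c' = 0" using g0 by simp
  then have "q * c' = (- b) * x + (- a) * y" by (simp add: eq_neg_iff_add_eq_0 algebra_simps)
  then have "q * c' \<in> ideal_gen {x, y}" unfolding ideal_gen_2 by blast
  then have "c' \<in> ideal_gen {x, y}" by (rule q_xy)
  then obtain \<gamma> \<beta> where gb: "c' = \<gamma> * x + \<beta> * y" unfolding ideal_gen_2 by blast
  have "(b + \<gamma> * q) * x + (a + \<beta> * q) * y = 0" using rel unfolding gb by (simp add: algebra_simps)
  then obtain t where t: "b + \<gamma> * q = t * y" "a + \<beta> * q = - t * x" by (rule regular_pair_syzygy[OF reg])
  show ?thesis
  proof (rule that[of "- t" \<beta> \<gamma>])
    show "a = - t * x - \<beta> * q" using t(2) by (metis add_diff_cancel_right')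
    show "b = - (- t) * y - \<gamma> * q" using t(1) by (metis add_diff_cancel_right' minus_minus)
    show "c = (\<beta> * y + \<gamma> * x) * g" unfolding c' gb by (simp add: algebra_simps)
  qed
qed

lemma syzygy_third_0:
  assumes "y * g * a + x * g * b + q * c = 0" "c = 0"
  obtains r where "a = r * x" "b = - r * y"
proof -
  have "g * (b * x + a * y) = 0" using assms by (simp add: algebra_simps)
  then have "b * x + a * y = 0" using g0 by simp
  then obtain t where "b = t * y" "a = - t * x" by (rule regular_pair_syzygy[OF reg])
  then show ?thesis using that[of "- t"] by simp
qed

lemma syz_iff: "v \<in> syz [y * g, x * g, q] \<longleftrightarrow>
    v \<in> carrier_vec 3 \<and> y * g * v $ 0 + x * g * v $ Suc 0 + q * v $ 2 = 0"
  by (rule syz3_iff)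

lemma initial_in_syz: "vec3 x (- y) 0 \<in> syz [y * g, x * g, q]"
  unfolding syz_iff by (simp add: algebra_simps)

text \<open>The map is the third entry divided by \<open>g\<close>: the third entries fill out
  \<open>g\<close> times the ideal of \<open>x\<close> and \<open>y\<close>, and the syzygies with
  third entry zero are the multiples of \<open>(x, -y, 0)\<close>. Dividing by \<open>g\<close>
  shifts degrees by \<open>e - 2\<close>.\<close>

lemma bourbaki: "bourbaki_ideal [y * g, x * g, q] (vec3 x (- y) 0) (ideal_gen {x, y})"
proof -
  let ?S = "syz [y * g, x * g, q]"
  define \<psi> where "\<psi> v = (THE c. v $ 2 = c * g)" for v :: "('k, 'n) mpoly vec"
  have \<psi>I: "\<psi> v = c" if "v $ 2 = c * g" for v :: "('k, 'n) mpoly vec" and c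
    unfolding \<psi>_def
  proof (rule the_equality)
    show "v $ 2 = c * g" by (rule that)
    fix c' assume "v $ 2 = c' * g"
    then have "g * c' = g * c" using that by (simp add: mult.commute)
    then show "c' = c" using g0 mpoly_mult_cancel by blast
  qed
  have ex: "v $ 2 = \<psi> v * g \<and> \<psi> v \<in> ideal_gen {x, y}" if "v \<in> ?S" for v
  proof -
    have "y * g * v $ 0 + x * g * v $ Suc 0 + q * v $ 2 = 0" using that unfolding syz_iff by blast
    then obtain \<beta> \<gamma> where *: "v $ 2 = (\<beta> * y + \<gamma> * x) * g" by (rule syzygy)
    have "\<psi> v = \<gamma> * x + \<beta> * y" using \<psi>I[OF *] by simp
    then have "\<psi> v \<in> ideal_gen {x, y}" unfolding ideal_gen_2 by blast
    then show ?thesis using * \<psi>I[OF *] by simp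
  qed
  have dim: "v \<in> carrier_vec 3" if "v \<in> ?S" for v :: "('k, 'n) mpoly vec"
    using that unfolding syz_iff by blast
  show ?thesis
    unfolding bourbaki_ideal_def
  proof (intro conjI exI[of _ \<psi>] exI[of _ "int e - 2"] ballI allI impI)
    show "homogeneous_ideal (ideal_gen {x, y})" by (rule homogeneous_ideal_pair[OF hx hy])
    show "unmixed (ideal_gen {x, y})" "height (ideal_gen {x, y}) = 2"
      by (rule height_regular_pair[OF reg one_notin])+
    show "\<psi> (v + w) = \<psi> v + \<psi> w" if "v \<in> ?S" "w \<in> ?S" for v w
      by (rule \<psi>I) (use ex[OF that(1)] ex[OF that(2)] in \<open>simp add: carrier3_add[OF dim[OF that(1)] dim[OF that(2)]] algebra_simps\<close>)
    show "\<psi> (r \<cdot>\<^sub>v v) = r * \<psi> v" if "v \<in> ?S" for r v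
      by (rule \<psi>I) (use ex[OF that] in \<open>simp add: carrier3_smult[OF dim[OF that]] algebra_simps\<close>)
    show "homogeneous (t + (int e - 2)) (\<psi> v)" if "v \<in> ?S" "homogeneous_vec t v" for t v
    proof -
      have "homogeneous t (v $ 2)" using that(2) homogeneous_vec3[OF dim[OF that(1)]] by blast
      then have "homogeneous t (\<psi> v * g)" using ex[OF that(1)] by simp
      from homogeneous_mult_cancel[OF hg g0 this] show ?thesis by (simp add: algebra_simps)
    qed
    show "\<psi> ` ?S = ideal_gen {x, y}"
    proof
      show "\<psi> ` ?S \<subseteq> ideal_gen {x, y}" using ex by blast
      show "ideal_gen {x, y} \<subseteq> \<psi> ` ?S"
      proof
        fix p assume "p \<in> ideal_gen {x, y}"
        then obtain \<gamma> \<beta> where p: "p = \<gamma> * x + \<beta> * y" unfolding ideal_gen_2 by blast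
        \<comment> \<open>The combination of the two Koszul relations with coefficients
          \<open>\<beta>\<close> and \<open>\<gamma>\<close>.\<close>
        let ?v = "vec3 (- \<beta> * q) (- \<gamma> * q) (p * g)"
        have "?v \<in> ?S" unfolding syz_iff p by (simp add: algebra_simps)
        moreover have "\<psi> ?v = p" by (rule \<psi>I) simp
        ultimately show "p \<in> \<psi> ` ?S" by (metis imageI)
      qed
    qed
    show "{v \<in> ?S. \<psi> v = 0} = {r \<cdot>\<^sub>v vec3 x (- y) 0 | r. True}"
    proof
      show "{v \<in> ?S. \<psi> v = 0} \<subseteq> {r \<cdot>\<^sub>v vec3 x (- y) 0 | r. True}"
      proof
        fix v assume "v \<in> {v \<in> ?S. \<psi> v = 0}"
        then have v: "v \<in> ?S" "v $ 2 = 0" using ex[of v] by simp_all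
        have "y * g * v $ 0 + x * g * v $ Suc 0 + q * v $ 2 = 0" using v(1) unfolding syz_iff by blast
        then obtain r where "v $ 0 = r * x" "v $ Suc 0 = - r * y"
          using syzygy_third_0[OF _ v(2)] by blast
        then have "v = r \<cdot>\<^sub>v vec3 x (- y) 0"
          using v dim[OF v(1)] by (intro eq_vec3I) (simp_all add: carrier3_smult_vec3)
        then show "v \<in> {r \<cdot>\<^sub>v vec3 x (- y) 0 | r. True}" by blast
      qed
      show "{r \<cdot>\<^sub>v vec3 x (- y) 0 | r. True} \<subseteq> {v \<in> ?S. \<psi> v = 0}"
      proof
        fix v assume "v \<in> {r \<cdot>\<^sub>v vec3 x (- y) 0 | r. True}"
        then obtain r where v: "v = r \<cdot>\<^sub>v vec3 x (- y) 0" by blast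
        have "v \<in> ?S" unfolding v by (rule syz_smult[OF initial_in_syz])
        moreover have "\<psi> v = 0" by (rule \<psi>I) (simp add: v carrier3_smult_vec3)
        ultimately show "v \<in> {v \<in> ?S. \<psi> v = 0}" by blast
      qed
    qed
  qed
qed

text \<open>The Koszul relations with \<open>q\<close> have degree two. In degree
  \<open>t < 2\<close> their coefficients would have degree \<open>t - 2\<close>, so they vanish and
  the third entry is zero.\<close>

lemma low_syzygy:
  assumes "v \<in> syz [y * g, x * g, q]" "homogeneous_vec (int t) v" "t < 2"
  obtains r where "v = r \<cdot>\<^sub>v vec3 x (- y) 0" "homogeneous (int t - int e) r"
proof -
  have v: "v \<in> carrier_vec 3" "y * g * v $ 0 + x * g * v $ Suc 0 + q * v $ 2 = 0"
    using assms(1) unfolding syz_iff by auto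
  have hv: "homogeneous (int t) (v $ 0)" "homogeneous (int t) (v $ 2)"
    using assms(2) homogeneous_vec3[OF v(1)] by auto
  obtain \<beta> \<gamma> where c: "v $ 2 = (\<beta> * y + \<gamma> * x) * g" by (rule syzygy[OF v(2)])
  let ?c = "\<beta> * y + \<gamma> * x" and ?d = "int t - (2 - int e)"
  have "homogeneous ?d ?c"
    using homogeneous_mult_cancel[OF hg g0] hv(2) unfolding c by blast
  then have "?c = hcomp ?d ?c" by (simp add: hcomp_homogeneous)
  also have "\<dots> = hcomp (?d - int e) \<beta> * y + hcomp (?d - int e) \<gamma> * x"
    by (simp add: hcomp_add hcomp_mult[OF hx] hcomp_mult[OF hy])
  also have "\<dots> = 0" using assms(3) by (simp add: hcomp_neg)
  finally have "v $ 2 = 0" unfolding c by simp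
  then obtain r where r: "v $ 0 = r * x" "v $ Suc 0 = - r * y" using syzygy_third_0[OF v(2)] by blast
  have "v = r \<cdot>\<^sub>v vec3 x (- y) 0"
    using v(1) r \<open>v $ 2 = 0\<close> by (intro eq_vec3I) (simp_all add: carrier3_smult_vec3)
  moreover have "homogeneous (int t - int e) r"
    using homogeneous_mult_cancel[OF hx x0] hv(1) unfolding r(1) by blast
  ultimately show ?thesis by (rule that)
qed

lemma smult_initial_eq_0: "r \<cdot>\<^sub>v vec3 x (- y) 0 = 0\<^sub>v 3 \<longleftrightarrow> r = 0"
proof
  assume "r \<cdot>\<^sub>v vec3 x (- y) 0 = 0\<^sub>v 3"
  then have "(r \<cdot>\<^sub>v vec3 x (- y) 0) $ 0 = 0\<^sub>v 3 $ 0" by simp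
  then have "r * x = 0" by (simp add: carrier3_smult_vec3)
  then show "r = 0" using x0 by simp
next
  assume "r = 0"
  then show "r \<cdot>\<^sub>v vec3 x (- y) 0 = 0\<^sub>v 3" by (intro eq_vec3I) (simp_all add: carrier3_smult_vec3)
qed

lemma indeg_syz: "indeg (syz [y * g, x * g, q]) = e"
  unfolding indeg_def
proof (rule Least_equality)
  have "vec3 x (- y) 0 \<noteq> 0\<^sub>v 3" using smult_initial_eq_0[of 1] by simp
  moreover have "homogeneous_vec (int e) (vec3 x (- y) 0)"
    unfolding homogeneous_vec3[OF vec3_carrier] using hx hy by (simp add: homogeneous_uminus)
  ultimately show "\<exists>v\<in>syz [y * g, x * g, q]. v \<noteq> 0\<^sub>v (dim_vec v) \<and> homogeneous_vec (int e) v"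
    using initial_in_syz vec3_carrier[of x "- y" 0] by (metis carrier_vecD)
  fix t assume "\<exists>v\<in>syz [y * g, x * g, q]. v \<noteq> 0\<^sub>v (dim_vec v) \<and> homogeneous_vec (int t) v"
  then obtain v where v: "v \<in> syz [y * g, x * g, q]" "v \<noteq> 0\<^sub>v (dim_vec v)" "homogeneous_vec (int t) v" by blast
  have d: "dim_vec v = 3" using v(1) unfolding syz_iff by auto
  show "e \<le> t"
  proof (rule ccontr)
    assume "\<not> e \<le> t"
    then have "t < 2" "int t - int e < 0" using e by auto
    then obtain r where "v = r \<cdot>\<^sub>v vec3 x (- y) 0" "homogeneous (int t - int e) r"
      using low_syzygy[OF v(1,3)] by blast
    moreover from this have "r = 0" using homogeneous_neg \<open>int t - int e < 0\<close> by blast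
    ultimately have "v = 0\<^sub>v 3" using smult_initial_eq_0[of r] by (simp only:)
    then show False using v(2) d by metis
  qed
qed

end

definition k_indep3 :: "('k::field, 'n::finite) mpoly \<Rightarrow> ('k, 'n) mpoly \<Rightarrow> ('k, 'n) mpoly \<Rightarrow> bool" where
  "k_indep3 f1 f2 f3 \<longleftrightarrow> (\<forall>a b c. cst a * f1 + cst b * f2 + cst c * f3 = 0 \<longrightarrow> a = 0 \<and> b = 0 \<and> c = 0)"

text \<open>A linear relation is a syzygy with constant entries, but the entries given by
  \<open>syzygy\<close> have no constant term.\<close>

lemma (in koszul_frame) k_indep3: "k_indep3 (y * g) (x * g) q"
  unfolding k_indep3_def
proof (intro allI impI)
  fix a b c assume *: "cst a * (y * g) + cst b * (x * g) + cst c * q = 0"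
  have "y * g * cst a + x * g * cst b + q * cst c = 0" using * by (simp add: algebra_simps)
  then obtain \<alpha> \<beta> \<gamma> where abc: "cst a = \<alpha> * x - \<beta> * q" "cst b = - \<alpha> * y - \<gamma> * q" "cst c = (\<beta> * y + \<gamma> * x) * g"
    by (rule syzygy)
  have "Poly_Mapping.lookup (cst a :: ('k, 'n) mpoly) 0 = 0" unfolding abc
    by (simp add: lookup_minus lookup_mult_0 const0)
  moreover have "Poly_Mapping.lookup (cst b :: ('k, 'n) mpoly) 0 = 0" unfolding abc
    by (simp add: lookup_minus lookup_mult_0 const0)
  moreover have "Poly_Mapping.lookup (cst c :: ('k, 'n) mpoly) 0 = 0" unfolding abc
    by (simp add: lookup_add lookup_mult_0 const0)
  ultimately show "a = 0 \<and> b = 0 \<and> c = 0" by simp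
qed

subsection \<open>Change of generators\<close>

lemma homogeneous_in_ideal3:
  fixes f1 f2 f3 :: "('k::field, 'n::finite) mpoly"
  assumes "homogeneous d p" "p \<in> ideal_gen {f1, f2, f3}" "homogeneous d' f1" "homogeneous d' f2" "homogeneous d' f3"
  obtains u v w where "p = u * f1 + v * f2 + w * f3"
    "homogeneous (d - d') u" "homogeneous (d - d') v" "homogeneous (d - d') w"
proof -
  obtain u v w where "p = u * f1 + v * f2 + w * f3" using assms(2) unfolding ideal_gen_3 by blast
  then have "hcomp d p = hcomp d (u * f1 + v * f2 + w * f3)" by simp
  then have "p = hcomp (d - d') u * f1 + hcomp (d - d') v * f2 + hcomp (d - d') w * f3"
    using hcomp_homogeneous[OF assms(1), of d] by (simp add: hcomp_add hcomp_mult[OF assms(3)] hcomp_mult[OF assms(4)] hcomp_mult[OF assms(5)])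
  then show ?thesis using that by (metis homogeneous_hcomp)
qed

lemma homogeneous_in_ideal3_same:
  fixes f1 f2 f3 :: "('k::field, 'n::finite) mpoly"
  assumes "homogeneous d p" "p \<in> ideal_gen {f1, f2, f3}" "homogeneous d f1" "homogeneous d f2" "homogeneous d f3"
  obtains a b c where "p = cst a * f1 + cst b * f2 + cst c * f3"
proof -
  obtain u v w where *: "p = u * f1 + v * f2 + w * f3" "homogeneous 0 u" "homogeneous 0 v" "homogeneous 0 w"
    using homogeneous_in_ideal3[OF assms] by auto
  then show ?thesis using that[of "Poly_Mapping.lookup u 0" "Poly_Mapping.lookup v 0" "Poly_Mapping.lookup w 0"]
    by (simp flip: homogeneous_0_cst)
qed

text \<open>\<open>bourbaki_degree\<close> leaves the degree of the generators open. It is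
  determined because a nonzero form of the ideal cannot have smaller degree than the
  generators.\<close>

lemma generators_same_degree:
  fixes f1 f2 f3 :: "('k::field, 'n::finite) mpoly"
  assumes f: "homogeneous d f1" "homogeneous d f2" "homogeneous d f3" "f1 \<noteq> 0"
    and g: "homogeneous d' g1" "homogeneous d' g2" "homogeneous d' g3"
    and eq: "ideal_gen {g1, g2, g3} = ideal_gen {f1, f2, f3}"
  shows "d' = d"
proof (rule ccontr)
  assume "d' \<noteq> d"
  have small: "p = 0" if h: "homogeneous a p" "p \<in> ideal_gen {h1, h2, h3}" "homogeneous b h1" "homogeneous b h2" "homogeneous b h3" "a < b"
    for a b p and h1 h2 h3 :: "('k, 'n) mpoly"
  proof -
    obtain u v w where "p = u * h1 + v * h2 + w * h3" "homogeneous (a - b) u" "homogeneous (a - b) v" "homogeneous (a - b) w"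
      by (rule homogeneous_in_ideal3[OF h(1-5)])
    then show ?thesis using homogeneous_neg[of "a - b" u] homogeneous_neg[of "a - b" v] homogeneous_neg[of "a - b" w] h(6) by simp
  qed
  have f1: "f1 \<in> ideal_gen {g1, g2, g3}" unfolding eq using ideal_gen_superset[of "{f1, f2, f3}"] by simp
  have g1: "g1 \<in> ideal_gen {f1, f2, f3}" "g2 \<in> ideal_gen {f1, f2, f3}" "g3 \<in> ideal_gen {f1, f2, f3}"
    unfolding eq[symmetric] using ideal_gen_superset[of "{g1, g2, g3}"] by simp_all
  consider "d < d'" | "d' < d" using \<open>d' \<noteq> d\<close> by linarith
  then show False
  proof cases
    case 1
    then show ?thesis using small[OF f(1) f1 g] f(4) by simp
  next
    case 2
    then have "g1 = 0" "g2 = 0" "g3 = 0"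
      using small[OF g(1) g1(1) f(1-3)] small[OF g(2) g1(2) f(1-3)] small[OF g(3) g1(3) f(1-3)] by simp_all
    then show ?thesis using f1 f(4) unfolding ideal_gen_3 by simp
  qed
qed

lemma sum_lessThan_3: "(\<Sum>i<3. h i) = h 0 + h (Suc 0) + (h 2 :: 'a::comm_monoid_add)"
  by (simp add: numeral_3_eq_3 numeral_2_eq_2)

lemma cst_sum: "cst (sum f A) = (\<Sum>i\<in>A. cst (f i))"
  for f :: "_ \<Rightarrow> 'k::comm_monoid_add"
  by (induction A rule: infinite_finite_induct) (simp_all add: single_add)

definition scalar_map :: "(nat \<Rightarrow> nat \<Rightarrow> 'k::field) \<Rightarrow> ('k, 'n::finite) mpoly vec \<Rightarrow> ('k, 'n) mpoly vec" where
  "scalar_map A v = vec 3 (\<lambda>i. \<Sum>j<3. cst (A i j) * v $ j)"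

lemma scalar_map_carrier [simp]: "scalar_map A v \<in> carrier_vec 3"
  by (simp add: scalar_map_def)

lemma scalar_map_index: "i < 3 \<Longrightarrow> scalar_map A v $ i = (\<Sum>j<3. cst (A i j) * v $ j)"
  by (simp add: scalar_map_def)

lemma scalar_map_inverse:
  fixes v :: "('k::field, 'n::finite) mpoly vec"
  assumes "\<And>i l. i < 3 \<Longrightarrow> l < 3 \<Longrightarrow> (\<Sum>j<3. A i j * B j l) = (if i = l then 1 else 0)" "v \<in> carrier_vec 3"
  shows "scalar_map A (scalar_map B v) = v"
proof (rule eq_vecI)
  show "dim_vec (scalar_map A (scalar_map B v)) = dim_vec v" using assms(2) by (simp add: scalar_map_def)
  fix i assume "i < dim_vec v"
  then have i: "i < 3" using assms(2) by simp
  have "scalar_map A (scalar_map B v) $ i = (\<Sum>j<3. cst (A i j) * (\<Sum>l<3. cst (B j l) * v $ l))"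
    by (simp add: scalar_map_index[OF i]) (intro sum.cong, simp_all add: scalar_map_index)
  also have "\<dots> = (\<Sum>j<3. \<Sum>l<3. cst (A i j * B j l) * v $ l)"
    by (simp add: sum_distrib_left mult_single flip: mult.assoc)
  also have "\<dots> = (\<Sum>l<3. \<Sum>j<3. cst (A i j * B j l) * v $ l)" by (rule sum.swap)
  also have "\<dots> = (\<Sum>l<3. cst (if i = l then 1 else 0) * v $ l)"
    by (intro sum.cong refl) (simp add: assms(1)[OF i, symmetric] cst_sum sum_distrib_right)
  also have "\<dots> = (\<Sum>l<3. if i = l then v $ l else 0)" by (intro sum.cong refl) simp
  also have "\<dots> = v $ i" using i by simp
  finally show "scalar_map A (scalar_map B v) $ i = v $ i" .
qed

lemma homogeneous_sum: "(\<And>i. i \<in> A \<Longrightarrow> homogeneous d (f i)) \<Longrightarrow> homogeneous d (sum f A)"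
  for f :: "_ \<Rightarrow> ('k::comm_ring_1, 'n::finite) mpoly"
  by (induction A rule: infinite_finite_induct) (auto intro: homogeneous_add)

lemma homogeneous_scalar_map:
  assumes "homogeneous_vec t v" "v \<in> carrier_vec 3"
  shows "homogeneous_vec t (scalar_map A v)"
  unfolding homogeneous_vec_def
proof (intro allI impI)
  fix i assume "i < dim_vec (scalar_map A v)"
  then have "i < 3" by (simp add: scalar_map_def)
  have "homogeneous t (\<Sum>j<3. cst (A i j) * v $ j)"
    using assms by (intro homogeneous_sum homogeneous_cst_mult) (simp add: homogeneous_vec_def)
  then show "homogeneous t (scalar_map A v $ i)" by (simp add: scalar_map_index[OF \<open>i < 3\<close>])
qed

text \<open>In degree \<open>d\<close> the coefficients are constants, so each triple is a constant
  matrix times the other. Independence of the \<open>f\<close>s gives \<open>GH = 1\<close>, and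
  over a field a one-sided inverse of a square matrix is two-sided. The same matrices act on the
  syzygies.\<close>

lemma basis_change:
  fixes f1 f2 f3 :: "('k::field, 'n::finite) mpoly"
  assumes f: "homogeneous d f1" "homogeneous d f2" "homogeneous d f3" and ind: "k_indep3 f1 f2 f3"
    and g: "homogeneous d g1" "homogeneous d g2" "homogeneous d g3"
    and eq: "ideal_gen {g1, g2, g3} = ideal_gen {f1, f2, f3}"
  obtains T T' where "syz_iso [g1, g2, g3] [f1, f2, f3] T T'"
proof -
  define F where "F i = (if i = 0 then f1 else if i = Suc 0 then f2 else f3)" for i :: nat
  define E where "E i = (if i = 0 then g1 else if i = Suc 0 then g2 else g3)" for i :: nat
  have F: "F 0 = f1" "F (Suc 0) = f2" "F 2 = f3" and E: "E 0 = g1" "E (Suc 0) = g2" "E 2 = g3"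
    by (simp_all add: F_def E_def)
  have syzF: "v \<in> syz [f1, f2, f3] \<longleftrightarrow> v \<in> carrier_vec 3 \<and> (\<Sum>i<3. F i * v $ i) = 0" for v :: "('k, 'n) mpoly vec"
    unfolding syz3_iff sum_lessThan_3 F ..
  have syzE: "v \<in> syz [g1, g2, g3] \<longleftrightarrow> v \<in> carrier_vec 3 \<and> (\<Sum>i<3. E i * v $ i) = 0" for v :: "('k, 'n) mpoly vec"
    unfolding syz3_iff sum_lessThan_3 E ..
  have expand: "\<exists>a. p = (\<Sum>i<3. cst (a i) * h i)"
    if h: "homogeneous d p" "p \<in> ideal_gen {h 0, h (Suc 0), h 2}" "homogeneous d (h 0)" "homogeneous d (h (Suc 0))" "homogeneous d (h 2)"
    for p and h :: "nat \<Rightarrow> ('k, 'n) mpoly"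
  proof -
    obtain a b c where "p = cst a * h 0 + cst b * h (Suc 0) + cst c * h 2"
      by (rule homogeneous_in_ideal3_same[OF h])
    then show ?thesis unfolding sum_lessThan_3
      by (intro exI[of _ "\<lambda>i. if i = 0 then a else if i = Suc 0 then b else c"]) simp
  qed
  have exG: "\<exists>a. E j = (\<Sum>i<3. cst (a i) * F i)" for j
  proof (rule expand)
    have "{g1, g2, g3} \<subseteq> ideal_gen {f1, f2, f3}" using ideal_gen_superset[of "{g1, g2, g3}"] eq by simp
    then show "E j \<in> ideal_gen {F 0, F (Suc 0), F 2}" unfolding F by (simp add: E_def)
  qed (use f g in \<open>simp_all add: E_def F\<close>)
  have "\<exists>G. \<forall>j. E j = (\<Sum>i<3. cst (G j i) * F i)" by (rule choice) (rule allI, rule exG)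
  then obtain G' where "\<forall>j. E j = (\<Sum>i<3. cst (G' j i) * F i)" by (rule exE)
  then have "\<And>j. E j = (\<Sum>i<3. cst ((\<lambda>i j. G' j i) i j) * F i)" by (rule spec)
  then obtain G where G: "\<And>j. E j = (\<Sum>i<3. cst (G i j) * F i)" by (rule that)
  have exH: "\<exists>a. F j = (\<Sum>i<3. cst (a i) * E i)" for j
  proof (rule expand)
    have "{f1, f2, f3} \<subseteq> ideal_gen {g1, g2, g3}" using ideal_gen_superset[of "{f1, f2, f3}"] eq by simp
    then show "F j \<in> ideal_gen {E 0, E (Suc 0), E 2}" unfolding E by (simp add: F_def)
  qed (use f g in \<open>simp_all add: F_def E\<close>)
  have "\<exists>H. \<forall>j. F j = (\<Sum>i<3. cst (H j i) * E i)" by (rule choice) (rule allI, rule exH)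
  then obtain H' where "\<forall>j. F j = (\<Sum>i<3. cst (H' j i) * E i)" by (rule exE)
  then have "\<And>j. F j = (\<Sum>i<3. cst ((\<lambda>i j. H' j i) i j) * E i)" by (rule spec)
  then obtain H where H: "\<And>j. F j = (\<Sum>i<3. cst (H i j) * E i)" by (rule that)
  have indF: "c i = 0" if "(\<Sum>i<3. cst (c i) * F i) = 0" "i < 3" for c i
  proof -
    have "cst (c 0) * f1 + cst (c (Suc 0)) * f2 + cst (c 2) * f3 = 0"
      using that(1) unfolding sum_lessThan_3 F .
    then have "c 0 = 0 \<and> c (Suc 0) = 0 \<and> c 2 = 0" by (rule ind[unfolded k_indep3_def, rule_format])
    moreover have "i = 0 \<or> i = Suc 0 \<or> i = 2" using that(2) by auto
    ultimately show ?thesis by auto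
  qed
  have GH: "(\<Sum>j<3. G l j * H j i) = (if l = i then 1 else 0)" if "l < 3" "i < 3" for l i
  proof -
    have "F i = (\<Sum>j<3. cst (H j i) * (\<Sum>l<3. cst (G l j) * F l))"
      by (subst H) (simp only: G)
    also have "\<dots> = (\<Sum>j<3. \<Sum>l<3. cst (G l j * H j i) * F l)"
      by (simp only: sum_distrib_left mult_single mult.assoc[symmetric] add_0_left mult.commute[of "H _ _"])
    also have "\<dots> = (\<Sum>l<3. \<Sum>j<3. cst (G l j * H j i) * F l)" by (rule sum.swap)
    also have "\<dots> = (\<Sum>l<3. cst (\<Sum>j<3. G l j * H j i) * F l)"
      by (simp add: cst_sum sum_distrib_right)
    finally have "(\<Sum>l<3. cst (\<Sum>j<3. G l j * H j i) * F l) = (\<Sum>l<3. cst (if l = i then 1 else 0) * F l)"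
      using that(2) by (simp add: if_distrib[of cst] if_distrib[of "\<lambda>z. z * _"] cong: if_cong)
    then have "(\<Sum>l<3. cst ((\<Sum>j<3. G l j * H j i) - (if l = i then 1 else 0)) * F l) = 0"
      by (simp add: single_diff left_diff_distrib sum_subtractf)
    from indF[OF this that(1)] show ?thesis by simp
  qed
  have HG: "(\<Sum>j<3. H l j * G j i) = (if l = i then 1 else 0)" if "l < 3" "i < 3" for l i
  proof -
    let ?A = "mat 3 3 (\<lambda>(i, j). G i j)" and ?B = "mat 3 3 (\<lambda>(i, j). H i j)"
    have "?A * ?B = 1\<^sub>m 3"
      by (rule eq_matI) (simp_all add: scalar_prod_def atLeast0LessThan GH)
    then have "?B * ?A = 1\<^sub>m 3"
      by (rule mat_mult_left_right_inverse[rotated 2]) simp_all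
    then have "(?B * ?A) $$ (l, i) = 1\<^sub>m 3 $$ (l, i)" by simp
    then show ?thesis using that by (simp add: scalar_prod_def atLeast0LessThan)
  qed
  have sumG: "(\<Sum>i<3. F i * scalar_map G v $ i) = (\<Sum>j<3. E j * v $ j)" for v
  proof -
    have "(\<Sum>i<3. F i * scalar_map G v $ i) = (\<Sum>i<3. \<Sum>j<3. cst (G i j) * F i * v $ j)"
      by (intro sum.cong refl) (simp add: scalar_map_index sum_distrib_left algebra_simps)
    also have "\<dots> = (\<Sum>j<3. \<Sum>i<3. cst (G i j) * F i * v $ j)" by (rule sum.swap)
    also have "\<dots> = (\<Sum>j<3. E j * v $ j)" by (simp add: G sum_distrib_right)
    finally show ?thesis .
  qed
  have sumH: "(\<Sum>i<3. E i * scalar_map H v $ i) = (\<Sum>j<3. F j * v $ j)" for v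
  proof -
    have "(\<Sum>i<3. E i * scalar_map H v $ i) = (\<Sum>i<3. \<Sum>j<3. cst (H i j) * E i * v $ j)"
      by (intro sum.cong refl) (simp add: scalar_map_index sum_distrib_left algebra_simps)
    also have "\<dots> = (\<Sum>j<3. \<Sum>i<3. cst (H i j) * E i * v $ j)" by (rule sum.swap)
    also have "\<dots> = (\<Sum>j<3. F j * v $ j)" by (subst H) (simp only: sum_distrib_right)
    finally show ?thesis .
  qed
  have "syz_iso [g1, g2, g3] [f1, f2, f3] (scalar_map G) (scalar_map H)"
    unfolding syz_iso_def
  proof (intro conjI ballI allI)
    fix v assume "v \<in> syz [g1, g2, g3]"
    then have v: "v \<in> carrier_vec 3" "(\<Sum>i<3. E i * v $ i) = 0" unfolding syzE by auto
    show "scalar_map G v \<in> syz [f1, f2, f3]" unfolding syzF sumG using v by simp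
    show inv: "scalar_map H (scalar_map G v) = v" by (rule scalar_map_inverse[OF HG v(1)])
    show "homogeneous_vec t v \<longleftrightarrow> homogeneous_vec t (scalar_map G v)" for t
      using homogeneous_scalar_map[of t v G] homogeneous_scalar_map[of t "scalar_map G v" H] v(1) inv by auto
    show "scalar_map G (r \<cdot>\<^sub>v v) = r \<cdot>\<^sub>v scalar_map G v" for r
    proof (rule eq_vecI)
      fix i assume "i < dim_vec (r \<cdot>\<^sub>v scalar_map G v)"
      then have "i < 3" by (simp add: scalar_map_def)
      then show "scalar_map G (r \<cdot>\<^sub>v v) $ i = (r \<cdot>\<^sub>v scalar_map G v) $ i"
        using v(1) by (simp add: scalar_map_def sum_distrib_left algebra_simps)
    qed (simp add: scalar_map_def)
    fix w assume "w \<in> syz [g1, g2, g3]"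
    then have w: "w \<in> carrier_vec 3" unfolding syzE by auto
    show "scalar_map G (v + w) = scalar_map G v + scalar_map G w"
    proof (rule eq_vecI)
      fix i assume "i < dim_vec (scalar_map G v + scalar_map G w)"
      then have "i < 3" by (simp add: scalar_map_def)
      then show "scalar_map G (v + w) $ i = (scalar_map G v + scalar_map G w) $ i"
        using v(1) w by (simp add: scalar_map_def distrib_left sum.distrib)
    qed (simp add: scalar_map_def)
  next
    fix v assume "v \<in> syz [f1, f2, f3]"
    then have v: "v \<in> carrier_vec 3" "(\<Sum>i<3. F i * v $ i) = 0" unfolding syzF by auto
    show "scalar_map H v \<in> syz [g1, g2, g3]" unfolding syzE sumH using v by simp
    show "scalar_map G (scalar_map H v) = v" by (rule scalar_map_inverse[OF GH v(1)])
  qed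
  then show ?thesis by (rule that)
qed

lemma length_3E:
  assumes "length fs = 3"
  obtains g1 g2 g3 where "fs = [g1, g2, g3]"
proof -
  obtain g1 fs1 where 1: "fs = g1 # fs1" "length fs1 = 2" using assms by (cases fs) auto
  obtain g2 fs2 where 2: "fs1 = g2 # fs2" "length fs2 = 1" using 1(2) by (cases fs1) auto
  obtain g3 fs3 where 3: "fs2 = g3 # fs3" "length fs3 = 0" using 2(2) by (cases fs2) auto
  show ?thesis using that 1 2 3 by simp
qed

lemma minimal_generators_change:
  fixes f1 f2 f3 :: "('k::field, 'n::finite) mpoly"
  assumes f: "homogeneous d f1" "homogeneous d f2" "homogeneous d f3" and ind: "k_indep3 f1 f2 f3"
    and fs: "minimal_form_generators d' (ideal_gen {f1, f2, f3}) fs" "length fs = 3"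
  obtains T T' where "syz_iso fs [f1, f2, f3] T T'"
proof -
  obtain g1 g2 g3 where g: "fs = [g1, g2, g3]" by (rule length_3E[OF fs(2)])
  have eq: "ideal_gen {g1, g2, g3} = ideal_gen {f1, f2, f3}" and hg: "homogeneous d' g1" "homogeneous d' g2" "homogeneous d' g3"
    using fs(1) unfolding minimal_form_generators_def g by simp_all
  have "f1 \<noteq> 0"
  proof
    assume "f1 = 0"
    then have "cst 1 * f1 + cst 0 * f2 + cst 0 * f3 = 0" by simp
    then show False using ind unfolding k_indep3_def by (metis one_neq_zero)
  qed
  have "d' = d" by (rule generators_same_degree[OF f \<open>f1 \<noteq> 0\<close> hg eq])
  then show ?thesis using basis_change[OF f ind hg[unfolded \<open>d' = d\<close>] eq] that unfolding g by blast
qed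

lemma initial_syzygy_iso:
  fixes fs :: "('k::field, 'n::finite) mpoly list"
  assumes "syz_iso fs gs T T'" "initial_syzygy fs \<nu>" "length fs = length gs"
  shows "initial_syzygy gs (T \<nu>)"
proof -
  note T = syz_isoD[OF assms(1)]
  have \<nu>: "\<nu> \<in> syz fs" "\<nu> \<noteq> 0\<^sub>v (length fs)" "homogeneous_vec (int (indeg (syz fs))) \<nu>"
    using assms(2) unfolding initial_syzygy_def by auto
  have "T \<nu> \<noteq> 0\<^sub>v (length gs)"
  proof
    assume 0: "T \<nu> = 0\<^sub>v (length gs)"
    have "T (0 \<cdot>\<^sub>v \<nu>) = 0 \<cdot>\<^sub>v T \<nu>" by (rule T(6)[OF \<nu>(1)])
    also have "\<dots> = T \<nu>" unfolding 0 by (rule eq_vecI) simp_all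
    finally have "T' (T (0 \<cdot>\<^sub>v \<nu>)) = T' (T \<nu>)" by simp
    then have "0 \<cdot>\<^sub>v \<nu> = \<nu>" using T(2)[OF \<nu>(1)] T(2)[OF syz_smult[OF \<nu>(1)]] by metis
    then have "\<nu> = 0\<^sub>v (dim_vec \<nu>)" using vec_eq_0_iff_smult by blast
    then show False using \<nu>(2) carrier_vecD[OF syz_carrier[OF \<nu>(1)]] by metis
  qed
  then show ?thesis
    unfolding initial_syzygy_def using T(1)[OF \<nu>(1)] T(7)[OF \<nu>(1)] \<nu>(3) indeg_syz_iso[OF assms(1)] by simp
qed

lemma (in koszul_frame) initial_syzygy_gens: "initial_syzygy [y * g, x * g, q] (vec3 x (- y) 0)"
  unfolding initial_syzygy_def indeg_syz
proof (intro conjI initial_in_syz)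
  show "vec3 x (- y) 0 \<noteq> 0\<^sub>v (length [y * g, x * g, q])"
    using smult_initial_eq_0[of 1] by (simp add: numeral_3_eq_3)
  show "homogeneous_vec (int e) (vec3 x (- y) 0)"
    unfolding homogeneous_vec3[OF vec3_carrier] using hx hy by (simp add: homogeneous_uminus)
qed

text \<open>For \<open>e = 1\<close> the initial syzygy is a nonzero constant times
  \<open>(x, -y, 0)\<close>, so every choice of generators and syzygy leads back to the same
  ideal.\<close>

lemma (in koszul_frame) bourbaki_linear:
  assumes "e = 1" "minimal_form_generators d (ideal_gen {y * g, x * g, q}) fs" "length fs = 3" "initial_syzygy fs \<nu>"
  shows "bourbaki_ideal fs \<nu> (ideal_gen {x, y})"
proof -
  let ?F = "[y * g, x * g, q]"
  obtain T T' where T: "syz_iso fs ?F T T'"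
    by (rule minimal_generators_change[OF homogeneous_gens hq k_indep3 assms(2,3)])
  have "initial_syzygy ?F (T \<nu>)" using initial_syzygy_iso[OF T assms(4)] assms(3) by simp
  then have T\<nu>: "T \<nu> \<in> syz ?F" "T \<nu> \<noteq> 0\<^sub>v 3" "homogeneous_vec (int 1) (T \<nu>)"
    unfolding initial_syzygy_def indeg_syz assms(1) by (simp_all add: numeral_3_eq_3)
  obtain r where r: "T \<nu> = r \<cdot>\<^sub>v vec3 x (- y) 0" "homogeneous (int 1 - int e) r"
    by (rule low_syzygy[OF T\<nu>(1,3)]) simp
  then obtain c where c: "r = cst c" using homogeneous_0_cst[of r] assms(1) by auto
  have "c \<noteq> 0" using T\<nu>(2) r(1) smult_initial_eq_0[of r] c by auto
  have "cst (inverse c) \<cdot>\<^sub>v (T \<nu>) = vec3 x (- y) 0"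
    using \<open>c \<noteq> 0\<close> unfolding r(1) c by (simp add: smult_smult_assoc mult_single)
  then have "bourbaki_ideal ?F (T \<nu>) (ideal_gen {x, y})"
    using bourbaki_ideal_scale[of ?F "inverse c" "T \<nu>"] bourbaki \<open>c \<noteq> 0\<close> by simp
  moreover have "\<nu> \<in> syz fs" using assms(4) by (simp add: initial_syzygy_def)
  ultimately show ?thesis using bourbaki_ideal_syz_iso[OF T] by blast
qed

subsection \<open>Exact Koszul complexes\<close>

text \<open>Exactness of the Koszul complex at the first syzygies: \<open>(a, b, c)\<close> is the
  cross product of \<open>(u, v, w)\<close> and \<open>(f1, f2, f3)\<close>.\<close>

definition koszul_exact :: "'a::comm_ring_1 \<Rightarrow> 'a \<Rightarrow> 'a \<Rightarrow> bool" where
  "koszul_exact f1 f2 f3 \<longleftrightarrow> (\<forall>a b c. f1 * a + f2 * b + f3 * c = 0 \<longrightarrow>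
     (\<exists>u v w. a = v * f3 - w * f2 \<and> b = w * f1 - u * f3 \<and> c = u * f2 - v * f1))"

lemma koszul_exact_rotate: "koszul_exact f1 f2 f3 \<Longrightarrow> koszul_exact f2 f3 f1"
  unfolding koszul_exact_def
proof (intro allI impI)
  fix a b c assume *: "\<forall>a b c. f1 * a + f2 * b + f3 * c = 0 \<longrightarrow>
     (\<exists>u v w. a = v * f3 - w * f2 \<and> b = w * f1 - u * f3 \<and> c = u * f2 - v * f1)"
    and "f2 * a + f3 * b + f1 * c = 0"
  then have "f1 * c + f2 * a + f3 * b = 0" by (simp add: algebra_simps)
  then obtain u v w where "c = v * f3 - w * f2" "a = w * f1 - u * f3" "b = u * f2 - v * f1" using * by blast
  then show "\<exists>u v w. a = v * f1 - w * f3 \<and> b = w * f2 - u * f1 \<and> c = u * f3 - v * f2" by blast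
qed

text \<open>Subtracting multiples of \<open>f3\<close> from the other generators is inverted by a
  change of the cross product coefficients. Such shears later bring a syzygy of degree two into a
  form with third entry zero.\<close>

lemma koszul_exact_shear:
  fixes f1 f2 f3 :: "'a::comm_ring_1"
  assumes "koszul_exact f1 f2 f3"
  shows "koszul_exact (f1 - s * f3) (f2 - t * f3) f3"
  unfolding koszul_exact_def
proof (intro allI impI)
  fix a b c assume "(f1 - s * f3) * a + (f2 - t * f3) * b + f3 * c = 0"
  then have "f1 * a + f2 * b + f3 * (c - s * a - t * b) = 0" by (simp add: algebra_simps)
  then obtain u v w where *: "a = v * f3 - w * f2" "b = w * f1 - u * f3" "c - s * a - t * b = u * f2 - v * f1"
    using assms unfolding koszul_exact_def by blast
  have "c = u * f2 - v * f1 + s * a + t * b" using *(3) by (simp add: algebra_simps)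
  then show "\<exists>u v w. a = v * f3 - w * (f2 - t * f3) \<and> b = w * (f1 - s * f3) - u * f3 \<and> c = u * (f2 - t * f3) - v * (f1 - s * f3)"
    unfolding *(1,2)
    by (intro exI[of _ "u - s * w"] exI[of _ "v - t * w"] exI[of _ w]) (simp add: algebra_simps)
qed

lemma sum_hcomp: "p = (\<Sum>t\<in>mon_degree ` Poly_Mapping.keys p. hcomp (int t) p)"
proof (rule poly_mapping_eqI)
  fix m
  show "Poly_Mapping.lookup p m = Poly_Mapping.lookup (\<Sum>t\<in>mon_degree ` Poly_Mapping.keys p. hcomp (int t) p) m"
    by (cases "m \<in> Poly_Mapping.keys p") (simp_all add: lookup_sum lookup_hcomp sum.delta' in_keys_iff)
qed

text \<open>If \<open>f1 * c = u * f2\<close>, then \<open>(c, -u, 0)\<close> is a syzygy, hence a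
  cross product. Its coefficient \<open>w2\<close> satisfies \<open>w1 * f2 = w2 * f1\<close>, which
  is the same problem two degrees lower, and divisibility of \<open>w2\<close> by \<open>f2\<close>
  gives that of \<open>c\<close>. The grading makes the descent stop.\<close>

lemma koszul_exact_regular:
  fixes f1 f2 f3 :: "('k::field, 'n::finite) mpoly"
  assumes K: "koszul_exact f1 f2 f3"
    and f: "homogeneous 2 f1" "homogeneous 2 f2" "homogeneous 2 f3" and "f2 \<noteq> 0"
  shows "regular_pair f2 f1"
proof -
  have graded: "\<exists>v. c = v * f2"
    if "homogeneous (int t) c" "homogeneous (int t) u" "f1 * c = u * f2" for t c u
    using that
  proof (induction t arbitrary: c u rule: less_induct)
    case (less t)
    have "f1 * c + f2 * (- u) + f3 * 0 = 0" using less.prems(3) by (simp add: algebra_simps)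
    then obtain w1 w2 w3 where w: "c = w2 * f3 - w3 * f2" "- u = w3 * f1 - w1 * f3" "0 = w1 * f2 - w2 * f1"
      using K unfolding koszul_exact_def by blast
    let ?h = "hcomp (int t - 2)"
    have "hcomp (int t) (w1 * f2) = hcomp (int t) (w2 * f1)" using w(3) by simp
    then have rel: "f1 * ?h w2 = ?h w1 * f2"
      unfolding hcomp_mult[OF f(1)] hcomp_mult[OF f(2)] by (simp only: mult.commute)
    have c: "c = ?h w2 * f3 - ?h w3 * f2"
      using arg_cong[OF w(1), of "hcomp (int t)"] hcomp_homogeneous[OF less.prems(1), of "int t"]
      by (simp add: hcomp_diff hcomp_mult[OF f(2)] hcomp_mult[OF f(3)])
    have "\<exists>v. ?h w2 = v * f2"
    proof (cases "t < 2")
      case True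
      then have "?h w2 = 0" by (simp add: hcomp_neg)
      then show ?thesis by (intro exI[of _ 0]) simp
    next
      case False
      then have "int (t - 2) = int t - 2" "t - 2 < t" by auto
      then show ?thesis using less.IH[of "t - 2" "?h w2" "?h w1"] rel by simp
    qed
    then obtain v where "?h w2 = v * f2" by blast
    then have "c = (v * f3 - ?h w3) * f2" using c by (simp add: algebra_simps)
    then show ?case by blast
  qed
  show ?thesis
    unfolding regular_pair_def
  proof (intro conjI allI impI assms(5))
    fix c u assume eq: "f1 * c = u * f2"
    have "\<exists>v. hcomp (int t) c = v * f2" for t
    proof (rule graded[OF homogeneous_hcomp homogeneous_hcomp])
      have "hcomp (int t + 2) (c * f1) = hcomp (int t + 2) (u * f2)" using eq by (simp only: mult.commute)
      then show "f1 * hcomp (int t) c = hcomp (int t) u * f2"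
        unfolding hcomp_mult[OF f(1)] hcomp_mult[OF f(2)] by (simp only: mult.commute add_diff_cancel_right')
    qed
    then obtain V where V: "\<And>t. hcomp (int t) c = V t * f2" by metis
    have "c = (\<Sum>t\<in>mon_degree ` Poly_Mapping.keys c. V t) * f2"
      by (subst sum_hcomp[of c]) (simp add: V sum_distrib_right)
    then show "\<exists>v. c = v * f2" by blast
  qed
qed

text \<open>With \<open>g = 1\<close> the order \<open>x = f2\<close>, \<open>y = f1\<close> makes
  the generators \<open>y * g, x * g, q\<close> of the frame equal to
  \<open>f1, f2, f3\<close>.\<close>

lemma koszul_exact_frame:
  fixes f1 f2 f3 :: "('k::field, 'n::finite) mpoly"
  assumes K: "koszul_exact f1 f2 f3"
    and f: "homogeneous 2 f1" "homogeneous 2 f2" "homogeneous 2 f3" and "f2 \<noteq> 0"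
  shows "koszul_frame f2 f1 1 f3 2"
proof
  show "regular_pair f2 f1" by (rule koszul_exact_regular[OF assms])
  fix c assume "f3 * c \<in> ideal_gen {f2, f1}"
  then obtain u v where "f3 * c = u * f2 + v * f1" unfolding ideal_gen_2 by blast
  then have "f1 * (- v) + f2 * (- u) + f3 * c = 0" by (simp add: algebra_simps)
  then obtain a b where "c = a * f2 - b * f1" using K unfolding koszul_exact_def by blast
  then have "c = a * f2 + (- b) * f1" by simp
  then show "c \<in> ideal_gen {f2, f1}" unfolding ideal_gen_2 by blast
next
  show "\<exists>v. c = v * 1" for c :: "('k, 'n) mpoly" by (intro exI[of _ c]) simp
  show "homogeneous (2 - int 2) (1 :: ('k, 'n) mpoly)" using homogeneous_cst[of "1 :: 'k"] by simp
qed (use f in simp_all)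

lemma syz_iso_rotate: "syz_iso [f1, f2, f3] [f2, f3, f1]
    (\<lambda>v. vec3 (v $ Suc 0) (v $ 2) (v $ 0)) (\<lambda>v. vec3 (v $ 2) (v $ 0) (v $ Suc 0))"
  for f1 f2 f3 :: "('k::field, 'n::finite) mpoly"
  unfolding syz_iso_def
proof (intro conjI ballI allI)
  fix v assume "v \<in> syz [f1, f2, f3]"
  then have v: "v \<in> carrier_vec 3" "f1 * v $ 0 + f2 * v $ Suc 0 + f3 * v $ 2 = 0" unfolding syz3_iff by auto
  show "vec3 (v $ Suc 0) (v $ 2) (v $ 0) \<in> syz [f2, f3, f1]"
    unfolding syz3_iff using v(2) by (simp add: algebra_simps)
  show "vec3 (vec3 (v $ Suc 0) (v $ 2) (v $ 0) $ 2) (vec3 (v $ Suc 0) (v $ 2) (v $ 0) $ 0) (vec3 (v $ Suc 0) (v $ 2) (v $ 0) $ Suc 0) = v"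
    using v(1) by (intro eq_vec3I) simp_all
  show "homogeneous_vec t v \<longleftrightarrow> homogeneous_vec t (vec3 (v $ Suc 0) (v $ 2) (v $ 0))" for t
    unfolding homogeneous_vec3[OF v(1)] homogeneous_vec3[OF vec3_carrier] by auto
  show "vec3 ((r \<cdot>\<^sub>v v) $ Suc 0) ((r \<cdot>\<^sub>v v) $ 2) ((r \<cdot>\<^sub>v v) $ 0) = r \<cdot>\<^sub>v vec3 (v $ Suc 0) (v $ 2) (v $ 0)" for r
    by (rule eq_vec3I) (simp_all add: carrier3_smult[OF v(1)] carrier3_smult_vec3)
  fix w assume "w \<in> syz [f1, f2, f3]"
  then have w: "w \<in> carrier_vec 3" unfolding syz3_iff by auto
  show "vec3 ((v + w) $ Suc 0) ((v + w) $ 2) ((v + w) $ 0) = vec3 (v $ Suc 0) (v $ 2) (v $ 0) + vec3 (w $ Suc 0) (w $ 2) (w $ 0)"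
    by (rule eq_vec3I) (simp_all add: carrier3_add[OF v(1) w] carrier3_add[OF vec3_carrier vec3_carrier])
next
  fix v assume "v \<in> syz [f2, f3, f1]"
  then have v: "v \<in> carrier_vec 3" "f2 * v $ 0 + f3 * v $ Suc 0 + f1 * v $ 2 = 0" unfolding syz3_iff by auto
  show "vec3 (v $ 2) (v $ 0) (v $ Suc 0) \<in> syz [f1, f2, f3]"
    unfolding syz3_iff using v(2) by (simp add: algebra_simps)
  show "vec3 (vec3 (v $ 2) (v $ 0) (v $ Suc 0) $ Suc 0) (vec3 (v $ 2) (v $ 0) (v $ Suc 0) $ 2) (vec3 (v $ 2) (v $ 0) (v $ Suc 0) $ 0) = v"
    using v(1) by (intro eq_vec3I) simp_all
qed

lemma syz_iso_shear:
  fixes f1 f2 f3 :: "('k::field, 'n::finite) mpoly"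
  defines "T \<equiv> \<lambda>s t (v :: ('k, 'n) mpoly vec). vec3 (v $ 0) (v $ Suc 0) (v $ 2 + cst s * v $ 0 + cst t * v $ Suc 0)"
  shows "syz_iso [f1, f2, f3] [f1 - cst s * f3, f2 - cst t * f3, f3] (T s t) (T (- s) (- t))"
  unfolding syz_iso_def
proof (intro conjI ballI allI)
  fix v assume "v \<in> syz [f1, f2, f3]"
  then have v: "v \<in> carrier_vec 3" "f1 * v $ 0 + f2 * v $ Suc 0 + f3 * v $ 2 = 0" unfolding syz3_iff by auto
  show "T s t v \<in> syz [f1 - cst s * f3, f2 - cst t * f3, f3]"
    unfolding syz3_iff T_def using v(2) by (simp add: algebra_simps)
  show inv: "T (- s) (- t) (T s t v) = v"
    unfolding T_def using v(1) by (intro eq_vec3I) (simp_all add: single_uminus)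
  show "homogeneous_vec d v \<longleftrightarrow> homogeneous_vec d (T s t v)" for d
  proof -
    have "homogeneous_vec d (T s t v)" if "homogeneous_vec d v" "v \<in> carrier_vec 3" for v :: "('k, 'n) mpoly vec" and s t
      using that(1) unfolding T_def homogeneous_vec3[OF that(2)] homogeneous_vec3[OF vec3_carrier]
      by (simp add: homogeneous_add homogeneous_cst_mult)
    from this[of v s t] this[of "T s t v" "- s" "- t"] show ?thesis
      using v(1) inv unfolding T_def by auto
  qed
  show "T s t (r \<cdot>\<^sub>v v) = r \<cdot>\<^sub>v T s t v" for r
    unfolding T_def by (rule eq_vec3I) (simp_all add: carrier3_smult[OF v(1)] carrier3_smult_vec3 algebra_simps)
  fix w assume "w \<in> syz [f1, f2, f3]"
  then have w: "w \<in> carrier_vec 3" unfolding syz3_iff by auto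
  show "T s t (v + w) = T s t v + T s t w"
    unfolding T_def
    by (rule eq_vec3I) (simp_all add: carrier3_add[OF v(1) w] carrier3_add[OF vec3_carrier vec3_carrier] algebra_simps)
next
  fix v assume "v \<in> syz [f1 - cst s * f3, f2 - cst t * f3, f3]"
  then have v: "v \<in> carrier_vec 3" "(f1 - cst s * f3) * v $ 0 + (f2 - cst t * f3) * v $ Suc 0 + f3 * v $ 2 = 0"
    unfolding syz3_iff by auto
  show "T (- s) (- t) v \<in> syz [f1, f2, f3]"
    unfolding syz3_iff T_def using v(2) by (simp add: single_uminus algebra_simps)
  show "T s t (T (- s) (- t) v) = v"
    unfolding T_def using v(1) by (intro eq_vec3I) (simp_all add: single_uminus)
qed

lemma k_indep3_rotate: "k_indep3 f1 f2 f3 \<Longrightarrow> k_indep3 f2 f3 f1"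
  unfolding k_indep3_def
proof (intro allI impI)
  fix a b c assume *: "\<forall>a b c. cst a * f1 + cst b * f2 + cst c * f3 = 0 \<longrightarrow> a = 0 \<and> b = 0 \<and> c = 0"
    and "cst a * f2 + cst b * f3 + cst c * f1 = 0"
  then have "cst c * f1 + cst a * f2 + cst b * f3 = 0" by (simp add: algebra_simps)
  with * show "a = 0 \<and> b = 0 \<and> c = 0" by blast
qed

text \<open>\<open>\<nu>\<close> is the cross product of \<open>(a, b, c)\<close> with the
  generators. Since \<open>c\<close> is invertible, the shear by \<open>a / c\<close> and
  \<open>b / c\<close> carries it to \<open>- c\<close> times \<open>(h2, -h1, 0)\<close>, the
  initial syzygy of the sheared frame.\<close>

lemma bourbaki_koszul_third:
  fixes f1 f2 f3 :: "('k::field, 'n::finite) mpoly" and a b c :: 'k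
  assumes K: "koszul_exact f1 f2 f3" and f: "homogeneous 2 f1" "homogeneous 2 f2" "homogeneous 2 f3"
    and ind: "k_indep3 f1 f2 f3" and c: "c \<noteq> 0"
  defines "\<nu> \<equiv> vec3 (cst b * f3 - cst c * f2) (cst c * f1 - cst a * f3) (cst a * f2 - cst b * f1)"
  shows "\<exists>x y. regular_pair x y \<and> homogeneous 2 x \<and> homogeneous 2 y \<and> bourbaki_ideal [f1, f2, f3] \<nu> (ideal_gen {x, y})"
proof -
  define s t where "s = a / c" and "t = b / c"
  have st: "cst a = cst c * cst s" "cst b = cst c * cst t" using c by (simp_all add: s_def t_def mult_single)
  define h1 where "h1 = f1 - cst s * f3"
  define h2 where "h2 = f2 - cst t * f3"
  have "h2 \<noteq> 0"
  proof
    assume "h2 = 0"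
    then have "cst 0 * f1 + cst 1 * f2 + cst (- t) * f3 = 0" by (simp add: h2_def single_uminus)
    then show False using ind unfolding k_indep3_def by (metis one_neq_zero)
  qed
  have hh: "homogeneous 2 h1" "homogeneous 2 h2" unfolding h1_def h2_def
    by (intro homogeneous_diff homogeneous_cst_mult f)+
  have "koszul_exact h1 h2 f3" unfolding h1_def h2_def by (rule koszul_exact_shear[OF K])
  then interpret koszul_frame h2 h1 1 f3 2
    by (rule koszul_exact_frame) (use hh f \<open>h2 \<noteq> 0\<close> in simp_all)
  define T where "T v = vec3 (v $ 0) (v $ Suc 0) (v $ 2 + cst s * v $ 0 + cst t * v $ Suc 0)" for v :: "('k, 'n) mpoly vec"
  obtain T' where iso: "syz_iso [f1, f2, f3] [h1, h2, f3] T T'"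
    using syz_iso_shear[of f1 f2 f3 s t] unfolding T_def h1_def h2_def by blast
  have T\<nu>: "T \<nu> = cst (- c) \<cdot>\<^sub>v vec3 h2 (- h1) 0"
    unfolding T_def \<nu>_def st h1_def h2_def
    by (rule eq_vec3I) (simp_all add: carrier3_smult_vec3 single_uminus algebra_simps)
  have "cst (inverse (- c)) \<cdot>\<^sub>v T \<nu> = vec3 h2 (- h1) 0"
    using c unfolding T\<nu> by (simp add: smult_smult_assoc mult_single)
  then have "bourbaki_ideal [h1, h2, f3] (T \<nu>) (ideal_gen {h2, h1})"
    using bourbaki_ideal_scale[of "[h1, h2, f3]" "inverse (- c)" "T \<nu>"] bourbaki c by simp
  moreover have "\<nu> \<in> syz [f1, f2, f3]" unfolding syz3_iff \<nu>_def by (simp add: algebra_simps)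
  ultimately have "bourbaki_ideal [f1, f2, f3] \<nu> (ideal_gen {h2, h1})"
    using bourbaki_ideal_syz_iso[OF iso] by blast
  then show ?thesis using reg hh by blast
qed

text \<open>A cyclic rotation of the generators moves a nonzero coefficient to the third
  place.\<close>

lemma bourbaki_koszul:
  fixes f1 f2 f3 :: "('k::field, 'n::finite) mpoly" and a b c :: 'k
  assumes K: "koszul_exact f1 f2 f3" and f: "homogeneous 2 f1" "homogeneous 2 f2" "homogeneous 2 f3"
    and ind: "k_indep3 f1 f2 f3" and abc: "a \<noteq> 0 \<or> b \<noteq> 0 \<or> c \<noteq> 0"
  defines "\<nu> \<equiv> vec3 (cst b * f3 - cst c * f2) (cst c * f1 - cst a * f3) (cst a * f2 - cst b * f1)"
  shows "\<exists>x y. regular_pair x y \<and> homogeneous 2 x \<and> homogeneous 2 y \<and> bourbaki_ideal [f1, f2, f3] \<nu> (ideal_gen {x, y})"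
proof -
  have \<nu>: "\<nu> \<in> syz [f1, f2, f3]" unfolding syz3_iff \<nu>_def by (simp add: algebra_simps)
  note iso1 = syz_iso_rotate[of f1 f2 f3] and iso2 = syz_iso_rotate[of f2 f3 f1]
  consider "c \<noteq> 0" | "a \<noteq> 0" | "b \<noteq> 0" using abc by blast
  then show ?thesis
  proof cases
    case 1
    then show ?thesis unfolding \<nu>_def by (rule bourbaki_koszul_third[OF K f ind])
  next
    case 2
    obtain x y where xy: "regular_pair x y" "homogeneous 2 x" "homogeneous 2 y"
      "bourbaki_ideal [f2, f3, f1] (vec3 (cst c * f1 - cst a * f3) (cst a * f2 - cst b * f1) (cst b * f3 - cst c * f2)) (ideal_gen {x, y})"
      using bourbaki_koszul_third[OF koszul_exact_rotate[OF K] f(2,3,1) k_indep3_rotate[OF ind] 2, of c b] by blast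
    have "bourbaki_ideal [f1, f2, f3] \<nu> (ideal_gen {x, y})"
      by (rule bourbaki_ideal_syz_iso[OF iso1 \<nu>]) (use xy(4) in \<open>simp add: \<nu>_def\<close>)
    then show ?thesis using xy by blast
  next
    case 3
    obtain x y where xy: "regular_pair x y" "homogeneous 2 x" "homogeneous 2 y"
      "bourbaki_ideal [f3, f1, f2] (vec3 (cst a * f2 - cst b * f1) (cst b * f3 - cst c * f2) (cst c * f1 - cst a * f3)) (ideal_gen {x, y})"
      using bourbaki_koszul_third[OF koszul_exact_rotate[OF koszul_exact_rotate[OF K]] f(3,1,2)
        k_indep3_rotate[OF k_indep3_rotate[OF ind]] 3, of a c] by blast
    have "bourbaki_ideal [f1, f2, f3] \<nu> (ideal_gen {x, y})"
      by (rule bourbaki_ideal_syz_iso[OF syz_iso_trans[OF iso1 iso2] \<nu>]) (use xy(4) in \<open>simp add: \<nu>_def\<close>)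
    then show ?thesis using xy by blast
  qed
qed

text \<open>An initial syzygy has degree two, so its cross product coefficients can be replaced by
  their constant terms. These are not all zero, which is what \<open>bourbaki_koszul\<close> asks
  for.\<close>

lemma bourbaki_complete_intersection:
  fixes f1 f2 f3 :: "('k::field, 'n::finite) mpoly"
  assumes K: "koszul_exact f1 f2 f3" and f: "homogeneous 2 f1" "homogeneous 2 f2" "homogeneous 2 f3"
    and ind: "k_indep3 f1 f2 f3"
    and fs: "minimal_form_generators d (ideal_gen {f1, f2, f3}) fs" "length fs = 3" "initial_syzygy fs \<nu>"
  obtains x y where "regular_pair x y" "homogeneous 2 x" "homogeneous 2 y" "bourbaki_ideal fs \<nu> (ideal_gen {x, y})"
proof -
  let ?F = "[f1, f2, f3]"
  have "f2 \<noteq> 0"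
  proof
    assume "f2 = 0"
    then have "cst 0 * f1 + cst 1 * f2 + cst 0 * f3 = 0" by simp
    then show False using ind unfolding k_indep3_def by (metis one_neq_zero)
  qed
  then interpret koszul_frame f2 f1 1 f3 2 by (rule koszul_exact_frame[OF K f])
  obtain T T' where T: "syz_iso fs ?F T T'"
    by (rule minimal_generators_change[OF f ind fs(1,2)])
  have "initial_syzygy ?F (T \<nu>)" using initial_syzygy_iso[OF T fs(3)] fs(2) by simp
  moreover have "indeg (syz ?F) = 2" using indeg_syz by simp
  ultimately have T\<nu>: "T \<nu> \<in> syz ?F" "T \<nu> \<noteq> 0\<^sub>v 3" "homogeneous_vec 2 (T \<nu>)"
    unfolding initial_syzygy_def by (simp_all add: numeral_3_eq_3)
  have cv: "T \<nu> \<in> carrier_vec 3" and rel: "f1 * T \<nu> $ 0 + f2 * T \<nu> $ Suc 0 + f3 * T \<nu> $ 2 = 0"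
    using T\<nu>(1) unfolding syz3_iff by auto
  have hom: "homogeneous 2 (T \<nu> $ 0)" "homogeneous 2 (T \<nu> $ Suc 0)" "homogeneous 2 (T \<nu> $ 2)"
    using T\<nu>(3) unfolding homogeneous_vec3[OF cv] by auto
  obtain u v w where uvw: "T \<nu> $ 0 = v * f3 - w * f2" "T \<nu> $ Suc 0 = w * f1 - u * f3" "T \<nu> $ 2 = u * f2 - v * f1"
    using K rel unfolding koszul_exact_def by blast
  have h0: "hcomp 0 p = cst (Poly_Mapping.lookup p 0)" for p :: "('k, 'n) mpoly"
    using homogeneous_0_cst[OF homogeneous_hcomp[of 0 p]] by (simp add: lookup_hcomp)
  let ?c = "\<lambda>p. Poly_Mapping.lookup p 0"
  have comps: "T \<nu> $ 0 = cst (?c v) * f3 - cst (?c w) * f2" "T \<nu> $ Suc 0 = cst (?c w) * f1 - cst (?c u) * f3"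
    "T \<nu> $ 2 = cst (?c u) * f2 - cst (?c v) * f1"
    using hcomp_homogeneous[OF hom(1), of 2] hcomp_homogeneous[OF hom(2), of 2] hcomp_homogeneous[OF hom(3), of 2]
    unfolding uvw by (simp_all add: hcomp_diff hcomp_mult[OF f(1)] hcomp_mult[OF f(2)] hcomp_mult[OF f(3)] h0)
  have eq: "T \<nu> = vec3 (cst (?c v) * f3 - cst (?c w) * f2) (cst (?c w) * f1 - cst (?c u) * f3) (cst (?c u) * f2 - cst (?c v) * f1)"
    by (rule eq_vec3I[OF cv]) (simp_all add: comps)
  have "?c u \<noteq> 0 \<or> ?c v \<noteq> 0 \<or> ?c w \<noteq> 0"
  proof (rule ccontr)
    assume "\<not> ?thesis"
    then have "T \<nu> = 0\<^sub>v 3" by (intro eq_vec3I[OF cv]) (simp_all add: comps)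
    then show False using T\<nu>(2) by simp
  qed
  from bourbaki_koszul[OF K f ind this, folded eq] obtain x y where
    xy: "regular_pair x y" "homogeneous 2 x" "homogeneous 2 y" "bourbaki_ideal ?F (T \<nu>) (ideal_gen {x, y})" by blast
  moreover have "\<nu> \<in> syz fs" using fs(3) by (simp add: initial_syzygy_def)
  ultimately show ?thesis using that bourbaki_ideal_syz_iso[OF T] by blast
qed

lemma minimal_form_generators_indep:
  fixes f1 f2 f3 :: "('k::field, 'n::finite) mpoly"
  assumes f: "homogeneous d f1" "homogeneous d f2" "homogeneous d f3" and ind: "k_indep3 f1 f2 f3"
  shows "minimal_form_generators d (ideal_gen {f1, f2, f3}) [f1, f2, f3]"
proof -
  have no: "h1 \<notin> ideal_gen {h2, h3}"
    if h: "homogeneous d h1" "homogeneous d h2" "homogeneous d h3" "k_indep3 h1 h2 h3" for h1 h2 h3 :: "('k, 'n) mpoly"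
  proof
    assume "h1 \<in> ideal_gen {h2, h3}"
    then have "h1 \<in> ideal_gen {h2, h3, h3}" by simp
    then obtain a b c where "h1 = cst a * h2 + cst b * h3 + cst c * h3"
      using homogeneous_in_ideal3_same[OF h(1) _ h(2,3,3)] by blast
    then have "cst (- 1) * h1 + cst a * h2 + cst (b + c) * h3 = 0"
      by (simp add: single_uminus single_add algebra_simps)
    then show False using h(4) unfolding k_indep3_def by (metis neg_equal_0_iff_equal one_neq_zero)
  qed
  have mem: "f1 \<in> ideal_gen {f1, f2, f3}" "f2 \<in> ideal_gen {f1, f2, f3}" "f3 \<in> ideal_gen {f1, f2, f3}"
    using ideal_gen_superset[of "{f1, f2, f3}"] by simp_all
  have "ideal_gen {f2, f3} \<noteq> ideal_gen {f1, f2, f3}" using no[OF f ind] mem(1) by metis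
  moreover have "ideal_gen {f1, f3} \<noteq> ideal_gen {f1, f2, f3}"
    using no[OF f(2,3,1) k_indep3_rotate[OF ind]] mem(2) by (metis insert_commute)
  moreover have "ideal_gen {f1, f2} \<noteq> ideal_gen {f1, f2, f3}"
    using no[OF f(3,1,2) k_indep3_rotate[OF k_indep3_rotate[OF ind]]] mem(3) by metis
  ultimately have ne: "ideal_gen {f2, f3} \<noteq> ideal_gen {f1, f2, f3}" "ideal_gen {f1, f3} \<noteq> ideal_gen {f1, f2, f3}"
    "ideal_gen {f1, f2} \<noteq> ideal_gen {f1, f2, f3}" by blast+
  have "ideal_gen (set (take i [f1, f2, f3] @ drop (Suc i) [f1, f2, f3])) \<noteq> ideal_gen {f1, f2, f3}"
    if i3: "i < 3" for i
  proof -
    have *: "take i [f1, f2, f3] @ drop (Suc i) [f1, f2, f3] = (if i = 0 then [f2, f3] else if i = 1 then [f1, f3] else [f1, f2])"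
      using i3 by (cases i; cases "i - 1") auto
    show ?thesis unfolding * using ne by simp
  qed
  then show ?thesis unfolding minimal_form_generators_def using f by (simp add: numeral_3_eq_3)
qed

text \<open>For every choice of generators and initial syzygy, \<open>all\<close> provides one
  Bourbaki ideal of the expected multiplicity, and \<open>bourbaki_ideal_unique\<close> identifies
  any other with it.\<close>

lemma bourbaki_degreeI:
  fixes J :: "('k::field, 'n::finite) mpoly set"
  assumes "\<not> perfect_height_two J"
    and ex: "minimal_form_generators d J fs" "length fs = 3" "initial_syzygy fs \<nu>"
    and all: "\<And>d fs \<nu>. minimal_form_generators d J fs \<Longrightarrow> length fs = 3 \<Longrightarrow> initial_syzygy fs \<nu> \<Longrightarrow>
      \<exists>x y. regular_pair x y \<and> bourbaki_ideal fs \<nu> (ideal_gen {x, y}) \<and> multiplicity_quot (ideal_gen {x, y}) = b"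
  shows "bourbaki_degree J = b"
proof -
  have "(THE b. \<exists>d fs \<nu> I. length fs = 3 \<and> minimal_form_generators d J fs \<and>
             initial_syzygy fs \<nu> \<and> bourbaki_ideal fs \<nu> I \<and> b = multiplicity_quot I) = b"
  proof (rule the_equality)
    show "\<exists>d fs \<nu> I. length fs = 3 \<and> minimal_form_generators d J fs \<and>
             initial_syzygy fs \<nu> \<and> bourbaki_ideal fs \<nu> I \<and> b = multiplicity_quot I"
      using ex all[OF ex] by metis
    fix b' assume "\<exists>d fs \<nu> I. length fs = 3 \<and> minimal_form_generators d J fs \<and>
             initial_syzygy fs \<nu> \<and> bourbaki_ideal fs \<nu> I \<and> b' = multiplicity_quot I"
    then obtain d fs \<nu> I where *: "length fs = 3" "minimal_form_generators d J fs"
      "initial_syzygy fs \<nu>" "bourbaki_ideal fs \<nu> I" "b' = multiplicity_quot I" by blast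
    obtain x y where "regular_pair x y" "bourbaki_ideal fs \<nu> (ideal_gen {x, y})" "multiplicity_quot (ideal_gen {x, y}) = b"
      using all[OF *(2,1,3)] by blast
    then show "b' = b" using bourbaki_ideal_unique *(4,5) by metis
  qed
  then show ?thesis unfolding bourbaki_degree_def using assms(1) by simp
qed

section \<open>Dimensions of the graded pieces of ideals\<close>

lemma homogeneous_supp_in: "{p :: ('k::field, 'n::finite) mpoly. homogeneous (int t) p} = supp_in {m. mon_degree m = t}"
  by (auto simp: supp_in_def homogeneous_def)

lemma finite_mon_degree: "finite {m :: 'n::finite \<Rightarrow>\<^sub>0 nat. mon_degree m = t}"
proof (rule finite_subset)
  show "{m :: 'n \<Rightarrow>\<^sub>0 nat. mon_degree m = t} \<subseteq> box UNIV t"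
  proof
    fix m :: "'n \<Rightarrow>\<^sub>0 nat" assume "m \<in> {m. mon_degree m = t}"
    then have "(\<Sum>i\<in>UNIV. Poly_Mapping.lookup m i) = t" by (simp add: mon_degree_def)
    then have "Poly_Mapping.lookup m i \<le> t" for i
      using member_le_sum[of i UNIV "Poly_Mapping.lookup m"] by simp
    then show "m \<in> box UNIV t" by (simp add: box_def)
  qed
qed (rule card_box)

lemma card_mon_degree:
  "card {m :: 'n::finite \<Rightarrow>\<^sub>0 nat. mon_degree m = t} = (t + CARD('n) - 1) choose t"
proof -
  obtain xs :: "'n list" where xs: "set xs = UNIV" "distinct xs"
    using finite_distinct_list[of "UNIV :: 'n set"] by auto
  have len: "length xs = CARD('n)" using distinct_card[OF xs(2)] xs(1) by simp
  have "bij_betw (\<lambda>m. map (Poly_Mapping.lookup m) xs) {m :: 'n \<Rightarrow>\<^sub>0 nat. mon_degree m = t}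
      {l. length l = CARD('n) \<and> sum_list l = t}"
    unfolding bij_betw_def
  proof
    show "inj_on (\<lambda>m. map (Poly_Mapping.lookup m) xs) {m :: 'n \<Rightarrow>\<^sub>0 nat. mon_degree m = t}"
    proof (rule inj_onI)
      fix m m' :: "'n \<Rightarrow>\<^sub>0 nat"
      assume "map (Poly_Mapping.lookup m) xs = map (Poly_Mapping.lookup m') xs"
      then have "Poly_Mapping.lookup m i = Poly_Mapping.lookup m' i" for i
        using xs(1) by (metis UNIV_I map_eq_conv)
      then show "m = m'" by (rule poly_mapping_eqI)
    qed
    have sum: "sum_list (map (Poly_Mapping.lookup m) xs) = mon_degree m" for m :: "'n \<Rightarrow>\<^sub>0 nat"
      using sum_list_distinct_conv_sum_set[OF xs(2), of "Poly_Mapping.lookup m"] xs(1) by (simp add: mon_degree_def)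
    show "(\<lambda>m. map (Poly_Mapping.lookup m) xs) ` {m :: 'n \<Rightarrow>\<^sub>0 nat. mon_degree m = t} = {l. length l = CARD('n) \<and> sum_list l = t}"
    proof
      show "(\<lambda>m. map (Poly_Mapping.lookup m) xs) ` {m :: 'n \<Rightarrow>\<^sub>0 nat. mon_degree m = t} \<subseteq> {l. length l = CARD('n) \<and> sum_list l = t}"
        using sum len by auto
      show "{l. length l = CARD('n) \<and> sum_list l = t} \<subseteq> (\<lambda>m. map (Poly_Mapping.lookup m) xs) ` {m :: 'n \<Rightarrow>\<^sub>0 nat. mon_degree m = t}"
      proof
        fix l assume "l \<in> {l. length l = CARD('n) \<and> sum_list l = t}"
        then have l: "length l = length xs" "sum_list l = t" using len by auto
        define m where "m = Abs_poly_mapping (\<lambda>i. the (map_of (zip xs l) i))"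
        have "map (Poly_Mapping.lookup m) xs = l"
        proof (rule nth_equalityI)
          show "length (map (Poly_Mapping.lookup m) xs) = length l" using l by simp
          fix j assume "j < length (map (Poly_Mapping.lookup m) xs)"
          then show "map (Poly_Mapping.lookup m) xs ! j = l ! j"
            using map_of_zip_nth[OF l(1)[symmetric] xs(2)] l(1) by (simp add: m_def)
        qed
        then show "l \<in> (\<lambda>m. map (Poly_Mapping.lookup m) xs) ` {m. mon_degree m = t}"
          using sum[of m] l(2) by (intro image_eqI[of _ _ m]) simp_all
      qed
    qed
  qed
  then have "card {m :: 'n \<Rightarrow>\<^sub>0 nat. mon_degree m = t} = card {l :: nat list. length l = CARD('n) \<and> sum_list l = t}"
    by (rule bij_betw_same_card)
  then show ?thesis using card_length_sum_list[of "CARD('n)" t] by simp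
qed

abbreviation forms :: "nat \<Rightarrow> ('k::zero, 'n::finite) mpoly set" where
  "forms t \<equiv> {p. homogeneous (int t) p}"

lemma dim_forms: "k_dim (forms t :: ('k::field, 'n::finite) mpoly set) = (t + CARD('n) - 1) choose t"
  unfolding homogeneous_supp_in by (simp add: dim_supp_in finite_mon_degree card_mon_degree)

lemma subspace_forms: "mpoly.subspace (forms t)"
  unfolding homogeneous_supp_in by (rule subspace_supp_in)

lemma forms_finite:
  obtains F :: "('k::field, 'n::finite) mpoly set" where "finite F" "forms t \<subseteq> mpoly.span F"
  unfolding homogeneous_supp_in by (rule supp_in_finite[OF finite_mon_degree])

lemma subspace_image_mult:
  fixes V :: "('k::field, 'n::finite) mpoly set"
  assumes "mpoly.subspace V"
  shows "mpoly.subspace ((\<lambda>p. f * p) ` V)"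
proof (rule mpoly.subspaceI)
  show "0 \<in> (\<lambda>p. f * p) ` V" using mpoly.subspace_0[OF assms] by (intro image_eqI[of _ _ 0]) simp_all
  fix y z c assume "y \<in> (\<lambda>p. f * p) ` V"
  then obtain y' where y: "y = f * y'" "y' \<in> V" by blast
  show "cst c * y \<in> (\<lambda>p. f * p) ` V"
    using mpoly.subspace_scale[OF assms y(2), of c] unfolding y(1)
    by (intro image_eqI[of _ _ "cst c * y'"]) (simp_all add: algebra_simps)
  assume "z \<in> (\<lambda>p. f * p) ` V"
  then obtain z' where z: "z = f * z'" "z' \<in> V" by blast
  show "y + z \<in> (\<lambda>p. f * p) ` V"
    using mpoly.subspace_add[OF assms y(2) z(2)] unfolding y(1) z(1)
    by (intro image_eqI[of _ _ "y' + z'"]) (simp_all add: algebra_simps)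
qed

lemma dim_image_mult:
  fixes V :: "('k::field, 'n::finite) mpoly set"
  assumes "f \<noteq> 0" "V \<subseteq> forms t" "mpoly.subspace V"
  shows "k_dim ((\<lambda>p. f * p) ` V) = k_dim V"
proof -
  obtain F :: "('k, 'n) mpoly set" where "finite F" "forms t \<subseteq> mpoly.span F" by (rule forms_finite)
  then show ?thesis
    using assms by (intro mpoly.dim_inj_image[of _ F]) (auto simp: algebra_simps)
qed

lemma dim_forms_sum:
  fixes V W :: "('k::field, 'n::finite) mpoly set"
  assumes "V \<subseteq> forms t" "W \<subseteq> forms t" "mpoly.subspace V" "mpoly.subspace W"
  shows "k_dim {v + w | v w. v \<in> V \<and> w \<in> W} + k_dim (V \<inter> W) = k_dim V + k_dim W"
proof -
  obtain F :: "('k, 'n) mpoly set" where F: "finite F" "forms t \<subseteq> mpoly.span F" by (rule forms_finite)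
  show ?thesis
    by (rule mpoly.dim_sum_Int[OF F(1) order_trans[OF assms(1) F(2)] order_trans[OF assms(2) F(2)] assms(3,4)])
qed

abbreviation ideal_forms :: "('k::field, 'n::finite) mpoly set \<Rightarrow> nat \<Rightarrow> ('k, 'n) mpoly set" where
  "ideal_forms I t \<equiv> {p \<in> I. homogeneous (int t) p}"

lemma subspace_ideal_forms: "is_ideal I \<Longrightarrow> mpoly.subspace (ideal_forms I t)"
  using mpoly.subspace_inter[OF subspace_ideal subspace_forms, of I t] by (simp add: Int_def)

lemma dim_ideal_forms_le: "is_ideal I \<Longrightarrow> k_dim (ideal_forms I t) \<le> k_dim (forms t :: ('k::field, 'n::finite) mpoly set)"
  for I :: "('k::field, 'n::finite) mpoly set"
proof -
  obtain F :: "('k, 'n) mpoly set" where F: "finite F" "forms t \<subseteq> mpoly.span F" by (rule forms_finite)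
  show ?thesis by (rule mpoly.dim_mono_finite[OF F]) blast
qed

lemma homogeneous_mult_nat:
  fixes p f :: "('k::field, 'n::finite) mpoly"
  assumes "homogeneous (int a) p" "homogeneous (int b) f" "c = a + b"
  shows "homogeneous (int c) (f * p)"
  using homogeneous_mult[OF assms(2,1)] assms(3) by (simp add: add.commute)

lemma image_mult_forms:
  fixes f :: "('k::field, 'n::finite) mpoly"
  assumes "homogeneous (int b) f" "V \<subseteq> forms a" "c = a + b"
  shows "(\<lambda>p. f * p) ` V \<subseteq> forms c"
  using assms(2) homogeneous_mult_nat[OF _ assms(1,3)] by blast

text \<open>A graded piece of the ideal is the sum of the multiples of \<open>x\<close> and those of
  \<open>y\<close>; by regularity they meet in the multiples of \<open>x * y\<close>. The shift by
  \<open>2 * e\<close> avoids subtraction of degrees.\<close>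

lemma dim_regular_pair:
  fixes x y :: "('k::field, 'n::finite) mpoly"
  assumes reg: "regular_pair x y" and h: "homogeneous (int e) x" "homogeneous (int e) y" and "y \<noteq> 0"
  shows "k_dim (ideal_forms (ideal_gen {x, y}) (s + 2 * e)) + k_dim (forms s :: ('k, 'n) mpoly set)
       = 2 * k_dim (forms (s + e) :: ('k, 'n) mpoly set)"
proof -
  let ?t = "s + 2 * e"
  let ?V = "(\<lambda>p. x * p) ` forms (s + e)" and ?W = "(\<lambda>p. y * p) ` forms (s + e)"
  have x0: "x \<noteq> 0" using reg by (simp add: regular_pair_def)
  have V: "?V \<subseteq> forms ?t" "?W \<subseteq> forms ?t"
    by (rule image_mult_forms[OF h(1) order_refl], simp) (rule image_mult_forms[OF h(2) order_refl], simp)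
  have I: "{v + w | v w. v \<in> ?V \<and> w \<in> ?W} = ideal_forms (ideal_gen {x, y}) ?t"
  proof
    show "{v + w | v w. v \<in> ?V \<and> w \<in> ?W} \<subseteq> ideal_forms (ideal_gen {x, y}) ?t"
    proof
      fix p assume "p \<in> {v + w | v w. v \<in> ?V \<and> w \<in> ?W}"
      then obtain v w where p: "p = v + w" "v \<in> ?V" "w \<in> ?W" by blast
      then obtain a b where "v = x * a" "w = y * b" by blast
      then have "p = a * x + b * y" using p(1) by (simp add: mult.commute)
      moreover have "homogeneous (int ?t) p" unfolding p(1) using p(2,3) V by (intro homogeneous_add) auto
      ultimately show "p \<in> ideal_forms (ideal_gen {x, y}) ?t" unfolding ideal_gen_2 by blast
    qed
    show "ideal_forms (ideal_gen {x, y}) ?t \<subseteq> {v + w | v w. v \<in> ?V \<and> w \<in> ?W}"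
    proof
      fix p assume "p \<in> ideal_forms (ideal_gen {x, y}) ?t"
      then obtain a b where p: "p = a * x + b * y" "homogeneous (int ?t) p" unfolding ideal_gen_2 by blast
      let ?h = "hcomp (int (s + e))"
      have "p = ?h a * x + ?h b * y"
        using arg_cong[OF p(1), of "hcomp (int ?t)"] hcomp_homogeneous[OF p(2), of "int ?t"]
        by (simp add: hcomp_add hcomp_mult[OF h(1)] hcomp_mult[OF h(2)] algebra_simps)
      then have "p = x * ?h a + y * ?h b" by (simp add: mult.commute)
      then show "p \<in> {v + w | v w. v \<in> ?V \<and> w \<in> ?W}" using homogeneous_hcomp by blast
    qed
  qed
  have int: "?V \<inter> ?W = (\<lambda>p. x * y * p) ` forms s"
  proof
    show "?V \<inter> ?W \<subseteq> (\<lambda>p. x * y * p) ` forms s"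
    proof
      fix p assume "p \<in> ?V \<inter> ?W"
      then obtain a b where p: "p = x * a" "p = y * b" "homogeneous (int (s + e)) a" by blast
      have "y * b = a * x" using p by (simp add: mult.commute)
      then obtain v where v: "b = v * x" using reg unfolding regular_pair_def by blast
      have "x * a = x * (v * y)" using p v by (simp add: algebra_simps)
      then have a: "a = v * y" using mpoly_mult_cancel[OF x0] by blast
      have "homogeneous (int (s + e) - int e) v"
        by (rule homogeneous_mult_cancel[OF h(2) assms(4)]) (use p(3) a in simp)
      then have "v \<in> forms s" by simp
      moreover have "p = x * y * v" using p(1) a by (simp add: algebra_simps)
      ultimately show "p \<in> (\<lambda>p. x * y * p) ` forms s" by blast
    qed
    show "(\<lambda>p. x * y * p) ` forms s \<subseteq> ?V \<inter> ?W"
    proof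
      fix p assume "p \<in> (\<lambda>p. x * y * p) ` forms s"
      then obtain v where v: "p = x * y * v" "homogeneous (int s) v" by blast
      have "p = x * (y * v)" "p = y * (x * v)" using v(1) by (simp_all add: algebra_simps)
      moreover have "y * v \<in> forms (s + e)" "x * v \<in> forms (s + e)"
        using homogeneous_mult_nat[OF v(2) h(2)] homogeneous_mult_nat[OF v(2) h(1)] by simp_all
      ultimately show "p \<in> ?V \<inter> ?W" by blast
    qed
  qed
  have "k_dim {v + w | v w. v \<in> ?V \<and> w \<in> ?W} + k_dim (?V \<inter> ?W) = k_dim ?V + k_dim ?W"
    by (intro dim_forms_sum[OF V] subspace_image_mult subspace_forms)
  moreover have "k_dim ?V = k_dim (forms (s + e) :: ('k, 'n) mpoly set)"
    by (rule dim_image_mult[OF x0 order_refl subspace_forms])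
  moreover have "k_dim ?W = k_dim (forms (s + e) :: ('k, 'n) mpoly set)"
    by (rule dim_image_mult[OF assms(4) order_refl subspace_forms])
  moreover have "k_dim ((\<lambda>p. x * y * p) ` forms s) = k_dim (forms s :: ('k, 'n) mpoly set)"
    by (rule dim_image_mult[OF _ order_refl subspace_forms]) (use x0 assms(4) in simp)
  ultimately show ?thesis unfolding I int by simp
qed

text \<open>The ideal is \<open>g\<close> times the ideal of \<open>x\<close> and \<open>y\<close>,
  plus the multiples of \<open>q\<close>. By the regularity of \<open>q\<close> modulo
  \<open>g\<close> and modulo \<open>x, y\<close>, the two parts meet in \<open>g * q\<close> times
  the ideal of \<open>x\<close> and \<open>y\<close>.\<close>

lemma (in koszul_frame) dim_ideal:
  fixes s :: nat
  assumes "e = 1"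
  shows "k_dim (ideal_forms (ideal_gen {y * g, x * g, q}) (s + 3)) + k_dim (ideal_forms (ideal_gen {x, y}) s)
       = k_dim (ideal_forms (ideal_gen {x, y}) (s + 2)) + k_dim (forms (s + 1) :: ('k, 'n) mpoly set)"
proof -
  let ?I = "ideal_gen {x, y}" and ?J = "ideal_gen {y * g, x * g, q}"
  let ?V = "(\<lambda>p. g * p) ` ideal_forms ?I (s + 2)" and ?W = "(\<lambda>p. q * p) ` forms (s + 1)"
  have hg': "homogeneous (int 1) g" and hq': "homogeneous (int 2) q" using hg hq assms by simp_all
  have q0: "q \<noteq> 0"
  proof
    assume "q = 0"
    then have "q * 1 \<in> ?I" using is_ideal_zero[OF is_ideal_ideal_gen] by simp
    then show False using q_xy one_notin by blast
  qed
  have V: "?V \<subseteq> forms (s + 3)" "?W \<subseteq> forms (s + 3)"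
    by (rule image_mult_forms[OF hg', of _ "s + 2"], blast, simp) (rule image_mult_forms[OF hq' order_refl], simp)
  have I: "{v + w | v w. v \<in> ?V \<and> w \<in> ?W} = ideal_forms ?J (s + 3)"
  proof
    show "{v + w | v w. v \<in> ?V \<and> w \<in> ?W} \<subseteq> ideal_forms ?J (s + 3)"
    proof
      fix p assume "p \<in> {v + w | v w. v \<in> ?V \<and> w \<in> ?W}"
      then obtain v w where p: "p = v + w" "v \<in> ?V" "w \<in> ?W" by blast
      then obtain i b where "v = g * i" "i \<in> ?I" "w = q * b" by blast
      moreover from this obtain c d where "i = c * x + d * y" unfolding ideal_gen_2 by blast
      ultimately have "p = d * (y * g) + c * (x * g) + b * q" using p(1) by (simp add: algebra_simps)
      moreover have "homogeneous (int (s + 3)) p" unfolding p(1) using p(2,3) V by (intro homogeneous_add) auto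
      ultimately show "p \<in> ideal_forms ?J (s + 3)" unfolding ideal_gen_3 by blast
    qed
    show "ideal_forms ?J (s + 3) \<subseteq> {v + w | v w. v \<in> ?V \<and> w \<in> ?W}"
    proof
      fix p assume "p \<in> ideal_forms ?J (s + 3)"
      then have p: "p \<in> ?J" "homogeneous (int (s + 3)) p" by auto
      obtain a b c where abc: "p = a * (y * g) + b * (x * g) + c * q"
        "homogeneous (int (s + 3) - 2) a" "homogeneous (int (s + 3) - 2) b" "homogeneous (int (s + 3) - 2) c"
        by (rule homogeneous_in_ideal3[OF p(2,1) homogeneous_gens hq])
      have deg: "int (s + 3) - 2 = int (s + 1)" by simp
      have "homogeneous (int (s + 2)) (b * x + a * y)"
        using homogeneous_mult[OF abc(3) hx] homogeneous_mult[OF abc(2) hy] assms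
        by (intro homogeneous_add) (simp_all add: algebra_simps)
      moreover have "b * x + a * y \<in> ?I" unfolding ideal_gen_2 by blast
      ultimately have "g * (b * x + a * y) \<in> ?V" by blast
      moreover have "q * c \<in> ?W" using abc(4) unfolding deg by blast
      moreover have "p = g * (b * x + a * y) + q * c" unfolding abc(1) by (simp add: algebra_simps)
      ultimately show "p \<in> {v + w | v w. v \<in> ?V \<and> w \<in> ?W}" by blast
    qed
  qed
  have int: "?V \<inter> ?W = (\<lambda>p. g * q * p) ` ideal_forms ?I s"
  proof
    show "?V \<inter> ?W \<subseteq> (\<lambda>p. g * q * p) ` ideal_forms ?I s"
    proof
      fix p assume "p \<in> ?V \<inter> ?W"
      then obtain i b where p: "p = g * i" "i \<in> ?I" "p = q * b" "homogeneous (int (s + 1)) b" by blast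
      have "q * b = i * g" using p by (simp add: mult.commute)
      then obtain v where v: "b = v * g" using q_g by blast
      have "g * i = g * (q * v)" using p v by (simp add: algebra_simps)
      then have i: "i = q * v" using mpoly_mult_cancel[OF g0] by blast
      then have "v \<in> ?I" using q_xy p(2) by blast
      moreover have "homogeneous (int (s + 1) - int 1) v"
        by (rule homogeneous_mult_cancel[OF hg' g0]) (use p(4) v in simp)
      ultimately have "v \<in> ideal_forms ?I s" by simp
      moreover have "p = g * q * v" using p(1) i by (simp add: algebra_simps)
      ultimately show "p \<in> (\<lambda>p. g * q * p) ` ideal_forms ?I s" by blast
    qed
    show "(\<lambda>p. g * q * p) ` ideal_forms ?I s \<subseteq> ?V \<inter> ?W"
    proof
      fix p assume "p \<in> (\<lambda>p. g * q * p) ` ideal_forms ?I s"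
      then obtain v where v: "p = g * q * v" "v \<in> ?I" "homogeneous (int s) v" by blast
      have "p = g * (q * v)" "p = q * (g * v)" using v(1) by (simp_all add: algebra_simps)
      moreover have "q * v \<in> ideal_forms ?I (s + 2)" "g * v \<in> forms (s + 1)"
        using homogeneous_mult_nat[OF v(3) hq'] homogeneous_mult_nat[OF v(3) hg']
          is_ideal_mult[OF is_ideal_ideal_gen v(2)] by simp_all
      ultimately show "p \<in> ?V \<inter> ?W" by blast
    qed
  qed
  have idI: "is_ideal ?I" by (rule is_ideal_ideal_gen)
  have "k_dim {v + w | v w. v \<in> ?V \<and> w \<in> ?W} + k_dim (?V \<inter> ?W) = k_dim ?V + k_dim ?W"
    by (intro dim_forms_sum[OF V] subspace_image_mult subspace_forms subspace_ideal_forms idI)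
  moreover have "k_dim ?V = k_dim (ideal_forms ?I (s + 2))"
    by (rule dim_image_mult[OF g0 _ subspace_ideal_forms[OF idI], of _ "s + 2"]) blast
  moreover have "k_dim ?W = k_dim (forms (s + 1) :: ('k, 'n) mpoly set)"
    by (rule dim_image_mult[OF q0 order_refl subspace_forms])
  moreover have "k_dim ((\<lambda>p. g * q * p) ` ideal_forms ?I s) = k_dim (ideal_forms ?I s)"
    by (rule dim_image_mult[OF _ _ subspace_ideal_forms[OF idI], of _ _ s]) (use g0 q0 in auto)
  ultimately show ?thesis unfolding I int by simp
qed

subsection \<open>Hilbert polynomials\<close>

fun binomial_poly :: "nat \<Rightarrow> rat poly" where
  "binomial_poly 0 = 1"
| "binomial_poly (Suc m) = smult (1 / of_nat (Suc m)) ([:of_nat (Suc m), 1:] * binomial_poly m)"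

lemma poly_binomial_poly: "poly (binomial_poly m) (of_nat t) = of_nat ((t + m) choose m)"
proof (induction m)
  case (Suc m)
  have "Suc m * ((t + Suc m) choose Suc m) = (t + Suc m) * ((t + m) choose m)"
    using Suc_times_binomial[of m "t + m"] by simp
  then have "(of_nat (Suc m) :: rat) * of_nat ((t + Suc m) choose Suc m) = of_nat (t + Suc m) * of_nat ((t + m) choose m)"
    by (metis of_nat_mult)
  moreover have "b = 1 / a * c" if "a * b = c" "a \<noteq> 0" for a b c :: rat using that by (auto simp: field_simps)
  moreover have "(of_nat (Suc m) :: rat) \<noteq> 0" by (simp del: of_nat_Suc)
  ultimately have *: "(of_nat ((t + Suc m) choose Suc m) :: rat) = 1 / of_nat (Suc m) * (of_nat (t + Suc m) * of_nat ((t + m) choose m))"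
    by blast
  have "poly [:of_nat (Suc m), 1:] (of_nat t) = (of_nat (t + Suc m) :: rat)" by simp
  then show ?case unfolding * binomial_poly.simps poly_smult poly_mult Suc by (simp only:)
qed simp

lemma degree_binomial_poly: "degree (binomial_poly m) = m" "lead_coeff (binomial_poly m) = 1 / fact m"
proof (induction m)
  case (Suc m)
  have ne: "binomial_poly m \<noteq> 0" using Suc(2) by (intro notI) simp
  have c: "(1 / of_nat (Suc m) :: rat) \<noteq> 0" by (simp del: of_nat_Suc)
  {
    case 1
    have "degree ([:of_nat (Suc m), 1:] * binomial_poly m) = Suc m"
      using ne Suc(1) by (subst degree_mult_eq) (simp_all del: of_nat_Suc)
    then show ?case using c by simp
  next
    case 2
    have "lead_coeff [:of_nat (Suc m), 1 :: rat:] = 1" by simp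
    then have "lead_coeff (binomial_poly (Suc m)) = 1 / of_nat (Suc m) * (1 * (1 / fact m))"
      unfolding binomial_poly.simps lead_coeff_smult lead_coeff_mult Suc(2) by (simp only:)
    then show ?case by (simp only: fact_Suc) (simp del: of_nat_Suc)
  }
qed simp_all

lemma hilbert_polynomial_eq:
  assumes "\<forall>\<^sub>F t in sequentially. poly P (of_nat t) = of_nat (hilbert_function I t)"
  shows "hilbert_polynomial I = P"
  unfolding hilbert_polynomial_def
proof (rule the_equality[where P = "\<lambda>P. \<forall>\<^sub>F t in sequentially. poly P (of_nat t) = of_nat (hilbert_function I t)", OF assms])
  fix Q :: "rat poly"
  assume "\<forall>\<^sub>F t in sequentially. poly Q (of_nat t) = of_nat (hilbert_function I t)"
  with assms have "\<forall>\<^sub>F t in sequentially. poly (Q - P) (of_nat t) = 0"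
    by eventually_elim simp
  then obtain N where N: "\<And>t. t \<ge> N \<Longrightarrow> poly (Q - P) (of_nat t) = 0"
    unfolding eventually_sequentially by blast
  show "Q = P"
  proof (rule ccontr)
    assume "Q \<noteq> P"
    then have fin: "finite {r. poly (Q - P) r = 0}" by (intro poly_roots_finite) simp
    have "(of_nat :: nat \<Rightarrow> rat) ` {N..} \<subseteq> {r. poly (Q - P) r = 0}" using N by auto
    then have "finite ((of_nat :: nat \<Rightarrow> rat) ` {N..})" using fin finite_subset by blast
    then have "finite {N..}" by (rule finite_imageD) (simp add: inj_on_def)
    then show False by (simp add: infinite_Ici)
  qed
qed

text \<open>The shifted binomials all have degree \<open>m\<close> and leading coefficient
  \<open>1 / fact m\<close>, so the multiplicity is the sum of their coefficients. Starting at
  \<open>k\<close> keeps the shifts nonnegative.\<close>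

lemma multiplicity_quotI:
  fixes I :: "('k::field, 'n::finite) mpoly set"
  assumes "\<And>s. (of_nat (hilbert_function I (s + k)) :: rat) =
      (\<Sum>j\<in>A. c j * of_nat ((s + j + m) choose m))" and "sum c A \<noteq> 0"
  shows "multiplicity_quot I = sum c A"
proof -
  define P where "P = (\<Sum>j\<in>A. smult (c j) (binomial_poly m \<circ>\<^sub>p [:of_nat j - of_nat k, 1:]))"
  have "poly P (of_nat t) = of_nat (hilbert_function I t)" if "t \<ge> k" for t
  proof -
    have "poly P (of_nat t) = (\<Sum>j\<in>A. c j * poly (binomial_poly m) (of_nat j - of_nat k + of_nat t))"
      by (simp add: P_def poly_sum poly_pcompose)
    also have "\<dots> = (\<Sum>j\<in>A. c j * of_nat ((t - k + j + m) choose m))"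
    proof (intro sum.cong refl)
      fix j
      have "(of_nat j - of_nat k + of_nat t :: rat) = of_nat (t - k + j)" using that by (simp add: of_nat_diff)
      then show "c j * poly (binomial_poly m) (of_nat j - of_nat k + of_nat t) = c j * of_nat ((t - k + j + m) choose m)"
        using poly_binomial_poly[of m "t - k + j"] by metis
    qed
    also have "\<dots> = of_nat (hilbert_function I t)" using assms(1)[of "t - k"] that by simp
    finally show ?thesis .
  qed
  then have hp: "hilbert_polynomial I = P"
    by (intro hilbert_polynomial_eq) (auto simp: eventually_sequentially)
  have deg: "degree (binomial_poly m \<circ>\<^sub>p [:a, 1:]) = m" and lc: "coeff (binomial_poly m \<circ>\<^sub>p [:a, 1:]) m = 1 / fact m" for a
  proof -
    show d: "degree (binomial_poly m \<circ>\<^sub>p [:a, 1:]) = m" by (simp add: degree_pcompose degree_binomial_poly)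
    have "lead_coeff (binomial_poly m \<circ>\<^sub>p [:a, 1:]) = 1 / fact m"
      by (subst lead_coeff_comp) (simp_all only: degree_binomial_poly(2), simp_all)
    then show "coeff (binomial_poly m \<circ>\<^sub>p [:a, 1:]) m = 1 / fact m" using d by simp
  qed
  have cm: "coeff P m = sum c A / fact m"
    by (simp add: P_def coeff_sum lc sum_divide_distrib)
  then have "coeff P m \<noteq> 0" using assms(2) by simp
  moreover have "degree P \<le> m" unfolding P_def
    by (cases "finite A") (auto intro!: degree_sum_le order_trans[OF degree_smult_le] simp: deg)
  ultimately have "degree P = m" "P \<noteq> 0" using le_degree le_antisym by force+
  then show ?thesis unfolding multiplicity_quot_def hp Let_def using cm by simp
qed

text \<open>Multiplication of the Hilbert series by \<open>(1 - z) ^ 2\<close>, which lowers the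
  number of variables from \<open>m + 3\<close> to \<open>m + 1\<close>.\<close>

lemma binomial_second_difference:
  "of_nat ((s + 2 + m + 2) choose (m + 2)) - 2 * of_nat ((s + 1 + m + 2) choose (m + 2)) + of_nat ((s + m + 2) choose (m + 2))
     = (of_nat ((s + 2 + m) choose m) :: rat)"
proof -
  have "(s + 2 + m + 2) choose (m + 2) = ((s + 1 + m + 2) choose (m + 1)) + ((s + 1 + m + 2) choose (m + 2))"
    "(s + 1 + m + 2) choose (m + 2) = ((s + m + 2) choose (m + 1)) + ((s + m + 2) choose (m + 2))"
    "(s + 1 + m + 2) choose (m + 1) = ((s + 2 + m) choose m) + ((s + m + 2) choose (m + 1))"
    by (simp_all add: add.commute)
  then show ?thesis by simp
qed

lemma hilbert_function_rat:
  fixes I :: "('k::field, 'n::finite) mpoly set"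
  assumes "is_ideal I"
  shows "(of_nat (hilbert_function I t) :: rat) =
    of_nat (k_dim (forms t :: ('k, 'n) mpoly set)) - of_nat (k_dim (ideal_forms I t))"
  unfolding hilbert_function_def using dim_ideal_forms_le[OF assms, of t] by (simp add: of_nat_diff)

lemma dim_forms_rat:
  assumes "CARD('n::finite) = m + 3"
  shows "k_dim (forms t :: ('k::field, 'n) mpoly set) = (t + m + 2) choose (m + 2)"
proof -
  have "t + CARD('n) - 1 = t + m + 2" using assms by simp
  moreover have "(t + m + 2) choose t = (t + m + 2) choose (m + 2)"
    using binomial_symmetric[of t "t + m + 2"] by simp
  ultimately show ?thesis unfolding dim_forms by simp
qed

lemma regular_pair_nonzero:
  fixes x y :: "('k::field, 'n::finite) mpoly"
  assumes "regular_pair x y" "Poly_Mapping.lookup x 0 = 0"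
  shows "y \<noteq> 0"
proof
  assume "y = 0"
  then have "y * 1 = 0 * x" by simp
  then obtain v where "1 = v * x" using assms(1) unfolding regular_pair_def by blast
  then have "Poly_Mapping.lookup (1 :: ('k, 'n) mpoly) 0 = Poly_Mapping.lookup (v * x) 0" by simp
  then show False using assms(2) by (simp add: lookup_mult_0)
qed

lemma dim_regular_pair_rat:
  fixes x y :: "('k::field, 'n::finite) mpoly"
  assumes n: "CARD('n) = m + 3" and reg: "regular_pair x y"
    and h: "homogeneous (int e) x" "homogeneous (int e) y" "1 \<le> e"
  shows "(of_nat (k_dim (ideal_forms (ideal_gen {x, y}) (s + 2 * e))) :: rat) =
    2 * of_nat ((s + e + m + 2) choose (m + 2)) - of_nat ((s + m + 2) choose (m + 2))"
proof -
  have "y \<noteq> 0" using regular_pair_nonzero[OF reg] homogeneous_lookup_0[OF h(1)] h(3) by simp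
  from arg_cong[OF dim_regular_pair[OF reg h(1,2) this, of s], of "of_nat :: nat \<Rightarrow> rat"]
  show ?thesis unfolding dim_forms_rat[OF n] by simp
qed

lemma multiplicity_linear_pair:
  fixes x y :: "('k::field, 'n::finite) mpoly"
  assumes n: "CARD('n) = m + 3" and reg: "regular_pair x y"
    and h: "homogeneous 1 x" "homogeneous 1 y"
  shows "multiplicity_quot (ideal_gen {x, y}) = 1"
proof -
  let ?c = "\<lambda>j. (1 :: rat)"
  have "multiplicity_quot (ideal_gen {x, y}) = sum ?c {2::nat}"
  proof (rule multiplicity_quotI)
    fix s
    show "of_nat (hilbert_function (ideal_gen {x, y}) (s + 2)) = (\<Sum>j\<in>{2::nat}. 1 * (of_nat ((s + j + m) choose m) :: rat))"
      using dim_regular_pair_rat[OF n reg, of 1 s] h binomial_second_difference[of s m]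
      unfolding hilbert_function_rat[OF is_ideal_ideal_gen] dim_forms_rat[OF n] by simp
  qed simp
  then show ?thesis by simp
qed

lemma multiplicity_quadric_pair:
  fixes x y :: "('k::field, 'n::finite) mpoly"
  assumes n: "CARD('n) = m + 3" and reg: "regular_pair x y"
    and h: "homogeneous 2 x" "homogeneous 2 y"
  shows "multiplicity_quot (ideal_gen {x, y}) = 4"
proof -
  \<comment> \<open>The Hilbert series has numerator
    \<open>(1 - z^2)^2 = (1 - z)^2 * (1 + 2z + z^2)\<close>. The last factor gives the coefficients
    1, 2, 1 at the shifts 4, 3, 2.\<close>
  let ?c = "\<lambda>j::nat. if j = 3 then 2 else (1 :: rat)"
  have "multiplicity_quot (ideal_gen {x, y}) = sum ?c {2, 3, 4}"
  proof (rule multiplicity_quotI)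
    fix s
    show "of_nat (hilbert_function (ideal_gen {x, y}) (s + 4)) = (\<Sum>j\<in>{2, 3, 4}. ?c j * (of_nat ((s + j + m) choose m) :: rat))"
      using dim_regular_pair_rat[OF n reg, of 2 s] h binomial_second_difference[of s m]
        binomial_second_difference[of "s + 1" m] binomial_second_difference[of "s + 2" m]
      unfolding hilbert_function_rat[OF is_ideal_ideal_gen] dim_forms_rat[OF n]
      by (simp add: eval_nat_numeral)
  qed simp
  then show ?thesis by simp
qed

lemma (in koszul_frame) multiplicity:
  assumes n: "CARD('n) = m + 3" and e1: "e = 1"
  shows "multiplicity_quot (ideal_gen {y * g, x * g, q}) = 2"
proof -
  \<comment> \<open>The twists 2, 2, 2 and 3, 4, 4 and 5 give the numerator
    \<open>1 - 3z^2 + z^3 + 2z^4 - z^5 = (1 - z)^2 * (1 + 2z - z^3)\<close>. The last factor is read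
    in degree \<open>s + 5\<close>, hence the coefficients 1, 2, -1 at the shifts 5, 4, 2.\<close>
  let ?c = "\<lambda>j::nat. if j = 2 then - 1 else if j = 4 then 2 else (1 :: rat)"
  have h: "homogeneous (int 1) x" "homogeneous (int 1) y" using hx hy e1 by simp_all
  have "multiplicity_quot (ideal_gen {y * g, x * g, q}) = sum ?c {2, 4, 5}"
  proof (rule multiplicity_quotI)
    fix s
    have "(of_nat (k_dim (ideal_forms (ideal_gen {y * g, x * g, q}) (s + 2 + 3))) :: rat)
        + of_nat (k_dim (ideal_forms (ideal_gen {x, y}) (s + 2)))
      = of_nat (k_dim (ideal_forms (ideal_gen {x, y}) (s + 2 + 2))) + of_nat (k_dim (forms (s + 2 + 1) :: ('k, 'n) mpoly set))"
      using arg_cong[OF dim_ideal[OF e1, of "s + 2"], of "of_nat :: nat \<Rightarrow> rat"] by simp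
    then show "of_nat (hilbert_function (ideal_gen {y * g, x * g, q}) (s + 5)) = (\<Sum>j\<in>{2, 4, 5}. ?c j * (of_nat ((s + j + m) choose m) :: rat))"
      using dim_regular_pair_rat[OF n reg h, of s] dim_regular_pair_rat[OF n reg h, of "s + 2"]
        binomial_second_difference[of s m] binomial_second_difference[of "s + 2" m] binomial_second_difference[of "s + 3" m]
      unfolding hilbert_function_rat[OF is_ideal_ideal_gen] dim_forms_rat[OF n]
      by (simp add: eval_nat_numeral)
  qed simp
  then show ?thesis by simp
qed

text \<open>All generators lie in the ideal of \<open>g\<close> and \<open>q\<close>. This is a
  regular pair, proper because \<open>g\<close> is a linear form when \<open>e = 1\<close>.\<close>

lemma (in koszul_frame) height_le_2:
  assumes "e = 1"
  shows "height (ideal_gen {y * g, x * g, q}) \<le> 2"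
proof -
  have "regular_pair g q" unfolding regular_pair_def using g0 q_g by blast
  moreover have "1 \<notin> ideal_gen {g, q}"
    by (rule one_notin_ideal_gen_pair[OF homogeneous_lookup_0[OF hg] const0(3)]) (use assms in simp)
  ultimately obtain P where P: "is_prime P" "ideal_gen {g, q} \<subseteq> P" "prime_height P \<le> 2"
    by (rule prime_over_regular_pair)
  have "ideal_gen {y * g, x * g, q} \<subseteq> ideal_gen {g, q}"
    using ideal_gen_superset[of "{g, q}"] is_ideal_mult[OF is_ideal_ideal_gen[of "{g, q}"]]
    by (intro ideal_gen_subset is_ideal_ideal_gen) auto
  then show ?thesis using height_le[OF P(1)] P(2,3) by (meson order_trans)
qed

text \<open>For \<open>e = 2\<close> the factor \<open>g\<close> is a nonzero constant, so a prime
  over the ideal contains the regular sequence \<open>x, y, q\<close>.\<close>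

lemma (in koszul_frame) height_ge_3:
  assumes "e = 2"
  shows "3 \<le> height (ideal_gen {y * g, x * g, q})"
proof (rule height_ge)
  fix P assume P: "is_prime P" "ideal_gen {y * g, x * g, q} \<subseteq> P"
  have hg0: "homogeneous 0 g" using hg assms by simp
  then obtain c where c: "g = cst c" using homogeneous_0_cst by blast
  have c0: "c \<noteq> 0" using g0 c by auto
  have mem: "y * g \<in> P" "x * g \<in> P" "q \<in> P" using P(2) ideal_gen_superset[of "{y * g, x * g, q}"] by auto
  have idP: "is_ideal P" using P(1) by (simp add: is_prime_iff)
  have "cst (inverse c) * (y * g) = y" "cst (inverse c) * (x * g) = x"
    using cst_inverse[OF c0] unfolding c by (simp_all add: mult.commute)
  then have xy: "x \<in> P" "y \<in> P" using is_ideal_mult[OF idP mem(1)] is_ideal_mult[OF idP mem(2)] by metis+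
  have "prime_chain 3 P"
  proof (rule prime_chain_3[OF P(1) xy mem(3) x0])
    show "\<exists>v. z = v * x" if "y * z = u * x" for z u using reg that unfolding regular_pair_def by blast
    fix z u v assume "q * z = u * x + v * y"
    then have "q * z \<in> ideal_gen {x, y}" unfolding ideal_gen_2 by blast
    then show "\<exists>u' v'. z = u' * x + v' * y" using q_xy unfolding ideal_gen_2 by blast
  qed
  then show "3 \<le> prime_height P" using prime_height_ge[of 3 P] by (simp add: numeral_eq_enat)
qed

subsection \<open>The shape of the resolution\<close>

lemma sum_lessThan_3_split:
  assumes "l < (3::nat)"
  obtains j k where "j < 3" "k < 3" "j \<noteq> k" "j \<noteq> l" "k \<noteq> l"
    "\<And>h :: nat \<Rightarrow> 'a::comm_monoid_add. (\<Sum>i<3. h i) = h l + h j + h k"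
proof -
  consider "l = 0" | "l = Suc 0" | "l = 2" using assms by linarith
  then show ?thesis
    by cases (rule that[of "Suc 0" 2] that[of 0 2] that[of 0 "Suc 0"]; simp add: sum_lessThan_3 ac_simps)+
qed

text \<open>The resolution in plain sums over indices below three. The degree of \<open>N j\<close>
  is the last twist minus \<open>2 + \<delta> j\<close>, and injectivity of the last map from a
  module of rank one is just the presence of a nonzero entry.\<close>

locale three_quadrics_resolution =
  fixes f :: "nat \<Rightarrow> ('k::field, 'n::finite) mpoly" and M :: "nat \<Rightarrow> nat \<Rightarrow> ('k, 'n) mpoly"
    and N :: "nat \<Rightarrow> ('k, 'n) mpoly" and \<delta> :: "nat \<Rightarrow> int"
  assumes f_hom: "\<And>i. i < 3 \<Longrightarrow> homogeneous 2 (f i)"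
    and M_hom: "\<And>i j. i < 3 \<Longrightarrow> j < 3 \<Longrightarrow> homogeneous (\<delta> j) (M i j)"
    and N_hom: "\<And>j. j < 3 \<Longrightarrow> homogeneous ((\<Sum>i<3. \<delta> i) - 2 - \<delta> j) (N j)"
    and exact1: "\<And>v. (\<Sum>i<3. f i * v i) = 0 \<longleftrightarrow> (\<exists>w. \<forall>i<3. v i = (\<Sum>j<3. M i j * w j))"
    and exact2: "\<And>w. (\<forall>i<3. (\<Sum>j<3. M i j * w j) = 0) \<longleftrightarrow> (\<exists>s. \<forall>j<3. w j = N j * s)"
    and inj: "\<exists>j<3. N j \<noteq> 0"
    and M_const: "\<And>i j. i < 3 \<Longrightarrow> j < 3 \<Longrightarrow> Poly_Mapping.lookup (M i j) 0 = 0"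
    and N_const: "\<And>j. j < 3 \<Longrightarrow> Poly_Mapping.lookup (N j) 0 = 0"
begin

lemma exact1D: "(\<Sum>i<3. f i * v i) = 0 \<Longrightarrow> \<exists>w. \<forall>i<3. v i = (\<Sum>j<3. M i j * w j)"
  by (rule exact1[THEN iffD1])

lemma exact2D: "(\<And>i. i < 3 \<Longrightarrow> (\<Sum>j<3. M i j * w j) = 0) \<Longrightarrow> \<exists>s. \<forall>j<3. w j = N j * s"
  by (rule exact2[THEN iffD1]) blast

lemma lookup_sum_M:
  assumes "i < 3"
  shows "Poly_Mapping.lookup (\<Sum>j<3. M i j * w j) 0 = 0"
  using assms by (simp add: lookup_sum lookup_mult_0 M_const)

text \<open>A constant relation would be a combination of the columns of \<open>M\<close>, whose
  entries have no constant term.\<close>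

lemma f_indep:
  assumes "(\<Sum>i<3. f i * cst (c i)) = 0" "i < 3"
  shows "c i = 0"
proof -
  obtain w where "\<forall>i<3. cst (c i) = (\<Sum>j<3. M i j * w j)" using exact1D[OF assms(1)] by blast
  then have "cst (c i) = (\<Sum>j<3. M i j * w j)" using assms(2) by blast
  then have "Poly_Mapping.lookup (cst (c i) :: ('k, 'n) mpoly) 0 = 0" using lookup_sum_M[OF assms(2), of w] by metis
  then show ?thesis by simp
qed

lemma k_indep3_f: "k_indep3 (f 0) (f (Suc 0)) (f 2)"
  unfolding k_indep3_def
proof (intro allI impI)
  fix a b c assume *: "cst a * f 0 + cst b * f (Suc 0) + cst c * f 2 = 0"
  let ?c = "\<lambda>i::nat. if i = 0 then a else if i = Suc 0 then b else c"
  have "(\<Sum>i<3. f i * cst (?c i)) = 0" unfolding sum_lessThan_3 using * by (simp add: algebra_simps)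
  from f_indep[OF this, of 0] f_indep[OF this, of "Suc 0"] f_indep[OF this, of 2]
  show "a = 0 \<and> b = 0 \<and> c = 0" by simp
qed

lemma f_nonzero:
  assumes "i < 3"
  shows "f i \<noteq> 0"
proof
  assume "f i = 0"
  then have "(\<Sum>j<3. f j * cst (if j = i then 1 else 0)) = 0" by (intro sum.neutral) auto
  from f_indep[OF this assms] show False by simp
qed

lemma column_syzygy: "j < 3 \<Longrightarrow> (\<Sum>i<3. f i * M i j) = 0"
  unfolding exact1 by (intro exI[of _ "\<lambda>l. if l = j then 1 else 0"]) (simp add: if_distrib cong: if_cong)

text \<open>A zero column puts a unit vector into the kernel, and by exactness its entry 1 would be
  a multiple of an entry of \<open>N\<close>, which has no constant term.\<close>

lemma column_nonzero:
  assumes "j < 3"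
  shows "\<exists>i<3. M i j \<noteq> 0"
proof (rule ccontr)
  assume *: "\<not> ?thesis"
  let ?w = "\<lambda>l. if l = j then 1 else 0"
  have "(\<Sum>l<3. M i l * ?w l) = 0" if "i < 3" for i
    using * assms that by (simp add: if_distrib cong: if_cong)
  then obtain s where "\<forall>l<3. ?w l = N l * s" using exact2D[of ?w] by blast
  then have "?w j = N j * s" using assms by blast
  then have "1 = N j * s" by simp
  then have "Poly_Mapping.lookup (1 :: ('k, 'n) mpoly) 0 = Poly_Mapping.lookup (N j * s) 0" by simp
  then show False using N_const[OF assms] by (simp add: lookup_mult_0)
qed

lemma N_relation: "i < 3 \<Longrightarrow> (\<Sum>j<3. M i j * N j) = 0"
proof -
  have "\<forall>i<3. (\<Sum>j<3. M i j * N j) = 0" unfolding exact2 by (intro exI[of _ 1]) simp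
  then show "i < 3 \<Longrightarrow> (\<Sum>j<3. M i j * N j) = 0" by blast
qed

text \<open>A relation between two of the columns would make both of them multiples of a third syzygy.\<close>

lemma N_nonzero:
  assumes l: "l < 3"
  shows "N l \<noteq> 0"
proof
  assume N0: "N l = 0"
  obtain j k where jk: "j < 3" "k < 3" "j \<noteq> k" "j \<noteq> l" "k \<noteq> l"
    and sp: "\<And>h :: nat \<Rightarrow> ('k, 'n) mpoly. (\<Sum>i<3. h i) = h l + h j + h k"
    using sum_lessThan_3_split[OF l, where 'a = "('k, 'n) mpoly"] by metis
  have rel: "M i j * N j = - (M i k * N k)" if "i < 3" for i
    using N_relation[OF that] unfolding sp N0 by (simp add: eq_neg_iff_add_eq_0)
  have all3: "i = l \<or> i = j \<or> i = k" if "i < 3" for i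
    using that l jk by linarith
  have Nk: "N k \<noteq> 0"
  proof
    assume "N k = 0"
    then have "N j \<noteq> 0" using inj N0 all3 by metis
    moreover have "\<forall>i<3. M i j * N j = 0" using rel \<open>N k = 0\<close> by simp
    ultimately show False using column_nonzero[OF jk(1)] by auto
  qed
  have Nj: "N j \<noteq> 0"
  proof
    assume "N j = 0"
    then have "\<forall>i<3. M i k * N k = 0" using rel by simp
    then show False using column_nonzero[OF jk(2)] Nk by auto
  qed
  have ex: "\<exists>s. M c k = N j * s" if c: "c < 3" for c
  proof -
    \<comment> \<open>The relation makes the columns \<open>j\<close> and \<open>k\<close>
      proportional, so this cross vector lies in the kernel of \<open>M\<close>. Exactness then
      makes every entry of column \<open>k\<close> divisible by \<open>N j\<close>.\<close>
    let ?w = "\<lambda>i. if i = j then M c k else if i = k then - M c j else 0"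
    have "(\<Sum>b<3. M i b * ?w b) = 0" if i: "i < 3" for i
    proof -
      have "(N j * N k) * (M i j * M c k - M i k * M c j) = (M i j * N j) * M c k * N k - (M c j * N j) * M i k * N k"
        by (simp add: algebra_simps)
      also have "\<dots> = 0" unfolding rel[OF i] rel[OF c] by (simp add: algebra_simps)
      finally have "M i j * M c k - M i k * M c j = 0" using Nj Nk by simp
      then show ?thesis unfolding sp using jk by simp
    qed
    then obtain s where "\<forall>b<3. ?w b = N b * s" using exact2D[of ?w] by blast
    then have "?w j = N j * s" using jk(1) by blast
    then show ?thesis by auto
  qed
  define s where "s c = (SOME s. M c k = N j * s)" for c
  have s: "M c k = N j * s c" if "c < 3" for c
    unfolding s_def using someI_ex[OF ex[OF that]] .
  have "N j * (\<Sum>c<3. f c * s c) = (\<Sum>c<3. f c * M c k)"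
    unfolding sum_distrib_left by (intro sum.cong refl) (simp add: s algebra_simps)
  also have "\<dots> = 0" by (rule column_syzygy[OF jk(2)])
  finally have "(\<Sum>c<3. f c * s c) = 0" using Nj by simp
  then obtain w where w: "\<forall>c<3. s c = (\<Sum>b<3. M c b * w b)" using exact1D by blast
  \<comment> \<open>Column \<open>k\<close> divided by \<open>N j\<close> is a syzygy, hence a
    combination of the columns with coefficients \<open>w\<close>. The resulting relation has entry
    \<open>N j * w k - 1\<close> at \<open>k\<close>, whose constant term -1 contradicts
    divisibility by \<open>N k\<close>.\<close>
  let ?u = "\<lambda>b. N j * w b - (if b = k then 1 else 0)"
  have "(\<Sum>b<3. M c b * ?u b) = 0" if c: "c < 3" for c
  proof -
    have "(\<Sum>b<3. M c b * ?u b) = N j * (\<Sum>b<3. M c b * w b) - (\<Sum>b<3. M c b * (if b = k then 1 else 0))"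
      by (simp add: right_diff_distrib sum_subtractf sum_distrib_left algebra_simps)
    also have "(\<Sum>b<3. M c b * (if b = k then 1 else 0)) = M c k"
      using jk(2) by (simp add: if_distrib cong: if_cong)
    finally show ?thesis using w s[OF c] c by simp
  qed
  then obtain t where "\<forall>b<3. ?u b = N b * t" using exact2D[of ?u] by blast
  then have "?u k = N k * t" using jk(2) by blast
  then have "N j * w k - 1 = N k * t" by simp
  then have "Poly_Mapping.lookup (N j * w k - 1) 0 = Poly_Mapping.lookup (N k * t) 0" by simp
  then show False using N_const jk by (simp add: lookup_minus lookup_mult_0)
qed

lemma graded_syzygy:
  assumes "(\<Sum>i<3. f i * v i) = 0" "\<forall>i<3. homogeneous d (v i)"
  shows "\<exists>w. (\<forall>j<3. homogeneous (d - \<delta> j) (w j)) \<and> (\<forall>i<3. v i = (\<Sum>j<3. M i j * w j))"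
proof -
  obtain w where w: "\<forall>i<3. v i = (\<Sum>j<3. M i j * w j)" using exact1D[OF assms(1)] by blast
  show ?thesis
  proof (intro exI[of _ "\<lambda>j. hcomp (d - \<delta> j) (w j)"] conjI allI impI homogeneous_hcomp)
    fix i :: nat assume i: "i < 3"
    have "v i = w 0 * M i 0 + w (Suc 0) * M i (Suc 0) + w 2 * M i 2"
      using w i by (simp add: sum_lessThan_3 mult.commute)
    then have "hcomp d (v i) = hcomp d (w 0 * M i 0 + w (Suc 0) * M i (Suc 0) + w 2 * M i 2)" by simp
    then have "v i = hcomp d (w 0 * M i 0 + w (Suc 0) * M i (Suc 0) + w 2 * M i 2)"
      using hcomp_homogeneous[of d "v i" d] assms(2) i by simp
    also have "\<dots> = (\<Sum>j<3. M i j * hcomp (d - \<delta> j) (w j))"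
      unfolding sum_lessThan_3 by (simp add: hcomp_add hcomp_mult[OF M_hom[OF i]] mult.commute)
    finally show "v i = (\<Sum>j<3. M i j * hcomp (d - \<delta> j) (w j))" .
  qed
qed

text \<open>\<open>koszul b\<close> is the cross product of the \<open>b\<close>-th unit vector with
  \<open>f\<close>: the Koszul relation between the other two forms, arranged as an alternating
  matrix.\<close>

definition koszul :: "nat \<Rightarrow> nat \<Rightarrow> ('k, 'n) mpoly" where
  "koszul b i = (if b = i then 0 else if b = 0 \<and> i = 1 then - f 2 else if b = 0 then f 1
     else if b = 1 \<and> i = 0 then f 2 else if b = 1 then - f 0 else if i = 0 then - f 1 else f 0)"

lemma koszul_syzygy: "b < 3 \<Longrightarrow> (\<Sum>i<3. f i * koszul b i) = 0"
proof -
  assume "b < 3"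
  then consider "b = 0" | "b = Suc 0" | "b = 2" by linarith
  then show ?thesis by cases (simp_all add: sum_lessThan_3 koszul_def algebra_simps)
qed

lemma koszul_alternating: "a < 3 \<Longrightarrow> b < 3 \<Longrightarrow> koszul a b = - koszul b a"
  by (auto simp: koszul_def numeral_3_eq_3 less_Suc_eq)

lemma koszul_nonzero: "a < 3 \<Longrightarrow> b < 3 \<Longrightarrow> a \<noteq> b \<Longrightarrow> koszul a b \<noteq> 0"
  using f_nonzero[of 0] f_nonzero[of 1] f_nonzero[of 2]
  by (auto simp: koszul_def numeral_3_eq_3 less_Suc_eq)

lemma koszul_hom: "b < 3 \<Longrightarrow> i < 3 \<Longrightarrow> homogeneous 2 (koszul b i)"
  using f_hom[of 0] f_hom[of 1] f_hom[of 2] by (simp add: koszul_def homogeneous_uminus)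

text \<open>In degree two only the first two columns could contribute, the second with constant
  coefficients. Eliminating it makes the vector of these constants proportional to the first column,
  hence a constant syzygy, hence zero in a suitable place. There a Koszul relation would be a
  multiple of the first column alone, which its zero diagonal entry rules out.\<close>

lemma delta_2:
  assumes "1 \<le> \<delta> 0" "2 \<le> \<delta> (Suc 0)" "3 \<le> \<delta> 2"
  shows False
proof -
  have ex: "\<exists>\<mu> c. \<forall>i<3. koszul b i = M i 0 * \<mu> + M i (Suc 0) * cst c" if b: "b < 3" for b
  proof -
    obtain w where "\<forall>j<3. homogeneous (2 - \<delta> j) (w j)" "\<forall>i<3. koszul b i = (\<Sum>j<3. M i j * w j)"
      using graded_syzygy[of "koszul b" 2] koszul_syzygy[OF b] koszul_hom[OF b] by blast
    then have w: "\<And>j. j < 3 \<Longrightarrow> homogeneous (2 - \<delta> j) (w j)" "\<And>i. i < 3 \<Longrightarrow> koszul b i = (\<Sum>j<3. M i j * w j)"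
      by blast+
    have "w 2 = 0" using homogeneous_neg[OF w(1)[of 2]] assms(3) by simp
    moreover have "\<exists>c. w (Suc 0) = cst c"
    proof (cases "\<delta> (Suc 0) = 2")
      case True
      then show ?thesis using homogeneous_0_cst[of "w (Suc 0)"] w(1)[of "Suc 0"] by auto
    next
      case False
      then have "w (Suc 0) = 0" using homogeneous_neg[OF w(1)[of "Suc 0"]] assms(2) by simp
      then show ?thesis by (intro exI[of _ 0]) simp
    qed
    then obtain c where "w (Suc 0) = cst c" by blast
    ultimately have "\<forall>i<3. koszul b i = M i 0 * w 0 + M i (Suc 0) * cst c"
      using w(2) unfolding sum_lessThan_3 by simp
    then show ?thesis by blast
  qed
  then obtain \<mu> where "\<forall>b<3. \<exists>c. \<forall>i<3. koszul b i = M i 0 * \<mu> b + M i (Suc 0) * cst c" by metis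
  then obtain c where K: "\<And>b i. b < 3 \<Longrightarrow> i < 3 \<Longrightarrow> koszul b i = M i 0 * \<mu> b + M i (Suc 0) * cst (c b)" by metis
  have prp: "cst (c a) * M b 0 = cst (c b) * M a 0" if ab: "a < 3" "b < 3" for a b
  proof (cases "a = b")
    case False
    let ?\<mu> = "cst (c a) * \<mu> b - cst (c b) * \<mu> a"
    have comb: "cst (c a) * koszul b i - cst (c b) * koszul a i = M i 0 * ?\<mu>" if "i < 3" for i
      unfolding K[OF ab(1) that] K[OF ab(2) that] by (simp add: algebra_simps)
    have aa: "koszul a a = 0" "koszul b b = 0" by (simp_all add: koszul_def)
    \<comment> \<open>At the entries \<open>a\<close> and \<open>b\<close> the diagonal Koszul
      entries vanish and the others differ by a sign, so the two instances of \<open>comb\<close>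
      cancel.\<close>
    have "?\<mu> * (cst (c a) * M b 0 - cst (c b) * M a 0) =
        cst (c a) * (cst (c a) * koszul b b - cst (c b) * koszul a b) - cst (c b) * (cst (c a) * koszul b a - cst (c b) * koszul a a)"
      unfolding comb[OF ab(2)] comb[OF ab(1)] by (simp add: algebra_simps)
    also have "\<dots> = 0" unfolding aa koszul_alternating[OF ab] by (simp add: algebra_simps)
    finally consider "?\<mu> = 0" | "cst (c a) * M b 0 - cst (c b) * M a 0 = 0" by auto
    then show ?thesis
    proof cases
      case 1
      have "cst (c a) * koszul b a = 0" "cst (c b) * koszul a b = 0"
        using comb[OF ab(1)] comb[OF ab(2)] unfolding 1 aa by simp_all
      then have "(cst (c a) :: ('k, 'n) mpoly) = 0" "(cst (c b) :: ('k, 'n) mpoly) = 0"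
        using koszul_nonzero[OF ab False] koszul_nonzero[OF ab(2,1)] False by auto
      then show ?thesis by simp
    qed simp
  qed simp
  obtain k where k: "k < 3" "M k 0 \<noteq> 0" using column_nonzero[of 0] by auto
  \<comment> \<open>By \<open>prp\<close>, the constants \<open>c\<close> times \<open>M k 0\<close>
    are \<open>c k\<close> times the first column, which is a syzygy.\<close>
  have "M k 0 * (\<Sum>i<3. f i * cst (c i)) = (\<Sum>i<3. f i * (cst (c i) * M k 0))"
    unfolding sum_distrib_left by (intro sum.cong refl) (simp add: algebra_simps)
  also have "\<dots> = (\<Sum>i<3. f i * (cst (c k) * M i 0))" by (intro sum.cong refl) (simp add: prp[OF _ k(1)])
  also have "\<dots> = cst (c k) * (\<Sum>i<3. f i * M i 0)"
    unfolding sum_distrib_left by (intro sum.cong refl) (simp add: algebra_simps)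
  also have "\<dots> = 0" using column_syzygy[of 0] by simp
  finally have "(\<Sum>i<3. f i * cst (c i)) = 0" using k(2) by simp
  then have "c k = 0" using f_indep k(1) by blast
  then have "koszul k k = M k 0 * \<mu> k" using K[OF k(1) k(1)] by simp
  then have "\<mu> k = 0" using k(2) by (simp add: koszul_def)
  then have "koszul k i = 0" if "i < 3" for i using K[OF k(1) that] \<open>c k = 0\<close> by simp
  then show False using koszul_nonzero[OF k(1), of 0] koszul_nonzero[OF k(1), of 1] by (cases "k = 0") auto
qed

text \<open>The third entry of the last map has degree
  \<open>\<delta> 0 + \<delta> (Suc 0) - 2 = 0\<close>, so minimality makes it zero, against
  \<open>N_nonzero\<close>.\<close>

lemma delta_1:
  assumes "\<delta> 0 = 1" "\<delta> (Suc 0) = 1"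
  shows False
proof -
  have "homogeneous 0 (N 2)" using N_hom[of 2] assms by (simp add: sum_lessThan_3)
  then have "N 2 = cst (Poly_Mapping.lookup (N 2) 0)" by (rule homogeneous_0_cst)
  then have "N 2 = 0" using N_const[of 2] by simp
  then show False using N_nonzero[of 2] by simp
qed

lemma deltas:
  assumes "1 \<le> \<delta> 0" "\<delta> 0 \<le> \<delta> (Suc 0)" "\<delta> (Suc 0) \<le> \<delta> 2"
  shows "\<delta> 0 \<in> {1, 2}" "\<delta> (Suc 0) = 2" "\<delta> 2 = 2"
proof -
  have "2 \<le> \<delta> (Suc 0)"
  proof (rule ccontr)
    assume "\<not> ?thesis"
    then have "\<delta> 0 = 1" "\<delta> (Suc 0) = 1" using assms by linarith+
    then show False by (rule delta_1)
  qed
  moreover have "\<delta> 2 \<le> 2"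
  proof (rule ccontr)
    assume "\<not> ?thesis"
    then have "3 \<le> \<delta> 2" by linarith
    with assms(1) calculation show False by (rule delta_2)
  qed
  ultimately show "\<delta> 0 \<in> {1, 2}" "\<delta> (Suc 0) = 2" "\<delta> 2 = 2" using assms by auto
qed

lemma linear_syzygy:
  assumes "\<delta> 0 = 1" "2 \<le> \<delta> (Suc 0)" "2 \<le> \<delta> 2"
    and "(\<Sum>i<3. f i * v i) = 0" "\<And>i. i < 3 \<Longrightarrow> homogeneous 1 (v i)"
  shows "\<exists>c. \<forall>i<3. v i = cst c * M i 0"
proof -
  obtain w where "\<forall>j<3. homogeneous (1 - \<delta> j) (w j)" and wv: "\<forall>i<3. v i = (\<Sum>j<3. M i j * w j)"
    using graded_syzygy[OF assms(4)] assms(5) by blast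
  then have w: "\<And>j. j < 3 \<Longrightarrow> homogeneous (1 - \<delta> j) (w j)" by blast
  have "w (Suc 0) = 0" "w 2 = 0"
    using homogeneous_neg[OF w(1)[of "Suc 0"]] homogeneous_neg[OF w(1)[of 2]] assms(2,3) by simp_all
  moreover obtain c where "w 0 = cst c" using homogeneous_0_cst[of "w 0"] w(1)[of 0] assms(1) by auto
  ultimately have "\<forall>i<3. v i = cst c * M i 0" using wv unfolding sum_lessThan_3 by (simp add: mult.commute)
  then show ?thesis by blast
qed

text \<open>The Koszul relations are constant combinations of the columns. Their linear independence
  makes the matrix of these constants invertible, so the columns, and with them all syzygies, are
  combinations of Koszul relations.\<close>

lemma koszul_exact:
  assumes d: "\<And>j. j < 3 \<Longrightarrow> \<delta> j = 2"
  shows "koszul_exact (f 0) (f (Suc 0)) (f 2)"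
proof -
  have ex: "\<exists>h. \<forall>i<3. koszul b i = (\<Sum>j<3. M i j * cst (h j))" if b: "b < 3" for b
  proof -
    obtain w where "\<forall>j<3. homogeneous (2 - \<delta> j) (w j)" "\<forall>i<3. koszul b i = (\<Sum>j<3. M i j * w j)"
      using graded_syzygy[of "koszul b" 2] koszul_syzygy[OF b] koszul_hom[OF b] by blast
    then have w: "\<And>j. j < 3 \<Longrightarrow> homogeneous (2 - \<delta> j) (w j)" "\<And>i. i < 3 \<Longrightarrow> koszul b i = (\<Sum>j<3. M i j * w j)"
      by blast+
    have "w j = cst (Poly_Mapping.lookup (w j) 0)" if "j < 3" for j
      using homogeneous_0_cst[of "w j"] w(1)[OF that] d[OF that] by simp
    then have "koszul b i = (\<Sum>j<3. M i j * cst (Poly_Mapping.lookup (w j) 0))" if "i < 3" for i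
      unfolding w(2)[OF that] by (intro sum.cong refl) simp
    then show ?thesis by (intro exI allI impI)
  qed
  define h where "h b = (SOME h. \<forall>i<3. koszul b i = (\<Sum>j<3. M i j * cst (h j)))" for b
  have h: "koszul b i = (\<Sum>j<3. M i j * cst (h b j))" if "b < 3" "i < 3" for b i
    using someI_ex[OF ex[OF that(1)]] that(2) unfolding h_def by blast
  let ?H = "mat 3 3 (\<lambda>(j, b). h b j)"
  have "det ?H \<noteq> 0"
  proof
    assume "det ?H = 0"
    then obtain v where v: "v \<in> carrier_vec 3" "v \<noteq> 0\<^sub>v 3" "?H *\<^sub>v v = 0\<^sub>v 3"
      using det_0_iff_vec_prod_zero_field[of ?H 3] by auto
    have hv: "(\<Sum>b<3. h b j * v $ b) = 0" if "j < 3" for j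
    proof -
      have "(?H *\<^sub>v v) $ j = 0\<^sub>v 3 $ j" using v(3) by simp
      then show ?thesis using that v(1) by (simp add: scalar_prod_def atLeast0LessThan)
    qed
    have kv: "(\<Sum>b<3. koszul b i * cst (v $ b)) = 0" if i: "i < 3" for i
    proof -
      have "(\<Sum>b<3. koszul b i * cst (v $ b)) = (\<Sum>b<3. \<Sum>j<3. M i j * cst (h b j * v $ b))"
        by (intro sum.cong refl) (simp add: h[OF _ i] sum_distrib_right mult.assoc mult_single)
      also have "\<dots> = (\<Sum>j<3. \<Sum>b<3. M i j * cst (h b j * v $ b))" by (rule sum.swap)
      also have "\<dots> = (\<Sum>j<3. M i j * cst (\<Sum>b<3. h b j * v $ b))"
        by (simp add: cst_sum sum_distrib_left)
      also have "\<dots> = 0" by (simp add: hv)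
      finally show ?thesis .
    qed
    \<comment> \<open>The first two entries of the combination already involve all three
      coefficients of \<open>v\<close>.\<close>
    have f1: "f 0 * cst 0 + f 1 * cst (- v $ 2) + f 2 * cst (v $ 1) = 0"
      using kv[of 0] by (simp add: sum_lessThan_3 koszul_def single_uminus)
    have f2: "f 0 * cst (v $ 2) + f 1 * cst 0 + f 2 * cst (- v $ 0) = 0"
      using kv[of 1] by (simp add: sum_lessThan_3 koszul_def single_uminus)
    have "v $ 2 = 0 \<and> v $ 1 = 0" using k_indep3_f f1 unfolding k_indep3_def
      by (metis mult.commute neg_equal_0_iff_equal One_nat_def)
    moreover have "v $ 0 = 0" using k_indep3_f f2 unfolding k_indep3_def
      by (metis mult.commute neg_equal_0_iff_equal One_nat_def)
    ultimately have "v = 0\<^sub>v 3" using v(1) by (intro eq_vec3I) simp_all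
    then show False using v(2) by simp
  qed
  then have "?H \<in> Units (ring_mat TYPE('k) 3 ())" by (intro det_non_zero_imp_unit) simp_all
  then obtain H' where H': "H' \<in> carrier_mat 3 3" "?H * H' = 1\<^sub>m 3"
    unfolding Units_def ring_mat_simps by blast
  have inv: "(\<Sum>b<3. h b l * H' $$ (b, j)) = (if l = j then 1 else 0)" if "l < 3" "j < 3" for l j
  proof -
    have "(?H * H') $$ (l, j) = 1\<^sub>m 3 $$ (l, j)" using H'(2) by simp
    then show ?thesis using that H'(1) by (simp add: scalar_prod_def atLeast0LessThan)
  qed
  have MK: "M i j = (\<Sum>b<3. koszul b i * cst (H' $$ (b, j)))" if ij: "i < 3" "j < 3" for i j
  proof -
    have "(\<Sum>b<3. koszul b i * cst (H' $$ (b, j))) = (\<Sum>b<3. \<Sum>l<3. M i l * cst (h b l * H' $$ (b, j)))"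
      by (intro sum.cong refl) (simp add: h[OF _ ij(1)] sum_distrib_right mult.assoc mult_single)
    also have "\<dots> = (\<Sum>l<3. \<Sum>b<3. M i l * cst (h b l * H' $$ (b, j)))" by (rule sum.swap)
    also have "\<dots> = (\<Sum>l<3. M i l * cst (\<Sum>b<3. h b l * H' $$ (b, j)))"
      by (simp add: cst_sum sum_distrib_left)
    also have "\<dots> = (\<Sum>l<3. if l = j then M i l else 0)" using ij(2) by (intro sum.cong refl) (simp add: inv)
    also have "\<dots> = M i j" using ij(2) by simp
    finally show ?thesis by simp
  qed
  show ?thesis
    unfolding koszul_exact_def
  proof (intro allI impI)
    fix a b c assume rel: "f 0 * a + f (Suc 0) * b + f 2 * c = 0"
    let ?v = "\<lambda>i::nat. if i = 0 then a else if i = Suc 0 then b else c"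
    have "(\<Sum>i<3. f i * ?v i) = 0" using rel unfolding sum_lessThan_3 by simp
    then obtain w where w: "\<forall>i<3. ?v i = (\<Sum>j<3. M i j * w j)" using exact1D[of ?v] by blast
    define y where "y b = (\<Sum>j<3. cst (H' $$ (b, j)) * w j)" for b
    have vy: "?v i = (\<Sum>b<3. koszul b i * y b)" if i: "i < 3" for i
    proof -
      have "?v i = (\<Sum>j<3. \<Sum>b<3. koszul b i * (cst (H' $$ (b, j)) * w j))"
        using w i by (simp add: MK[OF i] sum_distrib_right mult.assoc)
      also have "\<dots> = (\<Sum>b<3. \<Sum>j<3. koszul b i * (cst (H' $$ (b, j)) * w j))" by (rule sum.swap)
      finally show ?thesis by (simp add: y_def sum_distrib_left)
    qed
    have "a = y 1 * f 2 - y 2 * f (Suc 0)" "b = y 2 * f 0 - y 0 * f 2" "c = y 0 * f (Suc 0) - y 1 * f 0"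
      using vy[of 0] vy[of "Suc 0"] vy[of 2] by (simp_all add: sum_lessThan_3 koszul_def algebra_simps)
    then show "\<exists>u v w. a = v * f 2 - w * f (Suc 0) \<and> b = w * f 0 - u * f 2 \<and> c = u * f (Suc 0) - v * f 0" by blast
  qed
qed

end

section \<open>From a linear syzygy to a Koszul frame\<close>

lemma ideal_gen_shear3: "ideal_gen {f1 - s * f3, f2 - t * f3, f3} = ideal_gen {f1, f2, f3}"
  for f1 f2 f3 :: "'a::comm_ring_1"
proof
  have "f1 \<in> ideal_gen {f1, f2, f3}" "f2 \<in> ideal_gen {f1, f2, f3}" "f3 \<in> ideal_gen {f1, f2, f3}"
    using ideal_gen_superset[of "{f1, f2, f3}"] by simp_all
  then show "ideal_gen {f1 - s * f3, f2 - t * f3, f3} \<subseteq> ideal_gen {f1, f2, f3}"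
    by (intro ideal_gen_subset is_ideal_ideal_gen) (auto intro!: is_ideal_diff is_ideal_mult is_ideal_ideal_gen)
  let ?I = "ideal_gen {f1 - s * f3, f2 - t * f3, f3}"
  have m: "f1 - s * f3 \<in> ?I" "f2 - t * f3 \<in> ?I" "f3 \<in> ?I"
    using ideal_gen_superset[of "{f1 - s * f3, f2 - t * f3, f3}"] by simp_all
  have "f1 - s * f3 + s * f3 \<in> ?I" "f2 - t * f3 + t * f3 \<in> ?I"
    by (intro is_ideal_add is_ideal_mult is_ideal_ideal_gen m)+
  then have "f1 \<in> ?I" "f2 \<in> ?I" by simp_all
  then show "ideal_gen {f1, f2, f3} \<subseteq> ?I"
    using m by (intro ideal_gen_subset is_ideal_ideal_gen) simp
qed

text \<open>Eliminating \<open>v3\<close> leaves \<open>h1 * v1 + h2 * v2 = 0\<close> with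
  independent linear forms \<open>v1\<close> and \<open>v2\<close>, so
  \<open>h1 = v2 * \<gamma>\<close> and \<open>h2 = - v1 * \<gamma>\<close>. The two regularity
  conditions on \<open>f3\<close> hold because a failure of either would produce a second linear
  syzygy.\<close>

lemma frame_of_linear_syzygy_third:
  fixes f1 f2 f3 v1 v2 v3 :: "('k::field, 'n::finite) mpoly"
  assumes f: "homogeneous 2 f1" "homogeneous 2 f2" "homogeneous 2 f3" and ind: "k_indep3 f1 f2 f3"
    and v: "homogeneous 1 v1" "homogeneous 1 v2" "homogeneous 1 v3" "f1 * v1 + f2 * v2 + f3 * v3 = 0"
    and nz: "v1 \<noteq> 0 \<or> v2 \<noteq> 0 \<or> v3 \<noteq> 0"
    and uniq: "\<And>a b c. homogeneous 1 a \<Longrightarrow> homogeneous 1 b \<Longrightarrow> homogeneous 1 c \<Longrightarrow> f1 * a + f2 * b + f3 * c = 0 \<Longrightarrow>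
      \<exists>k. a = cst k * v1 \<and> b = cst k * v2 \<and> c = cst k * v3"
    and v3: "v3 = - (cst s * v1) - cst t * v2"
  shows "\<exists>x y g q. koszul_frame x y g q 1 \<and> ideal_gen {y * g, x * g, q} = ideal_gen {f1, f2, f3}"
proof -
  define h1 where "h1 = f1 - cst s * f3"
  define h2 where "h2 = f2 - cst t * f3"
  have rel: "h1 * v1 + h2 * v2 = 0" using v(4) unfolding h1_def h2_def v3 by (simp add: algebra_simps)
  have hh: "homogeneous 2 h1" "homogeneous 2 h2" unfolding h1_def h2_def
    by (intro homogeneous_diff homogeneous_cst_mult f)+
  have hind: "a = 0 \<and> b = 0" if "cst a * h1 + cst b * h2 = 0" for a b
  proof -
    have "cst a * f1 + cst b * f2 + cst (- a * s - b * t) * f3 = 0"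
      using that unfolding h1_def h2_def by (simp add: algebra_simps single_diff single_uminus mult_single flip: mult.assoc)
    then show ?thesis using ind unfolding k_indep3_def by blast
  qed
  have indv: "a = 0 \<and> b = 0" if "cst a * v1 + cst b * v2 = 0" for a b
  proof -
    \<comment> \<open>A relation between \<open>v1\<close> and \<open>v2\<close> with constants
      \<open>a\<close>, \<open>b\<close> makes this combination of \<open>h1\<close> and
      \<open>h2\<close>, with the constants crossed, vanish after multiplication by
      \<open>v1\<close> and by \<open>v2\<close>.\<close>
    let ?d = "cst b * h1 + cst (- a) * h2"
    have "v1 * ?d = cst b * (h1 * v1 + h2 * v2) - h2 * (cst a * v1 + cst b * v2)"
      "v2 * ?d = h1 * (cst a * v1 + cst b * v2) - cst a * (h1 * v1 + h2 * v2)"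
      by (simp_all add: single_uminus algebra_simps)
    then have "v1 * ?d = 0" "v2 * ?d = 0" unfolding that rel by simp_all
    moreover have "v1 \<noteq> 0 \<or> v2 \<noteq> 0" using nz unfolding v3 by auto
    ultimately have "?d = 0" by auto
    then show ?thesis using hind[of b "- a"] by simp
  qed
  interpret lp: linear_pair "- v1" v2
  proof
    show "homogeneous 1 (- v1)" "homogeneous 1 v2" using v by (simp_all add: homogeneous_uminus)
    show "a = 0 \<and> b = 0" if "cst a * - v1 + cst b * v2 = 0" for a b
      using indv[of "- a" b] that by (simp add: single_uminus)
  qed
  have v20: "v2 \<noteq> 0" using indv[of 0 1] by auto
  have "(- h1) * (- v1) + h2 * v2 = 0" using rel by simp
  then obtain \<gamma>' where "- h1 = \<gamma>' * v2" "h2 = - \<gamma>' * (- v1)" by (rule regular_pair_syzygy[OF lp.regular])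
  then obtain \<gamma> where \<gamma>: "h1 = v2 * \<gamma>" "h2 = - v1 * \<gamma>"
    by (intro that[of "- \<gamma>'"]) (simp_all add: mult.commute, metis add.inverse_inverse)
  have "homogeneous (2 - 1) \<gamma>"
    by (rule homogeneous_mult_cancel[OF v(2) v20]) (use hh(1) \<gamma>(1) in \<open>simp add: mult.commute\<close>)
  then have h\<gamma>: "homogeneous 1 \<gamma>" by simp
  have \<gamma>0: "\<gamma> \<noteq> 0" using hind[of 1 0] \<gamma> by auto
  have uniq': "\<exists>k. a = cst k * v1 \<and> b = cst k * v2 \<and> c - cst s * a - cst t * b = cst k * v3"
    if "homogeneous 1 a" "homogeneous 1 b" "homogeneous 1 c" "h1 * a + h2 * b + f3 * c = 0" for a b c
  proof (rule uniq)
    show "homogeneous 1 (c - cst s * a - cst t * b)" by (intro homogeneous_diff homogeneous_cst_mult that)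
    show "f1 * a + f2 * b + f3 * (c - cst s * a - cst t * b) = 0"
      using that(4) unfolding h1_def h2_def by (simp add: algebra_simps)
  qed (rule that)+
  have "koszul_frame (- v1) v2 \<gamma> f3 1"
  proof
    show "regular_pair (- v1) v2" by (rule lp.regular)
    show "\<gamma> \<noteq> 0" by (rule \<gamma>0)
    fix c
    {
      assume "f3 * c \<in> ideal_gen {- v1, v2}"
      moreover have "f3 \<notin> ideal_gen {- v1, v2}"
      proof
        assume "f3 \<in> ideal_gen {- v1, v2}"
        then obtain u0 w0 where uw0: "f3 = u0 * (- v1) + w0 * v2" unfolding ideal_gen_2 by blast
        define u where "u = hcomp 1 u0"
        define w where "w = hcomp 1 w0"
        have "hcomp 2 f3 = hcomp 2 (u0 * (- v1) + w0 * v2)" using uw0 by simp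
        then have f3: "f3 = u * (- v1) + w * v2"
          unfolding u_def w_def hcomp_add hcomp_mult[OF lp.x] hcomp_mult[OF lp.y] by (simp add: hcomp_homogeneous[OF f(3)])
        have huw: "homogeneous 1 w" "homogeneous 1 u" unfolding u_def w_def by (rule homogeneous_hcomp)+
        have hm\<gamma>: "homogeneous 1 (- \<gamma>)" using h\<gamma> by (simp add: homogeneous_uminus)
        \<comment> \<open>In the sheared generators the given syzygy is \<open>(v1, v2, 0)\<close>.
          By uniqueness the third entry \<open>- \<gamma>\<close> of this new one must
          vanish.\<close>
        have "h1 * w + h2 * u + f3 * (- \<gamma>) = 0" unfolding \<gamma> f3 by (simp add: algebra_simps)
        from uniq'[OF huw hm\<gamma> this]
        obtain k where k: "w = cst k * v1" "u = cst k * v2" "- \<gamma> - cst s * w - cst t * u = cst k * v3"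
          by (elim exE conjE) (rule that)
        have "\<gamma> = - (cst k * v3) - cst s * w - cst t * u" unfolding k(3)[symmetric] by simp
        also have "\<dots> = 0" unfolding k(1,2) v3 by (simp add: algebra_simps)
        finally show False using \<gamma>0 by simp
      qed
      ultimately show "c \<in> ideal_gen {- v1, v2}" using lp.prime by blast
    next
      fix u assume "f3 * c = u * \<gamma>"
      then consider v where "f3 = v * \<gamma>" | v where "c = v * \<gamma>" using linear_form_prime[OF h\<gamma> \<gamma>0] by blast
      then show "\<exists>v. c = v * \<gamma>"
      proof cases
        case (1 l)
        have "homogeneous (2 - 1) l" by (rule homogeneous_mult_cancel[OF h\<gamma> \<gamma>0]) (use f(3) 1 in simp)
        then have hl: "homogeneous 1 l" by simp
        have h0: "homogeneous 1 (0 :: ('k, 'n) mpoly)" by simp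
        have hv: "homogeneous 1 (- v2)" using v(2) by (simp add: homogeneous_uminus)
        \<comment> \<open>If \<open>f3\<close> is a multiple of \<open>\<gamma>\<close>, this linear
          syzygy has third entry \<open>- v2\<close>, which uniqueness again forces to be
          zero.\<close>
        have "h1 * l + h2 * 0 + f3 * (- v2) = 0" unfolding \<gamma> 1 by (simp add: algebra_simps)
        from uniq'[OF hl h0 hv this]
        obtain k where k: "l = cst k * v1" "0 = cst k * v2" "- v2 - cst s * l - cst t * 0 = cst k * v3"
          by (elim exE conjE) (rule that)
        have "cst k = (0 :: ('k, 'n) mpoly)" using k(2) v20 by simp
        then have "v2 = 0" using k(1,3) by simp
        then show ?thesis using v20 by blast
      qed blast
    }
  qed (use v f h\<gamma> in \<open>simp_all add: homogeneous_uminus\<close>)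
  moreover have "ideal_gen {v2 * \<gamma>, - v1 * \<gamma>, f3} = ideal_gen {f1, f2, f3}"
    unfolding \<gamma>[symmetric] h1_def h2_def by (rule ideal_gen_shear3)
  ultimately show ?thesis by blast
qed

text \<open>For independent entries the ideal of \<open>v1\<close> and \<open>v2\<close> is prime
  and misses \<open>v3\<close>, so it contains \<open>f3\<close>. Solving for all three generators
  with linear coefficients exhibits the second linear syzygy
  \<open>(-\<beta>, \<alpha>, \<gamma>)\<close>; being proportional to the first, it makes
  \<open>f3\<close> zero. So the entries are dependent, and a rotation puts a dependent one in third
  place.\<close>

lemma frame_of_linear_syzygy:
  fixes f1 f2 f3 v1 v2 v3 :: "('k::field, 'n::finite) mpoly"
  assumes f: "homogeneous 2 f1" "homogeneous 2 f2" "homogeneous 2 f3" and ind: "k_indep3 f1 f2 f3"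
    and v: "homogeneous 1 v1" "homogeneous 1 v2" "homogeneous 1 v3" "f1 * v1 + f2 * v2 + f3 * v3 = 0"
    and nz: "v1 \<noteq> 0 \<or> v2 \<noteq> 0 \<or> v3 \<noteq> 0"
    and uniq: "\<And>a b c. homogeneous 1 a \<Longrightarrow> homogeneous 1 b \<Longrightarrow> homogeneous 1 c \<Longrightarrow> f1 * a + f2 * b + f3 * c = 0 \<Longrightarrow>
      \<exists>k. a = cst k * v1 \<and> b = cst k * v2 \<and> c = cst k * v3"
  obtains x y g q where "koszul_frame x y g q 1" "ideal_gen {y * g, x * g, q} = ideal_gen {f1, f2, f3}"
proof -
  have "\<exists>a b c. (a \<noteq> 0 \<or> b \<noteq> 0 \<or> c \<noteq> 0) \<and> cst a * v1 + cst b * v2 + cst c * v3 = 0"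
  proof (rule ccontr)
    assume "\<not> ?thesis"
    then have vi: "a = 0 \<and> b = 0 \<and> c = 0" if "cst a * v1 + cst b * v2 + cst c * v3 = 0" for a b c
      using that by blast
    interpret lp: linear_pair v1 v2
    proof
      show "a = 0 \<and> b = 0" if "cst a * v1 + cst b * v2 = 0" for a b using vi[of a b 0] that by simp
    qed (rule v)+
    have v20: "v2 \<noteq> 0" using vi[of 0 1 0] by auto
    have "f3 * v3 = (- f1) * v1 + (- f2) * v2" using v(4) by (simp add: eq_neg_iff_add_eq_0 algebra_simps)
    then have "f3 * v3 \<in> ideal_gen {v1, v2}" unfolding ideal_gen_2 by blast
    moreover have "v3 \<notin> ideal_gen {v1, v2}"
    proof
      assume "v3 \<in> ideal_gen {v1, v2}"
      then have "v3 \<in> ideal_gen {v1, v2, v2}" by simp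
      then obtain a b c where "v3 = cst a * v1 + cst b * v2 + cst c * v2"
        using homogeneous_in_ideal3_same[OF v(3) _ v(1,2,2)] by blast
      then have "cst a * v1 + cst (b + c) * v2 + cst (- 1) * v3 = 0" by (simp add: single_add single_uminus algebra_simps)
      then show False using vi[of a "b + c" "- 1"] by simp
    qed
    ultimately have "f3 \<in> ideal_gen {v1, v2}" using lp.prime by blast
    then obtain \<alpha>0 \<beta>0 where ab0: "f3 = \<alpha>0 * v1 + \<beta>0 * v2" unfolding ideal_gen_2 by blast
    define \<alpha> where "\<alpha> = hcomp 1 \<alpha>0"
    define \<beta> where "\<beta> = hcomp 1 \<beta>0"
    have "hcomp 2 f3 = hcomp 2 (\<alpha>0 * v1 + \<beta>0 * v2)" using ab0 by simp
    then have f3: "f3 = \<alpha> * v1 + \<beta> * v2"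
      unfolding \<alpha>_def \<beta>_def hcomp_add hcomp_mult[OF v(1)] hcomp_mult[OF v(2)] by (simp add: hcomp_homogeneous[OF f(3)])
    have "(f1 + \<alpha> * v3) * v1 + (f2 + \<beta> * v3) * v2 = 0" using v(4) unfolding f3 by (simp add: algebra_simps)
    then obtain \<gamma> where \<gamma>: "f1 + \<alpha> * v3 = \<gamma> * v2" "f2 + \<beta> * v3 = - \<gamma> * v1"
      by (rule regular_pair_syzygy[OF lp.regular])
    have hab: "homogeneous 1 \<alpha>" "homogeneous 1 \<beta>" by (simp_all add: \<alpha>_def \<beta>_def)
    have "homogeneous 2 (f1 + \<alpha> * v3)" using homogeneous_mult[OF hab(1) v(3)] f(1) by (intro homogeneous_add) simp_all
    then have "homogeneous (2 - 1) \<gamma>" unfolding \<gamma>(1) by (rule homogeneous_mult_cancel[OF v(2) v20])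
    then have h\<gamma>: "homogeneous 1 \<gamma>" by simp
    have f12: "f1 = \<gamma> * v2 - \<alpha> * v3" "f2 = - \<gamma> * v1 - \<beta> * v3" using \<gamma> by (metis add_diff_cancel_right')+
    have "f1 * (- \<beta>) + f2 * \<alpha> + f3 * \<gamma> = 0" unfolding f12 f3 by (simp add: algebra_simps)
    moreover have "homogeneous 1 (- \<beta>)" using hab by (simp add: homogeneous_uminus)
    ultimately have "\<exists>k. - \<beta> = cst k * v1 \<and> \<alpha> = cst k * v2 \<and> \<gamma> = cst k * v3" using uniq hab(1) h\<gamma> by blast
    then obtain k where k: "- \<beta> = cst k * v1" "\<alpha> = cst k * v2" by (elim exE conjE) (rule that)
    have "\<beta> = - (cst k * v1)" unfolding k(1)[symmetric] by simp
    then have "f3 = 0" unfolding f3 k(2) by (simp add: algebra_simps)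
    then have "cst 0 * f1 + cst 0 * f2 + cst 1 * f3 = 0" by simp
    then show False using ind unfolding k_indep3_def by (metis one_neq_zero)
  qed
  then obtain a b c where abc: "a \<noteq> 0 \<or> b \<noteq> 0 \<or> c \<noteq> 0" "cst a * v1 + cst b * v2 + cst c * v3 = 0" by blast
  have solve: "z = - (cst (p / r) * x) - cst (q / r) * y" if "cst p * x + cst q * y + cst r * z = 0" "r \<noteq> 0"
    for p q r and x y z :: "('k, 'n) mpoly"
  proof -
    have "cst r * z = - (cst p * x) - cst q * y" using that(1) by (simp add: eq_neg_iff_add_eq_0 algebra_simps)
    then have "z = cst (inverse r) * (- (cst p * x) - cst q * y)" using cst_inverse[OF that(2), of z] by metis
    also have "\<dots> = - (cst (p / r) * x) - cst (q / r) * y"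
      by (simp add: right_diff_distrib mult_single divide_inverse mult.commute[of "inverse r"] flip: mult.assoc)
    finally show ?thesis .
  qed
  consider "c \<noteq> 0" | "a \<noteq> 0" | "b \<noteq> 0" using abc(1) by blast
  then have "\<exists>x y g q. koszul_frame x y g q 1 \<and> ideal_gen {y * g, x * g, q} = ideal_gen {f1, f2, f3}"
  proof cases
    case 1
    show ?thesis
      by (rule frame_of_linear_syzygy_third[OF f ind v nz uniq solve[OF abc(2) 1]])
  next
    case 2
    have "\<exists>x y g q. koszul_frame x y g q 1 \<and> ideal_gen {y * g, x * g, q} = ideal_gen {f2, f3, f1}"
    proof (rule frame_of_linear_syzygy_third[OF f(2,3,1) k_indep3_rotate[OF ind] v(2,3,1)])
      show "f2 * v2 + f3 * v3 + f1 * v1 = 0" using v(4) by (simp add: algebra_simps)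
      show "v2 \<noteq> 0 \<or> v3 \<noteq> 0 \<or> v1 \<noteq> 0" using nz by blast
      show "v1 = - (cst (b / a) * v2) - cst (c / a) * v3"
        by (rule solve[OF _ 2]) (use abc(2) in \<open>simp add: algebra_simps\<close>)
      fix x y z assume h: "homogeneous 1 x" "homogeneous 1 y" "homogeneous 1 z" "f2 * x + f3 * y + f1 * z = 0"
      have "f1 * z + f2 * x + f3 * y = 0" using h(4) by (simp add: algebra_simps)
      from uniq[OF h(3,1,2) this] show "\<exists>k. x = cst k * v2 \<and> y = cst k * v3 \<and> z = cst k * v1" by blast
    qed
    moreover have "{f2, f3, f1} = {f1, f2, f3}" by blast
    ultimately show ?thesis by simp
  next
    case 3
    have "\<exists>x y g q. koszul_frame x y g q 1 \<and> ideal_gen {y * g, x * g, q} = ideal_gen {f3, f1, f2}"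
    proof (rule frame_of_linear_syzygy_third[OF f(3,1,2) k_indep3_rotate[OF k_indep3_rotate[OF ind]] v(3,1,2)])
      show "f3 * v3 + f1 * v1 + f2 * v2 = 0" using v(4) by (simp add: algebra_simps)
      show "v3 \<noteq> 0 \<or> v1 \<noteq> 0 \<or> v2 \<noteq> 0" using nz by blast
      show "v2 = - (cst (c / b) * v3) - cst (a / b) * v1"
        by (rule solve[OF _ 3]) (use abc(2) in \<open>simp add: algebra_simps\<close>)
      fix x y z assume h: "homogeneous 1 x" "homogeneous 1 y" "homogeneous 1 z" "f3 * x + f1 * y + f2 * z = 0"
      have "f1 * y + f2 * z + f3 * x = 0" using h(4) by (simp add: algebra_simps)
      from uniq[OF h(2,3,1) this] show "\<exists>k. x = cst k * v3 \<and> y = cst k * v1 \<and> z = cst k * v2" by blast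
    qed
    moreover have "{f3, f1, f2} = {f1, f2, f3}" by blast
    ultimately show ?thesis by simp
  qed
  then show ?thesis using that by blast
qed

subsection \<open>Resolutions\<close>

lemma mult_mat_vec_sum:
  assumes "A \<in> carrier_mat r c" "v \<in> carrier_vec c" "i < r"
  shows "(A *\<^sub>v v) $ i = (\<Sum>j<c. A $$ (i, j) * v $ j)"
  using assms by (simp add: scalar_prod_def atLeast0LessThan)

text \<open>Projectivity of free modules, applied column by column.\<close>

lemma image_lift:
  assumes C: "C \<in> carrier_mat r c" and Y: "Y \<in> carrier_mat r n"
    and img: "\<And>j. j < n \<Longrightarrow> col Y j \<in> mat_image C"
  obtains Z where "Z \<in> carrier_mat c n" "Y = C * Z"
proof -
  have "\<exists>z. z \<in> carrier_vec c \<and> col Y j = C *\<^sub>v z" if "j < n" for j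
    using img[OF that] C unfolding mat_image_def by auto
  then obtain z where z: "\<And>j. j < n \<Longrightarrow> z j \<in> carrier_vec c \<and> col Y j = C *\<^sub>v z j" by metis
  let ?Z = "mat c n (\<lambda>(i, j). z j $ i)"
  have "Y = C * ?Z"
  proof (rule eq_matI)
    fix i j assume ij: "i < dim_row (C * ?Z)" "j < dim_col (C * ?Z)"
    then have ij: "i < r" "j < n" using C by auto
    have "col ?Z j = z j" using z[OF ij(2)] ij(2) by (intro eq_vecI) auto
    then have "(C * ?Z) $$ (i, j) = (C *\<^sub>v z j) $ i" using ij C by simp
    also have "\<dots> = col Y j $ i" using z[OF ij(2)] by simp
    finally show "Y $$ (i, j) = (C * ?Z) $$ (i, j)" using ij Y by simp
  qed (use C Y in auto)
  then show ?thesis using that[of ?Z] by simp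
qed

lemma exact_lift:
  assumes C: "C \<in> carrier_mat r c" and D: "D \<in> carrier_mat c d" and ex: "mat_kernel C = mat_image D"
    and Y: "Y \<in> carrier_mat c n" "C * Y = 0\<^sub>m r n"
  obtains Z where "Z \<in> carrier_mat d n" "Y = D * Z"
proof (rule image_lift[OF D Y(1)])
  fix j assume j: "j < n"
  have "C *\<^sub>v col Y j = col (C * Y) j" using j C Y(1) by (intro eq_vecI) auto
  also have "\<dots> = 0\<^sub>v r" unfolding Y(2) using j by (intro eq_vecI) auto
  finally show "col Y j \<in> mat_image D"
    unfolding ex[symmetric] using C Y(1) j by (intro mat_kernelI[OF C]) auto
qed

lemma exact_comp:
  assumes C: "C \<in> carrier_mat r c" and D: "D \<in> carrier_mat c d" and ex: "mat_kernel C = mat_image D"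
  shows "C * D = 0\<^sub>m r d"
proof (rule eq_matI)
  fix i j assume "i < dim_row (0\<^sub>m r d)" "j < dim_col (0\<^sub>m r d)"
  then have ij: "i < r" "j < d" by auto
  have "col D j = D *\<^sub>v unit_vec d j" using D ij(2) by (intro eq_vecI) auto
  then have "col D j \<in> mat_image D" unfolding mat_image_def using D by force
  then have "C *\<^sub>v col D j = 0\<^sub>v r" using ex mat_kernelD[OF C] by blast
  then have "(C *\<^sub>v col D j) $ i = 0\<^sub>v r $ i" by simp
  then show "(C * D) $$ (i, j) = 0\<^sub>m r d $$ (i, j)" using ij C D by simp
qed (use C D in auto)

text \<open>A chain homotopy equivalence with a shorter resolution would split the last map of the longer one, whose
  entries have no constant term.\<close>

lemma no_shorter_resolution:
  fixes D1 D2 D3 A B Z :: "('k::field, 'n::finite) mpoly mat"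
  assumes D: "D1 \<in> carrier_mat 1 r" "D2 \<in> carrier_mat r s" "D3 \<in> carrier_mat s 1"
    and exD: "mat_kernel D1 = mat_image D2" "mat_kernel D2 = mat_image D3"
    and B: "B \<in> carrier_mat 1 m" "A \<in> carrier_mat m n" "Z \<in> carrier_mat n 0"
    and exB: "mat_kernel B = mat_image A" "mat_kernel A = mat_image Z"
    and img: "mat_image B = mat_image D1"
    and const: "\<And>j. j < s \<Longrightarrow> Poly_Mapping.lookup (D3 $$ (j, 0)) 0 = 0"
    and nz: "j0 < s" "D3 $$ (j0, 0) \<noteq> 0"
  shows False
proof -
  have DD: "D1 * D2 = 0\<^sub>m 1 s" "D2 * D3 = 0\<^sub>m r 1" "B * A = 0\<^sub>m 1 n"
    by (rule exact_comp[OF D(1,2) exD(1)], rule exact_comp[OF D(2,3) exD(2)], rule exact_comp[OF B(1,2) exB(1)])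
  have col_in: "col C j \<in> mat_image C" if "C \<in> carrier_mat p q" "j < q" for C :: "('k, 'n) mpoly mat" and p q j
  proof -
    have "col C j = C *\<^sub>v unit_vec q j" using that by (intro eq_vecI) auto
    then show ?thesis unfolding mat_image_def using that by force
  qed
  \<comment> \<open>The matrices \<open>\<alpha>1\<close>, \<open>\<alpha>2\<close> and
    \<open>\<beta>1\<close>, \<open>\<beta>2\<close> are chain maps over the identity of the ideal,
    in both directions.\<close>
  obtain \<alpha>1 where a1: "\<alpha>1 \<in> carrier_mat m r" "D1 = B * \<alpha>1"
    by (rule image_lift[OF B(1) D(1)]) (use col_in[OF D(1)] img in auto)
  obtain \<beta>1 where b1: "\<beta>1 \<in> carrier_mat r m" "B = D1 * \<beta>1"
    by (rule image_lift[OF D(1) B(1)]) (use col_in[OF B(1)] img in auto)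
  have "B * (\<alpha>1 * D2) = D1 * D2" unfolding a1(2) using assoc_mult_mat[OF B(1) a1(1) D(2)] by simp
  then have "B * (\<alpha>1 * D2) = 0\<^sub>m 1 s" using DD by simp
  then obtain \<alpha>2 where a2: "\<alpha>2 \<in> carrier_mat n s" "\<alpha>1 * D2 = A * \<alpha>2"
    by (rule exact_lift[OF B(1,2) exB(1) mult_carrier_mat[OF a1(1) D(2)]]) (rule that)
  have "D1 * (\<beta>1 * A) = B * A" using assoc_mult_mat[OF D(1) b1(1) B(2)] b1(2) by simp
  then have "D1 * (\<beta>1 * A) = 0\<^sub>m 1 n" using DD by simp
  then obtain \<beta>2 where b2: "\<beta>2 \<in> carrier_mat s n" "\<beta>1 * A = D2 * \<beta>2"
    by (rule exact_lift[OF D(1,2) exD(1) mult_carrier_mat[OF b1(1) B(2)]]) (rule that)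
  have ba1: "\<beta>1 * \<alpha>1 \<in> carrier_mat r r" using a1(1) b1(1) by simp
  have "D1 * (\<beta>1 * \<alpha>1 - 1\<^sub>m r) = D1 * (\<beta>1 * \<alpha>1) - D1 * 1\<^sub>m r"
    by (rule mult_minus_distrib_mat[OF D(1) ba1 one_carrier_mat])
  also have "D1 * (\<beta>1 * \<alpha>1) = D1"
    unfolding assoc_mult_mat[OF D(1) b1(1) a1(1), symmetric] b1(2)[symmetric] a1(2)[symmetric] by (rule refl)
  also have "D1 - D1 * 1\<^sub>m r = 0\<^sub>m 1 r" using D(1) by simp
  finally have eq1: "D1 * (\<beta>1 * \<alpha>1 - 1\<^sub>m r) = 0\<^sub>m 1 r" .
  have car1: "\<beta>1 * \<alpha>1 - 1\<^sub>m r \<in> carrier_mat r r" by (rule minus_carrier_mat) simp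
  obtain h1 where h1: "h1 \<in> carrier_mat s r" "\<beta>1 * \<alpha>1 - 1\<^sub>m r = D2 * h1"
    by (rule exact_lift[OF D(1,2) exD(1) car1 eq1]) (rule that)
  \<comment> \<open>\<open>h1\<close> is the first part of a homotopy from the round trip to the
    identity. What it leaves over one step higher is killed by \<open>D2\<close> and hence factors
    through \<open>D3\<close>.\<close>
  define E where "E = \<beta>2 * \<alpha>2 - 1\<^sub>m s - h1 * D2"
  have ba2: "\<beta>2 * \<alpha>2 \<in> carrier_mat s s" and hd: "h1 * D2 \<in> carrier_mat s s" and ba21: "\<beta>2 * \<alpha>2 - 1\<^sub>m s \<in> carrier_mat s s"
    using a2 b2 h1(1) D by (simp_all add: minus_carrier_mat)
  have E: "E \<in> carrier_mat s s" unfolding E_def using hd by (rule minus_carrier_mat)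
  have "D2 * (\<beta>2 * \<alpha>2) = \<beta>1 * \<alpha>1 * D2"
  proof -
    have "D2 * (\<beta>2 * \<alpha>2) = \<beta>1 * A * \<alpha>2" unfolding b2(2) using assoc_mult_mat[OF D(2) b2(1) a2(1)] by simp
    also have "\<dots> = \<beta>1 * (\<alpha>1 * D2)" unfolding a2(2) by (rule assoc_mult_mat[OF b1(1) B(2) a2(1)])
    also have "\<dots> = \<beta>1 * \<alpha>1 * D2" using assoc_mult_mat[OF b1(1) a1(1) D(2)] by simp
    finally show ?thesis .
  qed
  moreover have "D2 * (h1 * D2) = \<beta>1 * \<alpha>1 * D2 - D2"
  proof -
    have "D2 * (h1 * D2) = (\<beta>1 * \<alpha>1 - 1\<^sub>m r) * D2" unfolding h1(2) using assoc_mult_mat[OF D(2) h1(1) D(2)] by simp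
    also have "\<dots> = \<beta>1 * \<alpha>1 * D2 - 1\<^sub>m r * D2" by (rule minus_mult_distrib_mat[OF ba1 one_carrier_mat D(2)])
    finally show ?thesis using D(2) by simp
  qed
  moreover have "D2 * E = D2 * (\<beta>2 * \<alpha>2) - D2 * 1\<^sub>m s - D2 * (h1 * D2)"
    unfolding E_def using mult_minus_distrib_mat[OF D(2) ba21 hd] mult_minus_distrib_mat[OF D(2) ba2 one_carrier_mat] by simp
  moreover have "\<beta>1 * \<alpha>1 * D2 - D2 * 1\<^sub>m s - (\<beta>1 * \<alpha>1 * D2 - D2) = 0\<^sub>m r s"
    using D(2) ba1 by (intro eq_matI) auto
  ultimately have "D2 * E = 0\<^sub>m r s" by simp
  then obtain h2 where h2: "h2 \<in> carrier_mat 1 s" "E = D3 * h2"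
    by (rule exact_lift[OF D(2,3) exD(2) E]) (rule that)
  have "A * (\<alpha>2 * D3) = \<alpha>1 * (D2 * D3)"
    using assoc_mult_mat[OF B(2) a2(1) D(3)] assoc_mult_mat[OF a1(1) D(2,3)] a2(2) by simp
  then have "A * (\<alpha>2 * D3) = 0\<^sub>m m 1" unfolding DD using a1(1) by simp
  then obtain W where W: "W \<in> carrier_mat 0 1" "\<alpha>2 * D3 = Z * W"
    by (rule exact_lift[OF B(2,3) exB(2) mult_carrier_mat[OF a2(1) D(3)]]) (rule that)
  \<comment> \<open>\<open>Z\<close> has no columns, so the round trip vanishes on the image of
    \<open>D3\<close>, and only \<open>- D3\<close> remains of \<open>E * D3\<close>.\<close>
  have "\<alpha>2 * D3 = 0\<^sub>m n 1" unfolding W(2) using W(1) B(3) by (intro eq_matI) (auto simp: scalar_prod_def)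
  then have "\<beta>2 * \<alpha>2 * D3 = 0\<^sub>m s 1" using assoc_mult_mat[OF b2(1) a2(1) D(3)] b2(1) by simp
  moreover have "h1 * D2 * D3 = 0\<^sub>m s 1" using assoc_mult_mat[OF h1(1) D(2,3)] h1(1) DD by simp
  moreover have "E * D3 = \<beta>2 * \<alpha>2 * D3 - 1\<^sub>m s * D3 - h1 * D2 * D3"
    unfolding E_def using minus_mult_distrib_mat[OF ba21 hd D(3)] minus_mult_distrib_mat[OF ba2 one_carrier_mat D(3)] by simp
  ultimately have E3: "E * D3 = 0\<^sub>m s 1 - D3 - 0\<^sub>m s 1" using D(3) by simp
  \<comment> \<open>\<open>D3 * h2 * D3 = - D3\<close> makes the scalar \<open>h2 * D3\<close> equal
    to -1, although all entries of \<open>D3\<close> lack a constant term.\<close>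
  define c where "c = (h2 * D3) $$ (0, 0)"
  have "(E * D3) $$ (j0, 0) = (D3 * (h2 * D3)) $$ (j0, 0)"
    unfolding h2(2) using assoc_mult_mat[OF D(3) h2(1) D(3)] by simp
  also have "\<dots> = D3 $$ (j0, 0) * c" using D(3) h2(1) nz(1) unfolding c_def by (simp add: scalar_prod_def)
  finally have "D3 $$ (j0, 0) * c = - D3 $$ (j0, 0)" unfolding E3 using nz(1) D(3) by simp
  then have "D3 $$ (j0, 0) * (c + 1) = 0" by (simp add: algebra_simps)
  then have c1: "c + 1 = 0" using nz(2) by simp
  have "c = (\<Sum>j<s. h2 $$ (0, j) * D3 $$ (j, 0))"
    unfolding c_def using D(3) h2(1) by (simp add: scalar_prod_def atLeast0LessThan)
  then have "Poly_Mapping.lookup c 0 = 0" by (simp add: lookup_sum lookup_mult_0 const)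
  then have "Poly_Mapping.lookup (c + 1) 0 = (1 :: 'k)" by (simp add: lookup_add)
  then show False unfolding c1 by simp
qed

text \<open>The least length is attained because a resolution exists. Length two would mean a third
  map without columns, the situation excluded by \<open>no_shorter_resolution\<close>.\<close>

lemma proj_dim_quot_neq_2:
  fixes J :: "('k::field, 'n::finite) mpoly set"
  assumes res: "graded_free_resolution J [F1, F2, [b]] \<phi>"
    and const: "\<And>j. j < length F2 \<Longrightarrow> Poly_Mapping.lookup (\<phi> 2 $$ (j, 0)) 0 = 0"
    and nz: "j0 < length F2" "\<phi> 2 $$ (j0, 0) \<noteq> 0"
  shows "proj_dim_quot J \<noteq> 2"
proof
  assume "proj_dim_quot J = 2"
  moreover have "\<exists>Fs \<psi>. length Fs = proj_dim_quot J \<and> graded_free_resolution J Fs \<psi>"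
    unfolding proj_dim_quot_def by (rule LeastI_ex) (use res in blast)
  ultimately obtain Fs \<psi> where Fs: "length Fs = 2" and psi: "graded_free_resolution J Fs \<psi>" by auto
  have carrier: "\<psi> i \<in> carrier_mat (length (res_module Gs i)) (length (res_module Gs (Suc i)))"
    if "graded_free_resolution J Gs \<psi>" for Gs i and \<psi> :: "nat \<Rightarrow> ('k, 'n) mpoly mat"
    using that unfolding graded_free_resolution_def graded_map_def by blast
  have ex: "mat_image (\<psi> 0) = {v \<in> carrier_vec 1. v $ 0 \<in> J}" "mat_kernel (\<psi> i) = mat_image (\<psi> (Suc i))"
    if "graded_free_resolution J Gs \<psi>" for Gs i and \<psi> :: "nat \<Rightarrow> ('k, 'n) mpoly mat"
    using that unfolding graded_free_resolution_def by blast+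
  show False
  proof (rule no_shorter_resolution[where ?D1.0 = "\<phi> 0" and ?D2.0 = "\<phi> 1" and ?D3.0 = "\<phi> 2" and B = "\<psi> 0" and A = "\<psi> 1" and Z = "\<psi> 2"])
    show "\<phi> 0 \<in> carrier_mat 1 (length F1)" "\<phi> 1 \<in> carrier_mat (length F1) (length F2)" "\<phi> 2 \<in> carrier_mat (length F2) 1"
      using carrier[OF res, of 0] carrier[OF res, of 1] carrier[OF res, of 2]
      by (simp_all add: res_module_def numeral_2_eq_2)
    show "\<psi> 0 \<in> carrier_mat 1 (length (res_module Fs 1))" "\<psi> 1 \<in> carrier_mat (length (res_module Fs 1)) (length (res_module Fs 2))"
      "\<psi> 2 \<in> carrier_mat (length (res_module Fs 2)) 0"
      using carrier[OF psi, of 0] carrier[OF psi, of 1] carrier[OF psi, of 2] Fs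
      by (simp_all add: res_module_def numeral_2_eq_2)
    show "mat_kernel (\<phi> 0) = mat_image (\<phi> 1)" "mat_kernel (\<phi> 1) = mat_image (\<phi> 2)"
      using ex(2)[OF res, of 0] ex(2)[OF res, of 1] by (simp_all add: numeral_2_eq_2)
    show "mat_kernel (\<psi> 0) = mat_image (\<psi> 1)" "mat_kernel (\<psi> 1) = mat_image (\<psi> 2)"
      using ex(2)[OF psi, of 0] ex(2)[OF psi, of 1] by (simp_all add: numeral_2_eq_2)
    show "mat_image (\<psi> 0) = mat_image (\<phi> 0)" using ex(1)[OF res] ex(1)[OF psi] by simp
  qed (use const nz in auto)
qed

lemma vec_mem_mat_kernel:
  assumes "A \<in> carrier_mat r c"
  shows "vec c v \<in> mat_kernel A \<longleftrightarrow> (\<forall>i<r. (\<Sum>j<c. A $$ (i, j) * v j) = 0)"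
proof -
  have "A *\<^sub>v vec c v = 0\<^sub>v r \<longleftrightarrow> (\<forall>i<r. (A *\<^sub>v vec c v) $ i = 0)"
    using assms by (auto simp: vec_eq_iff)
  moreover have "(A *\<^sub>v vec c v) $ i = (\<Sum>j<c. A $$ (i, j) * v j)" if "i < r" for i
    using mult_mat_vec_sum[OF assms vec_carrier that] by simp
  ultimately show ?thesis using assms unfolding mat_kernel_def by auto
qed

lemma vec_mem_mat_image:
  assumes "D \<in> carrier_mat c d"
  shows "vec c v \<in> mat_image D \<longleftrightarrow> (\<exists>w. \<forall>i<c. v i = (\<Sum>j<d. D $$ (i, j) * w j))"
proof
  assume "vec c v \<in> mat_image D"
  then obtain w where w: "w \<in> carrier_vec d" "vec c v = D *\<^sub>v w" using assms unfolding mat_image_def by auto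
  have "v i = (\<Sum>j<d. D $$ (i, j) * w $ j)" if "i < c" for i
    using mult_mat_vec_sum[OF assms w(1) that] that unfolding w(2)[symmetric] by simp
  then show "\<exists>w. \<forall>i<c. v i = (\<Sum>j<d. D $$ (i, j) * w j)" by (intro exI[of _ "\<lambda>j. w $ j"]) blast
next
  assume "\<exists>w. \<forall>i<c. v i = (\<Sum>j<d. D $$ (i, j) * w j)"
  then obtain w where w: "\<And>i. i < c \<Longrightarrow> v i = (\<Sum>j<d. D $$ (i, j) * w j)" by blast
  have "vec c v = D *\<^sub>v vec d w"
  proof (rule eq_vecI)
    fix i assume "i < dim_vec (D *\<^sub>v vec d w)"
    then have i: "i < c" using assms by simp
    show "vec c v $ i = (D *\<^sub>v vec d w) $ i" using mult_mat_vec_sum[OF assms vec_carrier i, of w] w[OF i] i by simp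
  qed (use assms in simp)
  then show "vec c v \<in> mat_image D" using assms unfolding mat_image_def by auto
qed

lemma kernel_eq_image_iff:
  assumes A: "A \<in> carrier_mat r c" and D: "D \<in> carrier_mat c d"
  shows "mat_kernel A = mat_image D \<longleftrightarrow>
    (\<forall>v. (\<forall>i<r. (\<Sum>j<c. A $$ (i, j) * v j) = 0) \<longleftrightarrow> (\<exists>w. \<forall>i<c. v i = (\<Sum>j<d. D $$ (i, j) * w j)))"
  unfolding vec_mem_mat_kernel[OF A, symmetric] vec_mem_mat_image[OF D, symmetric]
proof
  have car: "mat_kernel A \<subseteq> carrier_vec c" "mat_image D \<subseteq> carrier_vec c"
    using A D unfolding mat_kernel_def mat_image_def by auto
  assume *: "\<forall>v. vec c v \<in> mat_kernel A \<longleftrightarrow> vec c v \<in> mat_image D"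
  have "u \<in> mat_kernel A \<longleftrightarrow> u \<in> mat_image D" if "u \<in> carrier_vec c" for u
  proof -
    have "u = vec c (\<lambda>i. u $ i)" using that by (intro eq_vecI) auto
    then show ?thesis using * by metis
  qed
  then show "mat_kernel A = mat_image D" using car by blast
qed blast

lemma row_image_iff:
  fixes A :: "('k::comm_ring_1, 'n::finite) mpoly mat"
  assumes A: "A \<in> carrier_mat 1 3" and J: "is_ideal J"
  shows "mat_image A = {v \<in> carrier_vec 1. v $ 0 \<in> J} \<longleftrightarrow> J = ideal_gen {A $$ (0, 0), A $$ (0, Suc 0), A $$ (0, 2)}"
proof -
  have mem: "vec 1 (\<lambda>_. p) \<in> mat_image A \<longleftrightarrow> p \<in> ideal_gen {A $$ (0, 0), A $$ (0, Suc 0), A $$ (0, 2)}" (is "?l p = ?r p") for p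
  proof
    assume "?l p"
    then obtain w where "p = A $$ (0, 0) * w 0 + A $$ (0, Suc 0) * w (Suc 0) + A $$ (0, 2) * w 2"
      unfolding vec_mem_mat_image[OF A] sum_lessThan_3 by auto
    then have "p = w 0 * A $$ (0, 0) + w (Suc 0) * A $$ (0, Suc 0) + w 2 * A $$ (0, 2)" by (simp add: mult.commute)
    then show "?r p" unfolding ideal_gen_3 by blast
  next
    assume "?r p"
    then obtain a b c where "p = a * A $$ (0, 0) + b * A $$ (0, Suc 0) + c * A $$ (0, 2)" unfolding ideal_gen_3 by blast
    then show "?l p" unfolding vec_mem_mat_image[OF A] sum_lessThan_3
      by (intro exI[of _ "\<lambda>j::nat. if j = 0 then a else if j = Suc 0 then b else c"]) (simp add: mult.commute)
  qed
  have car: "mat_image A \<subseteq> carrier_vec 1" using A unfolding mat_image_def by auto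
  have vec1: "u = vec 1 (\<lambda>_. u $ 0)" if "u \<in> carrier_vec 1" for u :: "('k, 'n) mpoly vec"
    using that by (intro eq_vecI) auto
  show ?thesis
  proof
    assume *: "mat_image A = {v \<in> carrier_vec 1. v $ 0 \<in> J}"
    have "p \<in> J \<longleftrightarrow> ?l p" for p unfolding * by simp
    then show "J = ideal_gen {A $$ (0, 0), A $$ (0, Suc 0), A $$ (0, 2)}" unfolding mem by blast
  next
    assume *: "J = ideal_gen {A $$ (0, 0), A $$ (0, Suc 0), A $$ (0, 2)}"
    have "u \<in> mat_image A \<longleftrightarrow> u $ 0 \<in> J" if "u \<in> carrier_vec 1" for u
      using mem[of "u $ 0"] vec1[OF that] * by metis
    then show "mat_image A = {v \<in> carrier_vec 1. v $ 0 \<in> J}" using car by blast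
  qed
qed

lemma minimal_resolution_data:
  fixes J :: "('k::field, 'n::finite) mpoly set"
  assumes J: "is_ideal J"
    and res: "minimal_graded_free_resolution J [[2, 2, 2], [2 + \<delta>1, 2 + \<delta>2, 2 + \<delta>3], [\<delta>1 + \<delta>2 + \<delta>3]] \<phi>"
  shows "three_quadrics_resolution (\<lambda>i. \<phi> 0 $$ (0, i)) (\<lambda>i j. \<phi> 1 $$ (i, j)) (\<lambda>j. \<phi> 2 $$ (j, 0))
           (\<lambda>i. if i = 0 then \<delta>1 else if i = Suc 0 then \<delta>2 else \<delta>3)" (is "three_quadrics_resolution _ _ _ ?\<delta>")
    and "J = ideal_gen {\<phi> 0 $$ (0, 0), \<phi> 0 $$ (0, Suc 0), \<phi> 0 $$ (0, 2)}"
    and "proj_dim_quot J \<noteq> 2"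
proof -
  let ?Fs = "[[2, 2, 2], [2 + \<delta>1, 2 + \<delta>2, 2 + \<delta>3], [\<delta>1 + \<delta>2 + \<delta>3]]"
  have gres: "graded_free_resolution J ?Fs \<phi>"
    and min: "\<And>l i j. 1 \<le> l \<Longrightarrow> i < dim_row (\<phi> l) \<Longrightarrow> j < dim_col (\<phi> l) \<Longrightarrow> Poly_Mapping.lookup (\<phi> l $$ (i, j)) 0 = 0"
    using res unfolding minimal_graded_free_resolution_def by blast+
  have gr: "\<And>i. graded_map (res_module ?Fs (Suc i)) (res_module ?Fs i) (\<phi> i)"
    and img: "mat_image (\<phi> 0) = {v \<in> carrier_vec 1. v $ 0 \<in> J}"
    and ker: "\<And>i. mat_kernel (\<phi> i) = mat_image (\<phi> (Suc i))"
    using gres unfolding graded_free_resolution_def by blast+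
  have car0: "\<phi> 0 \<in> carrier_mat 1 3" and hom0: "\<And>j. j < 3 \<Longrightarrow> homogeneous ([2, 2, 2] ! j - 0) (\<phi> 0 $$ (0, j))"
    using gr[of 0] unfolding graded_map_def res_module_def by (simp_all add: numeral_3_eq_3)
  have car1: "\<phi> 1 \<in> carrier_mat 3 3"
    and hom1: "\<And>i j. i < 3 \<Longrightarrow> j < 3 \<Longrightarrow> homogeneous ([2 + \<delta>1, 2 + \<delta>2, 2 + \<delta>3] ! j - [2, 2, 2] ! i) (\<phi> 1 $$ (i, j))"
    using gr[of 1] unfolding graded_map_def res_module_def by (simp_all add: numeral_3_eq_3)
  have car2: "\<phi> 2 \<in> carrier_mat 3 1"
    and hom2: "\<And>i. i < 3 \<Longrightarrow> homogeneous (\<delta>1 + \<delta>2 + \<delta>3 - [2 + \<delta>1, 2 + \<delta>2, 2 + \<delta>3] ! i) (\<phi> 2 $$ (i, 0))"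
    using gr[of 2] unfolding graded_map_def res_module_def by (simp_all add: numeral_3_eq_3 numeral_2_eq_2)
  have car3: "\<phi> 3 \<in> carrier_mat 1 0"
    using gr[of 3] unfolding graded_map_def res_module_def by (simp add: numeral_3_eq_3)
  have ker0: "mat_kernel (\<phi> 0) = mat_image (\<phi> 1)" and ker1: "mat_kernel (\<phi> 1) = mat_image (\<phi> 2)"
    and ker2: "mat_kernel (\<phi> 2) = mat_image (\<phi> 3)"
    using ker[of 0] ker[of 1] ker[of 2] by (simp_all add: numeral_2_eq_2 numeral_3_eq_3)
  have three: "P i" if "P 0" "P (Suc 0)" "P 2" "i < 3" for P and i :: nat
    using that by (auto simp: numeral_3_eq_3 numeral_2_eq_2 less_Suc_eq)
  have inj: "\<exists>j<3. \<phi> 2 $$ (j, 0) \<noteq> 0"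
  proof (rule ccontr)
    assume *: "\<not> ?thesis"
    \<comment> \<open>If the last column were zero, the constant 1 would lie in its kernel, but the
      next matrix has no columns.\<close>
    have "(\<Sum>j<1. \<phi> 2 $$ (i, j) * 1) = 0" if "i < 3" for i using * that by simp
    then obtain w where "\<forall>i<1. 1 = (\<Sum>j<0. \<phi> 3 $$ (i, j) * w j)"
      using ker2[unfolded kernel_eq_image_iff[OF car2 car3], rule_format, of "\<lambda>_. 1"] by blast
    from this[rule_format, of 0] show False by simp
  qed
  show "J = ideal_gen {\<phi> 0 $$ (0, 0), \<phi> 0 $$ (0, Suc 0), \<phi> 0 $$ (0, 2)}"
    using img unfolding row_image_iff[OF car0 J] .
  have const2: "Poly_Mapping.lookup (\<phi> 2 $$ (j, 0)) 0 = 0" if "j < 3" for j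
    using min[of 2 j 0] car2 that by simp
  obtain j0 where j0: "j0 < 3" "\<phi> 2 $$ (j0, 0) \<noteq> 0" using inj by blast
  show "proj_dim_quot J \<noteq> 2"
    by (rule proj_dim_quot_neq_2[OF gres, of j0]) (use const2 j0 in simp_all)
  show "three_quadrics_resolution (\<lambda>i. \<phi> 0 $$ (0, i)) (\<lambda>i j. \<phi> 1 $$ (i, j)) (\<lambda>j. \<phi> 2 $$ (j, 0)) ?\<delta>"
  proof
    show "homogeneous 2 (\<phi> 0 $$ (0, i))" if "i < 3" for i
      by (rule three[OF _ _ _ that]) (use hom0[of 0] hom0[of "Suc 0"] hom0[of 2] in simp_all)
    show "homogeneous (?\<delta> j) (\<phi> 1 $$ (i, j))" if "i < 3" "j < 3" for i j
    proof -
      have "[2, 2, 2 :: int] ! i = 2" by (rule three[OF _ _ _ that(1)]) simp_all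
      moreover have "[2 + \<delta>1, 2 + \<delta>2, 2 + \<delta>3] ! j = 2 + ?\<delta> j" by (rule three[OF _ _ _ that(2)]) simp_all
      ultimately show ?thesis using hom1[OF that] by simp
    qed
    show "homogeneous ((\<Sum>i<3. ?\<delta> i) - 2 - ?\<delta> j) (\<phi> 2 $$ (j, 0))" if "j < 3" for j
    proof -
      have "[2 + \<delta>1, 2 + \<delta>2, 2 + \<delta>3] ! j = 2 + ?\<delta> j" by (rule three[OF _ _ _ that]) simp_all
      then show ?thesis using hom2[OF that] by (simp add: sum_lessThan_3 algebra_simps)
    qed
    show "((\<Sum>i<3. \<phi> 0 $$ (0, i) * v i) = 0) = (\<exists>w. \<forall>i<3. v i = (\<Sum>j<3. \<phi> 1 $$ (i, j) * w j))" for v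
      using ker0[unfolded kernel_eq_image_iff[OF car0 car1], rule_format, of v] by simp
    show "(\<forall>i<3. (\<Sum>j<3. \<phi> 1 $$ (i, j) * w j) = 0) = (\<exists>s. \<forall>j<3. w j = \<phi> 2 $$ (j, 0) * s)" for w
    proof -
      have "(\<forall>i<3. (\<Sum>j<3. \<phi> 1 $$ (i, j) * w j) = 0) = (\<exists>s. \<forall>j<3. w j = \<phi> 2 $$ (j, 0) * s (0::nat))"
        using ker1[unfolded kernel_eq_image_iff[OF car1 car2], rule_format, of w] by simp
      also have "\<dots> = (\<exists>s. \<forall>j<3. w j = \<phi> 2 $$ (j, 0) * s)"
        by (rule iffI; elim exE; rule exI; assumption)
      finally show ?thesis .
    qed
    show "\<exists>j<3. \<phi> 2 $$ (j, 0) \<noteq> 0" by (rule inj)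
    show "Poly_Mapping.lookup (\<phi> 1 $$ (i, j)) 0 = 0" if "i < 3" "j < 3" for i j
      using min[of 1 i j] car1 that by simp
    show "Poly_Mapping.lookup (\<phi> 2 $$ (j, 0)) 0 = 0" if "j < 3" for j by (rule const2[OF that])
  qed
qed

section \<open>The invariants in the two cases\<close>

lemma (in koszul_frame) degrees_linear:
  assumes n: "CARD('n) = m + 3" and e1: "e = 1" and J: "J = ideal_gen {y * g, x * g, q}"
    and h: "2 \<le> height J" and pd: "proj_dim_quot J \<noteq> 2"
  shows "codim2_degree J = 2" "bourbaki_degree J = 1"
proof -
  have "height J = 2" using height_le_2[OF e1] h unfolding J by (rule antisym)
  then show "codim2_degree J = 2" unfolding codim2_degree_def using multiplicity[OF n e1] J by simp
  have hxy: "homogeneous 1 x" "homogeneous 1 y" using hx hy e1 by simp_all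
  show "bourbaki_degree J = 1"
  proof (rule bourbaki_degreeI)
    show "\<not> perfect_height_two J" using pd by (simp add: perfect_height_two_def)
    show "minimal_form_generators 2 J [y * g, x * g, q]"
      unfolding J by (rule minimal_form_generators_indep[OF homogeneous_gens hq k_indep3])
    show "initial_syzygy [y * g, x * g, q] (vec3 x (- y) 0)" by (rule initial_syzygy_gens)
    fix d fs \<nu> assume "minimal_form_generators d J fs" "length fs = 3" "initial_syzygy fs \<nu>"
    then have "bourbaki_ideal fs \<nu> (ideal_gen {x, y})" unfolding J by (rule bourbaki_linear[OF e1])
    then show "\<exists>x y. regular_pair x y \<and> bourbaki_ideal fs \<nu> (ideal_gen {x, y}) \<and> multiplicity_quot (ideal_gen {x, y}) = 1"
      using reg multiplicity_linear_pair[OF n reg hxy] by blast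
  qed simp
qed

lemma degrees_complete_intersection:
  fixes f1 f2 f3 :: "('k::field, 'n::finite) mpoly"
  assumes n: "CARD('n) = m + 3" and K: "koszul_exact f1 f2 f3"
    and f: "homogeneous 2 f1" "homogeneous 2 f2" "homogeneous 2 f3" and ind: "k_indep3 f1 f2 f3"
    and J: "J = ideal_gen {f1, f2, f3}"
  shows "codim2_degree J = 0" "bourbaki_degree J = 4"
proof -
  have f20: "f2 \<noteq> 0"
  proof
    assume "f2 = 0"
    then have "cst 0 * f1 + cst 1 * f2 + cst 0 * f3 = 0" by simp
    then have "(1 :: 'k) = 0" using ind unfolding k_indep3_def by blast
    then show False by simp
  qed
  interpret koszul_frame f2 f1 1 f3 2 by (rule koszul_exact_frame[OF K f f20])
  have ht: "height J \<noteq> 2"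
  proof
    assume "height J = 2"
    then have "3 \<le> (2 :: enat)" using height_ge_3 J by simp
    then show False by (simp add: numeral_eq_enat)
  qed
  then show "codim2_degree J = 0" by (simp add: codim2_degree_def)
  show "bourbaki_degree J = 4"
  proof (rule bourbaki_degreeI)
    show "\<not> perfect_height_two J" using ht by (simp add: perfect_height_two_def)
    show "minimal_form_generators 2 J [f1, f2, f3]"
      unfolding J by (rule minimal_form_generators_indep[OF f ind])
    show "initial_syzygy [f1, f2, f3] (vec3 f2 (- f1) 0)" using initial_syzygy_gens by simp
    fix d fs \<nu> assume fs: "minimal_form_generators d J fs" "length fs = 3" "initial_syzygy fs \<nu>"
    obtain x y where xy: "regular_pair x y" "homogeneous 2 x" "homogeneous 2 y" "bourbaki_ideal fs \<nu> (ideal_gen {x, y})"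
      by (rule bourbaki_complete_intersection[OF K f ind fs(1)[unfolded J] fs(2,3)])
    show "\<exists>x y. regular_pair x y \<and> bourbaki_ideal fs \<nu> (ideal_gen {x, y}) \<and> multiplicity_quot (ideal_gen {x, y}) = 4"
      using xy(1,4) multiplicity_quadric_pair[OF n xy(1-3)] by blast
  qed simp
qed

lemma equigenerated_is_ideal: "equigenerated d J \<Longrightarrow> is_ideal J"
  unfolding equigenerated_def using is_ideal_ideal_gen by blast

lemma resolution_invariants:
  fixes J :: "('k::field, 'n::finite) mpoly set"
  assumes n: "CARD('n) = m + 3" and J: "is_ideal J" "2 \<le> height J"
    and d: "1 \<le> \<delta>1" "\<delta>1 \<le> \<delta>2" "\<delta>2 \<le> \<delta>3"
    and res: "minimal_graded_free_resolution J [[2, 2, 2], [2 + \<delta>1, 2 + \<delta>2, 2 + \<delta>3], [\<delta>1 + \<delta>2 + \<delta>3]] \<phi>"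
  shows "(\<delta>1, \<delta>2, \<delta>3, codim2_degree J, bourbaki_degree J) \<in> {(1, 2, 2, 2, 1), (2, 2, 2, 0, 4)}"
proof -
  let ?\<delta> = "\<lambda>i::nat. if i = 0 then \<delta>1 else if i = Suc 0 then \<delta>2 else \<delta>3"
  interpret R: three_quadrics_resolution "\<lambda>i. \<phi> 0 $$ (0, i)" "\<lambda>i j. \<phi> 1 $$ (i, j)" "\<lambda>j. \<phi> 2 $$ (j, 0)" ?\<delta>
    by (rule minimal_resolution_data(1)[OF J(1) res])
  let ?f1 = "\<phi> 0 $$ (0, 0)" and ?f2 = "\<phi> 0 $$ (0, Suc 0)" and ?f3 = "\<phi> 0 $$ (0, 2)"
  note Jf = minimal_resolution_data(2)[OF J(1) res] and pd = minimal_resolution_data(3)[OF J(1) res]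
  have f: "homogeneous 2 ?f1" "homogeneous 2 ?f2" "homogeneous 2 ?f3" by (rule R.f_hom; simp)+
  have \<delta>: "\<delta>1 \<in> {1, 2}" "\<delta>2 = 2" "\<delta>3 = 2" using R.deltas d by simp_all
  show ?thesis
  proof (cases "\<delta>1 = 1")
    case True
    note lin = R.linear_syzygy[of "\<lambda>i::nat. if i = 0 then a else if i = Suc 0 then b else c" for a b c]
    have h1: "homogeneous 1 (\<phi> 1 $$ (i, 0))" if "i < 3" for i using R.M_hom[OF that, of 0] True by simp
    obtain x y g q where F: "koszul_frame x y g q 1" and I: "ideal_gen {y * g, x * g, q} = ideal_gen {?f1, ?f2, ?f3}"
    proof (rule frame_of_linear_syzygy[OF f R.k_indep3_f h1[of 0] h1[of "Suc 0"] h1[of 2]])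
      show "?f1 * \<phi> 1 $$ (0, 0) + ?f2 * \<phi> 1 $$ (Suc 0, 0) + ?f3 * \<phi> 1 $$ (2, 0) = 0"
        using R.column_syzygy[of 0] by (simp add: sum_lessThan_3)
      show "\<phi> 1 $$ (0, 0) \<noteq> 0 \<or> \<phi> 1 $$ (Suc 0, 0) \<noteq> 0 \<or> \<phi> 1 $$ (2, 0) \<noteq> 0"
        using R.column_nonzero[of 0] by (auto simp: numeral_3_eq_3 numeral_2_eq_2 less_Suc_eq)
      fix a b c assume abc: "homogeneous 1 a" "homogeneous 1 b" "homogeneous 1 c" "?f1 * a + ?f2 * b + ?f3 * c = 0"
      have "\<exists>k. \<forall>i<3. (if i = 0 then a else if i = Suc 0 then b else c) = cst k * \<phi> 1 $$ (i, 0)"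
        by (rule lin) (use True \<delta> abc in \<open>simp_all add: sum_lessThan_3\<close>)
      then obtain k where k: "\<And>i. i < 3 \<Longrightarrow> (if i = 0 then a else if i = Suc 0 then b else c) = cst k * \<phi> 1 $$ (i, 0)"
        by blast
      show "\<exists>k. a = cst k * \<phi> 1 $$ (0, 0) \<and> b = cst k * \<phi> 1 $$ (Suc 0, 0) \<and> c = cst k * \<phi> 1 $$ (2, 0)"
        using k[of 0] k[of "Suc 0"] k[of 2] by (intro exI[of _ k]) simp
    qed simp_all
    have "codim2_degree J = 2" "bourbaki_degree J = 1"
      by (rule koszul_frame.degrees_linear[OF F n refl _ J(2) pd], simp add: I Jf[symmetric])+
    then show ?thesis using True \<delta> by simp
  next
    case False
    then have \<delta>1: "\<delta>1 = 2" using \<delta>(1) by simp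
    have K: "koszul_exact ?f1 ?f2 ?f3" by (rule R.koszul_exact) (use \<delta>1 \<delta> in simp)
    show ?thesis using degrees_complete_intersection[OF n K f R.k_indep3_f Jf] \<delta>1 \<delta> by simp
  qed
qed

text \<open>The columns of \<open>D1\<close> are the three generating syzygies found in
  \<open>syzygy\<close>. Their only relation, with coefficients \<open>q\<close>, \<open>x\<close>
  and \<open>- y\<close>, is the column \<open>D2\<close>; it is again a consequence of the
  regularity of \<open>x\<close> and \<open>y\<close>.\<close>

lemma (in koszul_frame) resolution:
  "\<exists>\<phi>. minimal_graded_free_resolution (ideal_gen {y * g, x * g, q})
     [[2, 2, 2], [2 + int e, 2 + 2, 2 + 2], [int e + 2 + 2]] \<phi>"
proof -
  define Fs :: "int list list" where "Fs = [[2, 2, 2], [2 + int e, 2 + 2, 2 + 2], [int e + 2 + 2]]"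
  define D0 where "D0 = mat 1 3 (\<lambda>(i, j). [[y * g, x * g, q]] ! i ! j)"
  define D1 where "D1 = mat 3 3 (\<lambda>(i, j). [[x, - q, 0], [- y, 0, - q], [0, y * g, x * g]] ! i ! j)"
  define D2 where "D2 = mat 3 1 (\<lambda>(i, j). [[q], [x], [- y]] ! i ! j)"
  define \<phi> where "\<phi> i = (if i = 0 then D0 else if i = 1 then D1 else if i = 2 then D2
    else 0\<^sub>m (length (res_module Fs i)) 0)" for i :: nat
  have car: "D0 \<in> carrier_mat 1 3" "D1 \<in> carrier_mat 3 3" "D2 \<in> carrier_mat 3 1"
    by (simp_all add: D0_def D1_def D2_def)
  have i3: "i = 0 \<or> i = Suc 0 \<or> i = 2" if "i < 3" for i :: nat using that by linarith
  have entries0: "D0 $$ (0, 0) = y * g" "D0 $$ (0, Suc 0) = x * g" "D0 $$ (0, 2) = q"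
    by (simp_all add: D0_def)
  have entries1: "D1 $$ (0, 0) = x" "D1 $$ (0, Suc 0) = - q" "D1 $$ (0, 2) = 0"
    "D1 $$ (Suc 0, 0) = - y" "D1 $$ (Suc 0, Suc 0) = 0" "D1 $$ (Suc 0, 2) = - q"
    "D1 $$ (2, 0) = 0" "D1 $$ (2, Suc 0) = y * g" "D1 $$ (2, 2) = x * g"
    by (simp_all add: D1_def)
  have entries2: "D2 $$ (0, 0) = q" "D2 $$ (Suc 0, 0) = x" "D2 $$ (2, 0) = - y"
    by (simp_all add: D2_def)
  have length: "length (res_module Fs i) = (if i = 0 then 1 else if i < 3 then 3 else if i = 3 then 1 else 0)" for i
    by (auto simp: res_module_def Fs_def nth_Cons split: nat.splits)
  have all3: "(\<forall>i<3. P i) \<longleftrightarrow> P 0 \<and> P (Suc 0) \<and> P 2" for P :: "nat \<Rightarrow> bool"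
    by (auto simp: numeral_3_eq_3 numeral_2_eq_2 less_Suc_eq)
  have car\<phi>: "\<phi> i \<in> carrier_mat (length (res_module Fs i)) (length (res_module Fs (Suc i)))" for i
    using car unfolding \<phi>_def length by (auto simp: numeral_3_eq_3 numeral_2_eq_2)
  have rm: "res_module Fs 0 = [0]" "res_module Fs (Suc 0) = [2, 2, 2]"
    "res_module Fs 2 = [2 + int e, 4, 4]" "res_module Fs 3 = [int e + 4]"
    by (simp_all add: res_module_def Fs_def numeral_3_eq_3 numeral_2_eq_2)
  have graded: "graded_map (res_module Fs (Suc i)) (res_module Fs i) (\<phi> i)" for i
  proof -
    have "homogeneous (res_module Fs (Suc i) ! j' - res_module Fs i ! i') (\<phi> i $$ (i', j'))"
      if "i' < length (res_module Fs i)" "j' < length (res_module Fs (Suc i))" for i' j'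
    proof -
      have "i < 3" using that(2) by (simp add: length split: if_splits)
      then consider "i = 0" | "i = Suc 0" | "i = 2" using i3 by blast
      then show ?thesis
      proof cases
        case 1
        then have "i' = 0" "j' = 0 \<or> j' = Suc 0 \<or> j' = 2" using that i3[of j'] by (simp_all add: length)
        then show ?thesis using 1 homogeneous_gens hq by (auto simp: \<phi>_def rm entries0)
      next
        case 2
        then have "i' = 0 \<or> i' = Suc 0 \<or> i' = 2" "j' = 0 \<or> j' = Suc 0 \<or> j' = 2"
          using that i3[of j'] i3[of i'] by (simp_all add: length)
        then show ?thesis using 2 homogeneous_gens hx hy hq
          by (elim disjE) (simp_all add: \<phi>_def rm entries1 homogeneous_uminus numeral_2_eq_2[symmetric])
      next
        case 3
        then have "i' = 0 \<or> i' = Suc 0 \<or> i' = 2" "j' = 0" using that i3[of i'] by (simp_all add: length)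
        then show ?thesis using 3 hx hy hq
          by (elim disjE) (simp_all add: \<phi>_def rm entries2 homogeneous_uminus numeral_3_eq_3[symmetric])
      qed
    qed
    then show ?thesis unfolding graded_map_def using car\<phi> by blast
  qed
  have exact0: "mat_kernel D0 = mat_image D1"
    unfolding kernel_eq_image_iff[OF car(1,2)]
  proof (rule allI, rule iffI)
    fix v :: "nat \<Rightarrow> ('k, 'n) mpoly" assume "\<forall>i<1. (\<Sum>j<3. D0 $$ (i, j) * v j) = 0"
    then have "y * g * v 0 + x * g * v (Suc 0) + q * v 2 = 0" by (simp add: sum_lessThan_3 entries0)
    then obtain \<alpha> \<beta> \<gamma> where "v 0 = \<alpha> * x - \<beta> * q" "v (Suc 0) = - \<alpha> * y - \<gamma> * q" "v 2 = (\<beta> * y + \<gamma> * x) * g"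
      by (rule syzygy)
    then show "\<exists>w. \<forall>i<3. v i = (\<Sum>j<3. D1 $$ (i, j) * w j)"
      unfolding all3 by (intro exI[of _ "\<lambda>j::nat. if j = 0 then \<alpha> else if j = Suc 0 then \<beta> else \<gamma>"])
        (simp add: sum_lessThan_3 entries1 algebra_simps)
  next
    fix v :: "nat \<Rightarrow> ('k, 'n) mpoly" assume "\<exists>w. \<forall>i<3. v i = (\<Sum>j<3. D1 $$ (i, j) * w j)"
    then obtain w where "v 0 = x * w 0 - q * w (Suc 0)" "v (Suc 0) = - y * w 0 - q * w 2" "v 2 = y * g * w (Suc 0) + x * g * w 2"
      unfolding all3 by (auto simp: sum_lessThan_3 entries1)
    then show "\<forall>i<1. (\<Sum>j<3. D0 $$ (i, j) * v j) = 0"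
      by (simp add: sum_lessThan_3 entries0) (simp add: algebra_simps)
  qed
  have exact1: "mat_kernel D1 = mat_image D2"
    unfolding kernel_eq_image_iff[OF car(2,3)]
  proof (rule allI, rule iffI)
    fix v :: "nat \<Rightarrow> ('k, 'n) mpoly" assume "\<forall>i<3. (\<Sum>j<3. D1 $$ (i, j) * v j) = 0"
    then have v: "x * v 0 - q * v (Suc 0) = 0" "y * g * v (Suc 0) + x * g * v 2 = 0"
      unfolding all3 by (simp_all add: sum_lessThan_3 entries1)
    have "g * (v 2 * x + v (Suc 0) * y) = 0" using v(2) by (simp add: algebra_simps)
    then have "v 2 * x + v (Suc 0) * y = 0" using g0 by simp
    then obtain t where t: "v 2 = t * y" "v (Suc 0) = - t * x" by (rule regular_pair_syzygy[OF reg])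
    have "x * (v 0 + q * t) = 0" using v(1) unfolding t by (simp add: algebra_simps)
    then have "v 0 + q * t = 0" using x0 by simp
    then have "v 0 = - q * t" by (simp add: eq_neg_iff_add_eq_0)
    then show "\<exists>w. \<forall>i<3. v i = (\<Sum>j<1. D2 $$ (i, j) * w j)"
      unfolding all3 by (intro exI[of _ "\<lambda>_. - t"]) (simp add: entries2 t mult.commute)
  next
    fix v :: "nat \<Rightarrow> ('k, 'n) mpoly" assume "\<exists>w. \<forall>i<3. v i = (\<Sum>j<1. D2 $$ (i, j) * w j)"
    then obtain w where "v 0 = q * w" "v (Suc 0) = x * w" "v 2 = - y * w"
      unfolding all3 by (auto simp: entries2)
    then show "\<forall>i<3. (\<Sum>j<3. D1 $$ (i, j) * v j) = 0"
      unfolding all3 by (simp add: sum_lessThan_3 entries1 algebra_simps)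
  qed
  have exact: "mat_kernel (\<phi> i) = mat_image (\<phi> (Suc i))" for i
  proof -
    consider "i = 0" | "i = Suc 0" | "i = 2" | "3 \<le> i" by linarith
    then show ?thesis
    proof cases
      case 3
      have "\<phi> 3 \<in> carrier_mat 1 0" using car\<phi>[of 3] by (simp add: length)
      then have "mat_kernel D2 = mat_image (\<phi> 3)"
        unfolding kernel_eq_image_iff[OF car(3) \<open>\<phi> 3 \<in> carrier_mat 1 0\<close>] all3 using x0 by (auto simp: entries2)
      then show ?thesis using 3 by (simp add: \<phi>_def numeral_3_eq_3 numeral_2_eq_2)
    next
      case 4
      have c: "\<phi> i \<in> carrier_mat (length (res_module Fs i)) 0" "\<phi> (Suc i) \<in> carrier_mat 0 0"
        using car\<phi>[of i] car\<phi>[of "Suc i"] 4 by (simp_all add: length)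
      show ?thesis unfolding kernel_eq_image_iff[OF c] by simp
    qed (simp_all add: \<phi>_def exact0 exact1 numeral_2_eq_2)
  qed
  have img: "mat_image (\<phi> 0) = {v \<in> carrier_vec 1. v $ 0 \<in> ideal_gen {y * g, x * g, q}}"
    using row_image_iff[OF car(1) is_ideal_ideal_gen[of "{y * g, x * g, q}"]] by (simp add: \<phi>_def entries0)
  have min: "Poly_Mapping.lookup (\<phi> l $$ (i, j)) 0 = 0" if l: "1 \<le> l" and ij: "i < dim_row (\<phi> l)" "j < dim_col (\<phi> l)" for l i j
  proof -
    have "i < length (res_module Fs l)" "j < length (res_module Fs (Suc l))"
      using ij car\<phi>[of l] by simp_all
    then consider "l = Suc 0" "i < 3" "j < 3" | "l = 2" "i < 3" "j = 0"
      using l by (auto simp: length numeral_2_eq_2 numeral_3_eq_3 less_Suc_eq split: if_splits)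
    then show ?thesis
    proof cases
      case 1
      show ?thesis using i3[OF 1(2)] i3[OF 1(3)] 1(1) const0
        by (elim disjE) (simp_all add: \<phi>_def entries1 lookup_mult_0)
    next
      case 2
      show ?thesis using i3[OF 2(2)] 2(1,3) const0 by (elim disjE) (simp_all add: \<phi>_def entries2)
    qed
  qed
  show ?thesis
    unfolding Fs_def[symmetric] minimal_graded_free_resolution_def graded_free_resolution_def
    using graded img exact min by (intro exI[of _ \<phi>]) blast
qed

subsection \<open>Examples\<close>

text \<open>Divisibility by \<open>x * x\<close> follows by dividing by \<open>x\<close>
  twice.\<close>

lemma regular_pair_square_left:
  fixes x y :: "('k::field, 'n::finite) mpoly"
  assumes "regular_pair x y"
  shows "regular_pair (x * x) y"
proof -
  have x: "x \<noteq> 0" and r: "\<And>c u. y * c = u * x \<Longrightarrow> \<exists>v. c = v * x" using assms unfolding regular_pair_def by blast+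
  have "\<exists>v. c = v * (x * x)" if c: "y * c = u * (x * x)" for c u
  proof -
    obtain v where v: "c = v * x" using r[of c "u * x"] c by (auto simp: mult.assoc)
    have "x * (y * v - u * x) = 0" using c unfolding v by (simp add: algebra_simps)
    then have "y * v = u * x" using x by simp
    then obtain w where "v = w * x" using r by blast
    then show ?thesis using v by (auto simp: mult.assoc)
  qed
  then show ?thesis unfolding regular_pair_def using x by auto
qed

lemma regular_pair_swap:
  fixes x y :: "('k::field, 'n::finite) mpoly"
  assumes "regular_pair x y" "y \<noteq> 0"
  shows "regular_pair y x"
  unfolding regular_pair_def
proof (intro conjI allI impI)
  fix c u assume "x * c = u * y"
  then have "c * x + (- u) * y = 0" by (simp add: algebra_simps)
  then obtain t where "c = t * y" by (rule regular_pair_syzygy[OF assms(1)])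
  then show "\<exists>v. c = v * y" by blast
qed (rule assms)

text \<open>Write \<open>c = a * x + b * y\<close>. Comparing the two expressions for
  \<open>z * c\<close> by a Koszul relation puts \<open>z * a\<close>, hence \<open>a\<close>, into
  the ideal of \<open>x\<close> and \<open>y\<close>, which supplies the second factor
  \<open>x\<close>.\<close>

lemma regular_sequence_square:
  fixes x y z :: "('k::field, 'n::finite) mpoly"
  assumes reg: "regular_pair x y" and z: "\<And>c. z * c \<in> ideal_gen {x, y} \<Longrightarrow> c \<in> ideal_gen {x, y}"
    and c: "z * c \<in> ideal_gen {x * x, y}"
  shows "c \<in> ideal_gen {x * x, y}"
proof -
  obtain u v where uv: "z * c = u * (x * x) + v * y" using c unfolding ideal_gen_2 by blast
  then have "z * c = (u * x) * x + v * y" by (simp add: mult.assoc)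
  then have "c \<in> ideal_gen {x, y}" using z unfolding ideal_gen_2 by blast
  then obtain a b where ab: "c = a * x + b * y" unfolding ideal_gen_2 by blast
  have "(z * a - u * x) * x + (z * b - v) * y = 0" using uv unfolding ab by (simp add: algebra_simps)
  then obtain t where "z * a - u * x = t * y" by (rule regular_pair_syzygy[OF reg])
  then have "z * a = u * x + t * y" by (simp add: algebra_simps)
  then have "a \<in> ideal_gen {x, y}" using z unfolding ideal_gen_2 by blast
  then obtain a' b' where "a = a' * x + b' * y" unfolding ideal_gen_2 by blast
  then have "c = a' * (x * x) + (b' * x + b) * y" unfolding ab by (simp add: algebra_simps)
  then show ?thesis unfolding ideal_gen_2 by blast
qed

lemma height_ge_2:
  fixes J :: "('k::field, 'n::finite) mpoly set"
  assumes "regular_pair x y" "x \<in> J" "y \<in> J"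
  shows "2 \<le> height J"
proof (rule height_ge)
  fix P assume P: "is_prime P" "J \<subseteq> P"
  have "prime_chain 2 P"
  proof (rule prime_chain_2[OF P(1)])
    show "x \<in> P" "y \<in> P" using assms P by blast+
    show "x \<noteq> 0" using assms(1) unfolding regular_pair_def by blast
    show "\<exists>v. c = v * x" if "y * c = u * x" for c u using assms(1) that unfolding regular_pair_def by blast
  qed
  then show "2 \<le> prime_height P" using prime_height_ge[of 2 P] by (simp add: numeral_eq_enat)
qed

definition mvar :: "'n::finite \<Rightarrow> ('k::field, 'n) mpoly" where
  "mvar i = Poly_Mapping.single (Poly_Mapping.single i 1) 1"

lemma homogeneous_one: "homogeneous 0 (1 :: ('k::field, 'n::finite) mpoly)"
  by (metis homogeneous_cst single_one)

lemma homogeneous_mvar: "homogeneous 1 (mvar i)"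
proof -
  have "mon_degree (Poly_Mapping.single i 1) = 1" unfolding mon_degree_def by (simp add: lookup_single when_def)
  then show ?thesis unfolding homogeneous_def mvar_def by simp
qed

lemma homogeneous_mvar_mult: "homogeneous 2 (mvar i * mvar j)"
  using homogeneous_mult[OF homogeneous_mvar homogeneous_mvar] by simp

lemma single_Suc_0_eq_iff: "Poly_Mapping.single i (Suc 0) = Poly_Mapping.single j (Suc 0) \<longleftrightarrow> i = j"
  by (metis lookup_single_eq lookup_single_not_eq zero_neq_one One_nat_def)

lemma mvar_indep:
  assumes "distinct [i, j, k]" "cst a * mvar i + cst b * mvar j + cst c * mvar k = 0"
  shows "a = 0" "b = 0" "c = 0"
proof -
  have "Poly_Mapping.lookup (cst a * mvar i + cst b * mvar j + cst c * mvar k) (Poly_Mapping.single l 1) = 0" for l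
    unfolding assms(2) by simp
  then have "(a when i = l) + (b when j = l) + (c when k = l) = 0" for l
    by (simp add: lookup_add mult_single lookup_single mvar_def single_Suc_0_eq_iff)
  from this[of i] this[of j] this[of k] show "a = 0" "b = 0" "c = 0" using assms(1) by (auto simp: when_def)
qed

lemma mvar_linear_pair:
  assumes "distinct [i, j, k]"
  shows "linear_pair (mvar i) (mvar j)"
proof
  fix c d assume "cst c * mvar i + cst d * mvar j = 0"
  then have "cst c * mvar i + cst d * mvar j + cst 0 * mvar k = 0" by simp
  from mvar_indep[OF assms this] show "c = 0 \<and> d = 0" by blast
qed (rule homogeneous_mvar)+

lemma mvar_regular:
  fixes c :: "('k::field, 'n::finite) mpoly"
  assumes ijk: "distinct [i, j, k]" and c: "mvar k * c \<in> ideal_gen {mvar i, mvar j}"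
  shows "c \<in> ideal_gen {mvar i, mvar j}"
proof -
  let ?X = "mvar :: 'n \<Rightarrow> ('k, 'n) mpoly"
  interpret linear_pair "?X i" "?X j" by (rule mvar_linear_pair[OF ijk])
  have "?X k \<notin> ideal_gen {?X i, ?X j}"
  proof
    assume "?X k \<in> ideal_gen {?X i, ?X j}"
    then have "?X k \<in> ideal_gen {?X i, ?X j, ?X j}" by simp
    then obtain a b c where "?X k = cst a * ?X i + cst b * ?X j + cst c * ?X j"
      by (rule homogeneous_in_ideal3_same[OF homogeneous_mvar _ homogeneous_mvar homogeneous_mvar homogeneous_mvar])
    then have "cst a * ?X i + cst (b + c) * ?X j + cst (- 1) * ?X k = 0"
      by (simp only: single_add single_uminus distrib_right) simp
    from mvar_indep(3)[OF ijk this] show False by simp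
  qed
  then show ?thesis using prime c by blast
qed

text \<open>Choosing \<open>g\<close> equal to the first variable puts the squares of
  \<open>mvar i\<close> and \<open>mvar k\<close> into the ideal, a regular pair that later shows
  height at least two.\<close>

lemma koszul_frame_linear:
  fixes i j k :: "'n::finite"
  assumes ijk: "distinct [i, j, k]"
  shows "koszul_frame (mvar i :: ('k::field, 'n) mpoly) (mvar j) (mvar i) (mvar k * mvar k) 1"
proof
  let ?X = "mvar :: 'n \<Rightarrow> ('k, 'n) mpoly"
  interpret ij: linear_pair "?X i" "?X j" by (rule mvar_linear_pair[OF ijk])
  have ikj: "distinct [i, k, j]" using ijk by auto
  interpret ik: linear_pair "?X i" "?X k" by (rule mvar_linear_pair[OF ikj])
  show "regular_pair (?X i) (?X j)" by (rule ij.regular)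
  show "?X i \<noteq> 0" using ij.regular unfolding regular_pair_def by blast
  show "c \<in> ideal_gen {?X i, ?X j}" if "?X k * ?X k * c \<in> ideal_gen {?X i, ?X j}" for c
    using mvar_regular[OF ijk mvar_regular[OF ijk]] that by (simp only: mult.assoc)
  have r: "\<exists>v. c = v * ?X i" if "?X k * c = u * ?X i" for c u
    using ik.regular that unfolding regular_pair_def by blast
  show "\<exists>v. c = v * ?X i" if "?X k * ?X k * c = u * ?X i" for c u
  proof -
    obtain v where "?X k * c = v * ?X i" using r[of "?X k * c" u] \<open>?X k * ?X k * c = u * ?X i\<close> unfolding mult.assoc by blast
    then show ?thesis by (rule r)
  qed
qed (use homogeneous_mvar homogeneous_mvar_mult in \<open>simp_all only: of_nat_1, simp_all\<close>)

lemma koszul_frame_squares: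
  fixes i j k :: "'n::finite"
  assumes ijk: "distinct [i, j, k]"
  shows "koszul_frame (mvar i * mvar i :: ('k::field, 'n) mpoly) (mvar j * mvar j) 1 (mvar k * mvar k) 2"
proof
  let ?X = "mvar :: 'n \<Rightarrow> ('k, 'n) mpoly"
  interpret ij: linear_pair "?X i" "?X j" by (rule mvar_linear_pair[OF ijk])
  have jik: "distinct [j, i, k]" using ijk by auto
  interpret ji: linear_pair "?X j" "?X i" by (rule mvar_linear_pair[OF jik])
  have nz: "?X i \<noteq> 0" "?X j \<noteq> 0" using ij.regular ji.regular unfolding regular_pair_def by blast+
  have r1: "regular_pair (?X i * ?X i) (?X j)" by (rule regular_pair_square_left[OF ij.regular])
  then have r2: "regular_pair (?X j) (?X i * ?X i)" by (rule regular_pair_swap) (rule nz)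
  then have r3: "regular_pair (?X j * ?X j) (?X i * ?X i)" by (rule regular_pair_square_left)
  then show "regular_pair (?X i * ?X i) (?X j * ?X j)"
    by (rule regular_pair_swap) (use nz(1) mpoly_mult_eq_0 in blast)
  have s1: "c \<in> ideal_gen {?X i * ?X i, ?X j}" if "?X k * c \<in> ideal_gen {?X i * ?X i, ?X j}" for c
    by (rule regular_sequence_square[OF ij.regular mvar_regular[OF ijk] that])
  have sw1: "{?X i * ?X i, ?X j} = {?X j, ?X i * ?X i}" by (rule insert_commute)
  have s2: "c \<in> ideal_gen {?X j * ?X j, ?X i * ?X i}" if "?X k * c \<in> ideal_gen {?X j * ?X j, ?X i * ?X i}" for c
    by (rule regular_sequence_square[OF r2 s1[unfolded sw1] that])
  show "c \<in> ideal_gen {?X i * ?X i, ?X j * ?X j}"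
    if "?X k * ?X k * c \<in> ideal_gen {?X i * ?X i, ?X j * ?X j}" for c
  proof -
    have sw: "{?X i * ?X i, ?X j * ?X j} = {?X j * ?X j, ?X i * ?X i}" by (rule insert_commute)
    have "?X k * (?X k * c) \<in> ideal_gen {?X j * ?X j, ?X i * ?X i}"
      using \<open>?X k * ?X k * c \<in> _\<close> unfolding sw mult.assoc .
    from s2[OF s2[OF this]] show ?thesis unfolding sw .
  qed
qed (use homogeneous_mvar_mult homogeneous_one in simp_all)

lemma exists_three_distinct:
  assumes "3 \<le> CARD('n::finite)"
  obtains i j k :: "'n::finite" where "distinct [i, j, k]"
proof -
  obtain S :: "'n set" where "card S = 3" using obtain_subset_with_card_n[OF assms] by blast
  then show ?thesis using that unfolding card_3_iff by auto
qed

theorem proposition3p12: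
  assumes "3 \<le> CARD('n::finite)"
  shows "{((\<delta>1, \<delta>2, \<delta>3), \<epsilon>1, codim2_degree J, bourbaki_degree J) | \<delta>1 \<delta>2 \<delta>3 \<epsilon>1
            (J :: ('k::{alg_closed_field, field_char_0}, 'n) mpoly set).
            equigenerated 2 J \<and> 2 \<le> height J \<and>
            1 \<le> \<delta>1 \<and> \<delta>1 \<le> \<delta>2 \<and> \<delta>2 \<le> \<delta>3 \<and>
            2 + \<delta>3 + \<epsilon>1 = \<delta>1 + \<delta>2 + \<delta>3 \<and>
            (\<exists>\<phi>. minimal_graded_free_resolution J
                   [[2, 2, 2], [2 + \<delta>1, 2 + \<delta>2, 2 + \<delta>3], [\<delta>1 + \<delta>2 + \<delta>3]] \<phi>)}
         = {((1, 2, 2), 1, 2, 1), ((2, 2, 2), 2, 0, 4)}"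
    (is "?L = _")
proof -
  obtain m where n: "CARD('n) = m + 3" using assms by (metis add.commute le_Suc_ex)
  obtain i j k :: 'n where ijk: "distinct [i, j, k]" by (rule exists_three_distinct[OF assms])
  have inv: "(\<delta>1, \<delta>2, \<delta>3, codim2_degree J, bourbaki_degree J) \<in> {(1, 2, 2, 2, 1), (2, 2, 2, 0, 4)}"
    if "equigenerated 2 J" "2 \<le> height J" "1 \<le> \<delta>1" "\<delta>1 \<le> \<delta>2" "\<delta>2 \<le> \<delta>3"
      "minimal_graded_free_resolution J [[2, 2, 2], [2 + \<delta>1, 2 + \<delta>2, 2 + \<delta>3], [\<delta>1 + \<delta>2 + \<delta>3]] \<phi>"
    for \<delta>1 \<delta>2 \<delta>3 \<phi> and J :: "('k, 'n) mpoly set"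
    by (rule resolution_invariants[OF n equigenerated_is_ideal[OF that(1)] that(2-6)])
  \<comment> \<open>A frame has column degrees \<open>(e, 2, 2)\<close>, and the equation for
    \<open>\<epsilon>1\<close> then gives \<open>\<epsilon>1 = e\<close>.\<close>
  have realised: "((int e, 2, 2), int e, codim2_degree J, bourbaki_degree J) \<in> ?L"
    if F: "koszul_frame x y g q e" and J: "J = ideal_gen {y * g, x * g, q}" and ht: "2 \<le> height J"
    for x y g q e and J :: "('k, 'n) mpoly set"
  proof -
    interpret koszul_frame x y g q e by (rule F)
    have "\<exists>\<phi>. minimal_graded_free_resolution J [[2, 2, 2], [2 + int e, 2 + 2, 2 + 2], [int e + 2 + 2]] \<phi>"
      unfolding J by (rule resolution)
    moreover have "equigenerated 2 J" unfolding equigenerated_def J using homogeneous_gens hq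
      by (intro exI[of _ "{y * g, x * g, q}"]) auto
    ultimately have "equigenerated 2 J \<and> 2 \<le> height J \<and> 1 \<le> int e \<and> int e \<le> 2 \<and> (2::int) \<le> 2 \<and> 2 + 2 + int e = int e + 2 + 2 \<and>
      (\<exists>\<phi>. minimal_graded_free_resolution J [[2, 2, 2], [2 + int e, 2 + 2, 2 + 2], [int e + 2 + 2]] \<phi>)"
      using ht e by simp
    then show ?thesis
      by (intro CollectI) (rule exI[of _ "int e"], rule exI[of _ 2], rule exI[of _ 2],
        rule exI[of _ "int e"], rule exI[of _ J], rule conjI[OF refl])
  qed
  let ?X = "mvar :: 'n \<Rightarrow> ('k, 'n) mpoly"
  let ?J1 = "ideal_gen {?X j * ?X i, ?X i * ?X i, ?X k * ?X k}"
  let ?J2 = "ideal_gen {?X j * ?X j * 1, ?X i * ?X i * 1, ?X k * ?X k}"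
  have h1: "2 \<le> height ?J1"
  proof -
    interpret F: koszul_frame "?X i" "?X j" "?X i" "?X k * ?X k" 1 by (rule koszul_frame_linear[OF ijk])
    have "regular_pair (?X i) (?X k * ?X k)" unfolding regular_pair_def using F.g0 F.q_g by blast
    from regular_pair_square_left[OF this] show ?thesis
      using ideal_gen_superset[of "{?X j * ?X i, ?X i * ?X i, ?X k * ?X k}"] by (intro height_ge_2) auto
  qed
  have h2: "2 \<le> height ?J2"
    by (rule order_trans[OF _ koszul_frame.height_ge_3[OF koszul_frame_squares[OF ijk] refl]]) (simp add: numeral_eq_enat)
  note m1 = realised[OF koszul_frame_linear[OF ijk] refl h1]
  note m2 = realised[OF koszul_frame_squares[OF ijk] refl h2]
  have sub: "?L \<subseteq> {((1, 2, 2), 1, 2, 1), ((2, 2, 2), 2, 0, 4)}"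
  proof
    fix z assume "z \<in> ?L"
    then obtain \<delta>1 \<delta>2 \<delta>3 \<epsilon>1 \<phi> and J :: "('k, 'n) mpoly set"
      where z: "z = ((\<delta>1, \<delta>2, \<delta>3), \<epsilon>1, codim2_degree J, bourbaki_degree J)"
        and J: "equigenerated 2 J" "2 \<le> height J" and d: "1 \<le> \<delta>1" "\<delta>1 \<le> \<delta>2" "\<delta>2 \<le> \<delta>3"
        and eps: "2 + \<delta>3 + \<epsilon>1 = \<delta>1 + \<delta>2 + \<delta>3"
        and res: "minimal_graded_free_resolution J [[2, 2, 2], [2 + \<delta>1, 2 + \<delta>2, 2 + \<delta>3], [\<delta>1 + \<delta>2 + \<delta>3]] \<phi>"
      by (elim CollectE exE conjE) (rule that)
    from inv[OF J d res] eps show "z \<in> {((1, 2, 2), 1, 2, 1), ((2, 2, 2), 2, 0, 4)}" unfolding z by auto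
  qed
  \<comment> \<open>The degrees of the example need no separate computation: it belongs to the left
    hand side with column degrees \<open>(1, 2, 2)\<close>, and \<open>sub\<close> leaves only one
    pair of values. The other example is treated alike.\<close>
  have "((1, 2, 2), 1, 2, 1) \<in> ?L"
  proof -
    have "((1, 2, 2), 1, codim2_degree ?J1, bourbaki_degree ?J1) \<in> ?L" using m1 by (simp only: of_nat_1)
    moreover from subsetD[OF sub this] have "codim2_degree ?J1 = 2 \<and> bourbaki_degree ?J1 = 1" by simp
    ultimately show ?thesis by (simp only:)
  qed
  moreover have "((2, 2, 2), 2, 0, 4) \<in> ?L"
  proof -
    have "((2, 2, 2), 2, codim2_degree ?J2, bourbaki_degree ?J2) \<in> ?L" using m2 by (simp only: of_nat_numeral)
    moreover from subsetD[OF sub this] have "codim2_degree ?J2 = 0 \<and> bourbaki_degree ?J2 = 4" by simp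
    ultimately show ?thesis by (simp only:)
  qed
  ultimately show ?thesis using sub by blast
qed

end
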